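(* Let $\alpha,\beta,\gamma\in\mathbb{R}^2$ be three non-collinear vectors, and let $|T_{\alpha\beta\gamma}|$ be the Lebesgue measure of the triangle with vertices $\alpha,\beta,\gamma$. Let $u:B_1(0)\subset\mathbb{R}^2\to\{\alpha,\beta,\gamma\}$ be the following map. Let $T_{A_0OB_0}$ be the equilateral triangle of side length $1$ with vertex $O=(0,0)$ and vertical side $A_0B_0$ to the right of $O$, that is, $A_0=(\tfrac{\sqrt3}{2},\tfrac12)$ and $B_0=(\tfrac{\sqrt3}{2},-\tfrac12)$. Let $A_1,B_1$ be the middle points of the oblique sides $OA_0$, $OB_0$. The vertical segment $A_1B_1$ divides $T_{A_0OB_0}$ into two regions; assign the value $\beta$ to the region on the right and $\gamma$ to the region on the left. Repeat the construction on the equilateral triangle $T_{A_1OB_1}$, and then iteratively on all smaller triangles. Thus, with $A_i=2^{-i}A_0$ and $B_i=2^{-i}B_0$, the values $\beta,\gamma,\beta,\gamma,\dots$ alternate on the successive trapezoids $A_{i}B_{i}B_{i+1}A_{i+1}$, $i=0,1,2,\dots$, starting with $\beta$ for $i=0$. Finally set $u=\alpha$ in $B_1(0)\setminus T_{A_0OB_0}$. Then $u$ has infinitely many triple points, located at $\{A_i,B_i\}_{i\ge1}$, and the following hold. (i) $u\in BV(B_1(0);\{\alpha,\beta,\gamma\})$, with $$|Du|(B_1(0))=\tfrac73|\beta-\alpha|+\tfrac23|\alpha-\gamma|+|\beta-\gamma|.$$ (ii) If $(r_i)_{i\ge1}$ is an infinitesimal sequence with $0<r_i<2^{-(i+1)}$,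 then $\overline{TVJ}_{BV}(u,B_{r_i}(A_i))=|T_{\alpha\beta\gamma}|$ for every $i\geq 1$. Moreover $$\overline{\mathcal A}_{BV}(u,B_1(0))\ \ge\ \overline{TVJ}_{BV}(u,B_1(0))=+\infty.$$ (iii) On the other hand, $$\overline{\mathcal A}_{L^1}(u,B_1(0))\le\pi+\tfrac{23}{6}|\beta-\alpha|+\tfrac{13}{6}|\alpha-\gamma|<+\infty.$$ In particular, $$\mathrm{Dom}\big(\overline{\mathcal A}_{BV}(\cdot,B_1(0))\big)\subsetneq\mathrm{Dom}\big(\overline{\mathcal A}_{L^1}(\cdot,B_1(0))\big).$$
   Context: $B_r(p)$ is the open disk of radius $r$ centred at $p$ in $\mathbb{R}^2$. For a bounded open set $\Omega\subset\mathbb{R}^2$ and $v\in C^1(\Omega;\mathbb{R}^2)$, $\mathcal A(v,\Omega)=\int_\Omega\sqrt{1+|\nabla v|^2+|Jv|^2}\,dx$ and $TVJ(v,\Omega)=\int_\Omega|Jv|\,dx$, where $Jv=\det\nabla v$ and $|\nabla v|$ is the Frobenius norm. A sequence $u_k\to u$ strictly $BV(\Omega;\mathbb{R}^2)$ if $u_k\to u$ in $L^1(\Omega;\mathbb{R}^2)$ and $|Du_k|(\Omega)\to|Du|(\Omega)$, where $|Du|(\Omega)$ is the total variation of the distributional derivative. The relaxed functionals are $\overline{\mathcal A}_{L^1}(u,\Omega)=\inf\{\liminf_k\mathcal A(u_k,\Omega):u_k\in C^1(\Omega;\mathbb{R}^2),\ u_k\to u\text{ in }L^1(\Omega;\mathbb{R}^2)\}$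 for $u\in L^1(\Omega;\mathbb{R}^2)$, and, for $u\in BV(\Omega;\mathbb{R}^2)$, $\overline{\mathcal A}_{BV}(u,\Omega)=\inf\{\liminf_k\mathcal A(u_k,\Omega)\}$ and $\overline{TVJ}_{BV}(u,\Omega)=\inf\{\liminf_kTVJ(u_k,\Omega)\}$, the infima being over sequences $u_k\in C^1(\Omega;\mathbb{R}^2)$ converging to $u$ strictly $BV(\Omega;\mathbb{R}^2)$. $\mathrm{Dom}$ denotes the set of maps at which the functional is finite. *)

theory Defs
  imports "HOL-Analysis.Analysis"
begin

section \<open>Functionals on smooth maps\<close>

definition C1_on :: "'a::real_normed_vector set \<Rightarrow> ('a \<Rightarrow> 'b::real_normed_vector) \<Rightarrow> bool" where
  "C1_on \<Omega> f \<longleftrightarrow>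
     (\<exists>f' :: 'a \<Rightarrow> 'a \<Rightarrow>\<^sub>L 'b.
        (\<forall>x\<in>\<Omega>. (f has_derivative blinfun_apply (f' x)) (at x)) \<and> continuous_on \<Omega> f')"

abbreviation grad :: "(real^2 \<Rightarrow> real^2) \<Rightarrow> real^2 \<Rightarrow> real^2^2" where
  "grad v x \<equiv> jacobian v (at x)"

text \<open>The library norm on \<open>real^2^2\<close> is the Euclidean norm of the four entries, i.e. the
  Frobenius norm.\<close>

definition area_functional :: "(real^2 \<Rightarrow> real^2) \<Rightarrow> (real^2) set \<Rightarrow> ennreal" where
  "area_functional v \<Omega> =
     (\<integral>\<^sup>+x\<in>\<Omega>. ennreal (sqrt (1 + (norm (grad v x))\<^sup>2 + \<bar>det (grad v x)\<bar>\<^sup>2)) \<partial>lebesgue)"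

definition TVJ :: "(real^2 \<Rightarrow> real^2) \<Rightarrow> (real^2) set \<Rightarrow> ennreal" where
  "TVJ v \<Omega> = (\<integral>\<^sup>+x\<in>\<Omega>. ennreal \<bar>det (grad v x)\<bar> \<partial>lebesgue)"

section \<open>Maps of bounded variation\<close>

text \<open>Maps are total functions on the plane; only their values on \<open>\<Omega>\<close> matter, and only up to
  null sets for everything below that concerns \<open>L\<^sup>1\<close> or \<open>BV\<close> maps.\<close>

definition L1_maps :: "(real^2) set \<Rightarrow> (real^2 \<Rightarrow> real^2) set" where
  "L1_maps \<Omega> = {u. u absolutely_integrable_on \<Omega>}"

definition L1_conv ::
    "(real^2) set \<Rightarrow> (nat \<Rightarrow> real^2 \<Rightarrow> real^2) \<Rightarrow> (real^2 \<Rightarrow> real^2) \<Rightarrow> bool" where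
  "L1_conv \<Omega> w u \<longleftrightarrow>
     u \<in> L1_maps \<Omega> \<and> (\<forall>k. w k \<in> L1_maps \<Omega>) \<and>
     (\<lambda>k. LINT x:\<Omega>|lebesgue. norm (w k x - u x)) \<longlonglongrightarrow> 0"

text \<open>Matrix-valued test fields \<open>\<phi> \<in> C\<^sup>1\<^sub>c(\<Omega>)\<close> with \<open>|\<phi>| \<le> 1\<close>; the \<open>i\<close>-th row of \<open>\<phi>\<close> is tested
  against the derivative of the \<open>i\<close>-th component of the map.\<close>

definition test_fields :: "(real^2) set \<Rightarrow> (real^2 \<Rightarrow> real^2^2) set" where
  "test_fields \<Omega> =
     {\<phi>. C1_on UNIV \<phi> \<and> (\<exists>K. compact K \<and> K \<subseteq> \<Omega> \<and> (\<forall>x. x \<notin> K \<longrightarrow> \<phi> x = 0)) \<and>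
         (\<forall>x. norm (\<phi> x) \<le> 1)}"

definition row_div :: "(real^2 \<Rightarrow> real^2^2) \<Rightarrow> real^2 \<Rightarrow> real^2" where
  "row_div \<phi> x = (\<chi> i. trace (jacobian (\<lambda>y. \<phi> y $ i) (at x)))"

definition distr_deriv ::
    "(real^2) set \<Rightarrow> (real^2 \<Rightarrow> real^2) \<Rightarrow> (real^2 \<Rightarrow> real^2^2) \<Rightarrow> real" where
  "distr_deriv \<Omega> u \<phi> = - (LINT x:\<Omega>|lebesgue. u x \<bullet> row_div \<phi> x)"

text \<open>\<open>|Du|(\<Omega>)\<close> as the norm of the distribution \<open>Du\<close> dual to the supremum norm on test fields. It
  is nonnegative since \<open>\<phi> = 0\<close> is admissible, and finite exactly when \<open>Du\<close> is a finite
  matrix-valued Radon measure on \<open>\<Omega>\<close>.\<close>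

definition total_var :: "(real^2 \<Rightarrow> real^2) \<Rightarrow> (real^2) set \<Rightarrow> ennreal" where
  "total_var u \<Omega> = (SUP \<phi>\<in>test_fields \<Omega>. ennreal (distr_deriv \<Omega> u \<phi>))"

definition BV_maps :: "(real^2) set \<Rightarrow> (real^2 \<Rightarrow> real^2) set" where
  "BV_maps \<Omega> = {u \<in> L1_maps \<Omega>. total_var u \<Omega> < \<infinity>}"

definition strict_BV_conv ::
    "(real^2) set \<Rightarrow> (nat \<Rightarrow> real^2 \<Rightarrow> real^2) \<Rightarrow> (real^2 \<Rightarrow> real^2) \<Rightarrow> bool" where
  "strict_BV_conv \<Omega> w u \<longleftrightarrow>
     u \<in> BV_maps \<Omega> \<and> (\<forall>k. w k \<in> BV_maps \<Omega>) \<and> L1_conv \<Omega> w u \<and>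
     (\<lambda>k. total_var (w k) \<Omega>) \<longlonglongrightarrow> total_var u \<Omega>"

section \<open>Relaxed functionals\<close>

definition area_L1 :: "(real^2 \<Rightarrow> real^2) \<Rightarrow> (real^2) set \<Rightarrow> ennreal" where
  "area_L1 u \<Omega> =
     Inf {liminf (\<lambda>k. area_functional (w k) \<Omega>) | w. (\<forall>k. C1_on \<Omega> (w k)) \<and> L1_conv \<Omega> w u}"

definition area_BV :: "(real^2 \<Rightarrow> real^2) \<Rightarrow> (real^2) set \<Rightarrow> ennreal" where
  "area_BV u \<Omega> =
     Inf {liminf (\<lambda>k. area_functional (w k) \<Omega>) | w. (\<forall>k. C1_on \<Omega> (w k)) \<and> strict_BV_conv \<Omega> w u}"

definition TVJ_BV :: "(real^2 \<Rightarrow> real^2) \<Rightarrow> (real^2) set \<Rightarrow> ennreal" where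
  "TVJ_BV u \<Omega> =
     Inf {liminf (\<lambda>k. TVJ (w k) \<Omega>) | w. (\<forall>k. C1_on \<Omega> (w k)) \<and> strict_BV_conv \<Omega> w u}"

definition Dom_area_L1 :: "(real^2) set \<Rightarrow> (real^2 \<Rightarrow> real^2) set" where
  "Dom_area_L1 \<Omega> = {u \<in> L1_maps \<Omega>. area_L1 u \<Omega> < \<infinity>}"

definition Dom_area_BV :: "(real^2) set \<Rightarrow> (real^2 \<Rightarrow> real^2) set" where
  "Dom_area_BV \<Omega> = {u \<in> BV_maps \<Omega>. area_BV u \<Omega> < \<infinity>}"

section \<open>Triple points\<close>

text \<open>Near a triple point the map is, almost everywhere, constant on each of three open sectors with
  vertex at the point, and takes three different values \<open>a \<in> V\<close> on them; \<open>C a\<close> is the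
  (translated) sector carrying the value \<open>a\<close>.\<close>

definition triple_point :: "(real^2 \<Rightarrow> real^2) \<Rightarrow> real^2 \<Rightarrow> bool" where
  "triple_point u p \<longleftrightarrow>
     (\<exists>r>0. \<exists>V. \<exists>C :: real^2 \<Rightarrow> (real^2) set.
        card V = 3 \<and>
        (\<forall>a\<in>V. open (C a) \<and> connected (C a) \<and> C a \<noteq> {} \<and> (\<forall>x\<in>C a. \<forall>t>0. t *\<^sub>R x \<in> C a)) \<and>
        disjoint_family_on C V \<and>
        (AE x in lebesgue. x \<in> ball p r \<longrightarrow> u x \<in> V \<and> x - p \<in> C (u x)))"

section \<open>The map with infinitely many triple points\<close>

definition A_pt :: "nat \<Rightarrow> real^2" where
  "A_pt i = (1/2)^i *\<^sub>R vector [sqrt 3 / 2, 1/2]"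

definition B_pt :: "nat \<Rightarrow> real^2" where
  "B_pt i = (1/2)^i *\<^sub>R vector [sqrt 3 / 2, - (1/2)]"

definition tri :: "nat \<Rightarrow> (real^2) set" where
  "tri i = convex hull {A_pt i, 0, B_pt i}"

text \<open>The trapezoid \<open>A\<^sub>i B\<^sub>i B\<^sub>i\<^sub>+\<^sub>1 A\<^sub>i\<^sub>+\<^sub>1\<close> is \<open>tri i - tri (Suc i)\<close>. The values on the
  separating segments and at the origin are a choice on a null set.\<close>

definition u_map :: "real^2 \<Rightarrow> real^2 \<Rightarrow> real^2 \<Rightarrow> real^2 \<Rightarrow> real^2" where
  "u_map \<alpha> \<beta> \<gamma> x =
     (if x \<notin> tri 0 then \<alpha>
      else if \<exists>i. even i \<and> x \<in> tri i - tri (Suc i) then \<beta>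
      else \<gamma>)"

end

(* Lower bounds. On a small ball around A_i the variation of u is the length of the three jump rays
   weighted by the jumps. If C1 maps converge strictly, no variation is left over away from the rays
   or in the wrong direction. Fubini then yields a closed curve around A_i, made of a few segments,
   whose image consists of three arcs close to the sides of the triangle with vertices
   alpha, beta, gamma. The curve winds around each interior point off these arcs, so the map covers
   almost the whole triangle, and the area formula bounds TVJ from below by the area of the triangle.
   Strict convergence on the disk localises to these balls, by lower semicontinuity on the complement;
   summing over infinitely many disjoint balls gives an infinite relaxed TVJ.

   Upper bounds. Take w = alpha + f(x) G(x_1), where f is a smoothed indicator of the wedge of
   opening 60 degrees at the origin. If G jumps directly from beta to gamma and back, the variation
   converges to that of u, and near A_i the map w covers the triangle only once. If G returns to 0
   (the value alpha of w) between two consecutive trapezoids, then G and G' are parallel, so Jw = 0;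
   the price is extra variation along the vertical segments, which is summable. *)
theory Submission
  imports Defs "HOL-Complex_Analysis.Complex_Analysis"
begin

section \<open>Calculus of C1 maps\<close>

text \<open>Two exact counts meet. Jump estimates on disjoint neighbourhoods of the sides bound the
  variation of u from below on every bounded open set, and one explicit C1 sequence has variation
  tending to the same sum; lower semicontinuity squeezes |Du| between them. Sharpness is essential:
  the bound off a small ball leaves exactly the mass of the ball, so every strictly convergent
  sequence inherits an upper bound there. A slice across a ray then has length at most the jump plus
  \<kappa> and end values within \<kappa> of two vertices, so its image lies in a thin ellipse with
  these foci. Ellipses are convex, hence the image loop deforms linearly into the boundary of the
  triangle without meeting points off the ellipses. One slice must meet several demands at once; a
  large weight K on the quantities that must be small lets a single use of Fubini suffice. In |Du|,
  4/3 and 2/3 are the sums of 2^-i over even and odd i. In (iii) the estimate tends to 10/3 and 5/3;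
  the remaining 1/2 in 23/6 and 13/6 absorbs the smoothing error at every stage.\<close>

lemma C1_onI:
  fixes f :: "'a::euclidean_space \<Rightarrow> 'b::real_normed_vector"
  assumes "\<And>x. x \<in> \<Omega> \<Longrightarrow> (f has_derivative D x) (at x)"
    and "\<And>h. continuous_on \<Omega> (\<lambda>x. D x h)"
  shows "C1_on \<Omega> f"
  unfolding C1_on_def
proof (intro exI conjI ballI)
  show "(f has_derivative blinfun_apply (Blinfun (D x))) (at x)" if "x \<in> \<Omega>" for x
    using assms(1)[OF that] by (simp add: bounded_linear_Blinfun_apply has_derivative_bounded_linear)
  \<comment> \<open>In finite dimension continuity in the operator norm reduces to continuity of
    every directional derivative, and this is the form of the C1 condition used from here
    on.\<close>
  show "continuous_on \<Omega> (\<lambda>x. Blinfun (D x))"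
  proof (rule continuous_on_blinfun_componentwise)
    fix i :: 'a
    show "continuous_on \<Omega> (\<lambda>x. blinfun_apply (Blinfun (D x)) i)"
      by (rule continuous_on_eq[OF assms(2)[of i]])
        (metis assms(1) bounded_linear_Blinfun_apply has_derivative_bounded_linear)
  qed
qed

lemma C1_onE:
  assumes "C1_on \<Omega> f"
  obtains D where "\<And>x. x \<in> \<Omega> \<Longrightarrow> (f has_derivative D x) (at x)"
    and "\<And>h. continuous_on \<Omega> (\<lambda>x. D x h)"
proof -
  obtain f' where f': "\<forall>x\<in>\<Omega>. (f has_derivative blinfun_apply (f' x)) (at x)" "continuous_on \<Omega> f'"
    using assms unfolding C1_on_def by blast
  show ?thesis
    by (rule that[of "\<lambda>x. blinfun_apply (f' x)"]) (use f' in \<open>auto intro!: continuous_intros\<close>)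
qed

lemma C1_on_subset: "C1_on \<Omega> f \<Longrightarrow> \<Omega>' \<subseteq> \<Omega> \<Longrightarrow> C1_on \<Omega>' f"
  unfolding C1_on_def by (meson continuous_on_subset subsetD)

lemma C1_on_differentiable: "C1_on \<Omega> f \<Longrightarrow> x \<in> \<Omega> \<Longrightarrow> f differentiable (at x)"
  unfolding C1_on_def differentiable_def by blast

lemma C1_on_imp_continuous_on: "C1_on \<Omega> f \<Longrightarrow> continuous_on \<Omega> f"
  by (meson C1_on_differentiable continuous_at_imp_continuous_on differentiable_imp_continuous_within)

lemma C1_on_bounded_linear:
  fixes f :: "'a::euclidean_space \<Rightarrow> 'b::real_normed_vector"
  assumes "C1_on \<Omega> f" "bounded_linear L"
  shows "C1_on \<Omega> (\<lambda>x. L (f x))"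
proof -
  obtain D where D: "\<And>x. x \<in> \<Omega> \<Longrightarrow> (f has_derivative D x) (at x)"
    "\<And>h. continuous_on \<Omega> (\<lambda>x. D x h)" using C1_onE[OF assms(1)] by blast
  show ?thesis
    by (rule C1_onI[where D="\<lambda>x h. L (D x h)"])
      (auto intro!: bounded_linear.has_derivative[OF assms(2)] D bounded_linear.continuous_on[OF assms(2)])
qed

lemma C1_on_linear:
  fixes L :: "'a::euclidean_space \<Rightarrow> 'b::real_normed_vector"
  assumes "bounded_linear L"
  shows "C1_on \<Omega> L"
  by (rule C1_onI[where D="\<lambda>x. L"]) (auto intro!: bounded_linear_imp_has_derivative assms)

lemma C1_on_const [simp]: "C1_on \<Omega> (\<lambda>x::'a::euclidean_space. c)"
  by (rule C1_onI[where D="\<lambda>x h. 0"]) auto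

lemma C1_on_add:
  fixes f :: "'a::euclidean_space \<Rightarrow> 'b::real_normed_vector"
  assumes "C1_on \<Omega> f" "C1_on \<Omega> g"
  shows "C1_on \<Omega> (\<lambda>x. f x + g x)"
proof -
  obtain D where D: "\<And>x. x \<in> \<Omega> \<Longrightarrow> (f has_derivative D x) (at x)"
    "\<And>h. continuous_on \<Omega> (\<lambda>x. D x h)" using C1_onE[OF assms(1)] by blast
  obtain E where E: "\<And>x. x \<in> \<Omega> \<Longrightarrow> (g has_derivative E x) (at x)"
    "\<And>h. continuous_on \<Omega> (\<lambda>x. E x h)" using C1_onE[OF assms(2)] by blast
  show ?thesis
    by (rule C1_onI[where D="\<lambda>x h. D x h + E x h"]) (auto intro!: has_derivative_add D E continuous_intros)
qed

lemma C1_on_bilinear: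
  fixes f :: "'a::euclidean_space \<Rightarrow> 'b::real_normed_vector"
  assumes "bounded_bilinear pr" "C1_on \<Omega> f" "C1_on \<Omega> g"
  shows "C1_on \<Omega> (\<lambda>x. pr (f x) (g x))"
proof -
  obtain D where D: "\<And>x. x \<in> \<Omega> \<Longrightarrow> (f has_derivative D x) (at x)"
    "\<And>h. continuous_on \<Omega> (\<lambda>x. D x h)" using C1_onE[OF assms(2)] by blast
  obtain E where E: "\<And>x. x \<in> \<Omega> \<Longrightarrow> (g has_derivative E x) (at x)"
    "\<And>h. continuous_on \<Omega> (\<lambda>x. E x h)" using C1_onE[OF assms(3)] by blast
  show ?thesis
    by (rule C1_onI[where D="\<lambda>x h. pr (f x) (E x h) + pr (D x h) (g x)"])
      (auto intro!: bounded_bilinear.FDERIV[OF assms(1)] D E continuous_on_add bounded_bilinear.continuous_on[OF assms(1)]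
         C1_on_imp_continuous_on[OF assms(2)] C1_on_imp_continuous_on[OF assms(3)])
qed

lemmas C1_on_scaleR = C1_on_bilinear[OF bounded_bilinear_scaleR]
lemmas C1_on_mult = C1_on_bilinear[OF bounded_bilinear_mult]
lemmas C1_on_inner = C1_on_bilinear[OF bounded_bilinear_inner]

lemma C1_on_diff:
  fixes f :: "'a::euclidean_space \<Rightarrow> 'b::real_normed_vector"
  assumes "C1_on \<Omega> f" "C1_on \<Omega> g"
  shows "C1_on \<Omega> (\<lambda>x. f x - g x)"
  using C1_on_add[OF assms(1) C1_on_bounded_linear[OF assms(2) bounded_linear_minus[OF bounded_linear_ident]]] by simp

lemma C1_on_sum:
  fixes f :: "'i \<Rightarrow> 'a::euclidean_space \<Rightarrow> 'b::real_normed_vector"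
  assumes "\<And>i. i \<in> I \<Longrightarrow> C1_on \<Omega> (f i)"
  shows "C1_on \<Omega> (\<lambda>x. \<Sum>i\<in>I. f i x)"
  using assms by (induction I rule: infinite_finite_induct) (auto intro: C1_on_add)

lemma C1_on_prod:
  fixes f :: "'i \<Rightarrow> 'a::euclidean_space \<Rightarrow> real"
  assumes "\<And>i. i \<in> I \<Longrightarrow> C1_on \<Omega> (f i)"
  shows "C1_on \<Omega> (\<lambda>x. \<Prod>i\<in>I. f i x)"
  using assms by (induction I rule: infinite_finite_induct) (auto intro: C1_on_mult)

lemma C1_on_compose_real:
  fixes f :: "'a::euclidean_space \<Rightarrow> real"
  assumes \<theta>: "\<And>t. (\<theta> has_vector_derivative \<theta>' t) (at t)" and c: "continuous_on UNIV \<theta>'"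
    and f: "C1_on \<Omega> f"
  shows "C1_on \<Omega> (\<lambda>x. \<theta> (f x))"
proof -
  obtain D where D: "\<And>x. x \<in> \<Omega> \<Longrightarrow> (f has_derivative D x) (at x)"
    "\<And>h. continuous_on \<Omega> (\<lambda>x. D x h)" using C1_onE[OF f] by blast
  show ?thesis
  proof (rule C1_onI[where D="\<lambda>x h. D x h *\<^sub>R \<theta>' (f x)"])
    show "((\<lambda>x. \<theta> (f x)) has_derivative (\<lambda>h. D x h *\<^sub>R \<theta>' (f x))) (at x)" if "x \<in> \<Omega>" for x
      using has_derivative_compose[OF D(1)[OF that] \<theta>[of "f x", unfolded has_vector_derivative_def]] .
    show "continuous_on \<Omega> (\<lambda>x. D x h *\<^sub>R \<theta>' (f x))" for h
      by (intro continuous_intros D(2) continuous_on_compose2[OF c C1_on_imp_continuous_on[OF f]]) auto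
  qed
qed

text \<open>Stone-Weierstrass supplies polynomial fields as substitutes for fields that are merely
  continuous; they are admissible in test fields because they are C1.\<close>

lemma C1_on_polynomial_function:
  fixes p :: "'a::euclidean_space \<Rightarrow> 'b::euclidean_space"
  assumes "polynomial_function p"
  shows "C1_on \<Omega> p"
proof -
  have r: "C1_on \<Omega> q" if "real_polynomial_function q" for q :: "'a \<Rightarrow> real"
    using that by induction (auto intro: C1_on_linear C1_on_add C1_on_mult)
  have "C1_on \<Omega> (\<lambda>x. \<Sum>b\<in>Basis. (p x \<bullet> b) *\<^sub>R b)"
  proof (intro C1_on_sum C1_on_scaleR C1_on_const r)
    fix b :: 'b
    show "real_polynomial_function (\<lambda>x. p x \<bullet> b)"
      using assms bounded_linear_inner_left[of b] unfolding polynomial_function_def o_def by blast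
  qed
  then show ?thesis by (simp add: euclidean_representation)
qed

subsection \<open>A C1 step and cutoff functions\<close>

text \<open>The integral of the tent of height 2 on [0,1], hence C1 and strictly increasing there.
  Truncated squares give a single formula that can be differentiated term by term.\<close>

definition sstep :: "real \<Rightarrow> real" where
  "sstep t = 2 * (max 0 t)\<^sup>2 - 4 * (max 0 (t - 1/2))\<^sup>2 + 2 * (max 0 (t - 1))\<^sup>2"

definition sstep' :: "real \<Rightarrow> real" where
  "sstep' t = 4 * max 0 t - 8 * max 0 (t - 1/2) + 4 * max 0 (t - 1)"

lemma has_real_derivative_max0_squared:
  "((\<lambda>t::real. (max 0 t)\<^sup>2) has_real_derivative 2 * max 0 t) (at t)"
proof -
  consider "t < 0" | "t > 0" | "t = 0" by linarith
  then show ?thesis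
  proof cases
    case 1
    show ?thesis
      by (rule has_field_derivative_transform_within[where f="\<lambda>_. 0" and d="-t"])
        (use 1 in \<open>auto simp: dist_real_def max_def\<close>)
  next
    case 2
    show ?thesis
      by (rule has_field_derivative_transform_within[where f="\<lambda>t. t\<^sup>2" and d="t"])
        (use 2 in \<open>auto simp: dist_real_def max_def intro!: derivative_eq_intros\<close>)
  next
    case 3
    have "((\<lambda>h. (max 0 h)\<^sup>2 / h) \<longlongrightarrow> 0) (at (0::real))"
    proof (rule Lim_null_comparison[where g="\<lambda>h. \<bar>h\<bar>"])
      show "\<forall>\<^sub>F x::real in at 0. norm ((max 0 x)\<^sup>2 / x) \<le> \<bar>x\<bar>"
        by (rule always_eventually) (auto simp: max_def power2_eq_square)
      show "((\<lambda>h::real. \<bar>h\<bar>) \<longlongrightarrow> 0) (at 0)" by (auto intro!: tendsto_eq_intros)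
    qed
    then show ?thesis using 3 by (simp add: DERIV_def)
  qed
qed

lemma sstep_deriv: "(sstep has_real_derivative sstep' t) (at t)"
proof -
  have s: "((\<lambda>t::real. (max 0 (t - c))\<^sup>2) has_real_derivative 2 * max 0 (t - c)) (at t)" for c
    using DERIV_shift[of "\<lambda>t. (max 0 t)\<^sup>2" "2 * max 0 (t-c)" t "-c"] has_real_derivative_max0_squared[of "t-c"] by simp
  show ?thesis unfolding sstep_def[abs_def] sstep'_def
    by (rule derivative_eq_intros has_real_derivative_max0_squared s refl)+ simp
qed

lemma sstep'_continuous: "continuous_on A sstep'"
  unfolding sstep'_def[abs_def] by (intro continuous_intros)

lemma sstep'_nonneg: "0 \<le> sstep' t" unfolding sstep'_def by (auto simp: max_def)

lemma sstep_0: "t \<le> 0 \<Longrightarrow> sstep t = 0" and sstep_1: "t \<ge> 1 \<Longrightarrow> sstep t = 1"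
  and sstep'_0: "t \<le> 0 \<Longrightarrow> sstep' t = 0" and sstep'_1: "t \<ge> 1 \<Longrightarrow> sstep' t = 0"
  unfolding sstep_def sstep'_def by (auto simp: max_def power2_eq_square algebra_simps)

lemma sstep_mono: "s \<le> t \<Longrightarrow> sstep s \<le> sstep t"
  using DERIV_nonneg_imp_nondecreasing[of s t sstep] sstep_deriv sstep'_nonneg by blast

lemma sstep_nonneg [simp]: "0 \<le> sstep t" and sstep_le_1 [simp]: "sstep t \<le> 1"
  using sstep_mono[of "min 0 t" t] sstep_0[of "min 0 t"] sstep_mono[of t "max 1 t"] sstep_1[of "max 1 t"] by auto

text \<open>Strictness on [0,1] later makes the approximants injective on the small square that
  carries their Jacobian.\<close>

lemma sstep_strict_mono:
  assumes "0 \<le> s" "s < t" "t \<le> 1"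
  shows "sstep s < sstep t"
proof (rule DERIV_pos_imp_increasing_open[OF assms(2)])
  show "\<And>x. s < x \<Longrightarrow> x < t \<Longrightarrow> \<exists>y. DERIV sstep x :> y \<and> y > 0"
  proof -
    fix x assume "s < x" "x < t"
    then have "0 < sstep' x" using assms by (auto simp: sstep'_def max_def)
    then show "\<exists>y. DERIV sstep x :> y \<and> y > 0" using sstep_deriv by blast
  qed
  show "continuous_on {s..t} sstep"
    using sstep_deriv by (meson DERIV_isCont continuous_at_imp_continuous_on)
qed

lemma sstep_inj: "inj_on sstep {0..1}"
  by (rule linorder_inj_onI') (use sstep_strict_mono in \<open>force\<close>)

lemma C1_on_sstep:
  fixes f :: "'a::euclidean_space \<Rightarrow> real"
  assumes "C1_on \<Omega> f"
  shows "C1_on \<Omega> (\<lambda>x. sstep (f x))"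
  using C1_on_compose_real[OF _ sstep'_continuous assms] sstep_deriv
  by (simp add: has_real_derivative_iff_has_vector_derivative)

text \<open>Finitely many balls cover K. One minus the product of the complementary bumps is C1 and
  equals 1 as soon as one bump does; a maximum of bumps would lose differentiability.\<close>

lemma C1_cutoff:
  fixes K :: "'a::euclidean_space set"
  assumes "compact K" "open G" "K \<subseteq> G"
  obtains \<psi> K' where "C1_on UNIV \<psi>" "\<And>x. 0 \<le> \<psi> x" "\<And>x. \<psi> x \<le> (1::real)" "\<And>x. x \<in> K \<Longrightarrow> \<psi> x = 1"
    "compact K'" "K' \<subseteq> G" "\<And>x. x \<notin> K' \<Longrightarrow> \<psi> x = 0"
proof -
  have "\<exists>\<rho>>0. cball x \<rho> \<subseteq> G" if "x \<in> K" for x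
    using assms(2,3) that unfolding open_contains_cball by blast
  then obtain \<rho> where \<rho>: "\<And>x. x \<in> K \<Longrightarrow> \<rho> x > 0 \<and> cball x (\<rho> x) \<subseteq> G"
    unfolding Bex_def by metis
  have "K \<subseteq> (\<Union>x\<in>K. ball x (\<rho> x / 2))" using \<rho> by force
  then obtain F where F: "F \<subseteq> K" "finite F" "K \<subseteq> (\<Union>x\<in>F. ball x (\<rho> x / 2))"
    using compactE_image[OF assms(1), of K "\<lambda>x. ball x (\<rho> x / 2)"] by auto
  define b where "b x y = sstep (2 - 2 * ((y - x) \<bullet> (y - x)) / (\<rho> x)\<^sup>2)" for x y
  define \<psi> where "\<psi> y = 1 - (\<Prod>x\<in>F. 1 - b x y)" for y
  have b01: "0 \<le> b x y" "b x y \<le> 1" for x y unfolding b_def by auto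
  have p01: "0 \<le> (\<Prod>x\<in>F. 1 - b x y)" "(\<Prod>x\<in>F. 1 - b x y) \<le> 1" for y
    using b01 by (auto intro!: prod_nonneg prod_le_1)
  show ?thesis
  proof (rule that[of \<psi> "\<Union>x\<in>F. cball x (\<rho> x)"])
    have "C1_on UNIV (\<lambda>y::'a. (y - x) \<bullet> (y - x))" for x
      by (intro C1_on_inner C1_on_diff C1_on_linear C1_on_const bounded_linear_ident)
    then have "C1_on UNIV (\<lambda>y. (2 / (\<rho> x)\<^sup>2) * ((y - x) \<bullet> (y - x)))" for x
      by (intro C1_on_mult C1_on_const)
    then show "C1_on UNIV \<psi>" unfolding \<psi>_def[abs_def] b_def
      by (intro C1_on_diff C1_on_const C1_on_prod C1_on_sstep) (simp add: field_simps)
    show "0 \<le> \<psi> y" "\<psi> y \<le> 1" for y using p01 unfolding \<psi>_def by auto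
    show "compact (\<Union>x\<in>F. cball x (\<rho> x))" using F by auto
    show "(\<Union>x\<in>F. cball x (\<rho> x)) \<subseteq> G" using F \<rho> by blast
    show "\<psi> y = 1" if "y \<in> K" for y
    proof -
      obtain x where x: "x \<in> F" "dist x y < \<rho> x / 2" using F(3) \<open>y \<in> K\<close> by auto
      have r: "\<rho> x > 0" using x(1) F(1) \<rho> by auto
      have "(y - x) \<bullet> (y - x) = (dist x y)\<^sup>2" by (metis dist_commute dist_norm power2_norm_eq_inner)
      also have "\<dots> \<le> (\<rho> x / 2)\<^sup>2" using x by (intro power_mono) auto
      also have "\<dots> = (\<rho> x)\<^sup>2 / 4" by (simp add: power_divide)
      finally have "4 * ((y - x) \<bullet> (y - x)) \<le> (\<rho> x)\<^sup>2" by simp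
      moreover have "0 \<le> (y - x) \<bullet> (y - x)" by simp
      ultimately have "2 * ((y - x) \<bullet> (y - x)) \<le> 1 * (\<rho> x)\<^sup>2" by linarith
      then have "2 * ((y - x) \<bullet> (y - x)) / (\<rho> x)\<^sup>2 \<le> 1" using r by (subst pos_divide_le_eq) auto
      then have "b x y = 1" unfolding b_def by (intro sstep_1) auto
      then show ?thesis unfolding \<psi>_def using x F by (auto simp: prod_zero_iff intro!: bexI[of _ x])
    qed
    show "\<psi> y = 0" if "y \<notin> (\<Union>x\<in>F. cball x (\<rho> x))" for y
    proof -
      have "b x y = 0" if x: "x \<in> F" for x
      proof -
        have r: "\<rho> x > 0" "dist x y > \<rho> x" using x F(1) \<rho> \<open>y \<notin> _\<close> by (auto simp: not_le)
        have "(y - x) \<bullet> (y - x) = (dist x y)\<^sup>2" by (metis dist_commute dist_norm power2_norm_eq_inner)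
        moreover have "(dist x y)\<^sup>2 \<ge> (\<rho> x)\<^sup>2" using r by (intro power_mono) auto
        ultimately have "2 * ((y - x) \<bullet> (y - x)) \<ge> 2 * (\<rho> x)\<^sup>2" by simp
        then have "2 * ((y - x) \<bullet> (y - x)) / (\<rho> x)\<^sup>2 \<ge> 2" using r by (subst pos_le_divide_eq) auto
        then show ?thesis unfolding b_def by (intro sstep_0) auto
      qed
      then show ?thesis unfolding \<psi>_def by simp
    qed
  qed
qed

section \<open>Fubini in orthonormal frames of the plane\<close>

lemma Basis_real2: "(Basis :: (real^2) set) = {axis 1 1, axis 2 1}"
  by (auto simp: Basis_vec_def UNIV_2)

lemma inner_real2: "(x::real^2) \<bullet> y = x$1 * y$1 + x$2 * y$2"
  by (simp add: inner_vec_def sum_2)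

lemma axis2_nth [simp]:
  "(axis 1 a :: real^2)$1 = a" "(axis 1 a :: real^2)$2 = 0"
  "(axis 2 a :: real^2)$1 = 0" "(axis 2 a :: real^2)$2 = a"
  by (simp_all add: axis_def)

lemma lborel_coordinates:
  "distr (lborel \<Otimes>\<^sub>M lborel) borel (\<lambda>(s,t). s *\<^sub>R axis 1 1 + t *\<^sub>R axis 2 1) = (lborel :: (real^2) measure)"
    (is "distr _ _ ?T = _")
proof (rule lborel_eqI[symmetric])
  fix l u :: "real^2" assume lu: "\<And>b. b \<in> Basis \<Longrightarrow> l \<bullet> b \<le> u \<bullet> b"
  have le: "l$1 \<le> u$1" "l$2 \<le> u$2" using lu[of "axis 1 1"] lu[of "axis 2 1"] by (auto simp: Basis_real2 inner_real2)
  have m: "?T \<in> borel_measurable (lborel \<Otimes>\<^sub>M lborel)" by measurable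
  have "?T -` box l u \<inter> space (lborel \<Otimes>\<^sub>M lborel) = {l$1<..<u$1} \<times> {l$2<..<u$2}"
    by (auto simp: mem_box_cart forall_2 space_pair_measure)
  then have "emeasure (distr (lborel \<Otimes>\<^sub>M lborel) borel ?T) (box l u) = emeasure (lborel \<Otimes>\<^sub>M lborel) ({l$1<..<u$1} \<times> {l$2<..<u$2})"
    using m by (simp add: emeasure_distr)
  also have "\<dots> = ennreal (u$1 - l$1) * ennreal (u$2 - l$2)"
    using le by (subst lborel.emeasure_pair_measure_Times) auto
  also have "\<dots> = ennreal (\<Prod>b\<in>Basis. (u - l) \<bullet> b)"
    using le by (simp add: Basis_real2 axis_eq_axis inner_real2 ennreal_mult)
  finally show "emeasure (distr (lborel \<Otimes>\<^sub>M lborel) borel ?T) (box l u) = (\<Prod>b\<in>Basis. (u - l) \<bullet> b)" .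
qed simp

lemma lborel_distr_orthogonal:
  fixes T :: "real^2 \<Rightarrow> real^2"
  assumes T: "orthogonal_transformation T"
  shows "distr lborel borel T = lborel"
proof (rule lborel_eqI[symmetric])
  have "bounded_linear T" using T orthogonal_transformation_linear linear_conv_bounded_linear by blast
  then have m: "T \<in> borel_measurable lborel"
    by (simp add: borel_measurable_continuous_onI linear_continuous_on)
  fix l u :: "real^2" assume lu: "\<And>b. b \<in> Basis \<Longrightarrow> l \<bullet> b \<le> u \<bullet> b"
  have "T -` box l u = inv T ` box l u"
    using orthogonal_transformation_bij[OF T] bij_vimage_eq_inv_image by blast
  moreover have "orthogonal_transformation (inv T)" using T orthogonal_transformation_inv by blast
  ultimately have 1: "T -` box l u \<in> lmeasurable" "measure lebesgue (T -` box l u) = measure lebesgue (box l u)"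
    by (simp_all add: measurable_orthogonal_image measure_orthogonal_image)
  have "emeasure (distr lborel borel T) (box l u) = emeasure lborel (T -` box l u)"
    using m by (simp add: emeasure_distr)
  also have "\<dots> = emeasure lebesgue (T -` box l u)"
    using measurable_sets[OF m, of "box l u"] by simp
  also have "\<dots> = ennreal (measure lebesgue (T -` box l u))" using 1 by (simp add: emeasure_eq_measure2)
  also have "\<dots> = (\<Prod>b\<in>Basis. (u - l) \<bullet> b)"
    using 1 lu measure_lborel_box_eq[of l u] by simp
  finally show "emeasure (distr lborel borel T) (box l u) = (\<Prod>b\<in>Basis. (u - l) \<bullet> b)" .
qed simp

text \<open>Interfaces run in three directions, so Fubini, jump estimates and slicing are set up
  once for an arbitrary orthonormal pair. In the jump and slicing estimates \<open>e\<close>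
  typically runs along an interface and \<open>\<nu>\<close> crosses it.\<close>

locale frame =
  fixes e \<nu> :: "real^2"
  assumes norm_e [simp]: "e \<bullet> e = 1" and norm_\<nu> [simp]: "\<nu> \<bullet> \<nu> = 1" and orth [simp]: "e \<bullet> \<nu> = 0"
begin

lemma orth' [simp]: "\<nu> \<bullet> e = 0" by (metis orth inner_commute)

lemma norm_e1 [simp]: "norm e = 1" and norm_\<nu>1 [simp]: "norm \<nu> = 1" by (simp_all add: norm_eq_sqrt_inner)

lemma swap: "frame \<nu> e" by unfold_locales auto

lemma lborel_frame:
  "distr (lborel \<Otimes>\<^sub>M lborel) borel (\<lambda>(s,t). p + s *\<^sub>R e + t *\<^sub>R \<nu>) = (lborel :: (real^2) measure)"
proof -
  define T where "T x = x$1 *\<^sub>R e + x$2 *\<^sub>R \<nu>" for x :: "real^2"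
  define A :: "real \<times> real \<Rightarrow> real^2" where "A = (\<lambda>(s,t). s *\<^sub>R axis 1 1 + t *\<^sub>R axis 2 1)"
  have "linear T" unfolding T_def[abs_def] by (rule linearI) (auto simp: algebra_simps)
  moreover have "T v \<bullet> T w = v \<bullet> w" for v w
    unfolding T_def inner_real2[of v w] by (simp add: inner_add_left inner_add_right)
  ultimately have T: "orthogonal_transformation T" unfolding orthogonal_transformation_def by blast
  have mA: "A \<in> borel_measurable (lborel \<Otimes>\<^sub>M lborel)" unfolding A_def by measurable
  have mT: "T \<in> borel_measurable borel" 
    using \<open>linear T\<close> by (simp add: borel_measurable_continuous_onI linear_continuous_on linear_conv_bounded_linear)
  have "(lborel :: (real^2) measure) = distr (distr (distr (lborel \<Otimes>\<^sub>M lborel) borel A) borel T) borel ((+) p)"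
    using lborel_coordinates lborel_distr_orthogonal[OF T] lborel_distr_plus[of p] by (simp add: A_def)
  also have "\<dots> = distr (lborel \<Otimes>\<^sub>M lborel) borel ((+) p \<circ> T \<circ> A)"
    using mA mT by (simp add: distr_distr o_assoc)
  also have "(+) p \<circ> T \<circ> A = (\<lambda>(s,t). p + s *\<^sub>R e + t *\<^sub>R \<nu>)"
    by (auto simp: T_def A_def fun_eq_iff add.assoc)
  finally show ?thesis by simp
qed

lemma frame_measurable: "(\<lambda>(s,t). p + s *\<^sub>R e + t *\<^sub>R \<nu>) \<in> borel_measurable (lborel \<Otimes>\<^sub>M lborel)"
  by measurable

lemma nn_integral_frame:
  assumes [measurable]: "f \<in> borel_measurable borel"
  shows "(\<integral>\<^sup>+x. f x \<partial>lborel) = (\<integral>\<^sup>+s. \<integral>\<^sup>+t. f (p + s *\<^sub>R e + t *\<^sub>R \<nu>) \<partial>lborel \<partial>lborel)"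
proof -
  have m: "(\<lambda>x. f (case x of (s,t) \<Rightarrow> p + s *\<^sub>R e + t *\<^sub>R \<nu>)) \<in> borel_measurable (lborel \<Otimes>\<^sub>M lborel)"
    using measurable_compose[OF frame_measurable assms] by simp
  have "(\<integral>\<^sup>+x. f x \<partial>lborel) = (\<integral>\<^sup>+x. f (case x of (s,t) \<Rightarrow> p + s *\<^sub>R e + t *\<^sub>R \<nu>) \<partial>(lborel \<Otimes>\<^sub>M lborel))"
    by (subst lborel_frame[of p, symmetric], subst nn_integral_distr[OF frame_measurable])
      (auto simp: case_prod_unfold)
  then show ?thesis using lborel.nn_integral_fst[OF m] by simp
qed

lemma integrable_frame:
  fixes f :: "real^2 \<Rightarrow> real"
  assumes "integrable lborel f"
  shows "integrable (lborel \<Otimes>\<^sub>M lborel) (\<lambda>(s,t). f (p + s *\<^sub>R e + t *\<^sub>R \<nu>))"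
proof -
  have m: "f \<in> borel_measurable borel" using assms by auto
  have "integrable (distr (lborel \<Otimes>\<^sub>M lborel) borel (\<lambda>(s,t). p + s *\<^sub>R e + t *\<^sub>R \<nu>)) f"
    using assms lborel_frame by simp
  then show ?thesis using integrable_distr_eq[OF frame_measurable, of f p] m by (simp add: case_prod_unfold)
qed

lemma integral_frame:
  fixes f :: "real^2 \<Rightarrow> real"
  assumes "integrable lborel f"
  shows "integral\<^sup>L lborel f = (\<integral>s. \<integral>t. f (p + s *\<^sub>R e + t *\<^sub>R \<nu>) \<partial>lborel \<partial>lborel)"
proof -
  have m: "f \<in> borel_measurable borel" using assms by auto
  have "integral\<^sup>L lborel f = (\<integral>x. (case x of (s,t) \<Rightarrow> f (p + s *\<^sub>R e + t *\<^sub>R \<nu>)) \<partial>(lborel \<Otimes>\<^sub>M lborel))"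
    by (subst lborel_frame[of p, symmetric], subst integral_distr[OF frame_measurable m])
      (auto simp: case_prod_unfold)
  also have "\<dots> = (\<integral>s. \<integral>t. f (p + s *\<^sub>R e + t *\<^sub>R \<nu>) \<partial>lborel \<partial>lborel)"
    using lborel_pair.integral_fst'[OF integrable_frame[OF assms, of p]] by simp
  finally show ?thesis .
qed

end

interpretation axes: frame "axis 1 1" "axis 2 1"
  by unfold_locales (auto simp: inner_real2)

section \<open>Integration by parts against compactly supported C1 maps\<close>

lemma integrable_continuous_compact_support:
  fixes f :: "'a::euclidean_space \<Rightarrow> 'b::euclidean_space"
  assumes "continuous_on UNIV f" "compact K" "\<And>x. x \<notin> K \<Longrightarrow> f x = 0"
  shows "integrable lborel f"
proof -
  have "integrable lborel (\<lambda>x. indicator K x *\<^sub>R f x)"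
    using borel_integrable_compact[OF assms(2)] continuous_on_subset[OF assms(1)] by auto
  moreover have "(\<lambda>x. indicator K x *\<^sub>R f x) = f" using assms(3) by (auto simp: indicator_def fun_eq_iff)
  ultimately show ?thesis by simp
qed

lemma has_derivative_zero_outside:
  assumes "(f has_derivative D) (at x)" "closed K" "x \<notin> K" "\<And>y. y \<notin> K \<Longrightarrow> f y = 0"
  shows "D h = 0"
proof -
  have "(f has_derivative (\<lambda>_. 0)) (at x)"
    by (rule has_derivative_transform_within_open[where f="\<lambda>_. 0" and s="-K"]) (use assms in auto)
  then show ?thesis using has_derivative_unique[OF assms(1)] by metis
qed

text \<open>Difference quotients integrate to 0 by translation invariance, and dominated convergence
  passes to the derivative.\<close>

lemma integral_directional_derivative_eq_0:
  fixes f :: "'a::euclidean_space \<Rightarrow> real"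
  assumes D: "\<And>x. (f has_derivative D x) (at x)" "\<And>h. continuous_on UNIV (\<lambda>x. D x h)"
    and K: "compact K" "\<And>x. x \<notin> K \<Longrightarrow> f x = 0"
  shows "integral\<^sup>L lborel (\<lambda>x. D x h) = 0"
proof -
  have cf: "continuous_on UNIV f"
    using D(1) by (meson continuous_at_imp_continuous_on has_derivative_continuous)
  have D0: "D x h = 0" if "x \<notin> K" for x
    using has_derivative_zero_outside[OF D(1) compact_imp_closed[OF K(1)] that K(2)] .
  obtain M where M: "\<And>x. x \<in> K \<Longrightarrow> \<bar>D x h\<bar> \<le> M"
    using compact_imp_bounded[OF compact_continuous_image[OF continuous_on_subset[OF D(2)[of h]] K(1)]]
    by (auto simp: bounded_real)
  have M': "\<bar>D x h\<bar> \<le> max M 0" for x using M[of x] D0[of x] by (cases "x \<in> K") auto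
  \<comment> \<open>All x for which some x + s h with 0 \<le> s \<le> 1 lies in K. It carries every
    difference quotient with step at most 1 and therefore the dominating function.\<close>
  define S where "S = (\<lambda>(x,s). x + s *\<^sub>R h) ` (K \<times> {-1..0})"
  have S: "compact S" unfolding S_def case_prod_unfold
    by (intro compact_continuous_image continuous_intros compact_Times K) auto
  have KS: "K \<subseteq> S" unfolding S_def by (force intro!: image_eqI[where x="(_,0)"])
  define q where "q n x = (f (x + (1 / real (Suc n)) *\<^sub>R h) - f x) * real (Suc n)" for n x
  have q0: "q n x = 0" if "x \<notin> S" for n x
  proof -
    have "x \<notin> K" using that KS by auto
    moreover have "x + (1 / real (Suc n)) *\<^sub>R h \<notin> K"
    proof
      assume "x + (1 / real (Suc n)) *\<^sub>R h \<in> K"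
      then have "x \<in> S" unfolding S_def
        by (intro image_eqI[where x="(x + (1 / real (Suc n)) *\<^sub>R h, - (1 / real (Suc n)))"]) (auto simp: field_simps)
      with that show False by simp
    qed
    ultimately show ?thesis using K(2) by (simp add: q_def)
  qed
  have qM: "\<bar>q n x\<bar> \<le> max M 0" for n x
  proof -
    define s where "s = 1 / real (Suc n)"
    have s: "s > 0" by (simp add: s_def)
    define F where "F \<equiv> \<lambda>\<tau>. f (x + \<tau> *\<^sub>R h)"
    have FD: "(F has_real_derivative D (x + \<tau> *\<^sub>R h) h) (at \<tau>)" for \<tau>
    proof -
      have l: "((\<lambda>\<tau>. x + \<tau> *\<^sub>R h) has_derivative (\<lambda>d. d *\<^sub>R h)) (at \<tau>)" by (auto intro!: derivative_eq_intros)
      have "(F has_derivative (\<lambda>d. D (x + \<tau> *\<^sub>R h) (d *\<^sub>R h))) (at \<tau>)"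
        unfolding F_def using has_derivative_compose[OF l D(1)] .
      then show ?thesis unfolding has_field_derivative_def
        using linear_cmul[OF has_derivative_linear[OF D(1)[of "x + \<tau> *\<^sub>R h"]]] by (simp add: mult_commute_abs)
    qed
    obtain z where "0 < z" "z < s" "F s - F 0 = (s - 0) * D (x + z *\<^sub>R h) h"
      using MVT2[OF s, of F "\<lambda>\<tau>. D (x + \<tau> *\<^sub>R h) h"] FD by blast
    then have "q n x = D (x + z *\<^sub>R h) h" using s by (simp add: q_def F_def s_def)
    then show ?thesis using M' by simp
  qed
  have int_q: "integral\<^sup>L lborel (q n) = 0" for n
  proof -
    let ?c = "(1 / real (Suc n)) *\<^sub>R h"
    have i: "integrable lborel f" by (rule integrable_continuous_compact_support[OF cf K])
    have "integrable (distr lborel borel ((+) ?c)) f" using i lborel_distr_plus[of ?c] by simp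
    then have i2: "integrable lborel (\<lambda>x. f (?c + x))"
      using i by (subst (asm) integrable_distr_eq) auto
    have "integral\<^sup>L lborel f = integral\<^sup>L (distr lborel borel ((+) ?c)) f" using lborel_distr_plus[of ?c] by simp
    also have "\<dots> = integral\<^sup>L lborel (\<lambda>x. f (?c + x))" using i by (subst integral_distr) auto
    finally have "integral\<^sup>L lborel (\<lambda>x. f (?c + x)) - integral\<^sup>L lborel f = 0" by simp
    then have "integral\<^sup>L lborel (\<lambda>x. f (?c + x) - f x) = 0" using i i2 by simp
    moreover have "q n = (\<lambda>x. real (Suc n) * (f (?c + x) - f x))"
      unfolding q_def by (simp only: add.commute mult.commute)
    ultimately show ?thesis by (metis integral_mult_right_zero mult_zero_right)
  qed
  have "(\<lambda>n. integral\<^sup>L lborel (q n)) \<longlonglongrightarrow> integral\<^sup>L lborel (\<lambda>x. D x h)"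
  proof (rule integral_dominated_convergence[where w="\<lambda>x. indicator S x *\<^sub>R max M 0"])
    show "(\<lambda>x. D x h) \<in> borel_measurable lborel"
      using D(2) by (simp add: borel_measurable_continuous_onI)
    have "continuous_on UNIV (q n)" for n unfolding q_def[abs_def]
      by (intro continuous_intros continuous_on_compose2[OF cf]) auto
    then show "q n \<in> borel_measurable lborel" for n by (simp add: borel_measurable_continuous_onI)
    show "integrable lborel (\<lambda>x. indicator S x *\<^sub>R max M 0)"
      by (rule borel_integrable_compact[OF S]) auto
    show "AE x in lborel. norm (q n x) \<le> indicator S x *\<^sub>R max M 0" for n
      using qM q0 by (intro AE_I2) (auto simp: indicator_def)
    show "AE x in lborel. (\<lambda>n. q n x) \<longlonglongrightarrow> D x h"
    proof (intro AE_I2)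
      fix x
      have l: "((\<lambda>\<tau>. x + \<tau> *\<^sub>R h) has_derivative (\<lambda>d. d *\<^sub>R h)) (at 0)" by (auto intro!: derivative_eq_intros)
      have "((\<lambda>\<tau>. f (x + \<tau> *\<^sub>R h)) has_derivative (\<lambda>d. D x (d *\<^sub>R h))) (at 0)"
        using has_derivative_compose[OF l, of f "D x"] D(1)[of x] by simp
      then have "((\<lambda>\<tau>. f (x + \<tau> *\<^sub>R h)) has_real_derivative D x h) (at 0)"
        unfolding has_field_derivative_def
        using linear_cmul[OF has_derivative_linear[OF D(1)[of x]]] by (simp add: mult_commute_abs)
      then have "((\<lambda>s. (f (x + s *\<^sub>R h) - f x) / s) \<longlongrightarrow> D x h) (at 0)" by (simp add: DERIV_def)
      moreover have "filterlim (\<lambda>n. 1 / real (Suc n)) (at 0) sequentially"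
        unfolding filterlim_at using LIMSEQ_Suc[OF lim_1_over_n] by (auto intro!: always_eventually)
      ultimately have "(\<lambda>n. (f (x + (1 / real (Suc n)) *\<^sub>R h) - f x) / (1 / real (Suc n))) \<longlonglongrightarrow> D x h"
        by (rule filterlim_compose)
      then show "(\<lambda>n. q n x) \<longlonglongrightarrow> D x h" by (simp add: q_def)
    qed
  qed
  then show ?thesis by (simp add: int_q LIMSEQ_const_iff)
qed

section \<open>The total variation\<close>

lemma trace_matrix: "trace (matrix f) = (\<Sum>j\<in>UNIV. f (axis j 1) $ j)"
  by (simp add: trace_def matrix_def)

text \<open>The row-wise divergence is regrouped by coordinate directions, the form to which
  integration by parts in one direction at a time applies.\<close>

lemma row_div_eq:
  assumes "(\<phi> has_derivative D) (at x)"
  shows "row_div \<phi> x = (\<Sum>j\<in>UNIV. column j (D (axis j 1)))"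
proof -
  have "((\<lambda>y. \<phi> y $ i) has_derivative (\<lambda>h. D h $ i)) (at x)" for i
    using bounded_linear.has_derivative[OF bounded_linear_vec_nth assms] .
  then have "frechet_derivative (\<lambda>y. \<phi> y $ i) (at x) = (\<lambda>h. D h $ i)" for i
    by (metis frechet_derivative_at)
  then show ?thesis
    by (simp add: row_div_def jacobian_def trace_matrix vec_eq_iff column_def)
qed

lemma test_fieldE:
  assumes "\<phi> \<in> test_fields \<Omega>"
  obtains D K where "\<And>x. (\<phi> has_derivative D x) (at x)" "\<And>h. continuous_on UNIV (\<lambda>x. D x h)"
    "compact K" "K \<subseteq> \<Omega>" "\<And>x. x \<notin> K \<Longrightarrow> \<phi> x = 0" "\<And>x. norm (\<phi> x) \<le> 1"
    "\<And>x h. x \<notin> K \<Longrightarrow> D x h = 0" "\<And>x. row_div \<phi> x = (\<Sum>j\<in>UNIV. column j (D x (axis j 1)))"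
proof -
  obtain K where K: "compact K" "K \<subseteq> \<Omega>" "\<And>x. x \<notin> K \<Longrightarrow> \<phi> x = 0" and n: "\<And>x. norm (\<phi> x) \<le> 1"
    and c: "C1_on UNIV \<phi>" using assms unfolding test_fields_def by blast
  obtain D where D: "\<And>x. x \<in> UNIV \<Longrightarrow> (\<phi> has_derivative D x) (at x)"
    "\<And>h. continuous_on UNIV (\<lambda>x. D x h)" by (rule C1_onE[OF c]) (rule that)
  show ?thesis
    by (rule that[of D K])
      (use D K n row_div_eq has_derivative_zero_outside[OF D(1) compact_imp_closed[OF K(1)] _ K(3)] in auto)
qed

lemma row_div_test_field:
  assumes "\<phi> \<in> test_fields \<Omega>"
  obtains M where "continuous_on UNIV (row_div \<phi>)" "\<And>x. norm (row_div \<phi> x) \<le> M"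
    "\<And>x. x \<notin> \<Omega> \<Longrightarrow> row_div \<phi> x = 0"
proof -
  obtain D K where D: "\<And>x. (\<phi> has_derivative D x) (at x)" "\<And>h. continuous_on UNIV (\<lambda>x. D x h)"
    "compact K" "K \<subseteq> \<Omega>" "\<And>x. x \<notin> K \<Longrightarrow> \<phi> x = 0" "\<And>x. norm (\<phi> x) \<le> 1"
    "\<And>x h. x \<notin> K \<Longrightarrow> D x h = 0" "\<And>x. row_div \<phi> x = (\<Sum>j\<in>UNIV. column j (D x (axis j 1)))"
    by (rule test_fieldE[OF assms]) (rule that)
  have "bounded_linear (column j :: real^2^2 \<Rightarrow> real^2)" for j
    unfolding linear_conv_bounded_linear[symmetric]
    by (rule linearI) (auto simp: column_def vec_eq_iff)
  then have c: "continuous_on UNIV (row_div \<phi>)"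
    unfolding D(8)[abs_def] by (intro continuous_on_sum bounded_linear.continuous_on[where f="column _"] D)
  have z: "row_div \<phi> x = 0" if "x \<notin> K" for x
    using D(7)[OF that] D(8)[of x] by (simp add: column_def vec_eq_iff zero_vec_def)
  obtain M where M: "\<And>x. x \<in> K \<Longrightarrow> norm (row_div \<phi> x) \<le> M"
    using compact_imp_bounded[OF compact_continuous_image[OF continuous_on_subset[OF c] D(3)]]
    by (auto simp: bounded_iff)
  show ?thesis
  proof (rule that[OF c])
    show "norm (row_div \<phi> x) \<le> max M 0" for x using M[of x] z[of x] by (cases "x \<in> K") auto
    show "row_div \<phi> x = 0" if "x \<notin> \<Omega>" for x using that z D(4) by blast
  qed
qed

text \<open>A test field is supported inside \<Omega>, so the set drops out of the integral.
  Distributional derivatives on different sets become comparable.\<close>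

lemma distr_deriv_eq:
  assumes "\<phi> \<in> test_fields \<Omega>"
  shows "distr_deriv \<Omega> u \<phi> = - (LINT x|lebesgue. u x \<bullet> row_div \<phi> x)"
proof -
  obtain M where M: "continuous_on UNIV (row_div \<phi>)" "\<And>x. norm (row_div \<phi> x) \<le> M"
    "\<And>x. x \<notin> \<Omega> \<Longrightarrow> row_div \<phi> x = 0"
    by (rule row_div_test_field[OF assms]) (rule that)
  have "indicat_real \<Omega> x *\<^sub>R (u x \<bullet> row_div \<phi> x) = u x \<bullet> row_div \<phi> x" for x
    using M(3) by (auto simp: indicator_def)
  then show ?thesis by (simp only: distr_deriv_def set_lebesgue_integral_def)
qed

lemma test_fields_mono: "\<Omega> \<subseteq> \<Omega>' \<Longrightarrow> test_fields \<Omega> \<subseteq> test_fields \<Omega>'"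
  unfolding test_fields_def by blast

lemma zero_test_field: "(\<lambda>x. 0) \<in> test_fields \<Omega>"
  unfolding test_fields_def by (auto intro!: exI[of _ "{}"])

lemma distr_deriv_zero: "distr_deriv \<Omega> u (\<lambda>x. 0) = 0"
  by (simp add: distr_deriv_eq[OF zero_test_field] row_div_eq[OF has_derivative_const] column_def zero_vec_def[symmetric])

lemma total_var_mono: "\<Omega> \<subseteq> \<Omega>' \<Longrightarrow> total_var u \<Omega> \<le> total_var u \<Omega>'"
  unfolding total_var_def
  using test_fields_mono[of \<Omega> \<Omega>'] by (intro SUP_mono) (metis distr_deriv_eq order_refl subsetD)

lemma integrable_L1_maps_row_div:
  assumes "u \<in> L1_maps \<Omega>" "\<phi> \<in> test_fields \<Omega>"
  shows "integrable lebesgue (\<lambda>x. u x \<bullet> row_div \<phi> x)"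
proof -
  obtain M where M: "continuous_on UNIV (row_div \<phi>)" "\<And>x. norm (row_div \<phi> x) \<le> M"
    "\<And>x. x \<notin> \<Omega> \<Longrightarrow> row_div \<phi> x = 0" by (rule row_div_test_field[OF assms(2)]) (rule that)
  have i: "integrable lebesgue (\<lambda>x. indicator \<Omega> x *\<^sub>R u x)"
    using assms(1) by (simp add: L1_maps_def set_integrable_def)
  have e: "u x \<bullet> row_div \<phi> x = (indicator \<Omega> x *\<^sub>R u x) \<bullet> row_div \<phi> x" for x
    using M(3) by (auto simp: indicator_def)
  have m: "row_div \<phi> \<in> borel_measurable lebesgue"
    using M(1) by (simp add: borel_measurable_continuous_onI measurable_completion)
  show ?thesis unfolding e
  proof (rule Bochner_Integration.integrable_bound[where f="\<lambda>x. M * norm (indicator \<Omega> x *\<^sub>R u x)"])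
    show "integrable lebesgue (\<lambda>x. M * norm (indicator \<Omega> x *\<^sub>R u x))"
      by (intro Bochner_Integration.integrable_mult_right integrable_norm i)
    show "(\<lambda>x. (indicator \<Omega> x *\<^sub>R u x) \<bullet> row_div \<phi> x) \<in> borel_measurable lebesgue"
      using borel_measurable_integrable[OF i] m by (rule borel_measurable_inner)
    have "norm ((indicator \<Omega> x *\<^sub>R u x) \<bullet> row_div \<phi> x) \<le> norm (M * norm (indicator \<Omega> x *\<^sub>R u x))" for x
    proof -
      have "norm ((indicator \<Omega> x *\<^sub>R u x) \<bullet> row_div \<phi> x) \<le> norm (indicator \<Omega> x *\<^sub>R u x) * norm (row_div \<phi> x)"
        unfolding real_norm_def by (rule Cauchy_Schwarz_ineq2)
      also have "\<dots> \<le> norm (indicator \<Omega> x *\<^sub>R u x) * M" by (intro mult_left_mono M) auto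
      also have "\<dots> \<le> norm (M * norm (indicator \<Omega> x *\<^sub>R u x))"
        unfolding real_norm_def mult.commute[of _ M] by (rule abs_ge_self)
      finally show ?thesis .
    qed
    then show "AE x in lebesgue. norm ((indicator \<Omega> x *\<^sub>R u x) \<bullet> row_div \<phi> x) \<le> norm (M * norm (indicator \<Omega> x *\<^sub>R u x))"
      by simp
  qed
qed

section \<open>Superadditivity and lower semicontinuity of the total variation\<close>

lemma test_field_add_disjoint:
  assumes "\<phi> \<in> test_fields A" "\<psi> \<in> test_fields B" "A \<inter> B = {}"
  shows "(\<lambda>x. \<phi> x + \<psi> x) \<in> test_fields (A \<union> B)"
    and "row_div (\<lambda>x. \<phi> x + \<psi> x) x = row_div \<phi> x + row_div \<psi> x"
proof -
  obtain D K where D: "\<And>x. (\<phi> has_derivative D x) (at x)" "\<And>h. continuous_on UNIV (\<lambda>x. D x h)"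
    "compact K" "K \<subseteq> A" "\<And>x. x \<notin> K \<Longrightarrow> \<phi> x = 0" "\<And>x. norm (\<phi> x) \<le> 1"
    "\<And>x h. x \<notin> K \<Longrightarrow> D x h = 0" "\<And>x. row_div \<phi> x = (\<Sum>j\<in>UNIV. column j (D x (axis j 1)))"
    by (rule test_fieldE[OF assms(1)]) (rule that)
  obtain E L where E: "\<And>x. (\<psi> has_derivative E x) (at x)" "\<And>h. continuous_on UNIV (\<lambda>x. E x h)"
    "compact L" "L \<subseteq> B" "\<And>x. x \<notin> L \<Longrightarrow> \<psi> x = 0" "\<And>x. norm (\<psi> x) \<le> 1"
    "\<And>x h. x \<notin> L \<Longrightarrow> E x h = 0" "\<And>x. row_div \<psi> x = (\<Sum>j\<in>UNIV. column j (E x (axis j 1)))"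
    by (rule test_fieldE[OF assms(2)]) (rule that)
  \<comment> \<open>Because the supports are disjoint, at most one summand is nonzero and the bound
    1 survives.\<close>
  have "norm (\<phi> x + \<psi> x) \<le> 1" for x
  proof (cases "x \<in> K")
    case True
    then have "x \<notin> L" using D(4) E(4) assms(3) by auto
    then show ?thesis using D(6) E(5) by simp
  qed (use D(5) E(6) in simp)
  moreover have "C1_on UNIV (\<lambda>x. \<phi> x + \<psi> x)" using assms unfolding test_fields_def by (auto intro: C1_on_add)
  moreover have "\<exists>K. compact K \<and> K \<subseteq> A \<union> B \<and> (\<forall>x. x \<notin> K \<longrightarrow> \<phi> x + \<psi> x = 0)"
    by (rule exI[of _ "K \<union> L"]) (use D E in auto)
  ultimately show "(\<lambda>x. \<phi> x + \<psi> x) \<in> test_fields (A \<union> B)" unfolding test_fields_def by blast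
  show "row_div (\<lambda>x. \<phi> x + \<psi> x) x = row_div \<phi> x + row_div \<psi> x"
    unfolding row_div_eq[OF has_derivative_add[OF D(1) E(1)]] D(8) E(8)
    by (simp add: sum.distrib[symmetric] column_def vec_eq_iff)
qed

text \<open>Competitors on disjoint sets add up to a competitor on the union. This inequality stands
  in for additivity of the measure |Du| throughout.\<close>

lemma total_var_superadditive:
  assumes u: "u \<in> L1_maps \<Omega>" and AB: "A \<subseteq> \<Omega>" "B \<subseteq> \<Omega>" "A \<inter> B = {}"
  shows "total_var u A + total_var u B \<le> total_var u (A \<union> B)"
proof -
  have ne: "test_fields X \<noteq> {}" for X using zero_test_field by blast
  have le: "ennreal (distr_deriv A u \<phi>) + ennreal (distr_deriv B u \<psi>) \<le> total_var u (A \<union> B)"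
    if "\<phi> \<in> test_fields A" "\<psi> \<in> test_fields B" for \<phi> \<psi>
  proof -
    \<comment> \<open>Since \<open>ennreal\<close> sends negative reals to 0, a field with negative
      pairing is exchanged for the zero field; with both pairings nonnegative, real and extended
      addition agree.\<close>
    let ?p = "if distr_deriv A u \<phi> < 0 then (\<lambda>x. 0) else \<phi>"
    let ?q = "if distr_deriv B u \<psi> < 0 then (\<lambda>x. 0) else \<psi>"
    have t: "?p \<in> test_fields A" "?q \<in> test_fields B" using that zero_test_field by auto
    have nn: "distr_deriv A u ?p \<ge> 0" "distr_deriv B u ?q \<ge> 0" using distr_deriv_zero by auto
    have s: "(\<lambda>x. ?p x + ?q x) \<in> test_fields (A \<union> B)" "\<And>x. row_div (\<lambda>x. ?p x + ?q x) x = row_div ?p x + row_div ?q x"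
      using test_field_add_disjoint[OF t AB(3)] by blast+
    have i: "integrable lebesgue (\<lambda>x. u x \<bullet> row_div ?p x)" "integrable lebesgue (\<lambda>x. u x \<bullet> row_div ?q x)"
      using integrable_L1_maps_row_div[OF u] t test_fields_mono AB by blast+
    have "ennreal (distr_deriv A u \<phi>) + ennreal (distr_deriv B u \<psi>) \<le> ennreal (distr_deriv A u ?p) + ennreal (distr_deriv B u ?q)"
      by (intro add_mono) (auto simp: distr_deriv_zero ennreal_neg)
    also have "\<dots> = ennreal (distr_deriv A u ?p + distr_deriv B u ?q)" using nn by (simp add: ennreal_plus)
    also have "distr_deriv A u ?p + distr_deriv B u ?q = distr_deriv (A \<union> B) u (\<lambda>x. ?p x + ?q x)"
      unfolding distr_deriv_eq[OF t(1)] distr_deriv_eq[OF t(2)] distr_deriv_eq[OF s(1)] s(2) inner_add_right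
      using i by (simp only: Bochner_Integration.integral_add) 
    also have "ennreal \<dots> \<le> total_var u (A \<union> B)" unfolding total_var_def by (intro SUP_upper s)
    finally show ?thesis .
  qed
  have "total_var u A + total_var u B = (SUP \<phi>\<in>test_fields A. ennreal (distr_deriv A u \<phi>) + total_var u B)"
    unfolding total_var_def[of u A] using ne by (simp add: ennreal_SUP_add_left)
  also have "\<dots> \<le> total_var u (A \<union> B)"
  proof (rule SUP_least)
    fix \<phi> assume p: "\<phi> \<in> test_fields A"
    have "ennreal (distr_deriv A u \<phi>) + total_var u B = (SUP \<psi>\<in>test_fields B. ennreal (distr_deriv A u \<phi>) + ennreal (distr_deriv B u \<psi>))"
      unfolding total_var_def[of u B] using ne by (simp add: ennreal_SUP_add_right)
    also have "\<dots> \<le> total_var u (A \<union> B)" by (rule SUP_least) (rule le[OF p])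
    finally show "ennreal (distr_deriv A u \<phi>) + total_var u B \<le> total_var u (A \<union> B)" .
  qed
  finally show ?thesis .
qed

lemma total_var_sum_le:
  assumes u: "u \<in> L1_maps \<Omega>" and "finite I" "\<And>i. i \<in> I \<Longrightarrow> A i \<subseteq> G" "G \<subseteq> \<Omega>"
    and "\<And>i j. i \<in> I \<Longrightarrow> j \<in> I \<Longrightarrow> i \<noteq> j \<Longrightarrow> A i \<inter> A j = {}"
  shows "(\<Sum>i\<in>I. total_var u (A i)) \<le> total_var u G"
proof -
  have "(\<Sum>i\<in>I. total_var u (A i)) \<le> total_var u (\<Union>i\<in>I. A i)"
    using assms(2,3,5)
  proof (induction I rule: finite_induct)
    case (insert i I)
    have IH: "(\<Sum>i\<in>I. total_var u (A i)) \<le> total_var u (\<Union>i\<in>I. A i)"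
      by (rule insert.IH) (use insert.prems in auto)
    have "(\<Sum>i\<in>insert i I. total_var u (A i)) \<le> total_var u (A i) + total_var u (\<Union>i\<in>I. A i)"
      using insert.hyps IH by (auto intro: add_mono)
    also have "\<dots> \<le> total_var u (A i \<union> (\<Union>i\<in>I. A i))"
    proof (rule total_var_superadditive[OF u])
      show "A i \<inter> (\<Union>i\<in>I. A i) = {}" using insert.prems(2) insert.hyps by blast
      show "A i \<subseteq> \<Omega>" "(\<Union>i\<in>I. A i) \<subseteq> \<Omega>" using insert.prems(1) assms(4) by blast+
    qed
    finally show ?case by simp
  qed simp
  also have "\<dots> \<le> total_var u G" using assms(3) by (intro total_var_mono) auto
  finally show ?thesis .
qed

lemma distr_deriv_L1_conv:
  assumes L: "L1_conv \<Omega> w u" and t: "\<phi> \<in> test_fields \<Omega>"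
  shows "(\<lambda>k. distr_deriv \<Omega> (w k) \<phi>) \<longlonglongrightarrow> distr_deriv \<Omega> u \<phi>"
proof -
  obtain M where M: "continuous_on UNIV (row_div \<phi>)" "\<And>x. norm (row_div \<phi> x) \<le> M"
    "\<And>x. x \<notin> \<Omega> \<Longrightarrow> row_div \<phi> x = 0" by (rule row_div_test_field[OF t]) (rule that)
  have iu: "u \<in> L1_maps \<Omega>" and iw: "\<And>k. w k \<in> L1_maps \<Omega>"
    and c: "(\<lambda>k. LINT x:\<Omega>|lebesgue. norm (w k x - u x)) \<longlonglongrightarrow> 0" using L unfolding L1_conv_def by auto
  have "\<bar>distr_deriv \<Omega> (w k) \<phi> - distr_deriv \<Omega> u \<phi>\<bar> \<le> M * (LINT x:\<Omega>|lebesgue. norm (w k x - u x))" for k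
  proof -
    have i: "integrable lebesgue (\<lambda>x. u x \<bullet> row_div \<phi> x)" "integrable lebesgue (\<lambda>x. w k x \<bullet> row_div \<phi> x)"
      using integrable_L1_maps_row_div[OF _ t] iu iw by auto
    have d: "integrable lebesgue (\<lambda>x. indicator \<Omega> x *\<^sub>R norm (w k x - u x))"
      using set_integrable_norm[OF set_integral_diff(1)[of lebesgue \<Omega> "w k" u]] iu iw
      unfolding L1_maps_def set_integrable_def by auto
    have "distr_deriv \<Omega> (w k) \<phi> - distr_deriv \<Omega> u \<phi> = - (LINT x|lebesgue. (w k x - u x) \<bullet> row_div \<phi> x)"
      unfolding distr_deriv_eq[OF t] using i by (simp add: inner_diff_left Bochner_Integration.integral_diff)
    also have "\<bar>\<dots>\<bar> = norm (LINT x|lebesgue. (w k x - u x) \<bullet> row_div \<phi> x)" by simp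
    also have "\<dots> \<le> (LINT x|lebesgue. M * (indicator \<Omega> x *\<^sub>R norm (w k x - u x)))"
    proof (rule Bochner_Integration.integral_norm_bound_integral)
      show "integrable lebesgue (\<lambda>x. (w k x - u x) \<bullet> row_div \<phi> x)" using i by (simp add: inner_diff_left)
      show "integrable lebesgue (\<lambda>x. M * (indicator \<Omega> x *\<^sub>R norm (w k x - u x)))" using d by auto
      show "norm ((w k x - u x) \<bullet> row_div \<phi> x) \<le> M * (indicator \<Omega> x *\<^sub>R norm (w k x - u x))" for x
      proof (cases "x \<in> \<Omega>")
        case True
        have "norm ((w k x - u x) \<bullet> row_div \<phi> x) \<le> norm (w k x - u x) * norm (row_div \<phi> x)"
          using Cauchy_Schwarz_ineq2 by simp
        also have "\<dots> \<le> norm (w k x - u x) * M" by (intro mult_left_mono M) auto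
        finally show ?thesis using True by (simp add: mult.commute)
      qed (use M(3) in simp)
    qed
    also have "\<dots> = M * (LINT x:\<Omega>|lebesgue. norm (w k x - u x))" by (simp add: set_lebesgue_integral_def)
    finally show ?thesis .
  qed
  then have "\<forall>\<^sub>F k in sequentially. norm (distr_deriv \<Omega> (w k) \<phi> - distr_deriv \<Omega> u \<phi>)
      \<le> M * (LINT x:\<Omega>|lebesgue. norm (w k x - u x))" by simp
  then have "(\<lambda>k. distr_deriv \<Omega> (w k) \<phi> - distr_deriv \<Omega> u \<phi>) \<longlonglongrightarrow> 0"
    by (rule Lim_null_comparison) (rule tendsto_mult_right_zero[OF c])
  then show ?thesis by (rule LIM_zero_cancel)
qed

text \<open>For a fixed test field the pairing is continuous under L1 convergence, and a supremum of
  continuous functionals is lower semicontinuous. The argument works on every subset A, which is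
  what localisation requires.\<close>

lemma total_var_lower_semicontinuous:
  assumes L: "L1_conv \<Omega> w u" and "A \<subseteq> \<Omega>"
  shows "total_var u A \<le> liminf (\<lambda>k. total_var (w k) A)"
  unfolding total_var_def[of u]
proof (rule SUP_least)
  fix \<phi> assume t: "\<phi> \<in> test_fields A"
  then have t': "\<phi> \<in> test_fields \<Omega>" using assms test_fields_mono by blast
  have e: "distr_deriv A v \<phi> = distr_deriv \<Omega> v \<phi>" for v
    unfolding distr_deriv_eq[OF t] distr_deriv_eq[OF t'] ..
  have "(\<lambda>k. ennreal (distr_deriv A (w k) \<phi>)) \<longlonglongrightarrow> ennreal (distr_deriv A u \<phi>)"
    unfolding e by (intro tendsto_ennrealI distr_deriv_L1_conv[OF L t'])
  then have "ennreal (distr_deriv A u \<phi>) = liminf (\<lambda>k. ennreal (distr_deriv A (w k) \<phi>))"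
    by (simp add: lim_imp_Liminf)
  also have "\<dots> \<le> liminf (\<lambda>k. total_var (w k) A)"
    unfolding total_var_def by (intro Liminf_mono always_eventually allI SUP_upper t)
  finally show "ennreal (distr_deriv A u \<phi>) \<le> liminf (\<lambda>k. total_var (w k) A)" .
qed

text \<open>This is how strict convergence is used. On B the variation cannot drop in the limit
  while the total converges, so A receives at most what u has left outside B, namely c.\<close>

lemma eventually_total_var_le:
  assumes L: "L1_conv \<Omega> w u" and lim: "(\<lambda>k. total_var (w k) \<Omega>) \<longlonglongrightarrow> total_var u \<Omega>"
    and fin: "total_var u \<Omega> < \<infinity>"
    and AB: "A \<subseteq> \<Omega>" "B \<subseteq> \<Omega>" "A \<inter> B = {}"
    and c: "total_var u \<Omega> \<le> total_var u B + ennreal c" "0 \<le> c" and "\<epsilon> > 0"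
  shows "eventually (\<lambda>k. total_var (w k) A \<le> ennreal (c + \<epsilon>)) sequentially"
proof -
  have uB: "total_var u B < \<infinity>" using total_var_mono[OF AB(2), of u] fin by auto
  obtain b where b: "total_var u B = ennreal b" "0 \<le> b" using uB by (cases "total_var u B") auto
  obtain a where a: "total_var u \<Omega> = ennreal a" "0 \<le> a" using fin by (cases "total_var u \<Omega>") auto
  have ab: "a \<le> b + c" using c a b by (simp add: ennreal_plus[symmetric] del: ennreal_plus)
  have e1: "eventually (\<lambda>k. total_var (w k) \<Omega> < ennreal (a + \<epsilon>/2)) sequentially"
    using order_tendstoD(2)[OF lim] a \<open>\<epsilon> > 0\<close> by (simp add: ennreal_lessI)
  have e2: "eventually (\<lambda>k. ennreal b \<le> total_var (w k) B + ennreal (\<epsilon>/2)) sequentially"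
  \<comment> \<open>For b < \<epsilon>/2 the claim is trivial. Otherwise b - \<epsilon>/2 is
    nonnegative, so that \<open>ennreal\<close> does not truncate it.\<close>
  proof (cases "b < \<epsilon>/2")
    case True
    then have "ennreal b \<le> total_var (w k) B + ennreal (\<epsilon>/2)" for k
      by (metis add_increasing ennreal_leI less_imp_le zero_le)
    then show ?thesis by simp
  next
    case False
    then have "ennreal (b - \<epsilon>/2) < ennreal b" using \<open>\<epsilon> > 0\<close> by (intro ennreal_lessI) auto
    also have "\<dots> \<le> liminf (\<lambda>k. total_var (w k) B)"
      using total_var_lower_semicontinuous[OF L AB(2)] b by simp
    finally have "ennreal (b - \<epsilon>/2) < liminf (\<lambda>k. total_var (w k) B)" .
    then have "eventually (\<lambda>k. ennreal (b - \<epsilon>/2) < total_var (w k) B) sequentially"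
      by (rule less_LiminfD)
    then show ?thesis
    proof (rule eventually_mono)
      fix k assume "ennreal (b - \<epsilon>/2) < total_var (w k) B"
      then have "ennreal (b - \<epsilon>/2) + ennreal (\<epsilon>/2) \<le> total_var (w k) B + ennreal (\<epsilon>/2)" by (intro add_right_mono) auto
      then show "ennreal b \<le> total_var (w k) B + ennreal (\<epsilon>/2)" using False \<open>\<epsilon> > 0\<close> by (simp add: ennreal_plus[symmetric] del: ennreal_plus)
    qed
  qed
  show ?thesis using e1 e2
  proof eventually_elim
    case (elim k)
    have wk: "w k \<in> L1_maps \<Omega>" using L by (auto simp: L1_conv_def)
    have s: "total_var (w k) A + total_var (w k) B \<le> total_var (w k) \<Omega>"
      using total_var_superadditive[OF wk AB] total_var_mono[of "A \<union> B" \<Omega> "w k"] AB by (metis Un_least order_trans)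
    have "total_var (w k) \<Omega> < \<infinity>" using elim by (metis ennreal_less_top infinity_ennreal_def order_less_trans)
    then have "total_var (w k) A < \<infinity>" "total_var (w k) B < \<infinity>"
      using total_var_mono[OF AB(1), of "w k"] total_var_mono[OF AB(2), of "w k"] by (auto intro: le_less_trans)
    then obtain x y where xy: "total_var (w k) A = ennreal x" "0 \<le> x" "total_var (w k) B = ennreal y" "0 \<le> y"
      by (cases "total_var (w k) A"; cases "total_var (w k) B") auto
    have "ennreal (x + y) < ennreal (a + \<epsilon>/2)" using s elim xy by (simp add: ennreal_plus)
    then have 1: "x + y < a + \<epsilon>/2" using xy by (subst (asm) ennreal_less_iff) auto
    have "ennreal b \<le> ennreal (y + \<epsilon>/2)" using elim xy \<open>\<epsilon> > 0\<close> by (simp add: ennreal_plus)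
    then have "b \<le> y + \<epsilon>/2" using xy \<open>\<epsilon> > 0\<close> by (subst (asm) ennreal_le_iff) auto
    then have "x \<le> c + \<epsilon>" using 1 ab by linarith
    then show ?case using xy by (simp add: ennreal_leI)
  qed
qed

text \<open>Test fields have compact support, so estimates come out on compact sets first; a
  monotone exhaustion carries them to the open set.\<close>

lemma nn_integral_open_le:
  fixes f :: "'a::euclidean_space \<Rightarrow> ennreal"
  assumes R: "open R" and m: "(\<lambda>x. f x * indicator R x) \<in> borel_measurable borel"
    and le: "\<And>K. compact K \<Longrightarrow> K \<subseteq> R \<Longrightarrow> (\<integral>\<^sup>+x. f x * indicator K x \<partial>lborel) \<le> V"
  shows "(\<integral>\<^sup>+x. f x * indicator R x \<partial>lborel) \<le> V"
proof -
  obtain C where C: "\<And>n. compact (C n)" "\<And>n. C n \<subseteq> R" "\<And>n. C n \<subseteq> interior (C (Suc n))" "\<Union>(range C) = R"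
    by (rule open_Union_compact_subsets[OF R]) (rule that)
  have incC: "incseq C" using C(3) interior_subset by (intro incseq_SucI) blast
  have inc: "incseq (\<lambda>n x. f x * indicator (C n) x)"
    using incC by (auto simp: incseq_def le_fun_def indicator_def)
  have mC: "(\<lambda>x. f x * indicator (C n) x) \<in> borel_measurable borel" for n
  proof -
    have "indicator (C n) \<in> borel_measurable borel" using borel_compact[OF C(1)[of n]] by (rule borel_measurable_indicator)
    from borel_measurable_times_ennreal[OF m this]
    have "(\<lambda>x. f x * indicator R x * indicator (C n) x) \<in> borel_measurable borel" .
    moreover have "(\<lambda>x. f x * indicator R x * indicator (C n) x) = (\<lambda>x. f x * indicator (C n) x)"
      using C(2)[of n] by (auto simp: indicator_def fun_eq_iff)
    ultimately show ?thesis by simp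
  qed
  have eq: "f x * indicator R x = (SUP n. f x * indicator (C n) x)" for x
  proof (cases "x \<in> R")
    case True
    then obtain n where "x \<in> C n" using C(4) by auto
    then show ?thesis using True by (intro antisym SUP_upper2[of n] SUP_least) (auto simp: indicator_def)
  next
    case False
    then have "x \<notin> C n" for n using C(2) by auto
    then show ?thesis using False by simp
  qed
  have "(\<integral>\<^sup>+x. f x * indicator R x \<partial>lborel) = (SUP n. \<integral>\<^sup>+x. f x * indicator (C n) x \<partial>lborel)"
    unfolding eq by (rule nn_integral_monotone_convergence_SUP[OF inc]) (use mC in simp)
  also have "\<dots> \<le> V" by (intro SUP_least le C)
  finally show ?thesis .
qed

section \<open>Total variation of C1 maps\<close>

lemma continuous_on_zero_extension:
  assumes "open \<Omega>" "closed K" "K \<subseteq> \<Omega>" "continuous_on \<Omega> g" "\<And>x. x \<in> \<Omega> - K \<Longrightarrow> g x = 0"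
  shows "continuous_on UNIV (\<lambda>x. if x \<in> \<Omega> then g x else 0)"
proof -
  have "continuous_on (\<Omega> \<union> -K) (\<lambda>x. if x \<in> \<Omega> then g x else 0)"
  proof (rule continuous_on_open_Un)
    show "continuous_on \<Omega> (\<lambda>x. if x \<in> \<Omega> then g x else 0)"
      using assms(4) by (rule continuous_on_eq) simp
    show "continuous_on (-K) (\<lambda>x. if x \<in> \<Omega> then g x else 0)"
      using continuous_on_const[of "-K" 0] by (rule continuous_on_eq) (use assms(5) in auto)
  qed (use assms in auto)
  moreover have "\<Omega> \<union> -K = UNIV" using assms(3) by auto
  ultimately show ?thesis by simp
qed

text \<open>The map w is regular only on \<Omega>, but its product with \<psi> vanishes off a
  compact subset of \<Omega> and so is C1 everywhere; its directional derivative integrates to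
  0.\<close>

lemma integration_by_parts:
  fixes w \<psi> :: "'a::euclidean_space \<Rightarrow> 'b::euclidean_space"
  assumes \<Omega>: "open \<Omega>" and W: "\<And>x. x \<in> \<Omega> \<Longrightarrow> (w has_derivative W x) (at x)" "\<And>h. continuous_on \<Omega> (\<lambda>x. W x h)"
    and P: "\<And>x. (\<psi> has_derivative P x) (at x)" "\<And>h. continuous_on UNIV (\<lambda>x. P x h)"
    and K: "compact K" "K \<subseteq> \<Omega>" "\<And>x. x \<notin> K \<Longrightarrow> \<psi> x = 0"
  shows "integrable lborel (\<lambda>x. w x \<bullet> P x h)" "integrable lborel (\<lambda>x. W x h \<bullet> \<psi> x)"
    "(\<integral>x. w x \<bullet> P x h \<partial>lborel) = - (\<integral>x. W x h \<bullet> \<psi> x \<partial>lborel)"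
proof -
  have P0: "P x h = 0" if "x \<notin> K" for x h
    using has_derivative_zero_outside[OF P(1) compact_imp_closed[OF K(1)] that K(3)] .
  have cw: "continuous_on \<Omega> w" using W(1) by (meson continuous_at_imp_continuous_on has_derivative_continuous)
  have cp: "continuous_on UNIV \<psi>" using P(1) by (meson continuous_at_imp_continuous_on has_derivative_continuous)
  have e1: "(\<lambda>x. w x \<bullet> P x h) = (\<lambda>x. if x \<in> \<Omega> then w x \<bullet> P x h else 0)" for h using P0 K(2) by fastforce
  have e2: "(\<lambda>x. W x h \<bullet> \<psi> x) = (\<lambda>x. if x \<in> \<Omega> then W x h \<bullet> \<psi> x else 0)" for h using K(2,3) by fastforce
  have c1: "continuous_on UNIV (\<lambda>x. w x \<bullet> P x h)" for h
    unfolding e1 by (rule continuous_on_zero_extension[OF \<Omega> compact_imp_closed[OF K(1)] K(2)])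
      (auto intro!: continuous_on_inner cw continuous_on_subset[OF P(2)] simp: P0)
  have c2: "continuous_on UNIV (\<lambda>x. W x h \<bullet> \<psi> x)" for h
    unfolding e2 by (rule continuous_on_zero_extension[OF \<Omega> compact_imp_closed[OF K(1)] K(2)])
      (auto intro!: continuous_on_inner W(2) continuous_on_subset[OF cp] simp: K(3))
  show i1: "integrable lborel (\<lambda>x. w x \<bullet> P x h)"
    by (rule integrable_continuous_compact_support[OF c1 K(1)]) (simp add: P0)
  show i2: "integrable lborel (\<lambda>x. W x h \<bullet> \<psi> x)"
    by (rule integrable_continuous_compact_support[OF c2 K(1)]) (simp add: K(3))
  have "integral\<^sup>L lborel (\<lambda>x. w x \<bullet> P x h + W x h \<bullet> \<psi> x) = 0"
  proof (rule integral_directional_derivative_eq_0[OF _ _ K(1), where f="\<lambda>x. w x \<bullet> \<psi> x"])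
    fix x
    show "((\<lambda>x. w x \<bullet> \<psi> x) has_derivative (\<lambda>h. w x \<bullet> P x h + W x h \<bullet> \<psi> x)) (at x)"
    proof (cases "x \<in> \<Omega>")
      case True
      then show ?thesis by (auto intro!: has_derivative_inner W P)
    next
      case False
      then have x: "x \<in> - K" using K(2) by auto
      have "((\<lambda>x. w x \<bullet> \<psi> x) has_derivative (\<lambda>h. 0)) (at x)"
        by (rule has_derivative_transform_within_open[OF has_derivative_const[of 0] _ x])
          (use K compact_imp_closed[OF K(1)] in auto)
      then show ?thesis using x P0 K(3) by simp
    qed
  next
    show "continuous_on UNIV (\<lambda>x. w x \<bullet> P x h + W x h \<bullet> \<psi> x)" for h by (intro continuous_on_add c1 c2)
  qed (use K(3) in simp)
  then show "(\<integral>x. w x \<bullet> P x h \<partial>lborel) = - (\<integral>x. W x h \<bullet> \<psi> x \<partial>lborel)"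
    using i1 i2 by simp
qed

lemma bounded_linear_column: "bounded_linear (column j :: real^2^2 \<Rightarrow> real^2)"
  unfolding linear_conv_bounded_linear[symmetric]
  by (rule linearI) (auto simp: column_def vec_eq_iff)

lemma distr_deriv_C1:
  assumes \<Omega>: "open \<Omega>" and W: "\<And>x. x \<in> \<Omega> \<Longrightarrow> (w has_derivative W x) (at x)" "\<And>h. continuous_on \<Omega> (\<lambda>x. W x h)"
    and t: "\<phi> \<in> test_fields \<Omega>"
  shows "integrable lborel (\<lambda>x. \<Sum>j\<in>UNIV. W x (axis j 1) \<bullet> column j (\<phi> x))"
    "distr_deriv \<Omega> w \<phi> = (\<integral>x. (\<Sum>j\<in>UNIV. W x (axis j 1) \<bullet> column j (\<phi> x)) \<partial>lborel)"
proof -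
  obtain D K where D: "\<And>x. (\<phi> has_derivative D x) (at x)" "\<And>h. continuous_on UNIV (\<lambda>x. D x h)"
    "compact K" "K \<subseteq> \<Omega>" "\<And>x. x \<notin> K \<Longrightarrow> \<phi> x = 0" "\<And>x. norm (\<phi> x) \<le> 1"
    "\<And>x h. x \<notin> K \<Longrightarrow> D x h = 0" "\<And>x. row_div \<phi> x = (\<Sum>j\<in>UNIV. column j (D x (axis j 1)))"
    by (rule test_fieldE[OF t]) (rule that)
  have cj: "((\<lambda>x. column j (\<phi> x)) has_derivative (\<lambda>h. column j (D x h))) (at x)" for j x
    by (rule bounded_linear.has_derivative[OF bounded_linear_column D(1)])
  have cc: "continuous_on UNIV (\<lambda>x. column j (D x h))" for j h
    by (rule bounded_linear.continuous_on[OF bounded_linear_column D(2)])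
  have z: "column j (\<phi> x) = 0" if "x \<notin> K" for j x using D(5)[OF that] by (simp add: column_def vec_eq_iff)
  note ibp = integration_by_parts[OF \<Omega> W cj cc D(3,4) z]
  show i: "integrable lborel (\<lambda>x. \<Sum>j\<in>UNIV. W x (axis j 1) \<bullet> column j (\<phi> x))"
    by (intro Bochner_Integration.integrable_sum ibp(2))
  have i1: "integrable lborel (\<lambda>x. w x \<bullet> row_div \<phi> x)"
    unfolding D(8) inner_sum_right by (intro Bochner_Integration.integrable_sum ibp(1))
  have "distr_deriv \<Omega> w \<phi> = - (\<integral>x. w x \<bullet> row_div \<phi> x \<partial>lborel)"
    unfolding distr_deriv_eq[OF t] using i1 by (simp add: integral_completion)
  also have "(\<integral>x. w x \<bullet> row_div \<phi> x \<partial>lborel) = (\<Sum>j\<in>UNIV. \<integral>x. w x \<bullet> column j (D x (axis j 1)) \<partial>lborel)"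
    unfolding D(8) inner_sum_right by (rule Bochner_Integration.integral_sum) (rule ibp(1))
  also have "\<dots> = (\<Sum>j\<in>UNIV. - (\<integral>x. W x (axis j 1) \<bullet> column j (\<phi> x) \<partial>lborel))"
    by (intro sum.cong refl ibp(3))
  also have "\<dots> = - (\<integral>x. (\<Sum>j\<in>UNIV. W x (axis j 1) \<bullet> column j (\<phi> x)) \<partial>lborel)"
    unfolding sum_negf by (subst Bochner_Integration.integral_sum) (auto intro: ibp(2))
  finally show "distr_deriv \<Omega> w \<phi> = (\<integral>x. (\<Sum>j\<in>UNIV. W x (axis j 1) \<bullet> column j (\<phi> x)) \<partial>lborel)" by simp
qed

lemma grad_eq:
  assumes "(w has_derivative W) (at x)"
  shows "grad w x = matrix W"
  using frechet_derivative_at[OF assms] by (simp add: jacobian_def)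

lemma sum_inner_column: "(\<Sum>j\<in>UNIV. W (axis j 1) \<bullet> column j A) = matrix W \<bullet> (A :: real^2^2)"
  by (simp add: inner_vec_def column_def matrix_def sum_2)

text \<open>The easy direction of duality: integrate by parts and apply Cauchy-Schwarz pointwise
  with |\<phi>| \<le> 1.\<close>

lemma total_var_C1_le:
  assumes \<Omega>: "open \<Omega>" and c: "C1_on \<Omega> w"
  shows "total_var w \<Omega> \<le> (\<integral>\<^sup>+x\<in>\<Omega>. ennreal (norm (grad w x)) \<partial>lebesgue)"
  unfolding total_var_def
proof (rule SUP_least)
  obtain W where W: "\<And>x. x \<in> \<Omega> \<Longrightarrow> (w has_derivative W x) (at x)" "\<And>h. continuous_on \<Omega> (\<lambda>x. W x h)"
    by (rule C1_onE[OF c]) (rule that)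
  fix \<phi> assume t: "\<phi> \<in> test_fields \<Omega>"
  let ?f = "\<lambda>x. \<Sum>j\<in>UNIV. W x (axis j 1) \<bullet> column j (\<phi> x)"
  have i: "integrable lborel ?f" and e: "distr_deriv \<Omega> w \<phi> = integral\<^sup>L lborel ?f"
    using distr_deriv_C1[OF \<Omega> W t] by auto
  have b: "norm (?f x) \<le> norm (grad w x) * indicator \<Omega> x" for x
  proof (cases "x \<in> \<Omega>")
    case True
    have "norm (\<phi> x) \<le> 1" using t by (auto simp: test_fields_def)
    then have "norm (matrix (W x)) * norm (\<phi> x) \<le> norm (matrix (W x))"
      by (simp add: mult_left_le)
    moreover have "norm (?f x) \<le> norm (matrix (W x)) * norm (\<phi> x)"
      unfolding sum_inner_column real_norm_def by (rule Cauchy_Schwarz_ineq2)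
    ultimately show ?thesis using True grad_eq[OF W(1)[OF True]] by simp
  next
    case False
    then have "\<phi> x = 0" using t unfolding test_fields_def by blast
    then have "matrix (W x) \<bullet> \<phi> x = 0" by simp
    then show ?thesis using False sum_inner_column[of "W x" "\<phi> x"] by simp
  qed
  have "ennreal (distr_deriv \<Omega> w \<phi>) \<le> ennreal (\<integral>x. norm (?f x) \<partial>lborel)"
    unfolding e using integral_mono[of lborel ?f "\<lambda>x. norm (?f x)"] i by (intro ennreal_leI) auto
  also have "\<dots> = (\<integral>\<^sup>+x. norm (?f x) \<partial>lborel)"
    using i by (subst nn_integral_eq_integral) auto
  also have "\<dots> = (\<integral>\<^sup>+x. norm (?f x) \<partial>lebesgue)" using i by (subst nn_integral_completion) auto
  also have "\<dots> \<le> (\<integral>\<^sup>+x\<in>\<Omega>. ennreal (norm (grad w x)) \<partial>lebesgue)"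
  proof (rule nn_integral_mono)
    fix x
    have "ennreal (norm (?f x)) \<le> ennreal (norm (grad w x) * indicator \<Omega> x)" by (rule ennreal_leI[OF b])
    also have "\<dots> = ennreal (norm (grad w x)) * indicator \<Omega> x" by (auto simp: indicator_def)
    finally show "ennreal (norm (?f x)) \<le> ennreal (norm (grad w x)) * indicator \<Omega> x" .
  qed
  finally show "ennreal (distr_deriv \<Omega> w \<phi>) \<le> (\<integral>\<^sup>+x\<in>\<Omega>. ennreal (norm (grad w x)) \<partial>lebesgue)" .
qed

text \<open>The matrix of the tensor product of v and e. Used as a test field it sees only the
  derivative in direction e.\<close>

definition outer :: "real^2 \<Rightarrow> real^2 \<Rightarrow> real^2^2" where
  "outer v e = (\<chi> i j. v$i * e$j)"

lemma norm_outer: "norm (outer v e) = norm v * norm e"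
proof -
  have "outer v e \<bullet> outer v e = (v \<bullet> v) * (e \<bullet> e)"
    by (simp add: outer_def inner_vec_def sum_2 algebra_simps)
  then show ?thesis by (simp add: norm_eq_sqrt_inner real_sqrt_mult)
qed

lemma bounded_linear_outer: "bounded_linear (\<lambda>v. outer v e)"
  unfolding linear_conv_bounded_linear[symmetric]
  by (rule linearI) (auto simp: outer_def vec_eq_iff algebra_simps)

lemma column_outer: "column j (outer v e) = e$j *\<^sub>R v"
  by (simp add: column_def outer_def vec_eq_iff mult.commute)

lemma sum_axis2: "(\<Sum>j\<in>UNIV. e$j *\<^sub>R axis j 1) = (e :: real^2)"
  by (simp add: vec_eq_iff sum_2 forall_2)

lemma outer_test_field:
  assumes "C1_on UNIV \<psi>" "compact K" "K \<subseteq> \<Omega>" "\<And>x. x \<notin> K \<Longrightarrow> \<psi> x = 0" "\<And>x. norm (\<psi> x) \<le> 1" "norm e = 1"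
  shows "(\<lambda>x. outer (\<psi> x) e) \<in> test_fields \<Omega>"
proof -
  have "outer 0 e = 0" by (simp add: outer_def vec_eq_iff)
  then have "\<exists>K. compact K \<and> K \<subseteq> \<Omega> \<and> (\<forall>x. x \<notin> K \<longrightarrow> outer (\<psi> x) e = 0)" using assms by metis
  then show ?thesis unfolding test_fields_def
    using C1_on_bounded_linear[OF assms(1) bounded_linear_outer] assms(5,6) by (auto simp: norm_outer)
qed

lemma real_le_of_small_slope:
  fixes x c :: real
  assumes "\<And>\<eta>. 0 < \<eta> \<Longrightarrow> \<eta> < 1 \<Longrightarrow> x \<le> \<eta> * c"
  shows "x \<le> 0"
proof (rule tendsto_lowerbound[where F="at_right 0" and f="\<lambda>\<eta>. \<eta> * c"])
  show "((\<lambda>\<eta>. \<eta> * c) \<longlongrightarrow> 0) (at_right 0)" by (auto intro!: tendsto_eq_intros)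
  show "\<forall>\<^sub>F \<eta> in at_right 0. x \<le> \<eta> * c"
    unfolding eventually_at_right_field using assms by (intro exI[of _ 1]) auto
qed simp

text \<open>Testing with a rank-one field bounds the integral of one directional derivative, the
  quantity that slicing controls. The optimal field W e / |W e| is at best continuous and undefined
  at zeros, so it is regularised, approximated by polynomials and cut off, with an error that
  vanishes with \<eta>.\<close>

lemma nn_integral_directional_derivative_le_total_var:
  assumes R: "open R" and W: "\<And>x. x \<in> R \<Longrightarrow> (w has_derivative W x) (at x)" "\<And>h. continuous_on R (\<lambda>x. W x h)"
    and e: "norm e = 1"
  shows "(\<integral>\<^sup>+x. ennreal (norm (W x e)) * indicator R x \<partial>lborel) \<le> total_var w R"
proof (rule nn_integral_open_le[OF R])
  have "(\<lambda>x. indicator R x *\<^sub>R norm (W x e)) \<in> borel_measurable borel"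
    using W(2)[of e] R by (intro borel_measurable_continuous_on_indicator continuous_on_norm) auto
  moreover have "ennreal (norm (W x e)) * indicator R x = ennreal (indicator R x *\<^sub>R norm (W x e))" for x
    by (auto simp: indicator_def)
  ultimately show "(\<lambda>x. ennreal (norm (W x e)) * indicator R x) \<in> borel_measurable borel" by simp
  fix K assume K: "compact K" "K \<subseteq> R"
  obtain \<psi> K' where \<psi>: "C1_on UNIV \<psi>" "\<And>x. 0 \<le> \<psi> x" "\<And>x. \<psi> x \<le> (1::real)" "\<And>x. x \<in> K \<Longrightarrow> \<psi> x = 1"
    "compact K'" "K' \<subseteq> R" "\<And>x. x \<notin> K' \<Longrightarrow> \<psi> x = 0" by (rule C1_cutoff[OF K(1) R K(2)]) (rule that)
  have c\<psi>: "continuous_on UNIV \<psi>" using C1_on_imp_continuous_on[OF \<psi>(1)] .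
  have i\<psi>: "integrable lborel \<psi>" by (rule integrable_continuous_compact_support[OF c\<psi> \<psi>(5,7)])
  have ce: "continuous_on UNIV (\<lambda>x. if x \<in> R then \<psi> x * norm (W x e) else 0)"
    by (rule continuous_on_zero_extension[OF R compact_imp_closed[OF \<psi>(5)] \<psi>(6)])
      (auto intro!: continuous_intros continuous_on_subset[OF c\<psi>] W(2) simp: \<psi>(7))
  have ee: "(\<lambda>x. if x \<in> R then \<psi> x * norm (W x e) else 0) = (\<lambda>x. \<psi> x * norm (W x e))"
    using \<psi>(6,7) by fastforce
  have ih: "integrable lborel (\<lambda>x. \<psi> x * norm (W x e))"
    by (rule integrable_continuous_compact_support[OF ce[unfolded ee] \<psi>(5)]) (simp add: \<psi>(7))
  define a where "a = (\<integral>x. \<psi> x * norm (W x e) \<partial>lborel)"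
  define b where "b = (\<integral>x. \<psi> x \<partial>lborel)"
  have a0: "a \<ge> 0" unfolding a_def using \<psi>(2) by (intro integral_nonneg_AE) auto
  have key: "ennreal (((1 - \<eta>) * a - \<eta> * b) / (1 + \<eta>)) \<le> total_var w R" if \<eta>: "0 < \<eta>" "\<eta> < 1" for \<eta>
  proof -
    \<comment> \<open>Adding \<eta> under the root removes the singularity where W e vanishes and
      keeps the norm at most 1.\<close>
    define v where "v x = W x e /\<^sub>R sqrt ((norm (W x e))\<^sup>2 + \<eta>\<^sup>2)" for x
    have pos: "(norm (W x e))\<^sup>2 + \<eta>\<^sup>2 > 0" for x using \<eta> by (simp add: add_nonneg_pos)
    have "continuous_on K' v" unfolding v_def[abs_def]
      using pos by (intro continuous_intros continuous_on_subset[OF W(2) \<psi>(6)]) (auto simp: less_imp_neq[THEN not_sym])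
    then obtain P where P: "polynomial_function P" "\<And>x. x \<in> K' \<Longrightarrow> norm (v x - P x) < \<eta>"
      using Stone_Weierstrass_polynomial_function[OF \<psi>(5) _ \<eta>(1)] by metis
    \<comment> \<open>The polynomial makes the field C1; dividing by 1 + \<eta> restores the bound 1
      on its norm.\<close>
    define \<xi> where "\<xi> x = (\<psi> x / (1 + \<eta>)) *\<^sub>R P x" for x
    have v1: "norm (v x) \<le> 1" for x
    proof -
      have "norm (W x e) \<le> sqrt ((norm (W x e))\<^sup>2 + \<eta>\<^sup>2)" by (intro real_le_rsqrt) simp
      then show ?thesis unfolding v_def using pos[of x] by (simp add: divide_inverse[symmetric] field_simps)
    qed
    have \<xi>1: "norm (\<xi> x) \<le> 1" for x
    proof (cases "x \<in> K'")
      case True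
      have "norm (P x) \<le> norm (v x) + norm (v x - P x)" by (metis norm_triangle_sub add.commute norm_minus_commute)
      then have "norm (P x) \<le> 1 + \<eta>" using v1[of x] P(2)[OF True] by linarith
      moreover have "\<psi> x * norm (P x) \<le> norm (P x)" using \<psi>(3)[of x] by (simp add: mult_left_le_one_le \<psi>(2))
      ultimately show ?thesis unfolding \<xi>_def using \<eta> \<psi>(2)[of x] by (simp add: field_simps)
    qed (simp add: \<xi>_def \<psi>(7))
    have "C1_on UNIV (\<lambda>x. (\<psi> x * (1 / (1 + \<eta>))) *\<^sub>R P x)"
      by (intro C1_on_scaleR C1_on_mult C1_on_const \<psi>(1) C1_on_polynomial_function P)
    then have t: "(\<lambda>x. outer (\<xi> x) e) \<in> test_fields R"
      by (intro outer_test_field[OF _ \<psi>(5,6)] e \<xi>1) (auto simp: \<xi>_def \<psi>(7))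
    let ?g = "\<lambda>x. \<Sum>j\<in>UNIV. W x (axis j 1) \<bullet> column j (outer (\<xi> x) e)"
    have g: "?g x = W x e \<bullet> \<xi> x" if "x \<in> R" for x
    proof -
      have l: "linear (W x)" using W(1)[OF that] has_derivative_linear by blast
      have "?g x = (\<Sum>j\<in>UNIV. W x (e$j *\<^sub>R axis j 1)) \<bullet> \<xi> x"
        by (simp add: column_outer inner_sum_left linear_cmul[OF l])
      also have "(\<Sum>j\<in>UNIV. W x (e$j *\<^sub>R axis j 1)) = W x (\<Sum>j\<in>UNIV. e$j *\<^sub>R axis j 1)"
        by (rule linear_sum[OF l, symmetric])
      finally show ?thesis unfolding sum_axis2 .
    qed
    \<comment> \<open>Two losses occur: the regularised direction pairs with W e to at least n -
      \<eta>, because s \<le> n + \<eta>, and the polynomial error costs at most n times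
      \<eta>.\<close>
    have lower: "(\<psi> x * norm (W x e) * (1 - \<eta>) - \<eta> * \<psi> x) / (1 + \<eta>) \<le> ?g x" for x
    proof (cases "x \<in> K'")
      case True
      define n where "n = norm (W x e)"
      define s where "s = sqrt (n\<^sup>2 + \<eta>\<^sup>2)"
      have n0: "n \<ge> 0" by (simp add: n_def)
      have s: "s > 0" "s \<le> n + \<eta>" unfolding s_def using pos[of x] n0 \<eta>
        by (auto simp: n_def intro!: real_le_lsqrt) (auto simp: power2_eq_square algebra_simps)
      have "W x e \<bullet> v x = n\<^sup>2 / s" unfolding v_def s_def n_def
        by (simp add: power2_norm_eq_inner divide_inverse mult.commute)
      moreover have "n - \<eta> \<le> n\<^sup>2 / s"
      proof (cases "n - \<eta> \<le> 0")
        case True then show ?thesis using s by (smt (verit) divide_nonneg_pos zero_le_power2)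
      next
        case False
        have "(n - \<eta>) * s \<le> (n - \<eta>) * (n + \<eta>)" using False s by (intro mult_left_mono) auto
        also have "\<dots> \<le> n\<^sup>2" using \<eta> by (simp add: power2_eq_square algebra_simps)
        finally show ?thesis using s by (simp add: pos_le_divide_eq)
      qed
      moreover have "\<bar>W x e \<bullet> (v x - P x)\<bar> \<le> n * \<eta>"
        using Cauchy_Schwarz_ineq2[of "W x e" "v x - P x"] mult_left_mono[of "norm (v x - P x)" \<eta> n] P(2)[OF True] n0
        unfolding n_def by linarith
      ultimately have "n * (1 - \<eta>) - \<eta> \<le> W x e \<bullet> P x"
        by (simp add: inner_diff_right algebra_simps abs_le_iff)
      then have "(\<psi> x / (1 + \<eta>)) * (n * (1 - \<eta>) - \<eta>) \<le> (\<psi> x / (1 + \<eta>)) * (W x e \<bullet> P x)"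
        using \<psi>(2)[of x] \<eta> by (intro mult_left_mono) auto
      moreover have "?g x = (\<psi> x / (1 + \<eta>)) * (W x e \<bullet> P x)"
        using g[of x] True \<psi>(6) by (auto simp: \<xi>_def)
      moreover have "(\<psi> x * n * (1 - \<eta>) - \<eta> * \<psi> x) / (1 + \<eta>) = (\<psi> x / (1 + \<eta>)) * (n * (1 - \<eta>) - \<eta>)"
        by (simp add: algebra_simps diff_divide_distrib)
      ultimately show ?thesis unfolding n_def by metis
    next
      case False
      then show ?thesis by (simp add: \<psi>(7) \<xi>_def outer_def column_def vec_eq_iff inner_vec_def)
    qed
    have "((1 - \<eta>) * a - \<eta> * b) / (1 + \<eta>) = (\<integral>x. (\<psi> x * norm (W x e) * (1 - \<eta>) - \<eta> * \<psi> x) / (1 + \<eta>) \<partial>lborel)"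
      unfolding a_def b_def using ih i\<psi> by (simp add: mult.commute)
    also have "\<dots> \<le> integral\<^sup>L lborel ?g"
      using ih i\<psi> distr_deriv_C1(1)[OF R W t] lower by (intro integral_mono) auto
    also have "\<dots> = distr_deriv R w (\<lambda>x. outer (\<xi> x) e)" using distr_deriv_C1(2)[OF R W t] by simp
    finally have "ennreal (((1 - \<eta>) * a - \<eta> * b) / (1 + \<eta>)) \<le> ennreal (distr_deriv R w (\<lambda>x. outer (\<xi> x) e))"
      by (rule ennreal_leI)
    also have "\<dots> \<le> total_var w R" unfolding total_var_def by (rule SUP_upper[OF t])
    finally show ?thesis .
  qed
  have "ennreal a \<le> total_var w R"
  proof (cases "total_var w R")
    case (real v)
    \<comment> \<open>Clearing the denominator leaves an error that is linear in \<eta>.\<close>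
    have "a - v \<le> \<eta> * (v + a + b)" if "0 < \<eta>" "\<eta> < 1" for \<eta>
    proof -
      have "((1 - \<eta>) * a - \<eta> * b) / (1 + \<eta>) \<le> v" using key[OF that] real by (simp add: ennreal_le_iff)
      then have "(1 - \<eta>) * a - \<eta> * b \<le> v * (1 + \<eta>)" using that by (simp add: pos_divide_le_eq)
      then show ?thesis by (simp add: algebra_simps)
    qed
    then have "a - v \<le> 0" by (rule real_le_of_small_slope)
    then show ?thesis using real by (simp add: ennreal_leI)
  qed simp
  moreover have "(\<integral>\<^sup>+x. ennreal (norm (W x e)) * indicator K x \<partial>lborel) \<le> (\<integral>\<^sup>+x. ennreal (\<psi> x * norm (W x e)) \<partial>lborel)"
    using \<psi>(4) by (intro nn_integral_mono) (auto simp: indicator_def)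
  moreover have "\<dots> = ennreal a" unfolding a_def using ih \<psi>(2) by (intro nn_integral_eq_integral) auto
  ultimately show "(\<integral>\<^sup>+x. ennreal (norm (W x e)) * indicator K x \<partial>lborel) \<le> total_var w R" by simp
qed

section \<open>Variation carried by a straight jump\<close>

lemma AE_not_hyperplane:
  fixes \<nu> :: "'a::euclidean_space"
  assumes "\<nu> \<noteq> 0"
  shows "AE x in lebesgue. (x - p) \<bullet> \<nu> \<noteq> 0"
proof -
  have "negligible {x. \<nu> \<bullet> x = \<nu> \<bullet> p}" using negligible_hyperplane assms by blast
  then have "{x. \<nu> \<bullet> x = \<nu> \<bullet> p} \<in> null_sets lebesgue" by (simp add: negligible_iff_null_sets)
  from AE_not_in[OF this] show ?thesis
    by eventually_elim (simp add: inner_diff_left inner_commute[of \<nu>])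
qed

context frame
begin

text \<open>On each line in direction \<open>\<nu>\<close> the half plane cuts out a half line, and
  the fundamental theorem leaves only the value on the boundary line.\<close>

lemma integral_halfplane_normal_derivative:
  fixes \<psi> :: "real^2 \<Rightarrow> real"
  assumes P: "\<And>x. (\<psi> has_derivative P x) (at x)" "\<And>h. continuous_on UNIV (\<lambda>x. P x h)"
    and K: "compact K" "\<And>x. x \<notin> K \<Longrightarrow> \<psi> x = 0"
  shows "integrable lborel (\<lambda>s. \<psi> (p + s *\<^sub>R e))"
    "integrable lborel (\<lambda>x. P x \<nu> * indicator {x. (x - p) \<bullet> \<nu> > 0} x)"
    "(\<integral>x. P x \<nu> * indicator {x. (x - p) \<bullet> \<nu> > 0} x \<partial>lborel) = - (\<integral>s. \<psi> (p + s *\<^sub>R e) \<partial>lborel)"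
proof -
  have c\<psi>: "continuous_on UNIV \<psi>" using P(1) by (meson continuous_at_imp_continuous_on has_derivative_continuous)
  have P0: "P x h = 0" if "x \<notin> K" for x h
    using has_derivative_zero_outside[OF P(1) compact_imp_closed[OF K(1)] that K(2)] .
  have "bounded ((\<lambda>x. x - p) ` K)"
    by (intro compact_imp_bounded compact_continuous_image continuous_intros K)
  then obtain M where M: "\<And>x. x \<in> K \<Longrightarrow> norm (x - p) \<le> M" by (auto simp: bounded_iff)
  have outK: "p + s *\<^sub>R e + t *\<^sub>R \<nu> \<notin> K" if "\<bar>s\<bar> > M \<or> \<bar>t\<bar> > M" for s t
  proof
    assume "p + s *\<^sub>R e + t *\<^sub>R \<nu> \<in> K"
    then have n: "norm (s *\<^sub>R e + t *\<^sub>R \<nu>) \<le> M" using M[of "p + s *\<^sub>R e + t *\<^sub>R \<nu>"] by (simp add: algebra_simps)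
    have "\<bar>(s *\<^sub>R e + t *\<^sub>R \<nu>) \<bullet> e\<bar> \<le> M" "\<bar>(s *\<^sub>R e + t *\<^sub>R \<nu>) \<bullet> \<nu>\<bar> \<le> M"
      using n Cauchy_Schwarz_ineq2[of "s *\<^sub>R e + t *\<^sub>R \<nu>" e] Cauchy_Schwarz_ineq2[of "s *\<^sub>R e + t *\<^sub>R \<nu>" \<nu>] by simp_all
    then show False using that by (simp add: inner_add_left)
  qed
  show "integrable lborel (\<lambda>s. \<psi> (p + s *\<^sub>R e))"
  proof (rule integrable_continuous_compact_support[of _ "{-M..M}"])
    show "continuous_on UNIV (\<lambda>s. \<psi> (p + s *\<^sub>R e))"
      by (intro continuous_intros continuous_on_compose2[OF c\<psi>]) auto
    show "\<psi> (p + s *\<^sub>R e) = 0" if "s \<notin> {-M..M}" for s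
    proof -
      have "\<bar>s\<bar> > M" using that by auto
      then show ?thesis using outK[of s 0] K(2) by auto
    qed
  qed auto
  have iP: "integrable lborel (\<lambda>x. P x \<nu>)"
    by (rule integrable_continuous_compact_support[OF P(2) K(1)]) (simp add: P0)
  have op: "open {x. (x - p) \<bullet> \<nu> > 0}" by (intro open_Collect_less continuous_intros)
  show i: "integrable lborel (\<lambda>x. P x \<nu> * indicator {x. (x - p) \<bullet> \<nu> > 0} x)"
    using integrable_mult_indicator[OF _ iP, of "{x. (x - p) \<bullet> \<nu> > 0}"] op by (simp add: mult.commute)
  have inner: "(\<integral>t. P (p + s *\<^sub>R e + t *\<^sub>R \<nu>) \<nu> * indicator {x. (x - p) \<bullet> \<nu> > 0} (p + s *\<^sub>R e + t *\<^sub>R \<nu>) \<partial>lborel)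
      = - \<psi> (p + s *\<^sub>R e)" for s
  proof -
    define T where "T = \<bar>M\<bar> + 1"
    have T: "T > 0" "T > M" unfolding T_def by auto
    let ?F = "\<lambda>t. \<psi> (p + s *\<^sub>R e + t *\<^sub>R \<nu>)"
    let ?f = "\<lambda>t. P (p + s *\<^sub>R e + t *\<^sub>R \<nu>) \<nu>"
    have der: "(?F has_vector_derivative ?f t) (at t within A)" for t A
    proof -
      have l: "((\<lambda>t. p + s *\<^sub>R e + t *\<^sub>R \<nu>) has_derivative (\<lambda>d. d *\<^sub>R \<nu>)) (at t within A)" by (auto intro!: derivative_eq_intros)
      show ?thesis unfolding has_vector_derivative_def
        using has_derivative_compose[OF l P(1)] linear_cmul[OF has_derivative_linear[OF P(1)]] by simp
    qed
    have "(\<integral>t. indicator {0..T} t *\<^sub>R ?f t \<partial>lborel) = ?F T - ?F 0"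
      by (rule integral_FTC_Icc) (use T der in \<open>auto intro!: continuous_intros continuous_on_compose2[OF P(2)]\<close>)
    moreover have "?F T = 0" using outK[of s T] T K(2) by auto
    moreover have "(\<integral>t. ?f t * indicator {x. (x - p) \<bullet> \<nu> > 0} (p + s *\<^sub>R e + t *\<^sub>R \<nu>) \<partial>lborel) = (\<integral>t. indicator {0..T} t *\<^sub>R ?f t \<partial>lborel)"
    proof (rule integral_cong_AE)
      have [measurable]: "?f \<in> borel_measurable borel"
        by (intro borel_measurable_continuous_onI continuous_intros continuous_on_compose2[OF P(2)]) auto
      have e: "indicator {x. (x - p) \<bullet> \<nu> > 0} (p + s *\<^sub>R e + t *\<^sub>R \<nu>) = (indicator {0<..} t :: real)" for t
        by (auto simp: indicator_def inner_add_left)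
      show "(\<lambda>t. ?f t * indicator {x. (x - p) \<bullet> \<nu> > 0} (p + s *\<^sub>R e + t *\<^sub>R \<nu>)) \<in> borel_measurable lborel"
        unfolding e by measurable
      show "(\<lambda>t. indicator {0..T} t *\<^sub>R ?f t) \<in> borel_measurable lborel" by measurable
      have "AE t in lborel. t \<noteq> (0::real)" by (rule AE_lborel_singleton)
      then show "AE t in lborel. ?f t * indicator {x. (x - p) \<bullet> \<nu> > 0} (p + s *\<^sub>R e + t *\<^sub>R \<nu>) = indicator {0..T} t *\<^sub>R ?f t"
      proof eventually_elim
        case (elim t)
        have "?f t = 0" if "t > T" using that T outK[of s t] P0 by auto
        then show ?case unfolding e using elim by (auto simp: indicator_def not_le)
      qed
    qed
    ultimately show ?thesis by simp
  qed
  show "(\<integral>x. P x \<nu> * indicator {x. (x - p) \<bullet> \<nu> > 0} x \<partial>lborel) = - (\<integral>s. \<psi> (p + s *\<^sub>R e) \<partial>lborel)"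
    unfolding integral_frame[OF i, of p] inner by simp
qed

text \<open>Test with \<psi> times the tensor product of the jump direction and the normal, where
  \<psi> is 1 on a compact part of the line inside G. The pairing is at least |b - a| times the
  length of that part. G has no prescribed shape, so single pieces of an interface can be isolated
  and counted separately.\<close>

lemma total_var_ge_jump:
  assumes u: "u \<in> L1_maps \<Omega>" and G: "open G" "G \<subseteq> \<Omega>"
    and ab: "\<And>x. x \<in> G \<Longrightarrow> (x - p) \<bullet> \<nu> < 0 \<Longrightarrow> u x = a" "\<And>x. x \<in> G \<Longrightarrow> (x - p) \<bullet> \<nu> > 0 \<Longrightarrow> u x = b"
  shows "ennreal (norm (b - a)) * emeasure lborel {s. p + s *\<^sub>R e \<in> G} \<le> total_var u G"
proof (cases "a = b")
  case False
  define E where "E = {s. p + s *\<^sub>R e \<in> G}"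
  have "open ((\<lambda>s. p + s *\<^sub>R e) -` G)" by (intro open_vimage G continuous_intros)
  then have oE: "open E" by (simp add: E_def vimage_def)
  define j where "j = (b - a) /\<^sub>R norm (b - a)"
  have j1: "norm j = 1" "(b - a) \<bullet> j = norm (b - a)" using False unfolding j_def
    by (auto simp: dot_square_norm power2_eq_square)
  have "(\<integral>\<^sup>+s. ennreal (norm (b - a)) * indicator E s \<partial>lborel) \<le> total_var u G"
  proof (rule nn_integral_open_le[OF oE])
    show "(\<lambda>s. ennreal (norm (b - a)) * indicator E s) \<in> borel_measurable borel" using oE
      by (intro borel_measurable_times_ennreal borel_measurable_indicator) auto
    fix K assume K: "compact K" "K \<subseteq> E"
    have cK: "compact ((\<lambda>s. p + s *\<^sub>R e) ` K)" by (intro compact_continuous_image continuous_intros K)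
    have KG: "(\<lambda>s. p + s *\<^sub>R e) ` K \<subseteq> G" using K(2) by (auto simp: E_def)
    obtain \<psi> L where \<psi>: "C1_on UNIV \<psi>" "\<And>x. 0 \<le> \<psi> x" "\<And>x. \<psi> x \<le> (1::real)"
      "\<And>x. x \<in> (\<lambda>s. p + s *\<^sub>R e) ` K \<Longrightarrow> \<psi> x = 1"
      "compact L" "L \<subseteq> G" "\<And>x. x \<notin> L \<Longrightarrow> \<psi> x = 0" by (rule C1_cutoff[OF cK G(1) KG]) (rule that)
    obtain P where P: "\<And>x. (\<psi> has_derivative P x) (at x)" "\<And>h. continuous_on UNIV (\<lambda>x. P x h)"
      by (rule C1_onE[OF \<psi>(1)]) (rule that, auto)
    have P0: "P x h = 0" if "x \<notin> L" for x h
      using has_derivative_zero_outside[OF P(1) compact_imp_closed[OF \<psi>(5)] that \<psi>(7)] .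
    note hp = integral_halfplane_normal_derivative[OF P \<psi>(5,7)]
    define \<phi> where "\<phi> x = outer (\<psi> x *\<^sub>R j) \<nu>" for x
    have t: "\<phi> \<in> test_fields G" unfolding \<phi>_def[abs_def]
      by (rule outer_test_field[OF _ \<psi>(5,6)]) (use \<psi> j1 in \<open>auto intro!: C1_on_scaleR C1_on_const\<close>)
    have rd: "row_div \<phi> x = P x \<nu> *\<^sub>R j" for x
    proof -
      have "(\<phi> has_derivative (\<lambda>h. outer (P x h *\<^sub>R j) \<nu>)) (at x)" unfolding \<phi>_def
        by (intro bounded_linear.has_derivative[OF bounded_linear_outer]) (auto intro!: derivative_eq_intros P(1))
      then have "row_div \<phi> x = (\<Sum>k\<in>UNIV. (P x (\<nu>$k *\<^sub>R axis k 1)) *\<^sub>R j)"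
        by (simp add: row_div_eq column_outer linear_cmul[OF has_derivative_linear[OF P(1)]])
      also have "\<dots> = P x (\<Sum>k\<in>UNIV. \<nu>$k *\<^sub>R axis k 1) *\<^sub>R j"
        by (simp add: linear_sum[OF has_derivative_linear[OF P(1)]] scaleR_sum_left)
      finally show ?thesis unfolding sum_axis2 .
    qed
    have iP: "integrable lborel (\<lambda>x. P x \<nu>)"
      by (rule integrable_continuous_compact_support[OF P(2) \<psi>(5)]) (simp add: P0)
    have "distr_deriv G u \<phi> = - (LINT x|lebesgue. u x \<bullet> (P x \<nu> *\<^sub>R j))"
      unfolding distr_deriv_eq[OF t] rd ..
    \<comment> \<open>Off the line, u pairs with j to the constant a \<bullet> j, plus |b - a| on
      the positive side. The constant will contribute 0, since the directional derivative of a
      compactly supported function has integral 0.\<close>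
    also have "(LINT x|lebesgue. u x \<bullet> (P x \<nu> *\<^sub>R j))
      = (LINT x|lebesgue. (a \<bullet> j) * P x \<nu> + norm (b - a) * (P x \<nu> * indicator {x. (x - p) \<bullet> \<nu> > 0} x))"
    proof (rule integral_cong_AE)
      have "u \<in> L1_maps \<Omega>" "\<phi> \<in> test_fields \<Omega>" using u t test_fields_mono G(2) by blast+
      from integrable_L1_maps_row_div[OF this] show "(\<lambda>x. u x \<bullet> (P x \<nu> *\<^sub>R j)) \<in> borel_measurable lebesgue"
        unfolding rd by auto
      have "integrable lborel (\<lambda>x. (a \<bullet> j) * P x \<nu> + norm (b - a) * (P x \<nu> * indicator {x. (x - p) \<bullet> \<nu> > 0} x))"
        using iP hp(2)[of p] by auto
      then show "(\<lambda>x. (a \<bullet> j) * P x \<nu> + norm (b - a) * (P x \<nu> * indicator {x. (x - p) \<bullet> \<nu> > 0} x)) \<in> borel_measurable lebesgue"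
        using measurable_completion by blast
      have "\<nu> \<noteq> 0" using norm_\<nu>1 by force
      from AE_not_hyperplane[OF this, of p]
      show "AE x in lebesgue. u x \<bullet> (P x \<nu> *\<^sub>R j) = (a \<bullet> j) * P x \<nu> + norm (b - a) * (P x \<nu> * indicator {x. (x - p) \<bullet> \<nu> > 0} x)"
      proof eventually_elim
        case (elim x)
        show ?case
        proof (cases "x \<in> G")
          case True
          show ?thesis
          proof (cases "(x - p) \<bullet> \<nu> > 0")
            case T: True
            have "b \<bullet> j = a \<bullet> j + norm (b - a)" using j1(2) by (simp add: inner_diff_left)
            then show ?thesis using T ab(2)[OF True T] by (simp add: algebra_simps)
          next
            case F: False
            then show ?thesis using elim ab(1)[OF True] by (simp add: indicator_def mult.commute)
          qed
        next
          case False
          then have "x \<notin> L" using \<psi>(6) by auto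
          then have "P x \<nu> = 0" by (rule P0)
          then show ?thesis by simp
        qed
      qed
    qed
    also have "\<dots> = (\<integral>x. (a \<bullet> j) * P x \<nu> + norm (b - a) * (P x \<nu> * indicator {x. (x - p) \<bullet> \<nu> > 0} x) \<partial>lborel)"
      using iP hp(2)[of p] by (intro integral_completion) auto
    also have "\<dots> = - (norm (b - a) * (\<integral>s. \<psi> (p + s *\<^sub>R e) \<partial>lborel))"
      using iP hp(2)[of p] integral_directional_derivative_eq_0[OF P \<psi>(5,7)] hp(3)[of p] by simp
    finally have d: "distr_deriv G u \<phi> = norm (b - a) * (\<integral>s. \<psi> (p + s *\<^sub>R e) \<partial>lborel)" by simp
    have "(\<integral>\<^sup>+s. ennreal (norm (b - a)) * indicator K s \<partial>lborel) \<le> (\<integral>\<^sup>+s. ennreal (norm (b - a) * \<psi> (p + s *\<^sub>R e)) \<partial>lborel)"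
    proof (rule nn_integral_mono)
      show "ennreal (norm (b - a)) * indicator K s \<le> ennreal (norm (b - a) * \<psi> (p + s *\<^sub>R e))" for s
        using \<psi>(4)[OF imageI[of s K "\<lambda>s. p + s *\<^sub>R e"]] by (cases "s \<in> K") auto
    qed
    also have "\<dots> = ennreal (\<integral>s. norm (b - a) * \<psi> (p + s *\<^sub>R e) \<partial>lborel)"
      using hp(1)[of p] \<psi>(2) by (intro nn_integral_eq_integral) auto
    also have "\<dots> = ennreal (distr_deriv G u \<phi>)" unfolding d by simp
    also have "\<dots> \<le> total_var u G" unfolding total_var_def by (rule SUP_upper[OF t])
    finally show "(\<integral>\<^sup>+s. ennreal (norm (b - a)) * indicator K s \<partial>lborel) \<le> total_var u G" .
  qed
  then show ?thesis using oE by (simp add: nn_integral_cmult_indicator E_def[symmetric])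
qed simp

end

section \<open>Area formula estimates\<close>

text \<open>Half of the area formula: covering a point several times only increases the integral of
  |Jw|. Finite \<open>TVJ\<close> is exactly the integrability that the image estimate demands; the
  infinite case is trivial.\<close>

lemma emeasure_image_le_TVJ:
  assumes \<Omega>: "open \<Omega>" and c: "C1_on \<Omega> w" and S: "S \<subseteq> w ` \<Omega>"
  shows "emeasure lebesgue S \<le> TVJ w \<Omega>"
proof (cases "TVJ w \<Omega> = \<infinity>")
  case False
  obtain W where W: "\<And>x. x \<in> \<Omega> \<Longrightarrow> (w has_derivative W x) (at x)" "\<And>h. continuous_on \<Omega> (\<lambda>x. W x h)"
    by (rule C1_onE[OF c]) (rule that)
  define d where "d x = \<bar>det (matrix (W x))\<bar>" for x
  have cd: "continuous_on \<Omega> d" unfolding d_def det_2 matrix_def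
    by (auto intro!: continuous_intros W(2))
  have md: "(\<lambda>x. indicator \<Omega> x *\<^sub>R d x) \<in> borel_measurable borel"
    using \<Omega> cd by (intro borel_measurable_continuous_on_indicator) auto
  have e: "TVJ w \<Omega> = (\<integral>\<^sup>+x. ennreal (indicator \<Omega> x *\<^sub>R d x) \<partial>lebesgue)"
    unfolding TVJ_def d_def using grad_eq[OF W(1)] by (intro nn_integral_cong) (auto simp: indicator_def)
  have i: "integrable lebesgue (\<lambda>x. indicator \<Omega> x *\<^sub>R d x)"
  proof (rule integrableI_bounded)
    show "(\<lambda>x. indicator \<Omega> x *\<^sub>R d x) \<in> borel_measurable lebesgue" using md by (intro measurable_completion) simp
    show "(\<integral>\<^sup>+x. ennreal (norm (indicator \<Omega> x *\<^sub>R d x)) \<partial>lebesgue) < \<infinity>"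
      using False e by (simp add: d_def top.not_eq_extremum)
  qed
  then have ai: "d absolutely_integrable_on \<Omega>" by (simp add: set_integrable_def)
  have d': "(w has_derivative W x) (at x within \<Omega>)" if "x \<in> \<Omega>" for x using W(1)[OF that] has_derivative_at_withinI by blast
  have io: "(\<lambda>x. \<bar>det (matrix (W x))\<bar>) integrable_on \<Omega>"
    using ai set_lebesgue_integral_eq_integral(1) unfolding d_def by blast
  have ol: "\<Omega> \<in> sets lebesgue" using \<Omega> by auto
  note im = measurable_differentiable_image[OF ol d' io] measure_differentiable_image[OF ol d' io]
  have "emeasure lebesgue S \<le> emeasure lebesgue (w ` \<Omega>)"
    by (rule emeasure_mono[OF S]) (use im in auto)
  also have "\<dots> = ennreal (measure lebesgue (w ` \<Omega>))" using im by (simp add: emeasure_eq_measure2)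
  also have "\<dots> \<le> ennreal (integral \<Omega> d)" using im(2) unfolding d_def by (rule ennreal_leI)
  also have "integral \<Omega> d = (\<integral>x. indicator \<Omega> x *\<^sub>R d x \<partial>lebesgue)"
    using set_lebesgue_integral_eq_integral(2)[OF ai] by (simp add: set_lebesgue_integral_def)
  also have "ennreal \<dots> = TVJ w \<Omega>" unfolding e
    by (rule nn_integral_eq_integral[symmetric, OF i]) (simp add: d_def)
  finally show ?thesis .
qed simp

text \<open>On the injective part the area formula is an equality, and elsewhere in \<Omega> the
  Jacobian vanishes.\<close>

lemma TVJ_le_emeasure_of_inj_on:
  assumes S: "open S" "S \<subseteq> \<Omega>" and d: "\<And>x. x \<in> S \<Longrightarrow> (w has_derivative W x) (at x)"
    and z: "\<And>x. x \<in> \<Omega> - S \<Longrightarrow> det (grad w x) = 0"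
    and inj: "inj_on w S" and T: "w ` S \<subseteq> T" "bounded T" "T \<in> sets lebesgue"
  shows "TVJ w \<Omega> \<le> emeasure lebesgue T"
proof -
  have d': "(w has_derivative W x) (at x within S)" if "x \<in> S" for x using d[OF that] has_derivative_at_withinI by blast
  have sl: "S \<in> sets lebesgue" using S by auto
  have "w ` S \<in> sets lebesgue"
    using d' sl by (intro differentiable_image_in_sets_lebesgue) (auto simp: differentiable_on_def differentiable_def)
  moreover have "bounded (w ` S)" using T bounded_subset by blast
  ultimately have l: "w ` S \<in> lmeasurable" by (simp add: bounded_set_imp_lmeasurable)
  have h: "((\<lambda>x. \<bar>det (matrix (W x))\<bar>) has_integral measure lebesgue (w ` S)) S"
    using has_measure_differentiable_image[OF sl d' inj] l by blast
  have "TVJ w \<Omega> = (\<integral>\<^sup>+x. ennreal (indicator S x * \<bar>det (matrix (W x))\<bar>) \<partial>lebesgue)"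
    unfolding TVJ_def
  proof (rule nn_integral_cong)
    fix x
    show "ennreal \<bar>det (grad w x)\<bar> * indicator \<Omega> x = ennreal (indicator S x * \<bar>det (matrix (W x))\<bar>)"
      using z[of x] S(2) grad_eq[OF d, of x] by (cases "x \<in> S") (auto simp: indicator_def)
  qed
  also have "\<dots> = ennreal (measure lebesgue (w ` S))"
    using nn_integral_has_integral_lebesgue[OF _ h] by (simp add: nn_integral_completion)
  also have "\<dots> = emeasure lebesgue (w ` S)" using l by (simp add: emeasure_eq_measure2)
  also have "\<dots> \<le> emeasure lebesgue T" by (rule emeasure_mono[OF T(1,3)])
  finally show ?thesis .
qed

section \<open>A planar loop winding once around a triangle\<close>

text \<open>Winding numbers live in the complex plane; this linear bijection carries the problem
  there.\<close>

definition toC :: "real^2 \<Rightarrow> complex" where "toC x = Complex (x$1) (x$2)"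

lemma linear_toC: "linear toC"
  by (rule linearI) (auto simp: toC_def complex_eq_iff)

lemma inj_toC: "inj toC"
  by (rule injI) (auto simp: toC_def vec_eq_iff forall_2)

lemma surj_toC: "surj toC"
proof (rule surjI)
  show "toC (vector [Re z, Im z]) = z" for z by (simp add: toC_def complex_eq_iff)
qed

lemma homotopic_loops_const_convex:
  fixes p :: "real \<Rightarrow> 'a::real_normed_vector"
  assumes "convex S" "path p" "pathfinish p = pathstart p" "path_image p \<subseteq> S" "q \<in> S"
  shows "homotopic_loops S p (linepath q q)"
proof (rule homotopic_loops_linear)
  show "closed_segment (p t) (linepath q q t) \<subseteq> S" if "t \<in> {0..1}" for t
  proof (rule closed_segment_subset[OF _ _ assms(1)])
    show "p t \<in> S" using assms(4) that by (auto simp: path_image_def)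
    show "linepath q q t \<in> S" using assms(5) by (simp add: linepath_def algebra_simps)
  qed
qed (use assms in auto)

text \<open>If y were missed, contracting the loop inside the convex set S would give a null
  homotopy of its image in the complement of y, hence winding number 0. But on each side the image
  and the matching edge of the triangle lie in one convex set that avoids y, so the image loop is
  linearly homotopic to the boundary of the triangle, whose winding number about an interior point
  is nonzero.\<close>

lemma loop_covers_triangle:
  fixes f :: "real^2 \<Rightarrow> real^2"
  assumes S: "convex S" "{q0,q1,q2,q3} \<subseteq> S" and f: "continuous_on S f"
    and E1: "convex E1" "f ` closed_segment q0 q1 \<subseteq> E1" "a \<in> E1" "b \<in> E1"
    and E2: "convex E2" "f ` closed_segment q1 q2 \<subseteq> E2" "b \<in> E2" "c \<in> E2"
    and E3: "convex E3" "f ` closed_segment q2 q3 \<subseteq> E3" "f ` closed_segment q3 q0 \<subseteq> E3" "c \<in> E3" "a \<in> E3"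
    and y: "y \<in> interior (convex hull {a,b,c})" "y \<notin> E1 \<union> E2 \<union> E3"
  shows "y \<in> f ` S"
proof (rule ccontr)
  assume nin: "y \<notin> f ` S"
  define p where "p = linepath q0 q1 +++ (linepath q1 q2 +++ (linepath q2 q3 +++ linepath q3 q0))"
  have pp: "path p" "pathstart p = q0" "pathfinish p = q0" unfolding p_def by auto
  have piS: "path_image p \<subseteq> S" unfolding p_def
    using S by (auto simp: path_image_join closed_segment_subset dest!: subsetD[OF closed_segment_subset, rotated -1])
  define F where "F = toC \<circ> f"
  have ct: "continuous_on UNIV toC" using linear_toC linear_continuous_on linear_conv_bounded_linear by blast
  have cF: "continuous_on S F" unfolding F_def
    by (rule continuous_on_compose[OF f continuous_on_subset[OF ct]]) simp
  define Y where "Y = toC y"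
  have FY: "F \<in> S \<rightarrow> - {Y}" using nin inj_toC by (auto simp: F_def Y_def inj_eq)
  have "homotopic_loops S p (linepath q0 q0)"
    by (rule homotopic_loops_const_convex[OF S(1) pp(1) _ piS]) (use pp S in auto)
  from homotopic_loops_continuous_image[OF this cF FY]
  have h1: "homotopic_loops (- {Y}) (F \<circ> p) (F \<circ> linepath q0 q0)" .
  have "F \<circ> linepath q0 q0 = linepath (F q0) (F q0)" by (auto simp: fun_eq_iff linepath_def algebra_simps)
  moreover have "F q0 \<noteq> Y" using FY S(2) by auto
  ultimately have w0: "winding_number (F \<circ> p) Y = 0"
    using winding_number_homotopic_loops[OF h1] winding_number_trivial[of "F q0" Y] by simp
  define A B C where "A = toC a" and "B = toC b" and "C = toC c"
  define h where "h = linepath A B +++ (linepath B C +++ linepath C A)"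
  have YnE: "Y \<notin> toC ` E1" "Y \<notin> toC ` E2" "Y \<notin> toC ` E3" using y(2) inj_toC by (auto simp: Y_def inj_eq)
  have cE: "convex (toC ` E1)" "convex (toC ` E2)" "convex (toC ` E3)"
    using E1 E2 E3 convex_linear_image[OF linear_toC] by auto
  have lp: "linepath u v t \<in> closed_segment u v" if "0 \<le> t" "t \<le> 1" for u v :: "'b::real_normed_vector" and t
    using that unfolding linepath_def closed_segment_def by auto
  have lpE: "linepath u v t \<in> E" if "convex E" "u \<in> E" "v \<in> E" "0 \<le> t" "t \<le> 1" for u v :: complex and E t
    using lp[OF that(4,5)] closed_segment_subset[OF that(2,3,1)] by blast
  have h2: "homotopic_loops (- {Y}) (F \<circ> p) h"
  proof (rule homotopic_loops_linear)
    show "path (F \<circ> p)" using pp(1) continuous_on_subset[OF cF piS] by (rule path_continuous_image)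
    show "path h" "pathfinish h = pathstart h" unfolding h_def by auto
    show "pathfinish (F \<circ> p) = pathstart (F \<circ> p)" using pp by (simp add: pathfinish_compose pathstart_compose)
    fix t :: real assume t: "t \<in> {0..1}"
    have seg: "closed_segment (F (p t)) (h t) \<subseteq> - {Y}" if "F (p t) \<in> toC ` E" "h t \<in> toC ` E" "convex (toC ` E)" "Y \<notin> toC ` E" for E
      using closed_segment_subset[OF that(1,2,3)] that(4) by blast
    \<comment> \<open>Breakpoints of the nested joins. The third edge of \<open>h\<close> is run
      through on [3/4,1], so it faces both of the last two segments of \<open>p\<close>; this is why
      \<open>E3\<close> receives two of them.\<close>
    consider "t \<le> 1/2" | "t > 1/2" "t \<le> 3/4" | "t > 3/4" "t \<le> 7/8" | "t > 7/8" by linarith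
    then have "closed_segment (F (p t)) (h t) \<subseteq> - {Y}"
    proof cases
      case 1
      have "p t \<in> closed_segment q0 q1" unfolding p_def joinpaths_def using 1 t by (auto intro!: lp)
      moreover have "h t \<in> toC ` E1" unfolding h_def joinpaths_def using 1 t E1 cE by (auto intro!: lpE simp: A_def B_def)
      ultimately show ?thesis using E1(2) by (intro seg[of E1] cE YnE) (auto simp: F_def)
    next
      case 2
      have "p t \<in> closed_segment q1 q2" unfolding p_def joinpaths_def using 2 t by (auto intro!: lp)
      moreover have "h t \<in> toC ` E2" unfolding h_def joinpaths_def using 2 t E2 cE by (auto intro!: lpE simp: B_def C_def)
      ultimately show ?thesis using E2(2) by (intro seg[of E2] cE YnE) (auto simp: F_def)
    next
      case 3
      have "p t \<in> closed_segment q2 q3" unfolding p_def joinpaths_def using 3 t by (auto intro!: lp)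
      moreover have "h t \<in> toC ` E3" unfolding h_def joinpaths_def using 3 t E3 cE by (auto intro!: lpE simp: A_def C_def)
      ultimately show ?thesis using E3(2) by (intro seg[of E3] cE YnE) (auto simp: F_def)
    next
      case 4
      have "p t \<in> closed_segment q3 q0" unfolding p_def joinpaths_def using 4 t by (auto intro!: lp)
      moreover have "h t \<in> toC ` E3" unfolding h_def joinpaths_def using 4 t E3 cE by (auto intro!: lpE simp: A_def C_def)
      ultimately show ?thesis using E3(3) by (intro seg[of E3] cE YnE) (auto simp: F_def)
    qed
    then show "closed_segment ((F \<circ> p) t) (h t) \<subseteq> - {Y}" by simp
  qed
  have "Y \<in> interior (convex hull {A,B,C})"
  proof -
    have "open (toC ` interior (convex hull {a,b,c}))"
      by (rule open_surjective_linear_image[OF open_interior linear_toC surj_toC])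
    moreover have "toC ` interior (convex hull {a,b,c}) \<subseteq> toC ` (convex hull {a,b,c})"
      using interior_subset by blast
    moreover have "toC ` (convex hull {a,b,c}) = convex hull {A,B,C}"
      using convex_hull_linear_image[OF linear_toC, of "{a,b,c}"] by (simp add: A_def B_def C_def)
    ultimately show ?thesis using y(1) by (auto simp: Y_def interior_def)
  qed
  then have "winding_number h Y \<noteq> 0" unfolding h_def by (simp add: winding_number_triangle)
  then show False using winding_number_homotopic_loops[OF h2] w0 by simp
qed

section \<open>Slices\<close>

lemma norm_diff_le_nn_integral_derivative:
  fixes \<gamma> :: "real \<Rightarrow> 'a::euclidean_space"
  assumes "a \<le> b" and "\<And>t. a \<le> t \<Longrightarrow> t \<le> b \<Longrightarrow> (\<gamma> has_vector_derivative \<gamma>' t) (at t)" and c: "continuous_on {a..b} \<gamma>'"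
  shows "ennreal (norm (\<gamma> b - \<gamma> a)) \<le> (\<integral>\<^sup>+t. ennreal (norm (\<gamma>' t)) * indicator {a..b} t \<partial>lborel)"
proof -
  have h: "has_bochner_integral lborel (\<lambda>x. indicator {a .. b} x *\<^sub>R \<gamma>' x) (\<gamma> b - \<gamma> a)"
    by (rule has_bochner_integral_FTC_Icc[OF assms(1) _ c]) (use assms(2) has_vector_derivative_at_within in blast)
  have "ennreal (norm (\<gamma> b - \<gamma> a)) \<le> (\<integral>\<^sup>+t. ennreal (norm (indicator {a .. b} t *\<^sub>R \<gamma>' t)) \<partial>lborel)"
    using integral_norm_bound_ennreal[OF integrable.intros[OF h]] has_bochner_integral_integral_eq[OF h] by simp
  also have "\<dots> = (\<integral>\<^sup>+t. ennreal (norm (\<gamma>' t)) * indicator {a..b} t \<partial>lborel)"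
    by (intro nn_integral_cong) (auto simp: indicator_def)
  finally show ?thesis .
qed

text \<open>Two chords through an intermediate point are together no longer than the path. This is
  what confines the image of a slice to an ellipse.\<close>

lemma norm_diffs_le_variation:
  fixes \<gamma> :: "real \<Rightarrow> 'a::euclidean_space"
  assumes "a \<le> t" "t \<le> b" and d: "\<And>t. a \<le> t \<Longrightarrow> t \<le> b \<Longrightarrow> (\<gamma> has_vector_derivative \<gamma>' t) (at t)" and c: "continuous_on {a..b} \<gamma>'"
    and L: "(\<integral>\<^sup>+t. ennreal (norm (\<gamma>' t)) * indicator {a..b} t \<partial>lborel) \<le> ennreal L" "0 \<le> L"
  shows "norm (\<gamma> t - \<gamma> a) + norm (\<gamma> b - \<gamma> t) \<le> L"
proof -
  have m: "(\<lambda>s. ennreal (norm (\<gamma>' s)) * indicator A s) \<in> borel_measurable lborel" if "A \<subseteq> {a..b}" "A \<in> sets borel" for A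
  proof -
    have "(\<lambda>x. indicator A x *\<^sub>R norm (\<gamma>' x)) \<in> borel_measurable borel"
      using that continuous_on_subset[OF c] by (intro borel_measurable_continuous_on_indicator continuous_on_norm) auto
    moreover have "ennreal (norm (\<gamma>' s)) * indicator A s = ennreal (indicator A s *\<^sub>R norm (\<gamma>' s))" for s by (auto simp: indicator_def)
    ultimately show ?thesis by simp
  qed
  have "ennreal (norm (\<gamma> t - \<gamma> a)) + ennreal (norm (\<gamma> b - \<gamma> t)) \<le>
     (\<integral>\<^sup>+s. ennreal (norm (\<gamma>' s)) * indicator {a..t} s \<partial>lborel) + (\<integral>\<^sup>+s. ennreal (norm (\<gamma>' s)) * indicator {t..b} s \<partial>lborel)"
    using assms(1,2) by (intro add_mono norm_diff_le_nn_integral_derivative d continuous_on_subset[OF c]) auto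
  also have "\<dots> = (\<integral>\<^sup>+s. ennreal (norm (\<gamma>' s)) * indicator {a..t} s + ennreal (norm (\<gamma>' s)) * indicator {t..b} s \<partial>lborel)"
    using assms(1,2) by (intro nn_integral_add[symmetric] m) auto
  also have "\<dots> = (\<integral>\<^sup>+s. ennreal (norm (\<gamma>' s)) * indicator {a..b} s \<partial>lborel)"
  proof (rule nn_integral_cong_AE)
    have "AE s in lborel. s \<noteq> t" by (rule AE_lborel_singleton)
    then show "AE s in lborel. ennreal (norm (\<gamma>' s)) * indicator {a..t} s + ennreal (norm (\<gamma>' s)) * indicator {t..b} s = ennreal (norm (\<gamma>' s)) * indicator {a..b} s"
      by eventually_elim (use assms(1,2) in \<open>auto simp: indicator_def\<close>)
  qed
  also have "\<dots> \<le> ennreal L" by (rule L)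
  finally have "ennreal (norm (\<gamma> t - \<gamma> a) + norm (\<gamma> b - \<gamma> t)) \<le> ennreal L" by (simp add: ennreal_plus)
  then show ?thesis using L(2) by (subst (asm) ennreal_le_iff) auto
qed

text \<open>A small integral of the distance to a provides one good point, and small variation
  spreads it over the whole interval.\<close>

lemma near_constant_of_small_integral:
  fixes \<gamma> :: "real \<Rightarrow> 'a::euclidean_space"
  assumes d: "\<And>t. t0 < t \<Longrightarrow> t < t1 \<Longrightarrow> (\<gamma> has_vector_derivative \<gamma>' t) (at t)" and c: "continuous_on {t0<..<t1} \<gamma>'"
    and v: "(\<integral>\<^sup>+t. ennreal (norm (\<gamma>' t)) * indicator {t0<..<t1} t \<partial>lborel) \<le> ennreal \<eta>"
    and i: "(\<integral>\<^sup>+t. ennreal (norm (\<gamma> t - a)) * indicator {t0<..<t1} t \<partial>lborel) < ennreal (\<eta> * (t1 - t0))"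
    and \<eta>: "0 \<le> \<eta>" and t: "t0 < t" "t < t1"
  shows "norm (\<gamma> t - a) \<le> 2 * \<eta>"
proof -
  have "\<exists>s. t0 < s \<and> s < t1 \<and> norm (\<gamma> s - a) \<le> \<eta>"
  proof (rule ccontr)
    assume "\<nexists>s. t0 < s \<and> s < t1 \<and> norm (\<gamma> s - a) \<le> \<eta>"
    then have "(\<integral>\<^sup>+s. ennreal \<eta> * indicator {t0<..<t1} s \<partial>lborel) \<le> (\<integral>\<^sup>+t. ennreal (norm (\<gamma> t - a)) * indicator {t0<..<t1} t \<partial>lborel)"
      by (intro nn_integral_mono) (auto simp: indicator_def not_le intro!: ennreal_leI less_imp_le)
    moreover have "(\<integral>\<^sup>+s. ennreal \<eta> * indicator {t0<..<t1} s \<partial>lborel) = ennreal (\<eta> * (t1 - t0))"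
      using t \<eta> by (simp add: nn_integral_cmult_indicator ennreal_mult)
    ultimately show False using i by simp
  qed
  then obtain s where s: "t0 < s" "s < t1" "norm (\<gamma> s - a) \<le> \<eta>" by blast
  have le: "norm (\<gamma> y - \<gamma> x) \<le> \<eta>" if "t0 < x" "x \<le> y" "y < t1" for x y
  proof -
    have "ennreal (norm (\<gamma> y - \<gamma> x)) \<le> (\<integral>\<^sup>+t. ennreal (norm (\<gamma>' t)) * indicator {x..y} t \<partial>lborel)"
      using that by (intro norm_diff_le_nn_integral_derivative d continuous_on_subset[OF c]) auto
    also have "\<dots> \<le> (\<integral>\<^sup>+t. ennreal (norm (\<gamma>' t)) * indicator {t0<..<t1} t \<partial>lborel)"
      using that by (intro nn_integral_mono) (auto simp: indicator_def)
    also have "\<dots> \<le> ennreal \<eta>" by (rule v)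
    finally show ?thesis using \<eta> by (subst (asm) ennreal_le_iff) auto
  qed
  have "norm (\<gamma> t - \<gamma> s) \<le> \<eta>"
    using le[of s t] le[of t s] s t by (cases "s \<le> t") (auto simp: norm_minus_commute)
  then show ?thesis using s(3) norm_triangle_ineq[of "\<gamma> t - \<gamma> s" "\<gamma> s - a"] by simp
qed

section \<open>Slices across a rectangle\<close>

context frame
begin

definition rect :: "real^2 \<Rightarrow> real \<Rightarrow> real \<Rightarrow> real \<Rightarrow> real \<Rightarrow> (real^2) set" where
  "rect p s0 s1 t0 t1 = {x. s0 < (x - p) \<bullet> e \<and> (x - p) \<bullet> e < s1 \<and> t0 < (x - p) \<bullet> \<nu> \<and> (x - p) \<bullet> \<nu> < t1}"

lemma open_rect: "open (rect p s0 s1 t0 t1)"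
  unfolding rect_def by (intro open_Collect_conj open_Collect_less continuous_intros)

lemma rect_coordinates: "p + s *\<^sub>R e + t *\<^sub>R \<nu> \<in> rect p s0 s1 t0 t1 \<longleftrightarrow> s0 < s \<and> s < s1 \<and> t0 < t \<and> t < t1"
  by (simp add: rect_def inner_add_left)

text \<open>An averaging argument: if every slice exceeded c, Fubini would give at least c (s1 - s0)
  for the rectangle.\<close>

lemma exists_slice:
  assumes m: "(\<lambda>x. F x * indicator (rect p s0 s1 t0 t1) x) \<in> borel_measurable borel"
    and less: "(\<integral>\<^sup>+x. F x * indicator (rect p s0 s1 t0 t1) x \<partial>lborel) < ennreal (c * (s1 - s0))"
    and "s0 < s1" "0 \<le> c"
  shows "\<exists>s. s0 < s \<and> s < s1 \<and> (\<integral>\<^sup>+t. F (p + s *\<^sub>R e + t *\<^sub>R \<nu>) * indicator {t0<..<t1} t \<partial>lborel) \<le> ennreal c"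
proof (rule ccontr)
  assume "\<not> ?thesis"
  then have g: "ennreal c \<le> (\<integral>\<^sup>+t. F (p + s *\<^sub>R e + t *\<^sub>R \<nu>) * indicator {t0<..<t1} t \<partial>lborel)" if "s0 < s" "s < s1" for s
    using that by (meson linorder_not_le less_imp_le)
  have ind: "indicator (rect p s0 s1 t0 t1) (p + s *\<^sub>R e + t *\<^sub>R \<nu>) = (indicator {s0<..<s1} s * indicator {t0<..<t1} t :: ennreal)" for s t
    by (auto simp: indicator_def rect_coordinates)
  have "ennreal (c * (s1 - s0)) = (\<integral>\<^sup>+s. ennreal c * indicator {s0<..<s1} s \<partial>lborel)"
    using assms by (simp add: nn_integral_cmult_indicator ennreal_mult)
  also have "\<dots> \<le> (\<integral>\<^sup>+s. \<integral>\<^sup>+t. F (p + s *\<^sub>R e + t *\<^sub>R \<nu>) * indicator (rect p s0 s1 t0 t1) (p + s *\<^sub>R e + t *\<^sub>R \<nu>) \<partial>lborel \<partial>lborel)"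
    unfolding ind by (intro nn_integral_mono) (use g in \<open>auto simp: indicator_def\<close>)
  also have "\<dots> = (\<integral>\<^sup>+x. F x * indicator (rect p s0 s1 t0 t1) x \<partial>lborel)"
    by (rule nn_integral_frame[OF m, symmetric])
  finally show False using less by simp
qed

end

text \<open>A sublevel set of a sum of two distances, each of them convex.\<close>

lemma convex_ellipse: "convex {z::'a::real_normed_vector. dist a z + dist b z \<le> c}"
proof (rule convexI, clarsimp)
  fix x y :: 'a and u v :: real
  assume xy: "dist a x + dist b x \<le> c" "dist a y + dist b y \<le> c" and uv: "0 \<le> u" "0 \<le> v" "u + v = 1"
  have d: "dist z (u *\<^sub>R x + v *\<^sub>R y) \<le> u * dist z x + v * dist z y" for z
    using convex_onD[OF convex_on_dist[of UNIV z], of v x y] uv by (simp add: eq_diff_eq[symmetric] add.commute)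
  have "u * (dist a x + dist b x) + v * (dist a y + dist b y) \<le> u * c + v * c"
    using xy uv by (intro add_mono mult_left_mono)
  also have "\<dots> = c" using uv by (simp add: distrib_right[symmetric])
  finally show "dist a (u *\<^sub>R x + v *\<^sub>R y) + dist b (u *\<^sub>R x + v *\<^sub>R y) \<le> c"
    using d[of a] d[of b] by (simp add: algebra_simps)
qed

context frame
begin

lemma frame_expand: "y = (y \<bullet> e) *\<^sub>R e + (y \<bullet> \<nu>) *\<^sub>R \<nu>"
proof -
  define T where "T x = x$1 *\<^sub>R e + x$2 *\<^sub>R \<nu>" for x :: "real^2"
  have "linear T" unfolding T_def[abs_def] by (rule linearI) (auto simp: algebra_simps)
  moreover have "T v \<bullet> T w = v \<bullet> w" for v w
    unfolding T_def inner_real2[of v w] by (simp add: inner_add_left inner_add_right)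
  ultimately have o: "orthogonal_transformation T" unfolding orthogonal_transformation_def by blast
  obtain z where "y = T z" using surjD[OF orthogonal_transformation_surj[OF o], of y] by metis
  then show ?thesis by (simp add: T_def inner_add_left)
qed

lemma norm_sq_frame: "(norm y)\<^sup>2 = (y \<bullet> e)\<^sup>2 + (y \<bullet> \<nu>)\<^sup>2"
proof -
  have "(norm y)\<^sup>2 = y \<bullet> ((y \<bullet> e) *\<^sub>R e + (y \<bullet> \<nu>) *\<^sub>R \<nu>)"
    using frame_expand[of y] by (simp add: power2_norm_eq_inner)
  then show ?thesis by (simp add: inner_add_right power2_eq_square)
qed

lemma rect_subset_ball:
  assumes "s0\<^sup>2 \<le> A" "s1\<^sup>2 \<le> A" "t0\<^sup>2 \<le> B" "t1\<^sup>2 \<le> B" "A + B \<le> r\<^sup>2" "0 < r"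
  shows "rect p s0 s1 t0 t1 \<subseteq> ball p r"
proof
  fix x assume x: "x \<in> rect p s0 s1 t0 t1"
  have sq: "z\<^sup>2 < C" if "l < z" "z < u" "l\<^sup>2 \<le> C" "u\<^sup>2 \<le> C" for l u z C :: real
  proof (cases "z \<ge> 0")
    case True then have "z\<^sup>2 < u\<^sup>2" using that by (intro power_strict_mono) auto
    then show ?thesis using that by simp
  next
    case False then have "(-z)\<^sup>2 < (-l)\<^sup>2" using that by (intro power_strict_mono) auto
    then show ?thesis using that by simp
  qed
  have "(norm (x - p))\<^sup>2 < A + B" unfolding norm_sq_frame
    using x assms by (intro add_strict_mono sq[of s0 _ s1] sq[of t0 _ t1]) (auto simp: rect_def)
  then have "(norm (x - p))\<^sup>2 < r\<^sup>2" using assms by simp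
  then have "norm (x - p) < r" using \<open>0 < r\<close> by (meson power_less_imp_less_base less_imp_le)
  then show "x \<in> ball p r" by (simp add: dist_norm norm_minus_commute)
qed

text \<open>Several demands fall on the same slice: total length at most J + \<kappa>, and
  near-constancy at both ends. The end demands enter the integrand with a large weight K, so a slice
  of at most average size meets all of them. K is large in terms of J and \<kappa>, and then
  \<epsilon> is so small that the weighted terms cost less than \<kappa> per unit of width.\<close>

lemma crossing_slice:
  assumes \<Omega>: "open \<Omega>" "rect p s0 s1 t0 t1 \<subseteq> \<Omega>" and c: "C1_on \<Omega> w"
    and s: "s0 < s1" and t: "t0 < \<tau>0" "\<tau>0 < t1" "t0 < \<tau>1" "\<tau>1 < t1"
    and V: "total_var w (rect p s0 s1 t0 t1) \<le> ennreal (J * (s1 - s0) + \<epsilon>)"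
      "total_var w (rect p s0 s1 t0 \<tau>0) \<le> ennreal \<epsilon>" "total_var w (rect p s0 s1 \<tau>1 t1) \<le> ennreal \<epsilon>"
    and I: "(\<integral>\<^sup>+x. ennreal (norm (w x - a)) * indicator (rect p s0 s1 t0 \<tau>0) x \<partial>lborel) \<le> ennreal \<epsilon>"
      "(\<integral>\<^sup>+x. ennreal (norm (w x - b)) * indicator (rect p s0 s1 \<tau>1 t1) x \<partial>lborel) \<le> ennreal \<epsilon>"
    and J: "0 \<le> J" and \<kappa>: "0 < \<kappa>" and \<epsilon>: "0 \<le> \<epsilon>" "(1 + 4 * K) * \<epsilon> < \<kappa> * (s1 - s0)"
    and K: "0 < K" "(J + \<kappa>) / K \<le> \<kappa> / 2" "(J + \<kappa>) / K < \<kappa> / 2 * (\<tau>0 - t0)" "(J + \<kappa>) / K < \<kappa> / 2 * (t1 - \<tau>1)"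
  shows "\<exists>s. s0 < s \<and> s < s1 \<and> (\<forall>t. t0 < t \<and> t < \<tau>0 \<longrightarrow> norm (w (p + s *\<^sub>R e + t *\<^sub>R \<nu>) - a) \<le> \<kappa>) \<and>
     (\<forall>t. \<tau>1 < t \<and> t < t1 \<longrightarrow> norm (w (p + s *\<^sub>R e + t *\<^sub>R \<nu>) - b) \<le> \<kappa>) \<and>
     (\<forall>x t y. t0 < x \<and> x \<le> t \<and> t \<le> y \<and> y < t1 \<longrightarrow>
        norm (w (p + s *\<^sub>R e + t *\<^sub>R \<nu>) - w (p + s *\<^sub>R e + x *\<^sub>R \<nu>)) + norm (w (p + s *\<^sub>R e + y *\<^sub>R \<nu>) - w (p + s *\<^sub>R e + t *\<^sub>R \<nu>)) \<le> J + \<kappa>)"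
proof -
  obtain W where W: "\<And>x. x \<in> \<Omega> \<Longrightarrow> (w has_derivative W x) (at x)" "\<And>h. continuous_on \<Omega> (\<lambda>x. W x h)"
    by (rule C1_onE[OF c]) (rule that)
  let ?R = "rect p s0 s1 t0 t1" and ?A = "rect p s0 s1 t0 \<tau>0" and ?B = "rect p s0 s1 \<tau>1 t1"
  have sub: "?A \<subseteq> ?R" "?B \<subseteq> ?R" using t by (auto simp: rect_def)
  have sub\<Omega>: "?R \<subseteq> \<Omega>" "?A \<subseteq> \<Omega>" "?B \<subseteq> \<Omega>" using sub \<Omega>(2) by auto
  have cw: "continuous_on \<Omega> w" using C1_on_imp_continuous_on[OF c] .
  have m: "(\<lambda>x. ennreal (f x) * indicator X x) \<in> borel_measurable borel" if "continuous_on \<Omega> f" "X \<subseteq> \<Omega>" "open X" for f :: "real^2 \<Rightarrow> real" and X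
  proof -
    have "(\<lambda>x. indicator X x *\<^sub>R f x) \<in> borel_measurable borel"
      using that by (intro borel_measurable_continuous_on_indicator continuous_on_subset[OF that(1)]) auto
    moreover have "ennreal (f s) * indicator X s = ennreal (indicator X s *\<^sub>R f s)" for s by (auto simp: indicator_def)
    ultimately show ?thesis by simp
  qed
  let ?v = "\<lambda>x. ennreal (norm (W x \<nu>))"
  let ?a = "\<lambda>x. ennreal (norm (w x - a))" and ?b = "\<lambda>x. ennreal (norm (w x - b))"
  have mv: "(\<lambda>x. ?v x * indicator X x) \<in> borel_measurable borel" if "X \<subseteq> \<Omega>" "open X" for X
    using that by (intro m continuous_on_norm W(2))
  have ma: "(\<lambda>x. ?a x * indicator ?A x) \<in> borel_measurable borel" "(\<lambda>x. ?b x * indicator ?B x) \<in> borel_measurable borel"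
    by (intro m continuous_intros cw sub\<Omega> open_rect)+
  \<comment> \<open>Variation along the whole slice plus K times the variation and the distance to
    the limit value on the two end strips. By the hypotheses its integral over the rectangle stays
    below (J + \<kappa>) (s1 - s0).\<close>
  define F where "F x = ?v x + ennreal K * (?v x * indicator ?A x + ?a x * indicator ?A x + ?v x * indicator ?B x + ?b x * indicator ?B x)" for x
  have Fe: "F x * indicator ?R x = ?v x * indicator ?R x + ennreal K * (?v x * indicator ?A x + ?a x * indicator ?A x + ?v x * indicator ?B x + ?b x * indicator ?B x)" for x
    using sub by (auto simp: F_def indicator_def)
  have mF: "(\<lambda>x. F x * indicator ?R x) \<in> borel_measurable borel" unfolding Fe
    by (intro borel_measurable_add borel_measurable_times_ennreal ma mv sub\<Omega> open_rect) auto
  have dle: "(\<integral>\<^sup>+x. ?v x * indicator X x \<partial>lborel) \<le> total_var w X" if "X \<subseteq> \<Omega>" "open X" for X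
    by (rule nn_integral_directional_derivative_le_total_var[OF that(2)])
      (use W that(1) in \<open>auto intro: continuous_on_subset\<close>)
  have "(\<integral>\<^sup>+x. F x * indicator ?R x \<partial>lborel)
    = (\<integral>\<^sup>+x. ?v x * indicator ?R x \<partial>lborel) + ennreal K * ((\<integral>\<^sup>+x. ?v x * indicator ?A x \<partial>lborel)
      + (\<integral>\<^sup>+x. ?a x * indicator ?A x \<partial>lborel) + (\<integral>\<^sup>+x. ?v x * indicator ?B x \<partial>lborel) + (\<integral>\<^sup>+x. ?b x * indicator ?B x \<partial>lborel))"
  proof -
    have "(\<integral>\<^sup>+x. f0 x + k * (f1 x + f2 x + f3 x + f4 x) \<partial>lborel)
      = integral\<^sup>N lborel f0 + k * (integral\<^sup>N lborel f1 + integral\<^sup>N lborel f2 + integral\<^sup>N lborel f3 + integral\<^sup>N lborel f4)"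
      if [measurable]: "f0 \<in> borel_measurable borel" "f1 \<in> borel_measurable borel" "f2 \<in> borel_measurable borel"
        "f3 \<in> borel_measurable borel" "f4 \<in> borel_measurable borel" for f0 f1 f2 f3 f4 :: "real^2 \<Rightarrow> ennreal" and k
      by (simp add: nn_integral_add nn_integral_cmult)
    note this[OF mv[OF sub\<Omega>(1) open_rect] mv[OF sub\<Omega>(2) open_rect] ma(1) mv[OF sub\<Omega>(3) open_rect] ma(2)]
    then show ?thesis unfolding Fe .
  qed
  also have "\<dots> \<le> ennreal (J * (s1 - s0) + \<epsilon>) + ennreal K * (ennreal \<epsilon> + ennreal \<epsilon> + ennreal \<epsilon> + ennreal \<epsilon>)"
    by (intro add_mono mult_left_mono order_trans[OF dle V(1)] order_trans[OF dle V(2)] order_trans[OF dle V(3)] I sub\<Omega> open_rect) auto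
  also have "\<dots> = ennreal (J * (s1 - s0) + (1 + 4 * K) * \<epsilon>)"
  proof -
    have "ennreal \<epsilon> + ennreal \<epsilon> + ennreal \<epsilon> + ennreal \<epsilon> = ennreal (4 * \<epsilon>)" using \<epsilon>(1) by (simp add: ennreal_plus[symmetric] del: ennreal_plus)
    then have "ennreal (J * (s1 - s0) + \<epsilon>) + ennreal K * (ennreal \<epsilon> + ennreal \<epsilon> + ennreal \<epsilon> + ennreal \<epsilon>)
        = ennreal ((J * (s1 - s0) + \<epsilon>) + K * (4 * \<epsilon>))"
      using \<epsilon>(1) K(1) J s by (simp only: ennreal_mult[symmetric] ennreal_plus[symmetric] mult_nonneg_nonneg add_nonneg_nonneg less_imp_le diff_ge_0_iff_ge zero_le_numeral)
    also have "(J * (s1 - s0) + \<epsilon>) + K * (4 * \<epsilon>) = J * (s1 - s0) + (1 + 4 * K) * \<epsilon>" by (simp add: algebra_simps)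
    finally show ?thesis .
  qed
  also have "\<dots> < ennreal ((J + \<kappa>) * (s1 - s0))"
  proof (rule ennreal_lessI)
    show "0 < (J + \<kappa>) * (s1 - s0)" using J \<kappa> s by (intro mult_pos_pos) auto
    show "J * (s1 - s0) + (1 + 4 * K) * \<epsilon> < (J + \<kappa>) * (s1 - s0)" using \<epsilon>(2) by (simp add: distrib_right)
  qed
  finally have less: "(\<integral>\<^sup>+x. F x * indicator ?R x \<partial>lborel) < ennreal ((J + \<kappa>) * (s1 - s0))" .
  have "0 \<le> J + \<kappa>" using J \<kappa> by simp
  from exists_slice[OF mF less s this]
  obtain s where ss: "s0 < s" "s < s1" and sF: "(\<integral>\<^sup>+t. F (p + s *\<^sub>R e + t *\<^sub>R \<nu>) * indicator {t0<..<t1} t \<partial>lborel) \<le> ennreal (J + \<kappa>)"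
    by blast
  define \<gamma> where "\<gamma> t = w (p + s *\<^sub>R e + t *\<^sub>R \<nu>)" for t
  define \<gamma>' where "\<gamma>' t = W (p + s *\<^sub>R e + t *\<^sub>R \<nu>) \<nu>" for t
  have inR: "p + s *\<^sub>R e + t *\<^sub>R \<nu> \<in> \<Omega>" if "t0 < t" "t < t1" for t
    using that ss sub\<Omega>(1) rect_coordinates[of p s t s0 s1 t0 t1] by auto
  have d: "(\<gamma> has_vector_derivative \<gamma>' t) (at t)" if "t0 < t" "t < t1" for t
  proof -
    have l: "((\<lambda>t. p + s *\<^sub>R e + t *\<^sub>R \<nu>) has_derivative (\<lambda>d. d *\<^sub>R \<nu>)) (at t)" by (auto intro!: derivative_eq_intros)
    note WD = W(1)[OF inR[OF that]]
    show ?thesis unfolding has_vector_derivative_def \<gamma>_def[abs_def] \<gamma>'_def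
      using has_derivative_compose[OF l WD] linear_cmul[OF has_derivative_linear[OF WD]] by simp
  qed
  have cg: "continuous_on {t0<..<t1} \<gamma>'" unfolding \<gamma>'_def
    by (rule continuous_on_compose2[OF W(2)]) (auto intro!: continuous_intros inR)
  have v1: "(\<integral>\<^sup>+t. ennreal (norm (\<gamma>' t)) * indicator {t0<..<t1} t \<partial>lborel) \<le> ennreal (J + \<kappa>)"
    by (rule order_trans[OF nn_integral_mono sF]) (auto simp: F_def \<gamma>'_def indicator_def)
  \<comment> \<open>The integral of F along the chosen slice is at most J + \<kappa>, so a quantity
    that enters with weight K has integral at most (J + \<kappa>) / K.\<close>
  have half: "(\<integral>\<^sup>+t. ennreal (f t) * indicator {l<..<u} t \<partial>lborel) \<le> ennreal ((J + \<kappa>) / K)"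
    if "\<And>t. t0 < t \<Longrightarrow> t < t1 \<Longrightarrow> l < t \<Longrightarrow> t < u \<Longrightarrow> ennreal K * ennreal (f t) \<le> F (p + s *\<^sub>R e + t *\<^sub>R \<nu>)" 
      "t0 \<le> l" "u \<le> t1" "\<And>t. f t \<ge> 0" for f l u
  proof -
    have "(\<integral>\<^sup>+t. ennreal (f t) * indicator {l<..<u} t \<partial>lborel) \<le> (\<integral>\<^sup>+t. ennreal (1/K) * (F (p + s *\<^sub>R e + t *\<^sub>R \<nu>) * indicator {t0<..<t1} t) \<partial>lborel)"
    proof (rule nn_integral_mono)
      fix t
      show "ennreal (f t) * indicator {l<..<u} t \<le> ennreal (1/K) * (F (p + s *\<^sub>R e + t *\<^sub>R \<nu>) * indicator {t0<..<t1} t)"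
      proof (cases "l < t \<and> t < u")
        case True
        have "ennreal (f t) = ennreal (1/K) * (ennreal K * ennreal (f t))"
          using K(1) that(4)[of t] by (simp add: ennreal_mult[symmetric] mult.assoc[symmetric])
        also have "\<dots> \<le> ennreal (1/K) * F (p + s *\<^sub>R e + t *\<^sub>R \<nu>)"
          using True that by (intro mult_left_mono that(1)) auto
        finally show ?thesis using True that(2,3) by (auto simp: indicator_def)
      next
        case False
        then have "indicator {l<..<u} t = (0::ennreal)" by auto
        then show ?thesis by simp
      qed
    qed
    also have "\<dots> = ennreal (1/K) * (\<integral>\<^sup>+t. F (p + s *\<^sub>R e + t *\<^sub>R \<nu>) * indicator {t0<..<t1} t \<partial>lborel)"
    proof (rule nn_integral_cmult)
      have ind: "F (p + s *\<^sub>R e + t *\<^sub>R \<nu>) * indicator {t0<..<t1} t = (\<lambda>x. F x * indicator ?R x) (p + s *\<^sub>R e + t *\<^sub>R \<nu>)" for t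
        using ss by (auto simp: indicator_def rect_coordinates)
      have "(\<lambda>t. p + s *\<^sub>R e + t *\<^sub>R \<nu>) \<in> borel_measurable borel" by measurable
      from measurable_compose[OF this mF] show "(\<lambda>t. F (p + s *\<^sub>R e + t *\<^sub>R \<nu>) * indicator {t0<..<t1} t) \<in> borel_measurable lborel"
        unfolding ind by simp
    qed
    also have "\<dots> \<le> ennreal (1/K) * ennreal (J + \<kappa>)" by (intro mult_left_mono sF) auto
    also have "\<dots> = ennreal ((J + \<kappa>) / K)" using K(1) J \<kappa> by (simp add: ennreal_mult[symmetric] del: ennreal_plus)
    finally show ?thesis .
  qed
  have inA: "indicator ?A (p + s *\<^sub>R e + t *\<^sub>R \<nu>) = (1::ennreal)" if "t0 < t" "t < \<tau>0" for t
    using that ss by (simp add: rect_coordinates)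
  have inB: "indicator ?B (p + s *\<^sub>R e + t *\<^sub>R \<nu>) = (1::ennreal)" if "\<tau>1 < t" "t < t1" for t
    using that ss by (simp add: rect_coordinates)
  have le1: "ennreal K * x \<le> v0 + ennreal K * y" if "x \<le> y" for x y v0 :: ennreal
    using mult_left_mono[OF that, of "ennreal K"] by (simp add: add_increasing)
  have s4: "v1 \<le> v1 + v2 + v3 + v4" "v2 \<le> v1 + v2 + v3 + v4" "v3 \<le> v1 + v2 + v3 + v4" "v4 \<le> v1 + v2 + v3 + v4" for v1 v2 v3 v4 :: ennreal
    by (simp_all add: add_increasing add_increasing2)
  note le4 = s4[THEN le1]
  have hA: "(\<integral>\<^sup>+t. ennreal (norm (\<gamma>' t)) * indicator {t0<..<\<tau>0} t \<partial>lborel) \<le> ennreal ((J + \<kappa>) / K)"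
    "(\<integral>\<^sup>+t. ennreal (norm (\<gamma> t - a)) * indicator {t0<..<\<tau>0} t \<partial>lborel) \<le> ennreal ((J + \<kappa>) / K)"
    unfolding \<gamma>_def \<gamma>'_def using t by (intro half; simp add: F_def inA le4)+
  have hB: "(\<integral>\<^sup>+t. ennreal (norm (\<gamma>' t)) * indicator {\<tau>1<..<t1} t \<partial>lborel) \<le> ennreal ((J + \<kappa>) / K)"
    "(\<integral>\<^sup>+t. ennreal (norm (\<gamma> t - b)) * indicator {\<tau>1<..<t1} t \<partial>lborel) \<le> ennreal ((J + \<kappa>) / K)"
    unfolding \<gamma>_def \<gamma>'_def using t by (intro half; simp add: F_def inB le4)+
  have JK: "0 \<le> (J + \<kappa>) / K" using J \<kappa> K by simp
  have nA: "norm (\<gamma> x - a) \<le> 2 * (\<kappa> / 2)" if "t0 < x" "x < \<tau>0" for x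
  proof (rule near_constant_of_small_integral[OF _ continuous_on_subset[OF cg] _ _ _ that])
    show "(\<integral>\<^sup>+t. ennreal (norm (\<gamma>' t)) * indicator {t0<..<\<tau>0} t \<partial>lborel) \<le> ennreal (\<kappa> / 2)"
      using hA(1) K(2) by (meson ennreal_leI order_trans)
    show "(\<integral>\<^sup>+t. ennreal (norm (\<gamma> t - a)) * indicator {t0<..<\<tau>0} t \<partial>lborel) < ennreal (\<kappa> / 2 * (\<tau>0 - t0))"
      by (rule le_less_trans[OF hA(2) ennreal_lessI[OF le_less_trans[OF JK K(3)] K(3)]])
  qed (use d t \<kappa> in auto)
  have nB: "norm (\<gamma> x - b) \<le> 2 * (\<kappa> / 2)" if "\<tau>1 < x" "x < t1" for x
  proof (rule near_constant_of_small_integral[OF _ continuous_on_subset[OF cg] _ _ _ that])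
    show "(\<integral>\<^sup>+t. ennreal (norm (\<gamma>' t)) * indicator {\<tau>1<..<t1} t \<partial>lborel) \<le> ennreal (\<kappa> / 2)"
      using hB(1) K(2) by (meson ennreal_leI order_trans)
    show "(\<integral>\<^sup>+t. ennreal (norm (\<gamma> t - b)) * indicator {\<tau>1<..<t1} t \<partial>lborel) < ennreal (\<kappa> / 2 * (t1 - \<tau>1))"
      by (rule le_less_trans[OF hB(2) ennreal_lessI[OF le_less_trans[OF JK K(4)] K(4)]])
  qed (use d t \<kappa> in auto)
  have var: "norm (\<gamma> y - \<gamma> x) + norm (\<gamma> z - \<gamma> y) \<le> J + \<kappa>" if "t0 < x" "x \<le> y" "y \<le> z" "z < t1" for x y z
  proof (rule norm_diffs_le_variation[OF that(2,3)])
    show "(\<gamma> has_vector_derivative \<gamma>' t) (at t)" if "x \<le> t" "t \<le> z" for t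
      using that \<open>t0 < x\<close> \<open>z < t1\<close> by (intro d) auto
    show "continuous_on {x..z} \<gamma>'" by (rule continuous_on_subset[OF cg]) (use that in auto)
    show "(\<integral>\<^sup>+t. ennreal (norm (\<gamma>' t)) * indicator {x..z} t \<partial>lborel) \<le> ennreal (J + \<kappa>)"
      by (rule order_trans[OF nn_integral_mono v1]) (use that in \<open>auto simp: indicator_def\<close>)
  qed (use J \<kappa> in auto)
  show ?thesis using ss nA nB var by (intro exI[of _ s]) (auto simp: \<gamma>_def)
qed

text \<open>The two chords sum to at most J + \<kappa>, and moving the end values to the foci a and
  b costs another \<kappa> each.\<close>

lemma segment_in_ellipse:
  assumes a: "norm (w (p + s *\<^sub>R e + x *\<^sub>R \<nu>) - a) \<le> \<kappa>" and b: "norm (w (p + s *\<^sub>R e + y *\<^sub>R \<nu>) - b) \<le> \<kappa>"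
    and v: "\<And>t. x \<le> t \<Longrightarrow> t \<le> y \<Longrightarrow> norm (w (p + s *\<^sub>R e + t *\<^sub>R \<nu>) - w (p + s *\<^sub>R e + x *\<^sub>R \<nu>)) + norm (w (p + s *\<^sub>R e + y *\<^sub>R \<nu>) - w (p + s *\<^sub>R e + t *\<^sub>R \<nu>)) \<le> J + \<kappa>"
    and "x \<le> y"
  shows "w ` closed_segment (p + s *\<^sub>R e + x *\<^sub>R \<nu>) (p + s *\<^sub>R e + y *\<^sub>R \<nu>) \<subseteq> {z. dist a z + dist b z \<le> J + 3 * \<kappa>}"
proof clarify
  fix z assume "z \<in> closed_segment (p + s *\<^sub>R e + x *\<^sub>R \<nu>) (p + s *\<^sub>R e + y *\<^sub>R \<nu>)"
  then obtain l where l: "0 \<le> l" "l \<le> 1" "z = (1 - l) *\<^sub>R (p + s *\<^sub>R e + x *\<^sub>R \<nu>) + l *\<^sub>R (p + s *\<^sub>R e + y *\<^sub>R \<nu>)"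
    unfolding closed_segment_def by blast
  define t where "t = x + l * (y - x)"
  have z: "z = p + s *\<^sub>R e + t *\<^sub>R \<nu>" unfolding l(3) t_def by (simp add: algebra_simps)
  have t: "x \<le> t" "t \<le> y" unfolding t_def using l \<open>x \<le> y\<close> mult_right_mono[of l 1 "y - x"] by auto
  define X Y Z where "X = w (p + s *\<^sub>R e + x *\<^sub>R \<nu>)" and "Y = w (p + s *\<^sub>R e + y *\<^sub>R \<nu>)" and "Z = w z"
  have 1: "norm (Z - X) + norm (Y - Z) \<le> J + \<kappa>" using v[OF t] by (simp add: X_def Y_def Z_def z)
  have "norm (X - a) \<le> \<kappa>" "norm (Y - b) \<le> \<kappa>" using a b by (simp_all add: X_def Y_def)
  moreover have "norm (Z - a) \<le> norm (Z - X) + norm (X - a)" by (metis norm_triangle_sub diff_add_cancel norm_triangle_ineq add_diff_eq)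
  moreover have "norm (Z - b) \<le> norm (Y - Z) + norm (Y - b)" by (metis norm_triangle_ineq norm_minus_commute diff_add_cancel add_diff_eq)
  ultimately show "dist a (w z) + dist b (w z) \<le> J + 3 * \<kappa>"
    using 1 by (simp add: dist_norm norm_minus_commute Z_def)
qed

end

section \<open>Three sectors at a triple point\<close>

text \<open>The cosine of 30 degrees, the angle between the horizontal axis and the two bounding
  rays of the triangles.\<close>

definition cc :: real where "cc = sqrt 3 / 2"

lemma cc_sq: "cc * cc = 3/4" by (simp add: cc_def)

lemma cc_bounds: "0.866 < cc" "cc < 0.8661"
proof -
  have "1.732 < sqrt 3" by (rule real_less_rsqrt) (simp add: power2_eq_square)
  then show "0.866 < cc" by (simp add: cc_def)
  have "sqrt 3 < 1.7322" by (rule real_less_lsqrt) (simp_all add: power2_eq_square)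
  then show "cc < 0.8661" by (simp add: cc_def)
qed

lemma cc_pos: "0 < cc" using cc_bounds by simp

text \<open>The unit vector along the ray that contains all \<open>A_pt i\<close>; its companion
  \<open>nn\<close> is the normal that points out of the triangle.\<close>

definition ee :: "real^2" where "ee = vector [cc, 1/2]"
definition nn :: "real^2" where "nn = vector [- (1/2), cc]"

lemma ee_nth [simp]: "ee$1 = cc" "ee$2 = 1/2" "nn$1 = - (1/2)" "nn$2 = cc"
  by (simp_all add: ee_def nn_def)

interpretation tilted: frame ee nn
  by unfold_locales (auto simp: inner_real2 cc_sq)

interpretation tilted': frame nn ee by (rule tilted.swap)

interpretation axes': frame "axis 2 1" "axis 1 1" by (rule axes.swap)

lemma inner_ee: "x \<bullet> ee = cc * x$1 + x$2 / 2" and inner_nn: "x \<bullet> nn = cc * x$2 - x$1 / 2"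
  by (simp_all add: inner_real2)

lemma emeasure_add_le_of_subset:
  assumes "{x<..<y} \<subseteq> S \<union> X" "S \<in> sets borel" "X \<in> sets borel" "emeasure lborel X \<le> ennreal d" "x \<le> y" "0 \<le> j"
  shows "ennreal (j * (y - x)) \<le> ennreal j * emeasure lborel S + ennreal j * ennreal d"
proof -
  have "ennreal (y - x) = emeasure lborel {x<..<y}" using assms by simp
  also have "\<dots> \<le> emeasure lborel (S \<union> X)" using assms by (intro emeasure_mono) auto
  also have "\<dots> \<le> emeasure lborel S + emeasure lborel X" using assms by (intro emeasure_subadditive) auto
  also have "\<dots> \<le> emeasure lborel S + ennreal d" using assms by (intro add_left_mono)
  finally have "ennreal j * ennreal (y - x) \<le> ennreal j * (emeasure lborel S + ennreal d)" by (intro mult_left_mono) auto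
  then show ?thesis using assms by (simp add: ennreal_mult distrib_left)
qed

text \<open>The local model at a point A_i: \<alpha> above the oblique line, b to the right and g to
  the left of the vertical ray below it. The colours stay abstract because \<beta> and \<gamma>
  exchange roles with the parity of i.\<close>

locale three_sectors =
  fixes p :: "real^2" and r :: real and u :: "real^2 \<Rightarrow> real^2" and \<alpha> b g :: "real^2"
  assumes r: "0 < r" and u1: "u \<in> L1_maps (ball p r)"
    and above: "\<And>x. x \<in> ball p r \<Longrightarrow> (x - p) \<bullet> nn > 0 \<Longrightarrow> u x = \<alpha>"
    and right: "\<And>x. x \<in> ball p r \<Longrightarrow> (x - p) \<bullet> nn < 0 \<Longrightarrow> (x - p)$1 > 0 \<Longrightarrow> u x = b"
    and left: "\<And>x. x \<in> ball p r \<Longrightarrow> (x - p) \<bullet> nn < 0 \<Longrightarrow> (x - p)$1 < 0 \<Longrightarrow> u x = g"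
begin

text \<open>Each ray is isolated in its own open region, the jump estimate is applied there, and
  superadditivity collects the three contributions.\<close>

lemma total_var_ge_rays:
  assumes G: "open G" "G \<subseteq> ball p r"
  shows "ennreal (norm (b - \<alpha>)) * emeasure lborel {s. 0 < s \<and> p + s *\<^sub>R ee \<in> G}
    + ennreal (norm (g - \<alpha>)) * emeasure lborel {s. s < 0 \<and> p + s *\<^sub>R ee \<in> G}
    + ennreal (norm (b - g)) * emeasure lborel {s. s < 0 \<and> p + s *\<^sub>R axis 2 1 \<in> G} \<le> total_var u G"
proof -
  \<comment> \<open>Disjoint open sectors around the three rays, cut out by linear inequalities.
    Each contains its ray and stays away from the other two, so u has a single straight jump in
    it.\<close>
  define G1 where "G1 = G \<inter> {x. 0 < (x - p)$1 \<and> - (x - p)$1 < (x - p)$2}"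
  define G2 where "G2 = G \<inter> {x. (x - p)$1 < 0 \<and> 2 * (x - p)$1 < (x - p)$2}"
  define G3 where "G3 = G \<inter> {x. (x - p)$2 < - (x - p)$1 \<and> (x - p)$2 < 2 * (x - p)$1}"
  have o: "open G1" "open G2" "open G3" unfolding G1_def G2_def G3_def
    by (intro open_Int G open_Collect_conj open_Collect_less continuous_intros)+
  have sub: "G1 \<subseteq> ball p r" "G2 \<subseteq> ball p r" "G3 \<subseteq> ball p r" using G by (auto simp: G1_def G2_def G3_def)
  have below1: "(x - p)$1 > 0" if "x \<in> G1" for x using that by (simp add: G1_def)
  have below3: "(x - p) \<bullet> nn < 0" if "x \<in> G3" for x
  proof -
    define y where "y = x - p"
    have y: "y$2 < - y$1" "y$2 < 2 * y$1" using that by (auto simp: G3_def y_def)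
    have "cc * y$2 < y$1 / 2"
    proof (cases "y$1 \<ge> 0")
      case True
      then have "y$2 < 0" using y by linarith
      then have "cc * y$2 < 0" using cc_pos by (simp add: mult_pos_neg)
      then show ?thesis using True by linarith
    next
      case False
      have "cc * y$2 < cc * (2 * y$1)" using y cc_pos by (intro mult_strict_left_mono) auto
      also have "\<dots> \<le> 0.866 * (2 * y$1)" using False cc_bounds by (intro mult_right_mono_neg) auto
      also have "\<dots> \<le> y$1 / 2" using False by simp
      finally show ?thesis .
    qed
    then show ?thesis by (simp add: inner_nn y_def[symmetric])
  qed
  have 1: "ennreal (norm (\<alpha> - b)) * emeasure lborel {s. p + s *\<^sub>R ee \<in> G1} \<le> total_var u G1"
    by (rule tilted.total_var_ge_jump[OF u1 o(1) sub(1)]) (use sub above right below1 in auto)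
  have 2: "ennreal (norm (\<alpha> - g)) * emeasure lborel {s. p + s *\<^sub>R ee \<in> G2} \<le> total_var u G2"
    by (rule tilted.total_var_ge_jump[OF u1 o(2) sub(2)]) (use sub above left in \<open>auto simp: G2_def\<close>)
  have 3: "ennreal (norm (b - g)) * emeasure lborel {s. p + s *\<^sub>R axis 2 1 \<in> G3} \<le> total_var u G3"
    by (rule axes'.total_var_ge_jump[OF u1 o(3) sub(3)]) (use sub right left below3 in \<open>auto simp: inner_real2\<close>)
  have S1: "{s. 0 < s \<and> p + s *\<^sub>R ee \<in> G} = {s. p + s *\<^sub>R ee \<in> G1}"
  proof -
    have "- (s * cc) < s / 2 \<longleftrightarrow> 0 < s * (cc + 1/2)" for s by (auto simp: algebra_simps)
    then show ?thesis using cc_pos by (auto simp: G1_def zero_less_mult_iff)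
  qed
  have S2: "{s. s < 0 \<and> p + s *\<^sub>R ee \<in> G} = {s. p + s *\<^sub>R ee \<in> G2}"
  proof -
    have "2 * (s * cc) < s / 2 \<longleftrightarrow> s * (2 * cc - 1/2) < 0" for s by (auto simp: algebra_simps)
    then show ?thesis using cc_bounds by (auto simp: G2_def mult_less_0_iff)
  qed
  have S3: "{s. s < 0 \<and> p + s *\<^sub>R axis 2 1 \<in> G} = {s. p + s *\<^sub>R axis 2 1 \<in> G3}"
    by (auto simp: G3_def)
  have d: "G1 \<inter> G2 = {}" "(G1 \<union> G2) \<inter> G3 = {}" by (auto simp: G1_def G2_def G3_def)
  have "total_var u G1 + total_var u G2 + total_var u G3 \<le> total_var u (G1 \<union> G2) + total_var u G3"
    by (intro add_right_mono total_var_superadditive[OF u1 _ _ d(1)] sub)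
  also have "\<dots> \<le> total_var u (G1 \<union> G2 \<union> G3)"
    using sub by (intro total_var_superadditive[OF u1 _ _ d(2)]) auto
  also have "\<dots> \<le> total_var u G" by (intro total_var_mono) (auto simp: G1_def G2_def G3_def)
  finally show ?thesis using 1 2 3 unfolding S1 S2 S3
    by (simp add: norm_minus_commute) (meson add_mono order_trans)
qed

text \<open>If G misses at most the lengths d1, d2, d3 of the three rays, then u has at most the
  correspondingly weighted variation outside G. The hypothesis \<open>V\<close> says that the ball
  carries nothing besides its three rays.\<close>

lemma total_var_ball_le:
  assumes V: "total_var u (ball p r) \<le> ennreal (r * (norm (b - \<alpha>) + norm (g - \<alpha>) + norm (b - g)))"
    and G: "open G" "G \<subseteq> ball p r"
    and X: "{0<..<r} \<subseteq> {s. p + s *\<^sub>R ee \<in> G} \<union> XA" "{-r<..<0} \<subseteq> {s. p + s *\<^sub>R ee \<in> G} \<union> XB"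
      "{-r<..<0} \<subseteq> {s. p + s *\<^sub>R axis 2 1 \<in> G} \<union> XC" "XA \<in> sets borel" "XB \<in> sets borel" "XC \<in> sets borel"
      "emeasure lborel XA \<le> ennreal d1" "emeasure lborel XB \<le> ennreal d2" "emeasure lborel XC \<le> ennreal d3"
      "0 \<le> d1" "0 \<le> d2" "0 \<le> d3"
  shows "total_var u (ball p r) \<le> total_var u G + ennreal (norm (b - \<alpha>) * d1 + norm (g - \<alpha>) * d2 + norm (b - g) * d3)"
proof -
  have o: "open {s. p + s *\<^sub>R a \<in> G}" for a
    using open_vimage[OF G(1), of "\<lambda>s. p + s *\<^sub>R a"] by (simp add: vimage_def continuous_intros)
  have os: "open {s. 0 < s \<and> p + s *\<^sub>R a \<in> G}" "open {s. s < 0 \<and> p + s *\<^sub>R a \<in> G}" for a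
    by (intro open_Collect_conj o open_Collect_less continuous_intros)+
  have "total_var u (ball p r) \<le> ennreal (norm (b - \<alpha>) * (r - 0)) + ennreal (norm (g - \<alpha>) * (0 - (-r))) + ennreal (norm (b - g) * (0 - (-r)))"
    using V r by (simp add: ennreal_plus[symmetric] algebra_simps del: ennreal_plus)
  also have "\<dots> \<le> (ennreal (norm (b - \<alpha>)) * emeasure lborel {s. 0 < s \<and> p + s *\<^sub>R ee \<in> G} + ennreal (norm (b - \<alpha>)) * ennreal d1)
     + (ennreal (norm (g - \<alpha>)) * emeasure lborel {s. s < 0 \<and> p + s *\<^sub>R ee \<in> G} + ennreal (norm (g - \<alpha>)) * ennreal d2)
     + (ennreal (norm (b - g)) * emeasure lborel {s. s < 0 \<and> p + s *\<^sub>R axis 2 1 \<in> G} + ennreal (norm (b - g)) * ennreal d3)"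
  proof (intro add_mono)
    show "ennreal (norm (b - \<alpha>) * (r - 0)) \<le> ennreal (norm (b - \<alpha>)) * emeasure lborel {s. 0 < s \<and> p + s *\<^sub>R ee \<in> G} + ennreal (norm (b - \<alpha>)) * ennreal d1"
      by (rule emeasure_add_le_of_subset[where X=XA]) (use X r os[of ee] in auto)
    show "ennreal (norm (g - \<alpha>) * (0 - (-r))) \<le> ennreal (norm (g - \<alpha>)) * emeasure lborel {s. s < 0 \<and> p + s *\<^sub>R ee \<in> G} + ennreal (norm (g - \<alpha>)) * ennreal d2"
      by (rule emeasure_add_le_of_subset[where X=XB]) (use X r os[of ee] in auto)
    show "ennreal (norm (b - g) * (0 - (-r))) \<le> ennreal (norm (b - g)) * emeasure lborel {s. s < 0 \<and> p + s *\<^sub>R axis 2 1 \<in> G} + ennreal (norm (b - g)) * ennreal d3"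
      by (rule emeasure_add_le_of_subset[where X=XC]) (use X r os[of "axis 2 1"] in auto)
  qed
  also have "\<dots> = (ennreal (norm (b - \<alpha>)) * emeasure lborel {s. 0 < s \<and> p + s *\<^sub>R ee \<in> G}
     + ennreal (norm (g - \<alpha>)) * emeasure lborel {s. s < 0 \<and> p + s *\<^sub>R ee \<in> G}
     + ennreal (norm (b - g)) * emeasure lborel {s. s < 0 \<and> p + s *\<^sub>R axis 2 1 \<in> G})
     + ennreal (norm (b - \<alpha>) * d1 + norm (g - \<alpha>) * d2 + norm (b - g) * d3)"
    using X by (simp add: ennreal_mult ac_simps)
  also have "\<dots> \<le> total_var u G + ennreal (norm (b - \<alpha>) * d1 + norm (g - \<alpha>) * d2 + norm (b - g) * d3)"
    by (intro add_right_mono total_var_ge_rays G)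
  finally show ?thesis .
qed

text \<open>The regions where approximants must be controlled, each with its budget of variation:
  three regions inside the sectors with budget 0, and three strips of width \<rho>/10 that cross
  exactly one ray each. In the last two, the extra bound by -\<rho> keeps the strip off a second ray
  which its band would otherwise meet. Being a finite list, it admits one index from which all
  bounds hold.\<close>

definition crossing_rects :: "((real^2) set \<times> real) list" where
  "crossing_rects = (let \<rho> = r/4 in
    [(ball p r \<inter> {x. \<rho>/8 < (x - p) \<bullet> nn}, 0),
     (ball p r \<inter> {x. (x - p) \<bullet> nn < - \<rho>/8 \<and> \<rho>/8 < (x - p)$1}, 0),
     (ball p r \<inter> {x. (x - p) \<bullet> nn < - \<rho>/8 \<and> (x - p)$1 < - \<rho>/8}, 0),
     (ball p r \<inter> {x. \<rho> < (x - p) \<bullet> ee \<and> (x - p) \<bullet> ee < 1.1 * \<rho>}, norm (b - \<alpha>) * (\<rho>/10)),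
     (ball p r \<inter> {x. -1.1 * \<rho> < (x - p) \<bullet> ee \<and> (x - p) \<bullet> ee < -\<rho> \<and> -\<rho> < (x - p) \<bullet> nn}, norm (g - \<alpha>) * (\<rho>/10)),
     (ball p r \<inter> {x. -1.1 * \<rho> < (x - p)$2 \<and> (x - p)$2 < -\<rho> \<and> -\<rho> < (x - p)$1}, norm (b - g) * (\<rho>/10))])"

text \<open>B is given by the opposite strict inequalities. It misses from the rays at most the
  closed segment of length \<rho>/10 inside the strip, which is exactly what the budget pays
  for.\<close>

lemma crossing_rects_bound:
  assumes V: "total_var u (ball p r) \<le> ennreal (r * (norm (b - \<alpha>) + norm (g - \<alpha>) + norm (b - g)))"
    and A: "(A, c) \<in> set crossing_rects"
  shows "\<exists>B. A \<subseteq> ball p r \<and> B \<subseteq> ball p r \<and> A \<inter> B = {} \<and> total_var u (ball p r) \<le> total_var u B + ennreal c \<and> 0 \<le> c"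
proof -
  define \<rho> where "\<rho> = r/4"
  have \<rho>: "0 < \<rho>" "r = 4 * \<rho>" using r by (auto simp: \<rho>_def)
  have nb: "dist p (p + s *\<^sub>R ee) = \<bar>s\<bar>" "dist p (p + s *\<^sub>R axis 2 1) = \<bar>s\<bar>" for s by (simp_all add: dist_norm)
  have es: "ee \<bullet> ee = 1" "ee \<bullet> nn = 0" "axis 2 1 \<bullet> nn = cc" "axis 2 1 \<bullet> ee = 1/2" by (simp_all add: inner_real2 cc_sq)
  have cs: "s * cc * 8 < \<rho>" if "s < 0" for s
    using mult_neg_pos[OF that cc_pos] \<rho>(1) by linarith
  \<comment> \<open>From distance 2 \<rho> on, a ray has passed below -\<rho> in the coordinate that
    limits the strip. It therefore runs in B where it enters the band of the other ray.\<close>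
  have cs2: "cc * s < - \<rho>" if "s \<le> - 2 * \<rho>" for s
  proof -
    have "cc * s \<le> cc * (- 2 * \<rho>)" using that cc_pos by (intro mult_left_mono) auto
    also have "\<dots> < - \<rho>" using cc_bounds(1) \<rho>(1) mult_strict_right_mono[of "0.866" cc \<rho>] by simp
    finally show ?thesis .
  qed
  have o1: "open (ball p r \<inter> {x. (x - p) \<bullet> nn < \<rho>/8})"
    "open (ball p r \<inter> {x. - \<rho>/8 < (x - p) \<bullet> nn \<or> (x - p)$1 < \<rho>/8})"
    "open (ball p r \<inter> {x. - \<rho>/8 < (x - p) \<bullet> nn \<or> - \<rho>/8 < (x - p)$1})"
    "open (ball p r \<inter> {x. (x - p) \<bullet> ee < \<rho> \<or> 1.1 * \<rho> < (x - p) \<bullet> ee})"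
    "open (ball p r \<inter> {x. (x - p) \<bullet> ee < - 1.1 * \<rho> \<or> - \<rho> < (x - p) \<bullet> ee \<or> (x - p) \<bullet> nn < - \<rho>})"
    "open (ball p r \<inter> {x. (x - p)$2 < - 1.1 * \<rho> \<or> - \<rho> < (x - p)$2 \<or> (x - p)$1 < - \<rho>})"
    by (intro open_Int open_ball open_Collect_disj open_Collect_less continuous_intros)+
  note le = total_var_ball_le[OF V]
  consider "A = ball p r \<inter> {x. \<rho>/8 < (x - p) \<bullet> nn}" "c = 0"
    | "A = ball p r \<inter> {x. (x - p) \<bullet> nn < - \<rho>/8 \<and> \<rho>/8 < (x - p)$1}" "c = 0"
    | "A = ball p r \<inter> {x. (x - p) \<bullet> nn < - \<rho>/8 \<and> (x - p)$1 < - \<rho>/8}" "c = 0"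
    | "A = ball p r \<inter> {x. \<rho> < (x - p) \<bullet> ee \<and> (x - p) \<bullet> ee < 1.1 * \<rho>}" "c = norm (b - \<alpha>) * (\<rho>/10)"
    | "A = ball p r \<inter> {x. -1.1 * \<rho> < (x - p) \<bullet> ee \<and> (x - p) \<bullet> ee < -\<rho> \<and> -\<rho> < (x - p) \<bullet> nn}" "c = norm (g - \<alpha>) * (\<rho>/10)"
    | "A = ball p r \<inter> {x. -1.1 * \<rho> < (x - p)$2 \<and> (x - p)$2 < -\<rho> \<and> -\<rho> < (x - p)$1}" "c = norm (b - g) * (\<rho>/10)"
    using A unfolding crossing_rects_def Let_def \<rho>_def[symmetric] by auto
  then show ?thesis
  proof cases
    case 1
    have "total_var u (ball p r) \<le> total_var u (ball p r \<inter> {x. (x - p) \<bullet> nn < \<rho>/8}) + ennreal (norm (b - \<alpha>) * 0 + norm (g - \<alpha>) * 0 + norm (b - g) * 0)"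
      by (rule le[where XA="{}" and XB="{}" and XC="{}", OF o1(1)]) (use \<rho> in \<open>auto simp: nb es intro: cs\<close>)
    then show ?thesis using 1 by (intro exI[of _ "ball p r \<inter> {x. (x - p) \<bullet> nn < \<rho>/8}"]) auto
  next
    case 2
    have "total_var u (ball p r) \<le> total_var u (ball p r \<inter> {x. - \<rho>/8 < (x - p) \<bullet> nn \<or> (x - p)$1 < \<rho>/8}) + ennreal (norm (b - \<alpha>) * 0 + norm (g - \<alpha>) * 0 + norm (b - g) * 0)"
      by (rule le[where XA="{}" and XB="{}" and XC="{}", OF o1(2)]) (use \<rho> in \<open>auto simp: nb es\<close>)
    then show ?thesis using 2 by (intro exI[of _ "ball p r \<inter> {x. - \<rho>/8 < (x - p) \<bullet> nn \<or> (x - p)$1 < \<rho>/8}"]) auto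
  next
    case 3
    have "total_var u (ball p r) \<le> total_var u (ball p r \<inter> {x. - \<rho>/8 < (x - p) \<bullet> nn \<or> - \<rho>/8 < (x - p)$1}) + ennreal (norm (b - \<alpha>) * 0 + norm (g - \<alpha>) * 0 + norm (b - g) * 0)"
      by (rule le[where XA="{}" and XB="{}" and XC="{}", OF o1(3)]) (use \<rho> in \<open>auto simp: nb es\<close>)
    then show ?thesis using 3 by (intro exI[of _ "ball p r \<inter> {x. - \<rho>/8 < (x - p) \<bullet> nn \<or> - \<rho>/8 < (x - p)$1}"]) auto
  next
    case 4
    have "total_var u (ball p r) \<le> total_var u (ball p r \<inter> {x. (x - p) \<bullet> ee < \<rho> \<or> 1.1 * \<rho> < (x - p) \<bullet> ee}) + ennreal (norm (b - \<alpha>) * (\<rho>/10) + norm (g - \<alpha>) * 0 + norm (b - g) * 0)"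
      by (rule le[where XA="{\<rho>..1.1 * \<rho>}" and XB="{}" and XC="{}", OF o1(4)]) (use \<rho> in \<open>auto simp: nb es\<close>)
    then show ?thesis unfolding 4 using \<rho>(1) by (intro exI[of _ "ball p r \<inter> {x. (x - p) \<bullet> ee < \<rho> \<or> 1.1 * \<rho> < (x - p) \<bullet> ee}"]) auto
  next
    case 5
    have "total_var u (ball p r) \<le> total_var u (ball p r \<inter> {x. (x - p) \<bullet> ee < - 1.1 * \<rho> \<or> - \<rho> < (x - p) \<bullet> ee \<or> (x - p) \<bullet> nn < - \<rho>}) + ennreal (norm (b - \<alpha>) * 0 + norm (g - \<alpha>) * (\<rho>/10) + norm (b - g) * 0)"
    proof (rule le[where XA="{}" and XB="{-1.1 * \<rho>..-\<rho>}" and XC="{}", OF o1(5)])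
      show "{- r<..<0} \<subseteq> {s. p + s *\<^sub>R axis 2 1 \<in> ball p r \<inter> {x. (x - p) \<bullet> ee < - 1.1 * \<rho> \<or> - \<rho> < (x - p) \<bullet> ee \<or> (x - p) \<bullet> nn < - \<rho>}} \<union> {}"
      proof
        fix s assume "s \<in> {- r<..<0}"
        then show "s \<in> {s. p + s *\<^sub>R axis 2 1 \<in> ball p r \<inter> {x. (x - p) \<bullet> ee < - 1.1 * \<rho> \<or> - \<rho> < (x - p) \<bullet> ee \<or> (x - p) \<bullet> nn < - \<rho>}} \<union> {}"
          using cs2[of s] \<rho> by (cases "s \<le> - 2 * \<rho>") (auto simp: nb es mult.commute)
      qed
    qed (use \<rho> in \<open>auto simp: nb es\<close>)
    then show ?thesis unfolding 5 using \<rho>(1) by (intro exI[of _ "ball p r \<inter> {x. (x - p) \<bullet> ee < - 1.1 * \<rho> \<or> - \<rho> < (x - p) \<bullet> ee \<or> (x - p) \<bullet> nn < - \<rho>}"]) auto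
  next
    case 6
    have "total_var u (ball p r) \<le> total_var u (ball p r \<inter> {x. (x - p)$2 < - 1.1 * \<rho> \<or> - \<rho> < (x - p)$2 \<or> (x - p)$1 < - \<rho>}) + ennreal (norm (b - \<alpha>) * 0 + norm (g - \<alpha>) * 0 + norm (b - g) * (\<rho>/10))"
    proof (rule le[where XA="{}" and XB="{}" and XC="{-1.1 * \<rho>..-\<rho>}", OF o1(6)])
      show "{- r<..<0} \<subseteq> {s. p + s *\<^sub>R ee \<in> ball p r \<inter> {x. (x - p)$2 < - 1.1 * \<rho> \<or> - \<rho> < (x - p)$2 \<or> (x - p)$1 < - \<rho>}} \<union> {}"
      proof
        fix s assume "s \<in> {- r<..<0}"
        then show "s \<in> {s. p + s *\<^sub>R ee \<in> ball p r \<inter> {x. (x - p)$2 < - 1.1 * \<rho> \<or> - \<rho> < (x - p)$2 \<or> (x - p)$1 < - \<rho>}} \<union> {}"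
          using cs2[of s] \<rho> by (cases "s \<le> - 2 * \<rho>") (auto simp: nb mult.commute)
      qed
    qed (use \<rho> in \<open>auto simp: nb es\<close>)
    then show ?thesis unfolding 6 using \<rho>(1) by (intro exI[of _ "ball p r \<inter> {x. (x - p)$2 < - 1.1 * \<rho> \<or> - \<rho> < (x - p)$2 \<or> (x - p)$1 < - \<rho>}"]) auto
  qed
qed

end

section \<open>The loop around a triple point\<close>

lemma nn_integral_L1_conv:
  assumes L: "L1_conv \<Omega> w u" and "0 < \<epsilon>"
  shows "eventually (\<lambda>k. (\<integral>\<^sup>+x. ennreal (norm (w k x - u x)) * indicator \<Omega> x \<partial>lborel) \<le> ennreal \<epsilon>) sequentially"
proof -
  have "(\<lambda>k. LINT x:\<Omega>|lebesgue. norm (w k x - u x)) \<longlonglongrightarrow> 0" using L by (simp add: L1_conv_def)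
  then have "eventually (\<lambda>k. (LINT x:\<Omega>|lebesgue. norm (w k x - u x)) < \<epsilon>) sequentially"
    using \<open>0 < \<epsilon>\<close> by (rule order_tendstoD)
  then show ?thesis
  proof eventually_elim
    case (elim k)
    have "set_integrable lebesgue \<Omega> (w k)" "set_integrable lebesgue \<Omega> u" using L by (auto simp: L1_conv_def L1_maps_def)
    from set_integrable_norm[OF set_integral_diff(1)[OF this]]
    have i: "integrable lebesgue (\<lambda>x. indicator \<Omega> x *\<^sub>R norm (w k x - u x))" by (simp add: set_integrable_def)
    have "(\<integral>\<^sup>+x. ennreal (norm (w k x - u x)) * indicator \<Omega> x \<partial>lborel)
      = (\<integral>\<^sup>+x. ennreal (indicator \<Omega> x *\<^sub>R norm (w k x - u x)) \<partial>lebesgue)"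
      unfolding nn_integral_completion by (intro nn_integral_cong) (auto simp: indicator_def)
    also have "\<dots> = ennreal (LINT x:\<Omega>|lebesgue. norm (w k x - u x))"
      unfolding set_lebesgue_integral_def by (rule nn_integral_eq_integral[OF i]) simp
    also have "\<dots> \<le> ennreal \<epsilon>" using elim by (intro ennreal_leI) auto
    finally show ?case .
  qed
qed

text \<open>The parameter is the excess over the distance of the foci, so that the value 0 gives the
  segment between them.\<close>

definition ellipse :: "real^2 \<Rightarrow> real^2 \<Rightarrow> real \<Rightarrow> (real^2) set" where
  "ellipse a b \<kappa> = {z. dist a z + dist b z \<le> norm (b - a) + \<kappa>}"

lemma foci_in_ellipse: "0 \<le> \<kappa> \<Longrightarrow> a \<in> ellipse a b \<kappa>" "0 \<le> \<kappa> \<Longrightarrow> b \<in> ellipse a b \<kappa>"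
  by (auto simp: ellipse_def dist_norm norm_minus_commute)

lemma convex_ellipse': "convex (ellipse a b \<kappa>)"
  unfolding ellipse_def by (rule convex_ellipse)

lemma ellipse_mono: "\<kappa> \<le> \<kappa>' \<Longrightarrow> ellipse a b \<kappa> \<subseteq> ellipse a b \<kappa>'"
  by (auto simp: ellipse_def)

context three_sectors
begin

text \<open>Four slices form a loop around p: one across each ray, and one inside the sector of
  \<alpha> that closes it. Each crossing slice is confined to the ellipse of the two values that it
  joins, and the closing one stays near \<alpha>.\<close>

lemma triangle_covered:
  assumes c: "C1_on (ball p r) w"
    and V: "\<And>A c. (A, c) \<in> set crossing_rects \<Longrightarrow> total_var w A \<le> ennreal (c + \<epsilon>)"
    and I: "(\<integral>\<^sup>+x. ennreal (norm (w x - u x)) * indicator (ball p r) x \<partial>lborel) \<le> ennreal \<epsilon>"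
    and \<kappa>: "0 < \<kappa>" and K: "0 < K" "(M + \<kappa>) / K \<le> \<kappa> / 2" "(M + \<kappa>) / K < \<kappa> / 2 * (r / 8)"
    and M: "norm (b - \<alpha>) \<le> M" "norm (g - \<alpha>) \<le> M" "norm (b - g) \<le> M"
    and \<epsilon>: "0 \<le> \<epsilon>" "(1 + 4 * K) * \<epsilon> < \<kappa> * (r / 40)"
    and y: "y \<in> interior (convex hull {\<alpha>, b, g})"
      "y \<notin> ellipse \<alpha> b (4 * \<kappa>)" "y \<notin> ellipse b g (4 * \<kappa>)" "y \<notin> ellipse g \<alpha> (4 * \<kappa>)"
  shows "y \<in> w ` ball p r"
proof -
  define \<rho> where "\<rho> = r/4"
  have \<rho>: "0 < \<rho>" "r = 4 * \<rho>" using r by (auto simp: \<rho>_def)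
  have sq: "(1.1 * \<rho>)\<^sup>2 + (2 * \<rho>)\<^sup>2 \<le> r\<^sup>2" using \<rho> by (simp add: power2_eq_square)
  have sq1: "x\<^sup>2 \<le> (c * \<rho>)\<^sup>2" if "\<bar>x\<bar> \<le> c * \<rho>" for x c using that \<rho> by (simp add: abs_le_square_iff[symmetric])
  have M0: "0 \<le> M" using M(1) norm_ge_zero order_trans by blast
  have Kj1: "(J + \<kappa>) / K \<le> \<kappa> / 2" if "J \<le> M" for J
  proof -
    have "(J + \<kappa>) / K \<le> (M + \<kappa>) / K" using that K by (intro divide_right_mono) auto
    then show ?thesis using K by linarith
  qed
  have Kj: "(J + \<kappa>) / K < \<kappa> / 2 * l" if "J \<le> M" "\<rho> / 2 \<le> l" for J l
  proof -
    have "(J + \<kappa>) / K \<le> (M + \<kappa>) / K" using that K by (intro divide_right_mono) auto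
    moreover have "\<kappa> / 2 * (r / 8) \<le> \<kappa> / 2 * l" using that \<kappa> \<rho> by (intro mult_left_mono) auto
    ultimately show ?thesis using K by linarith
  qed
  have IX: "(\<integral>\<^sup>+x. ennreal (norm (w x - v)) * indicator X x \<partial>lborel) \<le> ennreal \<epsilon>"
    if "X \<subseteq> ball p r" "\<And>x. x \<in> X \<Longrightarrow> u x = v" for X v
    by (rule order_trans[OF nn_integral_mono I]) (use that in \<open>auto simp: indicator_def\<close>)
  define A1 A2 A3 A4 A5 A6 where A: "A1 = ball p r \<inter> {x. \<rho>/8 < (x - p) \<bullet> nn}"
     "A2 = ball p r \<inter> {x. (x - p) \<bullet> nn < - \<rho>/8 \<and> \<rho>/8 < (x - p)$1}"
     "A3 = ball p r \<inter> {x. (x - p) \<bullet> nn < - \<rho>/8 \<and> (x - p)$1 < - \<rho>/8}"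
     "A4 = ball p r \<inter> {x. \<rho> < (x - p) \<bullet> ee \<and> (x - p) \<bullet> ee < 1.1 * \<rho>}"
     "A5 = ball p r \<inter> {x. -1.1 * \<rho> < (x - p) \<bullet> ee \<and> (x - p) \<bullet> ee < -\<rho> \<and> -\<rho> < (x - p) \<bullet> nn}"
     "A6 = ball p r \<inter> {x. -1.1 * \<rho> < (x - p)$2 \<and> (x - p)$2 < -\<rho> \<and> -\<rho> < (x - p)$1}"
  have VA: "total_var w A1 \<le> ennreal \<epsilon>" "total_var w A2 \<le> ennreal \<epsilon>" "total_var w A3 \<le> ennreal \<epsilon>"
    "total_var w A4 \<le> ennreal (norm (b - \<alpha>) * (\<rho>/10) + \<epsilon>)" "total_var w A5 \<le> ennreal (norm (g - \<alpha>) * (\<rho>/10) + \<epsilon>)"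
    "total_var w A6 \<le> ennreal (norm (b - g) * (\<rho>/10) + \<epsilon>)"
    using V[of A1 0] V[of A2 0] V[of A3 0] V[of A4 "norm (b - \<alpha>) * (\<rho>/10)"] V[of A5 "norm (g - \<alpha>) * (\<rho>/10)"] V[of A6 "norm (b - g) * (\<rho>/10)"]
    unfolding crossing_rects_def Let_def \<rho>_def[symmetric] A by simp_all
  note VX = order_trans[OF total_var_mono]
  have uA: "\<And>x. x \<in> A1 \<Longrightarrow> u x = \<alpha>" "\<And>x. x \<in> A2 \<Longrightarrow> u x = b" "\<And>x. x \<in> A3 \<Longrightarrow> u x = g"
    using above right left \<rho>(1) by (auto simp: A)
  have sA: "A1 \<subseteq> ball p r" "A2 \<subseteq> ball p r" "A3 \<subseteq> ball p r" by (auto simp: A)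
  have IA: "X \<subseteq> A1 \<Longrightarrow> (\<integral>\<^sup>+x. ennreal (norm (w x - \<alpha>)) * indicator X x \<partial>lborel) \<le> ennreal \<epsilon>"
    "X \<subseteq> A2 \<Longrightarrow> (\<integral>\<^sup>+x. ennreal (norm (w x - b)) * indicator X x \<partial>lborel) \<le> ennreal \<epsilon>"
    "X \<subseteq> A3 \<Longrightarrow> (\<integral>\<^sup>+x. ennreal (norm (w x - g)) * indicator X x \<partial>lborel) \<le> ennreal \<epsilon>" for X
    using uA sA by (auto intro!: IX)
  have ex: "(x - p)$1 = cc * ((x - p) \<bullet> ee) - ((x - p) \<bullet> nn) / 2" for x
    using arg_cong[OF tilted.frame_expand[of "x - p"], of "\<lambda>y::real^2. y$1"] by (simp add: mult.commute)
  \<comment> \<open>The number 433/500 is the lower bound 0.866 for \<open>cc\<close>; with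
    \<open>gen\<close> it places the lower strips inside their sectors.\<close>
  have cclo: "cc * s < - (433/500) * \<rho>" if "s < - \<rho>" for s
  proof -
    have "cc * s < cc * (- \<rho>)" using that cc_pos by (intro mult_strict_left_mono) auto
    also have "\<dots> < - (433/500) * \<rho>" using cc_bounds(1) \<rho>(1) mult_strict_right_mono[of "0.866" cc \<rho>] by simp
    finally show ?thesis .
  qed
  have gen: "cc * a - b / 2 < - \<rho> / 8" if "cc * a < - (433/500) * \<rho>" "- \<rho> < b" for a b :: real
    using that \<rho>(1) by linarith
  have \<epsilon>': "(1 + 4 * K) * \<epsilon> < \<kappa> * (1.1 * \<rho> - \<rho>)" "(1 + 4 * K) * \<epsilon> < \<kappa> * (- \<rho> - (-1.1 * \<rho>))"
    using \<epsilon>(2) \<rho> by (simp_all add: algebra_simps)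
  have hh: "J * (1.1 * \<rho> - \<rho>) = J * (\<rho>/10)" "J * (- \<rho> - (-1.1 * \<rho>)) = J * (\<rho>/10)" for J
    by (simp_all add: algebra_simps)
  have R1: "tilted.rect p \<rho> (1.1 * \<rho>) (-2 * \<rho>) (2 * \<rho>) \<subseteq> ball p r"
    by (rule tilted.rect_subset_ball[OF _ _ _ _ sq]) (use \<rho> in \<open>auto intro!: sq1\<close>)
  obtain s1 where s1: "\<rho> < s1" "s1 < 1.1 * \<rho>"
    "\<And>t. -2 * \<rho> < t \<Longrightarrow> t < -\<rho>/4 \<Longrightarrow> norm (w (p + s1 *\<^sub>R ee + t *\<^sub>R nn) - b) \<le> \<kappa>"
    "\<And>t. \<rho>/4 < t \<Longrightarrow> t < 2 * \<rho> \<Longrightarrow> norm (w (p + s1 *\<^sub>R ee + t *\<^sub>R nn) - \<alpha>) \<le> \<kappa>"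
    "\<And>x t y. -2 * \<rho> < x \<Longrightarrow> x \<le> t \<Longrightarrow> t \<le> y \<Longrightarrow> y < 2 * \<rho> \<Longrightarrow>
        norm (w (p + s1 *\<^sub>R ee + t *\<^sub>R nn) - w (p + s1 *\<^sub>R ee + x *\<^sub>R nn)) + norm (w (p + s1 *\<^sub>R ee + y *\<^sub>R nn) - w (p + s1 *\<^sub>R ee + t *\<^sub>R nn)) \<le> norm (b - \<alpha>) + \<kappa>"
  proof -
    have x1: "tilted.rect p \<rho> (1.1 * \<rho>) (-2 * \<rho>) (-\<rho>/4) \<subseteq> A2"
    proof
      fix x assume x: "x \<in> tilted.rect p \<rho> (1.1 * \<rho>) (-2 * \<rho>) (-\<rho>/4)"
      then have "x \<in> ball p r" using R1 \<rho> by (auto simp: tilted.rect_def)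
      moreover have "0 < cc * ((x - p) \<bullet> ee)" using x \<rho> cc_pos by (intro mult_pos_pos) (auto simp: tilted.rect_def)
      ultimately show "x \<in> A2" using x \<rho> ex[of x] by (auto simp: A tilted.rect_def)
    qed
    have x2: "tilted.rect p \<rho> (1.1 * \<rho>) (\<rho>/4) (2 * \<rho>) \<subseteq> A1" using R1 \<rho> by (auto simp: tilted.rect_def A)
    have x3: "tilted.rect p \<rho> (1.1 * \<rho>) (-2 * \<rho>) (2 * \<rho>) \<subseteq> A4" using R1 \<rho> by (auto simp: tilted.rect_def A)
    have v: "total_var w (tilted.rect p (\<rho>) (1.1 * \<rho>) (-2 * \<rho>) (2 * \<rho>)) \<le> ennreal (norm (b - \<alpha>) * (1.1 * \<rho> - (\<rho>)) + \<epsilon>)"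
      unfolding hh by (rule VX[OF x3 VA(4)])
    have k: "(norm (b - \<alpha>) + \<kappa>) / K < \<kappa> / 2 * (-\<rho>/4 - (-2 * \<rho>))" "(norm (b - \<alpha>) + \<kappa>) / K < \<kappa> / 2 * (2 * \<rho> - (\<rho>/4))"
      by (rule Kj; use M M0 \<rho> in simp)+
    have "\<exists>s. \<rho> < s \<and> s < 1.1 * \<rho> \<and> (\<forall>t. -2 * \<rho> < t \<and> t < -\<rho>/4 \<longrightarrow> norm (w (p + s *\<^sub>R ee + t *\<^sub>R nn) - b) \<le> \<kappa>) \<and>
     (\<forall>t. \<rho>/4 < t \<and> t < 2 * \<rho> \<longrightarrow> norm (w (p + s *\<^sub>R ee + t *\<^sub>R nn) - \<alpha>) \<le> \<kappa>) \<and>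
     (\<forall>x t y. -2 * \<rho> < x \<and> x \<le> t \<and> t \<le> y \<and> y < 2 * \<rho> \<longrightarrow>
        norm (w (p + s *\<^sub>R ee + t *\<^sub>R nn) - w (p + s *\<^sub>R ee + x *\<^sub>R nn)) + norm (w (p + s *\<^sub>R ee + y *\<^sub>R nn) - w (p + s *\<^sub>R ee + t *\<^sub>R nn)) \<le> norm (b - \<alpha>) + \<kappa>)"
      by (rule tilted.crossing_slice[OF open_ball R1 c _ _ _ _ _ v VX[OF x1 VA(2)] VX[OF x2 VA(1)] IA(2)[OF x1] IA(1)[OF x2] _ \<kappa> \<epsilon>(1) \<epsilon>'(1) K(1) Kj1 k])
        (use \<rho> M M0 in auto)
    then show ?thesis using that by auto
  qed
  have R2: "tilted.rect p (-1.1 * \<rho>) (-\<rho>) (-\<rho>) (2 * \<rho>) \<subseteq> ball p r"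
    by (rule tilted.rect_subset_ball[OF _ _ _ _ sq]) (use \<rho> in \<open>auto intro!: sq1\<close>)
  obtain s2 where s2: "-1.1 * \<rho> < s2" "s2 < - \<rho>"
    "\<And>t. -\<rho> < t \<Longrightarrow> t < -\<rho>/4 \<Longrightarrow> norm (w (p + s2 *\<^sub>R ee + t *\<^sub>R nn) - g) \<le> \<kappa>"
    "\<And>t. \<rho>/4 < t \<Longrightarrow> t < 2 * \<rho> \<Longrightarrow> norm (w (p + s2 *\<^sub>R ee + t *\<^sub>R nn) - \<alpha>) \<le> \<kappa>"
    "\<And>x t y. - \<rho> < x \<Longrightarrow> x \<le> t \<Longrightarrow> t \<le> y \<Longrightarrow> y < 2 * \<rho> \<Longrightarrow>
        norm (w (p + s2 *\<^sub>R ee + t *\<^sub>R nn) - w (p + s2 *\<^sub>R ee + x *\<^sub>R nn)) + norm (w (p + s2 *\<^sub>R ee + y *\<^sub>R nn) - w (p + s2 *\<^sub>R ee + t *\<^sub>R nn)) \<le> norm (g - \<alpha>) + \<kappa>"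
  proof -
    have x1: "tilted.rect p (-1.1 * \<rho>) (-\<rho>) (-\<rho>) (-\<rho>/4) \<subseteq> A3"
    proof
      fix x assume x: "x \<in> tilted.rect p (-1.1 * \<rho>) (-\<rho>) (-\<rho>) (-\<rho>/4)"
      then have "x \<in> ball p r" using R2 \<rho> by (auto simp: tilted.rect_def)
      moreover have "cc * ((x - p) \<bullet> ee) < - (433/500) * \<rho>" using x by (intro cclo) (auto simp: tilted.rect_def)
      ultimately show "x \<in> A3" using x \<rho> ex[of x] by (auto simp: A tilted.rect_def)
    qed
    have x2: "tilted.rect p (-1.1 * \<rho>) (-\<rho>) (\<rho>/4) (2 * \<rho>) \<subseteq> A1" using R2 \<rho> by (auto simp: tilted.rect_def A)
    have x3: "tilted.rect p (-1.1 * \<rho>) (-\<rho>) (-\<rho>) (2 * \<rho>) \<subseteq> A5" using R2 \<rho> by (auto simp: tilted.rect_def A)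
    have v: "total_var w (tilted.rect p (-1.1 * \<rho>) (-\<rho>) (-\<rho>) (2 * \<rho>)) \<le> ennreal (norm (g - \<alpha>) * (-\<rho> - (-1.1 * \<rho>)) + \<epsilon>)"
      unfolding hh by (rule VX[OF x3 VA(5)])
    have k: "(norm (g - \<alpha>) + \<kappa>) / K < \<kappa> / 2 * (-\<rho>/4 - (-\<rho>))" "(norm (g - \<alpha>) + \<kappa>) / K < \<kappa> / 2 * (2 * \<rho> - (\<rho>/4))"
      by (rule Kj; use M M0 \<rho> in simp)+
    have "\<exists>s. -1.1 * \<rho> < s \<and> s < - \<rho> \<and> (\<forall>t. - \<rho> < t \<and> t < -\<rho>/4 \<longrightarrow> norm (w (p + s *\<^sub>R ee + t *\<^sub>R nn) - g) \<le> \<kappa>) \<and>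
     (\<forall>t. \<rho>/4 < t \<and> t < 2 * \<rho> \<longrightarrow> norm (w (p + s *\<^sub>R ee + t *\<^sub>R nn) - \<alpha>) \<le> \<kappa>) \<and>
     (\<forall>x t y. - \<rho> < x \<and> x \<le> t \<and> t \<le> y \<and> y < 2 * \<rho> \<longrightarrow>
        norm (w (p + s *\<^sub>R ee + t *\<^sub>R nn) - w (p + s *\<^sub>R ee + x *\<^sub>R nn)) + norm (w (p + s *\<^sub>R ee + y *\<^sub>R nn) - w (p + s *\<^sub>R ee + t *\<^sub>R nn)) \<le> norm (g - \<alpha>) + \<kappa>)"
      by (rule tilted.crossing_slice[OF open_ball R2 c _ _ _ _ _ v VX[OF x1 VA(3)] VX[OF x2 VA(1)] IA(3)[OF x1] IA(1)[OF x2] _ \<kappa> \<epsilon>(1) \<epsilon>'(2) K(1) Kj1 k])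
        (use \<rho> M M0 in auto)
    then show ?thesis using that by auto
  qed
  have R3: "axes'.rect p (-1.1 * \<rho>) (-\<rho>) (-\<rho>) (2 * \<rho>) \<subseteq> ball p r"
    by (rule axes'.rect_subset_ball[OF _ _ _ _ sq]) (use \<rho> in \<open>auto intro!: sq1\<close>)
  have in3: "(x - p) \<bullet> axis 2 1 = (x - p)$2" "(x - p) \<bullet> axis 1 1 = (x - p)$1" for x by (simp_all add: inner_real2)
  obtain s3 where s3: "-1.1 * \<rho> < s3" "s3 < - \<rho>"
    "\<And>t. -\<rho> < t \<Longrightarrow> t < -\<rho>/4 \<Longrightarrow> norm (w (p + s3 *\<^sub>R axis 2 1 + t *\<^sub>R axis 1 1) - g) \<le> \<kappa>"
    "\<And>t. \<rho>/4 < t \<Longrightarrow> t < 2 * \<rho> \<Longrightarrow> norm (w (p + s3 *\<^sub>R axis 2 1 + t *\<^sub>R axis 1 1) - b) \<le> \<kappa>"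
    "\<And>x t y. - \<rho> < x \<Longrightarrow> x \<le> t \<Longrightarrow> t \<le> y \<Longrightarrow> y < 2 * \<rho> \<Longrightarrow>
        norm (w (p + s3 *\<^sub>R axis 2 1 + t *\<^sub>R axis 1 1) - w (p + s3 *\<^sub>R axis 2 1 + x *\<^sub>R axis 1 1)) + norm (w (p + s3 *\<^sub>R axis 2 1 + y *\<^sub>R axis 1 1) - w (p + s3 *\<^sub>R axis 2 1 + t *\<^sub>R axis 1 1)) \<le> norm (b - g) + \<kappa>"
  proof -
    have x1: "axes'.rect p (-1.1 * \<rho>) (-\<rho>) (-\<rho>) (-\<rho>/4) \<subseteq> A3"
    proof
      fix x assume x: "x \<in> axes'.rect p (-1.1 * \<rho>) (-\<rho>) (-\<rho>) (-\<rho>/4)"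
      then have "x \<in> ball p r" using R3 \<rho> by (auto simp: axes'.rect_def)
      moreover have "cc * (x - p)$2 < - (433/500) * \<rho>" using x by (intro cclo) (auto simp: axes'.rect_def in3)
      moreover have x': "- \<rho> < (x - p)$1" using x \<rho> by (auto simp: axes'.rect_def in3)
      ultimately have "x \<in> ball p r" "(x - p) \<bullet> nn < - \<rho> / 8" unfolding inner_nn by (simp_all only: gen)
      then show "x \<in> A3" using x \<rho> by (auto simp: A axes'.rect_def in3)
    qed
    have x2: "axes'.rect p (-1.1 * \<rho>) (-\<rho>) (\<rho>/4) (2 * \<rho>) \<subseteq> A2"
    proof
      fix x assume x: "x \<in> axes'.rect p (-1.1 * \<rho>) (-\<rho>) (\<rho>/4) (2 * \<rho>)"
      then have "x \<in> ball p r" using R3 \<rho> by (auto simp: axes'.rect_def)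
      moreover have "cc * (x - p)$2 < - (433/500) * \<rho>" using x by (intro cclo) (auto simp: axes'.rect_def in3)
      moreover have x': "- \<rho> < (x - p)$1" using x \<rho> by (auto simp: axes'.rect_def in3)
      ultimately have "x \<in> ball p r" "(x - p) \<bullet> nn < - \<rho> / 8" unfolding inner_nn by (simp_all only: gen)
      then show "x \<in> A2" using x \<rho> by (auto simp: A axes'.rect_def in3)
    qed
    have x3: "axes'.rect p (-1.1 * \<rho>) (-\<rho>) (-\<rho>) (2 * \<rho>) \<subseteq> A6" using R3 \<rho> by (auto simp: axes'.rect_def A in3)
    have v: "total_var w (axes'.rect p (-1.1 * \<rho>) (-\<rho>) (-\<rho>) (2 * \<rho>)) \<le> ennreal (norm (b - g) * (-\<rho> - (-1.1 * \<rho>)) + \<epsilon>)"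
      unfolding hh by (rule VX[OF x3 VA(6)])
    have k: "(norm (b - g) + \<kappa>) / K < \<kappa> / 2 * (-\<rho>/4 - (-\<rho>))" "(norm (b - g) + \<kappa>) / K < \<kappa> / 2 * (2 * \<rho> - (\<rho>/4))"
      by (rule Kj; use M M0 \<rho> in simp)+
    have "\<exists>s. -1.1 * \<rho> < s \<and> s < - \<rho> \<and> (\<forall>t. - \<rho> < t \<and> t < -\<rho>/4 \<longrightarrow> norm (w (p + s *\<^sub>R axis 2 1 + t *\<^sub>R axis 1 1) - g) \<le> \<kappa>) \<and>
     (\<forall>t. \<rho>/4 < t \<and> t < 2 * \<rho> \<longrightarrow> norm (w (p + s *\<^sub>R axis 2 1 + t *\<^sub>R axis 1 1) - b) \<le> \<kappa>) \<and>
     (\<forall>x t y. - \<rho> < x \<and> x \<le> t \<and> t \<le> y \<and> y < 2 * \<rho> \<longrightarrow>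
        norm (w (p + s *\<^sub>R axis 2 1 + t *\<^sub>R axis 1 1) - w (p + s *\<^sub>R axis 2 1 + x *\<^sub>R axis 1 1)) + norm (w (p + s *\<^sub>R axis 2 1 + y *\<^sub>R axis 1 1) - w (p + s *\<^sub>R axis 2 1 + t *\<^sub>R axis 1 1)) \<le> norm (b - g) + \<kappa>)"
      by (rule axes'.crossing_slice[OF open_ball R3 c _ _ _ _ _ v VX[OF x1 VA(3)] VX[OF x2 VA(2)] IA(3)[OF x1] IA(2)[OF x2] _ \<kappa> \<epsilon>(1) \<epsilon>'(2) K(1) Kj1 k])
        (use \<rho> M M0 in auto)
    then show ?thesis using that by auto
  qed
  have R4: "tilted'.rect p \<rho> (1.1 * \<rho>) (-2 * \<rho>) (2 * \<rho>) \<subseteq> ball p r"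
    by (rule tilted'.rect_subset_ball[OF _ _ _ _ sq]) (use \<rho> in \<open>auto intro!: sq1\<close>)
  \<comment> \<open>No ray is crossed here: the frame is swapped, both end values are \<alpha> and J
    = 0. The slice stays near \<alpha> and serves only to close the loop.\<close>
  obtain s4 where s4: "\<rho> < s4" "s4 < 1.1 * \<rho>"
    "\<And>t. -2 * \<rho> < t \<Longrightarrow> t < 0 \<Longrightarrow> norm (w (p + s4 *\<^sub>R nn + t *\<^sub>R ee) - \<alpha>) \<le> \<kappa>"
    "\<And>t. 0 < t \<Longrightarrow> t < 2 * \<rho> \<Longrightarrow> norm (w (p + s4 *\<^sub>R nn + t *\<^sub>R ee) - \<alpha>) \<le> \<kappa>"
    "\<And>x t y. -2 * \<rho> < x \<Longrightarrow> x \<le> t \<Longrightarrow> t \<le> y \<Longrightarrow> y < 2 * \<rho> \<Longrightarrow>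
        norm (w (p + s4 *\<^sub>R nn + t *\<^sub>R ee) - w (p + s4 *\<^sub>R nn + x *\<^sub>R ee)) + norm (w (p + s4 *\<^sub>R nn + y *\<^sub>R ee) - w (p + s4 *\<^sub>R nn + t *\<^sub>R ee)) \<le> 0 + \<kappa>"
  proof -
    have x0: "tilted'.rect p \<rho> (1.1 * \<rho>) t t' \<subseteq> A1" if "-2 * \<rho> \<le> t" "t' \<le> 2 * \<rho>" for t t'
    proof -
      have "tilted'.rect p \<rho> (1.1 * \<rho>) t t' \<subseteq> tilted'.rect p \<rho> (1.1 * \<rho>) (-2 * \<rho>) (2 * \<rho>)"
        using that by (auto simp: tilted'.rect_def)
      then show ?thesis using R4 \<rho> by (auto simp: A tilted'.rect_def)
    qed
    have x1: "tilted'.rect p \<rho> (1.1 * \<rho>) (-2 * \<rho>) 0 \<subseteq> A1" "tilted'.rect p \<rho> (1.1 * \<rho>) 0 (2 * \<rho>) \<subseteq> A1"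
      "tilted'.rect p \<rho> (1.1 * \<rho>) (-2 * \<rho>) (2 * \<rho>) \<subseteq> A1" by (rule x0; use \<rho>(1) in simp)+
    have v: "total_var w (tilted'.rect p (\<rho>) (1.1 * \<rho>) (-2 * \<rho>) (2 * \<rho>)) \<le> ennreal (0 * (1.1 * \<rho> - (\<rho>)) + \<epsilon>)"
      using VX[OF x1(3) VA(1)] by (simp only: mult_zero_left add_0_left)
    have k: "(0 + \<kappa>) / K < \<kappa> / 2 * (0 - (-2 * \<rho>))" "(0 + \<kappa>) / K < \<kappa> / 2 * (2 * \<rho> - (0))"
      by (rule Kj; use M M0 \<rho> in simp)+
    have "\<exists>s. \<rho> < s \<and> s < 1.1 * \<rho> \<and> (\<forall>t. -2 * \<rho> < t \<and> t < 0 \<longrightarrow> norm (w (p + s *\<^sub>R nn + t *\<^sub>R ee) - \<alpha>) \<le> \<kappa>) \<and>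
     (\<forall>t. 0 < t \<and> t < 2 * \<rho> \<longrightarrow> norm (w (p + s *\<^sub>R nn + t *\<^sub>R ee) - \<alpha>) \<le> \<kappa>) \<and>
     (\<forall>x t y. -2 * \<rho> < x \<and> x \<le> t \<and> t \<le> y \<and> y < 2 * \<rho> \<longrightarrow>
        norm (w (p + s *\<^sub>R nn + t *\<^sub>R ee) - w (p + s *\<^sub>R nn + x *\<^sub>R ee)) + norm (w (p + s *\<^sub>R nn + y *\<^sub>R ee) - w (p + s *\<^sub>R nn + t *\<^sub>R ee)) \<le> 0 + \<kappa>)"
      by (rule tilted'.crossing_slice[OF open_ball R4 c _ _ _ _ _ v VX[OF x1(1) VA(1)] VX[OF x1(2) VA(1)] IA(1)[OF x1(1)] IA(1)[OF x1(2)] _ \<kappa> \<epsilon>(1) \<epsilon>'(1) K(1) Kj1 k])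
        (use \<rho> M M0 in auto)
    then show ?thesis using that by auto
  qed
  \<comment> \<open>Lower corners of the loop, where the tilted slices meet the horizontal one.
    \<open>\<tau>1\<close> solves s1/2 + cc t = s3, using 1/cc = 4/3 cc, and \<open>x1\<close> is
    the horizontal offset of the same point; \<open>\<tau>2\<close> and \<open>x2\<close> belong to
    the slice through s2. The bounds below put these corners in the strips where the slices are
    already near b and g.\<close>
  define \<tau>1 where "\<tau>1 = 4/3 * (cc * (s3 - s1/2))"
  define \<tau>2 where "\<tau>2 = 4/3 * (cc * (s3 - s2/2))"
  define x1 where "x1 = cc * (4/3 * s1 - 2/3 * s3)"
  define x2 where "x2 = cc * (4/3 * s2 - 2/3 * s3)"
  have cm: "l * (cc * \<rho>) \<le> cc * z" "cc * z \<le> u * (cc * \<rho>)" if "l * \<rho> \<le> z" "z \<le> u * \<rho>" for l z u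
    using mult_left_mono[OF that(1), of cc] mult_left_mono[OF that(2), of cc] cc_pos by (simp_all add: mult.left_commute)
  have c\<rho>: "433/500 * \<rho> < cc * \<rho>" "cc * \<rho> < 8661/10000 * \<rho>" using cc_bounds \<rho> by (auto intro!: mult_strict_right_mono)
  have s1': "\<rho> < s1" "s1 < 11/10 * \<rho>" and s2': "- (11/10) * \<rho> < s2" "s2 < - \<rho>" and s3': "- (11/10) * \<rho> < s3" "s3 < - \<rho>"
    using s1(1,2) s2(1,2) s3(1,2) by simp_all
  have "- (33/20) * \<rho> \<le> s3 - s1/2" "s3 - s1/2 \<le> - (3/2) * \<rho>" using s1' s3' by linarith+
  from cm[OF this] have \<tau>1b: "-2 * \<rho> < \<tau>1" "\<tau>1 < -\<rho>/4" unfolding \<tau>1_def using c\<rho> \<rho>(1) by linarith+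
  have "- (3/5) * \<rho> \<le> s3 - s2/2" "s3 - s2/2 \<le> - (9/20) * \<rho>" using s2' s3' by linarith+
  from cm[OF this] have \<tau>2b: "- \<rho> < \<tau>2" "\<tau>2 < -\<rho>/4" unfolding \<tau>2_def using c\<rho> \<rho>(1) by linarith+
  have "2 * \<rho> \<le> 4/3 * s1 - 2/3 * s3" "4/3 * s1 - 2/3 * s3 \<le> 11/5 * \<rho>" using s1' s3' by linarith+
  from cm[OF this] have x1b: "\<rho>/4 < x1" "x1 < 2 * \<rho>" unfolding x1_def using c\<rho> \<rho>(1) by linarith+
  have "- (4/5) * \<rho> \<le> 4/3 * s2 - 2/3 * s3" "4/3 * s2 - 2/3 * s3 \<le> - (3/5) * \<rho>" using s2' s3' by linarith+
  from cm[OF this] have x2b: "- \<rho> < x2" "x2 < -\<rho>/4" unfolding x2_def using c\<rho> \<rho>(1) by linarith+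
  define q0 where "q0 = p + s1 *\<^sub>R ee + s4 *\<^sub>R nn"
  define q1 where "q1 = p + s1 *\<^sub>R ee + \<tau>1 *\<^sub>R nn"
  define q2 where "q2 = p + s2 *\<^sub>R ee + \<tau>2 *\<^sub>R nn"
  define q3 where "q3 = p + s2 *\<^sub>R ee + s4 *\<^sub>R nn"
  have ccz: "cc * (cc * z) = 3/4 * z" for z using cc_sq by (simp add: mult.assoc[symmetric])
  have q0': "q0 = p + s4 *\<^sub>R nn + s1 *\<^sub>R ee" "q3 = p + s4 *\<^sub>R nn + s2 *\<^sub>R ee" by (simp_all add: q0_def q3_def)
  have q1': "q1 = p + s3 *\<^sub>R axis 2 1 + x1 *\<^sub>R axis 1 1"
    unfolding q1_def \<tau>1_def x1_def vec_eq_iff forall_2 by (simp add: ccz algebra_simps)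
  have q2': "q2 = p + s3 *\<^sub>R axis 2 1 + x2 *\<^sub>R axis 1 1"
    unfolding q2_def \<tau>2_def x2_def vec_eq_iff forall_2 by (simp add: ccz algebra_simps)
  have e01: "w ` closed_segment q1 q0 \<subseteq> {z. dist b z + dist \<alpha> z \<le> norm (b - \<alpha>) + 3 * \<kappa>}"
    unfolding q0_def q1_def
    by (rule tilted.segment_in_ellipse) (use s1 s4(1,2) \<tau>1b \<rho> in auto)
  have e23: "w ` closed_segment q2 q3 \<subseteq> {z. dist g z + dist \<alpha> z \<le> norm (g - \<alpha>) + 3 * \<kappa>}"
    unfolding q2_def q3_def
    by (rule tilted.segment_in_ellipse) (use s2 s4(1,2) \<tau>2b \<rho> in auto)
  have e12: "w ` closed_segment q2 q1 \<subseteq> {z. dist g z + dist b z \<le> norm (b - g) + 3 * \<kappa>}"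
    unfolding q1' q2'
    by (rule axes'.segment_in_ellipse) (use s3 x1b x2b \<rho> in auto)
  have e30: "w ` closed_segment q3 q0 \<subseteq> {z. dist \<alpha> z + dist \<alpha> z \<le> 0 + 3 * \<kappa>}"
    unfolding q0'
    by (rule tilted'.segment_in_ellipse) (use s4 s1(1,2) s2(1,2) \<rho> in auto)
  have inb: "q0 \<in> ball p r" "q1 \<in> ball p r" "q2 \<in> ball p r" "q3 \<in> ball p r"
    using R1 R2 tilted.rect_coordinates[of p s1 s4] tilted.rect_coordinates[of p s1 \<tau>1] tilted.rect_coordinates[of p s2 \<tau>2] tilted.rect_coordinates[of p s2 s4]
      s1(1,2) s2(1,2) s4(1,2) \<tau>1b \<tau>2b \<rho> unfolding q0_def q1_def q2_def q3_def by (auto dest!: subsetD)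
  show ?thesis
  proof (rule loop_covers_triangle[of "ball p r" q0 q1 q2 q3 w "ellipse \<alpha> b (4 * \<kappa>)" \<alpha> b "ellipse b g (4 * \<kappa>)" g "ellipse g \<alpha> (4 * \<kappa>)"])
    show "continuous_on (ball p r) w" by (rule C1_on_imp_continuous_on[OF c])
    show "w ` closed_segment q0 q1 \<subseteq> ellipse \<alpha> b (4 * \<kappa>)"
      using e01 \<kappa> by (force simp: ellipse_def closed_segment_commute norm_minus_commute)
    show "w ` closed_segment q1 q2 \<subseteq> ellipse b g (4 * \<kappa>)"
      using e12 \<kappa> by (force simp: ellipse_def closed_segment_commute norm_minus_commute)
    show "w ` closed_segment q2 q3 \<subseteq> ellipse g \<alpha> (4 * \<kappa>)"
      using e23 \<kappa> by (force simp: ellipse_def norm_minus_commute)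
    \<comment> \<open>Closeness to \<alpha> places the closing side in the ellipse with foci g and
      \<alpha>: the triangle inequality charges twice the distance to \<alpha>, at most 3
      \<kappa>.\<close>
    show "w ` closed_segment q3 q0 \<subseteq> ellipse g \<alpha> (4 * \<kappa>)"
    proof
      fix z assume "z \<in> w ` closed_segment q3 q0"
      then have "dist \<alpha> z + dist \<alpha> z \<le> 3 * \<kappa>" using e30 by auto
      moreover have "dist g z \<le> norm (\<alpha> - g) + dist \<alpha> z"
        using dist_triangle[of g z \<alpha>] by (simp add: dist_norm norm_minus_commute)
      ultimately show "z \<in> ellipse g \<alpha> (4 * \<kappa>)" using \<kappa> by (simp add: ellipse_def)
    qed
  qed (use inb y \<kappa> in \<open>auto simp: convex_ellipse' foci_in_ellipse\<close>)
qed

text \<open>For each n the covering of \<open>T n\<close> holds from some k on, because finitely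
  many regions have to be controlled. The increasing sets \<open>T n\<close> exhaust the interior of
  the triangle up to its sides, hence its full measure.\<close>

theorem emeasure_triangle_le_liminf_TVJ:
  assumes V: "total_var u (ball p r) \<le> ennreal (r * (norm (b - \<alpha>) + norm (g - \<alpha>) + norm (b - g)))"
    and c: "\<And>k. C1_on (ball p r) (w k)" and L: "L1_conv (ball p r) w u"
    and lim: "(\<lambda>k. total_var (w k) (ball p r)) \<longlonglongrightarrow> total_var u (ball p r)"
  shows "emeasure lebesgue (convex hull {\<alpha>, b, g}) \<le> liminf (\<lambda>k. TVJ (w k) (ball p r))"
proof -
  define T where "T n = interior (convex hull {\<alpha>, b, g}) - (ellipse \<alpha> b (4 / real (Suc n)) \<union> ellipse b g (4 / real (Suc n)) \<union> ellipse g \<alpha> (4 / real (Suc n)))" for n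
  have fin: "total_var u (ball p r) < \<infinity>" using V by (auto simp: le_less_trans)
  have cl: "closed (ellipse a a' \<kappa>)" for a a' \<kappa> unfolding ellipse_def
    by (intro closed_Collect_le continuous_intros)
  have oT: "open (T n)" for n unfolding T_def by (intro open_Diff open_interior closed_Un cl)
  have Tn: "emeasure lebesgue (T n) \<le> liminf (\<lambda>k. TVJ (w k) (ball p r))" for n
  proof -
    define \<kappa> where "\<kappa> = 1 / real (Suc n)"
    have \<kappa>: "0 < \<kappa>" "4 / real (Suc n) = 4 * \<kappa>" by (auto simp: \<kappa>_def)
    define M where "M = norm (b - \<alpha>) + norm (g - \<alpha>) + norm (b - g)"
    have M: "norm (b - \<alpha>) \<le> M" "norm (g - \<alpha>) \<le> M" "norm (b - g) \<le> M" "0 \<le> M" by (auto simp: M_def)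
    \<comment> \<open>With this choice (M + \<kappa>) / K equals \<kappa>/2 times r / (r + 16), and
      the last factor is below both 1 and r/8, the two bounds demanded of K.\<close>
    define K where "K = 2 * (M + \<kappa>) / \<kappa> * (1 + 16 / r)"
    have K: "0 < K" using M \<kappa> r by (auto simp: K_def intro!: mult_pos_pos add_pos_pos divide_pos_pos add_nonneg_pos)
    have mk: "M + \<kappa> > 0" using M \<kappa> by simp
    have "(M + \<kappa>) / K = \<kappa> / 2 * (r / (r + 16))" unfolding K_def using mk \<kappa> r
      by (simp add: divide_simps) (simp add: algebra_simps)
    moreover have "r / (r + 16) \<le> 1" "r / (r + 16) < r / 8" using r by (simp, intro divide_strict_left_mono) auto
    ultimately have K': "(M + \<kappa>) / K \<le> \<kappa> / 2" "(M + \<kappa>) / K < \<kappa> / 2 * (r / 8)"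
      using \<kappa>(1) mult_left_mono[of "r / (r + 16)" 1 "\<kappa> / 2"] mult_strict_left_mono[of "r / (r + 16)" "r / 8" "\<kappa> / 2"]
      by simp_all
    \<comment> \<open>Half of the largest value for which the weighted errors stay below \<kappa>
      per unit of width.\<close>
    define \<epsilon> where "\<epsilon> = \<kappa> * (r / 40) / (2 * (1 + 4 * K))"
    have \<epsilon>: "0 < \<epsilon>" "(1 + 4 * K) * \<epsilon> < \<kappa> * (r / 40)" 
    proof -
      have x: "0 < \<kappa> * (r / 40)" "0 < 1 + 4 * K" using K \<kappa> r by auto
      then show "0 < \<epsilon>" unfolding \<epsilon>_def by (intro divide_pos_pos) auto
      have "d * (z / (2 * d)) = z / 2" if "0 < d" for d z :: real using that by simp
      from this[OF x(2)] have "(1 + 4 * K) * \<epsilon> = \<kappa> * (r / 40) / 2" unfolding \<epsilon>_def .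
      then show "(1 + 4 * K) * \<epsilon> < \<kappa> * (r / 40)" using x(1) by linarith
    qed
    have "eventually (\<lambda>k. \<forall>x\<in>set crossing_rects. total_var (w k) (fst x) \<le> ennreal (snd x + \<epsilon>)) sequentially"
    proof (intro eventually_ball_finite ballI)
      fix x assume "x \<in> set crossing_rects"
      then have "(fst x, snd x) \<in> set crossing_rects" by simp
      from crossing_rects_bound[OF V this] obtain B where B: "fst x \<subseteq> ball p r" "B \<subseteq> ball p r" "fst x \<inter> B = {}"
        "total_var u (ball p r) \<le> total_var u B + ennreal (snd x)" "0 \<le> snd x" by blast
      show "eventually (\<lambda>k. total_var (w k) (fst x) \<le> ennreal (snd x + \<epsilon>)) sequentially"
        by (rule eventually_total_var_le[OF L lim fin B \<epsilon>(1)])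
    qed simp
    then have "eventually (\<lambda>k. emeasure lebesgue (T n) \<le> TVJ (w k) (ball p r)) sequentially"
      using nn_integral_L1_conv[OF L \<epsilon>(1)]
    proof eventually_elim
      case (elim k)
      have "T n \<subseteq> w k ` ball p r"
      proof
        fix y assume "y \<in> T n"
        then show "y \<in> w k ` ball p r" unfolding T_def \<kappa>(2)
          by (intro triangle_covered[OF c _ elim(2) \<kappa>(1) K K' M(1-3) _ \<epsilon>(2)]) (use elim(1) \<epsilon>(1) in auto)
      qed
      then show ?case by (rule emeasure_image_le_TVJ[OF open_ball c])
    qed
    then show ?thesis by (rule Liminf_bounded)
  qed
  have inc: "incseq T"
  proof (rule incseq_SucI)
    fix n
    have "4 / real (Suc (Suc n)) \<le> 4 / real (Suc n)" by (intro divide_left_mono) auto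
    from ellipse_mono[OF this] show "T n \<subseteq> T (Suc n)" unfolding T_def by blast
  qed
  have seg: "closed_segment a a' \<in> null_sets lebesgue" for a a' :: "real^2"
    using negligible_convex_interior[of "closed_segment a a'"] interior_closed_segment_ge2[of a a']
    by (simp add: negligible_iff_null_sets)
  have un: "interior (convex hull {\<alpha>, b, g}) - (closed_segment \<alpha> b \<union> closed_segment b g \<union> closed_segment g \<alpha>) \<subseteq> (\<Union>n. T n)"
  proof
    fix y assume y: "y \<in> interior (convex hull {\<alpha>, b, g}) - (closed_segment \<alpha> b \<union> closed_segment b g \<union> closed_segment g \<alpha>)"
    \<comment> \<open>Off the segment the triangle inequality is strict, and its excess d eventually
      exceeds 4 / (n + 1).\<close>
    have out: "\<exists>N. \<forall>n\<ge>N. y \<notin> ellipse a a' (4 / real (Suc n))" if "y \<notin> closed_segment a a'" for a a'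
    proof -
      define d where "d = dist a y + dist a' y - norm (a' - a)"
      have "dist a a' \<noteq> dist a y + dist y a'" using that between[of a a' y] between_mem_segment[of a a' y] by auto
      then have d: "0 < d" unfolding d_def using dist_triangle[of a a' y] by (simp add: dist_norm norm_minus_commute)
      obtain N where N: "4 / d < real N" using reals_Archimedean2 by blast
      have "y \<notin> ellipse a a' (4 / real (Suc n))" if "n \<ge> N" for n
      proof -
        have "4 / d < real (Suc n)" using N that by linarith
        then have "4 / real (Suc n) < d" using d by (simp add: field_simps)
        then show ?thesis by (auto simp: ellipse_def d_def)
      qed
      then show ?thesis by blast
    qed
    obtain N1 N2 N3 where "\<forall>n\<ge>N1. y \<notin> ellipse \<alpha> b (4 / real (Suc n))" "\<forall>n\<ge>N2. y \<notin> ellipse b g (4 / real (Suc n))" "\<forall>n\<ge>N3. y \<notin> ellipse g \<alpha> (4 / real (Suc n))"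
      using out y by (metis DiffD2 UnCI)
    then have "y \<in> T (max N1 (max N2 N3))" using y unfolding T_def by auto
    then show "y \<in> (\<Union>n. T n)" by blast
  qed
  have "emeasure lebesgue (convex hull {\<alpha>, b, g}) = emeasure lebesgue (interior (convex hull {\<alpha>, b, g}) - (closed_segment \<alpha> b \<union> closed_segment b g \<union> closed_segment g \<alpha>))"
  proof -
    have "compact (convex hull {\<alpha>, b, g})" by (simp add: finite_imp_compact_convex_hull)
    then have "bounded (convex hull {\<alpha>, b, g})" "closed (convex hull {\<alpha>, b, g})" by (auto simp: compact_imp_bounded compact_imp_closed)
    then have "convex hull {\<alpha>, b, g} - interior (convex hull {\<alpha>, b, g}) = frontier (convex hull {\<alpha>, b, g})"
      by (simp add: frontier_def)
    then have f: "convex hull {\<alpha>, b, g} - interior (convex hull {\<alpha>, b, g}) \<in> null_sets lebesgue"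
      using negligible_convex_frontier[of "convex hull {\<alpha>, b, g}"] by (simp add: negligible_iff_null_sets)
    have n: "closed_segment \<alpha> b \<union> closed_segment b g \<union> closed_segment g \<alpha> \<in> null_sets lebesgue" using seg by auto
    have i: "interior (convex hull {\<alpha>, b, g}) \<in> sets lebesgue" by auto
    have "convex hull {\<alpha>, b, g} = interior (convex hull {\<alpha>, b, g}) \<union> (convex hull {\<alpha>, b, g} - interior (convex hull {\<alpha>, b, g}))"
      using interior_subset by blast
    then have "emeasure lebesgue (convex hull {\<alpha>, b, g}) = emeasure lebesgue (interior (convex hull {\<alpha>, b, g}))"
      using emeasure_Un_null_set[OF i f] by metis
    then show ?thesis using emeasure_Diff_null_set[OF n i] by simp
  qed
  also have "\<dots> \<le> emeasure lebesgue (\<Union>n. T n)" using oT by (intro emeasure_mono[OF un]) auto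
  also have "\<dots> = (SUP n. emeasure lebesgue (T n))"
    by (rule SUP_emeasure_incseq[symmetric, OF _ inc]) (use oT in auto)
  also have "\<dots> \<le> liminf (\<lambda>k. TVJ (w k) (ball p r))" by (intro SUP_least Tn)
  finally show ?thesis .
qed

end

section \<open>Geometry of the map\<close>

text \<open>The side length of the i-th triangle, and also the distance of \<open>A_pt i\<close> and
  \<open>B_pt i\<close> from the origin.\<close>

definition q :: "nat \<Rightarrow> real" where "q i = (1/2)^i"
definition ee' :: "real^2" where "ee' = vector [cc, - (1/2)]"
definition nn' :: "real^2" where "nn' = vector [- (1/2), - cc]"

lemma ee'_nth [simp]: "ee'$1 = cc" "ee'$2 = - (1/2)" "nn'$1 = - (1/2)" "nn'$2 = - cc"
  by (simp_all add: ee'_def nn'_def)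

interpretation mirrored: frame ee' nn'
  by unfold_locales (auto simp: inner_real2 cc_sq)

lemma q_pos [simp]: "0 < q i" and q_nonneg [simp]: "0 \<le> q i" and q_nonzero [simp]: "q i \<noteq> 0"
  and q_le_1: "q i \<le> 1" and q_Suc: "q (Suc i) = q i / 2" and q_0 [simp]: "q 0 = 1"
  by (simp_all add: q_def power_le_one)

lemma q_less: "i < j \<Longrightarrow> q j \<le> q i / 2"
proof -
  assume "i < j"
  then have "q j \<le> q (Suc i)" unfolding q_def by (intro power_decreasing) auto
  then show ?thesis by (simp add: q_Suc)
qed

lemma q_tendsto: "q \<longlonglongrightarrow> 0" unfolding q_def[abs_def] by (intro LIMSEQ_realpow_zero) auto

lemma A_pt_eq: "A_pt i = q i *\<^sub>R ee" and B_pt_eq: "B_pt i = q i *\<^sub>R ee'"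
  by (simp_all add: A_pt_def B_pt_def q_def ee_def ee'_def cc_def)

lemma wedge_iff: "2 * cc * \<bar>a\<bar> \<le> b \<longleftrightarrow> 2 * (cc * a) \<le> b \<and> - (2 * (cc * a)) \<le> b"
proof -
  have "2 * cc * \<bar>a\<bar> = \<bar>2 * (cc * a)\<bar>" using cc_pos by (simp add: abs_mult)
  then show ?thesis by (simp only: abs_le_iff)
qed

text \<open>The wedge of opening 60 degrees, cut off at the common abscissa of A_i and B_i. Later
  case distinctions work with these inequalities rather than with the convex hull.\<close>

lemma tri_eq: "tri i = {x. 2 * cc * \<bar>x$2\<bar> \<le> x$1 \<and> x$1 \<le> cc * q i}"
proof
  have e: "{x. 2 * cc * \<bar>x$2\<bar> \<le> x$1 \<and> x$1 \<le> cc * q i} = {x. nn \<bullet> x \<le> 0} \<inter> {x. nn' \<bullet> x \<le> 0} \<inter> {x. axis 1 1 \<bullet> x \<le> cc * q i}"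
    by (auto simp: inner_real2 wedge_iff)
  show "tri i \<subseteq> {x. 2 * cc * \<bar>x$2\<bar> \<le> x$1 \<and> x$1 \<le> cc * q i}" unfolding tri_def
  proof (rule hull_minimal)
    show "{A_pt i, 0, B_pt i} \<subseteq> {x::real^2. 2 * cc * \<bar>x$2\<bar> \<le> x$1 \<and> x$1 \<le> cc * q i}"
      using cc_pos q_pos[of i] less_imp_le[OF q_pos[of i]] by (auto simp: A_pt_eq B_pt_eq abs_mult mult.commute)
    show "convex {x::real^2. 2 * cc * \<bar>x$2\<bar> \<le> x$1 \<and> x$1 \<le> cc * q i}" unfolding e
      by (intro convex_Int convex_halfspace_le)
  qed
  show "{x. 2 * cc * \<bar>x$2\<bar> \<le> x$1 \<and> x$1 \<le> cc * q i} \<subseteq> tri i"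
  proof clarify
    fix x :: "real^2" assume x: "2 * cc * \<bar>x$2\<bar> \<le> x$1" "x$1 \<le> cc * q i"
    \<comment> \<open>Barycentric coordinates of x with respect to A_i and B_i; the origin receives
      the remaining weight.\<close>
    define a where "a = (x$1 / (cc * q i) + 2 * x$2 / q i) / 2"
    define b where "b = (x$1 / (cc * q i) - 2 * x$2 / q i) / 2"
    have ne: "cc * q i > 0" "q i \<noteq> 0" "cc \<noteq> 0" using cc_pos q_pos[of i] by (auto intro: mult_pos_pos)
    have "\<bar>2 * x$2 / q i\<bar> = 2 * cc * \<bar>x$2\<bar> / (cc * q i)" using ne by (simp add: abs_mult)
    also have "\<dots> \<le> x$1 / (cc * q i)" using x(1) ne(1) by (intro divide_right_mono) auto
    finally have le: "\<bar>2 * x$2 / q i\<bar> \<le> x$1 / (cc * q i)" .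
    have "x$1 / (cc * q i) \<le> 1" using x(2) ne(1) by simp
    moreover have "0 \<le> (X + Y) / 2 \<and> 0 \<le> (X - Y) / 2 \<and> (X + Y) / 2 + (X - Y) / 2 \<le> 1" if "\<bar>Y\<bar> \<le> X" "X \<le> 1" for X Y :: real
      using that by (auto simp: abs_le_iff field_simps)
    ultimately have ab: "0 \<le> a" "0 \<le> b" "a + b \<le> 1" unfolding a_def b_def using le by blast+
    have "x = a *\<^sub>R A_pt i + (1 - a - b) *\<^sub>R 0 + b *\<^sub>R B_pt i"
      using ne by (simp add: vec_eq_iff forall_2 A_pt_eq B_pt_eq a_def b_def field_simps)
    then show "x \<in> tri i" unfolding tri_def convex_hull_3
      using ab by (intro CollectI exI[of _ a] exI[of _ "1 - a - b"] exI[of _ b]) auto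
  qed
qed

definition col :: "real^2 \<Rightarrow> real^2 \<Rightarrow> nat \<Rightarrow> real^2" where
  "col \<beta> \<gamma> i = (if even i then \<beta> else \<gamma>)"

lemma u_map_outside:
  fixes x :: "real^2"
  shows "\<not> 2 * cc * \<bar>x$2\<bar> \<le> x$1 \<or> cc < x$1 \<Longrightarrow> u_map \<alpha> \<beta> \<gamma> x = \<alpha>"
  by (auto simp: u_map_def tri_eq)

lemma zone_unique:
  assumes "q (Suc i) < z" "z \<le> q i" "q (Suc j) < z" "z \<le> q j"
  shows "i = j"
proof (rule ccontr)
  assume "i \<noteq> j"
  then consider "i < j" | "j < i" by linarith
  then show False
    using assms q_less[of i j] q_less[of j i] by cases (auto simp: q_Suc)
qed

lemma u_map_zone:
  fixes x :: "real^2"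
  assumes "2 * cc * \<bar>x$2\<bar> \<le> x$1" "cc * q (Suc i) < x$1" "x$1 \<le> cc * q i"
  shows "u_map \<alpha> \<beta> \<gamma> x = col \<beta> \<gamma> i"
proof -
  have "cc * q i \<le> cc * 1" using q_le_1[of i] cc_pos by (intro mult_left_mono) auto
  then have "x \<in> tri 0" using assms by (simp add: tri_eq)
  moreover have "x \<in> tri j - tri (Suc j) \<longleftrightarrow> j = i" for j
  proof
    assume "x \<in> tri j - tri (Suc j)"
    then have "q (Suc j) < x$1 / cc" "x$1 / cc \<le> q j" using assms cc_pos by (auto simp: tri_eq field_simps)
    moreover have "q (Suc i) < x$1 / cc" "x$1 / cc \<le> q i" using assms cc_pos by (auto simp: field_simps)
    ultimately show "j = i" using zone_unique by blast
  qed (use assms in \<open>auto simp: tri_eq\<close>)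
  ultimately show ?thesis by (auto simp: u_map_def col_def)
qed

lemma u_map_measurable: "u_map \<alpha> \<beta> \<gamma> \<in> borel_measurable borel"
proof -
  have [measurable]: "tri i \<in> sets borel" for i
    unfolding tri_def by (intro borel_compact finite_imp_compact_convex_hull) auto
  have [measurable]: "{x. \<exists>i. even i \<and> x \<in> tri i - tri (Suc i)} \<in> sets borel"
  proof -
    have "{x. \<exists>i. even i \<and> x \<in> tri i - tri (Suc i)} = (\<Union>i\<in>{i. even i}. tri i - tri (Suc i))" by auto
    also have "\<dots> \<in> sets borel" by (intro sets.countable_UN'') auto
    finally show ?thesis .
  qed
  show ?thesis unfolding u_map_def[abs_def] by measurable
qed

lemma u_map_range: "u_map \<alpha> \<beta> \<gamma> x \<in> {\<alpha>, \<beta>, \<gamma>}" by (simp add: u_map_def)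

lemma borel_bounded_L1_maps:
  assumes m: "u \<in> borel_measurable borel" and b: "\<And>x. x \<in> \<Omega> \<Longrightarrow> norm (u x) \<le> C" and \<Omega>: "bounded \<Omega>" "open \<Omega>"
  shows "u \<in> L1_maps \<Omega>"
proof -
  have l: "\<Omega> \<in> lmeasurable" using \<Omega> by (simp add: bounded_set_imp_lmeasurable)
  have "u absolutely_integrable_on \<Omega>"
  proof (rule measurable_bounded_by_integrable_imp_absolutely_integrable)
    show "u \<in> borel_measurable (lebesgue_on \<Omega>)" using m by (intro measurable_restrict_space1 measurable_completion) simp
    show "(\<lambda>x. C) integrable_on \<Omega>" using l by (rule integrable_on_const)
  qed (use l b in auto)
  then show ?thesis by (simp add: L1_maps_def)
qed

lemma u_map_L1: "bounded \<Omega> \<Longrightarrow> open \<Omega> \<Longrightarrow> u_map \<alpha> \<beta> \<gamma> \<in> L1_maps \<Omega>"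
proof (rule borel_bounded_L1_maps[OF u_map_measurable, where C="norm \<alpha> + norm \<beta> + norm \<gamma>"])
  show "norm (u_map \<alpha> \<beta> \<gamma> x) \<le> norm \<alpha> + norm \<beta> + norm \<gamma>" for x using u_map_range[of \<alpha> \<beta> \<gamma> x] by auto
qed

section \<open>Lower bound for the variation of the map on open sets\<close>

text \<open>For i = 0 the neighbour is the background \<alpha>. With this convention the jumps
  telescope to the value of a trapezoid relative to \<alpha>.\<close>

definition jump :: "real^2 \<Rightarrow> real^2 \<Rightarrow> real^2 \<Rightarrow> nat \<Rightarrow> real^2" where
  "jump \<alpha> \<beta> \<gamma> i = col \<beta> \<gamma> i - (if i = 0 then \<alpha> else col \<beta> \<gamma> (i - 1))"

definition upper_set :: "(real^2) set \<Rightarrow> nat \<Rightarrow> real set" where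
  "upper_set X i = {s. q (Suc i) < s \<and> s < q i \<and> s *\<^sub>R ee \<in> X}"
definition lower_set :: "(real^2) set \<Rightarrow> nat \<Rightarrow> real set" where
  "lower_set X i = {s. q (Suc i) < s \<and> s < q i \<and> s *\<^sub>R ee' \<in> X}"
definition vertical_set :: "(real^2) set \<Rightarrow> nat \<Rightarrow> real set" where
  "vertical_set X i = {s. \<bar>s\<bar> < q i / 2 \<and> (cc * q i) *\<^sub>R axis 1 1 + s *\<^sub>R axis 2 1 \<in> X}"

text \<open>Neighbourhoods of the open sides that pinch towards the vertices. The factor 4 here and
  in \<open>Dreg\<close>, and 2 in \<open>Vreg\<close>, make them thin enough to be pairwise
  disjoint.\<close>

definition Ureg :: "nat \<Rightarrow> (real^2) set" where
  "Ureg i = {x. cc * q (Suc i) < x$1 \<and> x$1 < cc * q i \<and> 4 * \<bar>cc * x$2 - x$1 / 2\<bar> < x$1 - cc * q (Suc i) \<and> 4 * \<bar>cc * x$2 - x$1 / 2\<bar> < cc * q i - x$1}"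
definition Dreg :: "nat \<Rightarrow> (real^2) set" where
  "Dreg i = {x. cc * q (Suc i) < x$1 \<and> x$1 < cc * q i \<and> 4 * \<bar>cc * x$2 + x$1 / 2\<bar> < x$1 - cc * q (Suc i) \<and> 4 * \<bar>cc * x$2 + x$1 / 2\<bar> < cc * q i - x$1}"
definition Vreg :: "nat \<Rightarrow> (real^2) set" where
  "Vreg i = {x. 2 * \<bar>x$1 - cc * q i\<bar> < cc * q i / 2 - cc * \<bar>x$2\<bar>}"

lemma open_regions: "open (Ureg i)" "open (Dreg i)" "open (Vreg i)"
  unfolding Ureg_def Dreg_def Vreg_def
  by (auto intro!: open_Collect_conj open_Collect_less continuous_intros)

lemma cq_pos [simp]: "0 < cc * q i" using cc_pos by (simp add: mult_pos_pos)
lemma cq_Suc: "cc * q (Suc i) = cc * q i / 2" by (simp add: q_Suc)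

lemma cq_less: "i < j \<Longrightarrow> cc * q j \<le> cc * q i / 2"
  using mult_left_mono[OF q_less, of i j cc] cc_pos by simp

text \<open>The conditions are piecewise linear in x$1 and cc times x$2. Distinct indices are
  separated because their scales differ at least by a factor 2.\<close>

lemma regions_disjoint:
  shows "i \<noteq> j \<Longrightarrow> Ureg i \<inter> Ureg j = {}" "i \<noteq> j \<Longrightarrow> Dreg i \<inter> Dreg j = {}" "i \<noteq> j \<Longrightarrow> Vreg i \<inter> Vreg j = {}"
    "Ureg i \<inter> Dreg j = {}" "Ureg i \<inter> Vreg j = {}" "Dreg i \<inter> Vreg j = {}"
proof -
  have z: "i = j" if "cc * q (Suc i) < z" "z < cc * q i" "cc * q (Suc j) < z" "z < cc * q j" for z
  proof (rule ccontr)
    assume "i \<noteq> j"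
    then consider "i < j" | "j < i" by linarith
    then show False using that cq_less[of i j] cq_less[of j i] by cases (simp_all add: cq_Suc)
  qed
  show "i \<noteq> j \<Longrightarrow> Ureg i \<inter> Ureg j = {}" "i \<noteq> j \<Longrightarrow> Dreg i \<inter> Dreg j = {}"
    using z by (auto simp: Ureg_def Dreg_def)
  have ca: "0 \<le> cc * \<bar>a\<bar>" "cc * a \<le> cc * \<bar>a\<bar>" "- (cc * a) \<le> cc * \<bar>a\<bar>" for a :: real using cc_pos by (auto simp: abs_if mult_less_0_iff)
  have v: "3/4 * (cc * q i) < x$1" "x$1 < 5/4 * (cc * q i)" if "x \<in> Vreg i" for x :: "real^2" and i
    using that ca[of "x$2"] unfolding Vreg_def by (auto simp: abs_if split: if_splits)
  show "i \<noteq> j \<Longrightarrow> Vreg i \<inter> Vreg j = {}"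
  proof (rule ccontr)
    assume "i \<noteq> j" "Vreg i \<inter> Vreg j \<noteq> {}"
    then obtain x where x: "x \<in> Vreg i" "x \<in> Vreg j" by auto
    from \<open>i \<noteq> j\<close> consider "i < j" | "j < i" by linarith
    then show False
    proof cases
      case 1 then show ?thesis using v[OF x(1)] v[OF x(2)] cq_less[OF 1] cq_pos[of i] by linarith
    next
      case 2 then show ?thesis using v[OF x(1)] v[OF x(2)] cq_less[OF 2] cq_pos[of j] by linarith
    qed
  qed
  show "Ureg i \<inter> Dreg j = {}"
  proof (rule ccontr)
    assume "Ureg i \<inter> Dreg j \<noteq> {}"
    then obtain x where x: "x \<in> Ureg i" "x \<in> Dreg j" by auto
    define a b where "a = cc * x$2" and "b = x$1"
    have "4 * \<bar>a - b / 2\<bar> < b - cc * q (Suc i)" "4 * \<bar>a + b / 2\<bar> < b - cc * q (Suc j)"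
      using x by (auto simp: Ureg_def Dreg_def a_def b_def)
    moreover have False if "4 * \<bar>a - b / 2\<bar> < b - k" "4 * \<bar>a + b / 2\<bar> < b - l" "0 < k" "0 < l" for k l
      using that by (auto simp: abs_if split: if_splits)
    ultimately show False using cq_pos by blast
  qed
  have UV: "j = i \<or> j = Suc i" if "cc * q (Suc i) < x$1" "x$1 < cc * q i" "x \<in> Vreg j" for x :: "real^2"
  proof (rule ccontr)
    assume "\<not> (j = i \<or> j = Suc i)"
    then consider "j < i" | "Suc i < j" by linarith
    then show False
    proof cases
      case 1 then show ?thesis using v[OF that(3)] that(1,2) cq_less[OF 1] cq_pos[of j] by linarith
    next
      case 2 then show ?thesis using v[OF that(3)] that(1,2) cq_less[OF 2] cq_pos[of "Suc i"] by linarith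
    qed
  qed
  show "Ureg i \<inter> Vreg j = {}"
  proof (rule ccontr)
    assume "Ureg i \<inter> Vreg j \<noteq> {}"
    then obtain x where x: "x \<in> Ureg i" "x \<in> Vreg j" by auto
    define a b c where "a = cc * x$2" and "b = x$1" and "c = cc * \<bar>x$2\<bar>"
    have f: "cc * q (Suc i) < b" "b < cc * q i" "4 * \<bar>a - b / 2\<bar> < b - cc * q (Suc i)" "4 * \<bar>a - b / 2\<bar> < cc * q i - b"
      "2 * \<bar>b - cc * q j\<bar> < cc * q j / 2 - c" "a \<le> c" using x ca[of "x$2"] by (auto simp: Ureg_def Vreg_def a_def b_def c_def)
    have "j = i \<or> j = Suc i" using UV x by (auto simp: Ureg_def)
    then show False using f by (auto simp: cq_Suc)
  qed
  show "Dreg i \<inter> Vreg j = {}"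
  proof (rule ccontr)
    assume "Dreg i \<inter> Vreg j \<noteq> {}"
    then obtain x where x: "x \<in> Dreg i" "x \<in> Vreg j" by auto
    define a b c where "a = cc * x$2" and "b = x$1" and "c = cc * \<bar>x$2\<bar>"
    have f: "cc * q (Suc i) < b" "b < cc * q i" "4 * \<bar>a + b / 2\<bar> < b - cc * q (Suc i)" "4 * \<bar>a + b / 2\<bar> < cc * q i - b"
      "2 * \<bar>b - cc * q j\<bar> < cc * q j / 2 - c" "- a \<le> c" using x ca[of "x$2"] by (auto simp: Dreg_def Vreg_def a_def b_def c_def)
    have "j = i \<or> j = Suc i" using UV x by (auto simp: Dreg_def)
    then show False using f by (auto simp: cq_Suc)
  qed
qed

definition interface_measure :: "real^2 \<Rightarrow> real^2 \<Rightarrow> real^2 \<Rightarrow> nat \<Rightarrow> (real^2) set \<Rightarrow> ennreal" where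
  "interface_measure \<alpha> \<beta> \<gamma> n X = (\<Sum>i<n. ennreal (norm (col \<beta> \<gamma> i - \<alpha>)) * (emeasure lborel (upper_set X i) + emeasure lborel (lower_set X i))
     + ennreal (norm (jump \<alpha> \<beta> \<gamma> i)) * emeasure lborel (vertical_set X i))"

text \<open>One jump estimate per side, added up over the disjoint neighbourhoods. G stays arbitrary
  because the bound serves both for the unit disk and for the disk with a small ball
  removed.\<close>

lemma interface_measure_le_total_var:
  assumes G: "open G" "bounded G"
  shows "interface_measure \<alpha> \<beta> \<gamma> n G \<le> total_var (u_map \<alpha> \<beta> \<gamma>) G"
proof -
  let ?u = "u_map \<alpha> \<beta> \<gamma>"
  have u1: "?u \<in> L1_maps G" using G by (simp add: u_map_L1)
  \<comment> \<open>Below the oblique line, narrowness of \<open>Ureg\<close> also keeps x above the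
    lower ray, so that u takes the value of the trapezoid. Here z stands for cc times x$2 and b for
    x$1; \<open>g2\<close> is the mirror image.\<close>
  have g1: "2 * z \<le> b \<and> - (2 * z) \<le> b" if "4 * \<bar>z - b / 2\<bar> < b - k" "z - b / 2 < 0" "0 < k" for z b k :: real
    using that by (auto simp: abs_if split: if_splits)
  have g2: "2 * z \<le> b \<and> - (2 * z) \<le> b" if "4 * \<bar>z + b / 2\<bar> < b - k" "- z - b / 2 < 0" "0 < k" for z b k :: real
    using that by (auto simp: abs_if split: if_splits)
  have U: "ennreal (norm (col \<beta> \<gamma> i - \<alpha>)) * emeasure lborel (upper_set G i) \<le> total_var ?u (G \<inter> Ureg i)" for i
  proof -
    have "ennreal (norm (\<alpha> - col \<beta> \<gamma> i)) * emeasure lborel {s. 0 + s *\<^sub>R ee \<in> G \<inter> Ureg i} \<le> total_var ?u (G \<inter> Ureg i)"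
    proof (rule tilted.total_var_ge_jump[OF u1])
      fix x assume x: "x \<in> G \<inter> Ureg i"
      have f: "cc * q (Suc i) < x$1" "x$1 < cc * q i" "4 * \<bar>cc * x$2 - x$1 / 2\<bar> < x$1 - cc * q (Suc i)"
        using x by (auto simp: Ureg_def)
      have ip: "(x - 0) \<bullet> nn = cc * x$2 - x$1 / 2" by (simp add: inner_real2)
      show "?u x = col \<beta> \<gamma> i" if "(x - 0) \<bullet> nn < 0"
      proof (rule u_map_zone)
        show "2 * cc * \<bar>x$2\<bar> \<le> x$1" unfolding wedge_iff
          using g1[OF f(3) _ cq_pos] that unfolding ip by blast
      qed (use f in auto)
      show "?u x = \<alpha>" if "(x - 0) \<bullet> nn > 0"
      proof (rule u_map_outside, rule disjI1)
        show "\<not> 2 * cc * \<bar>x$2\<bar> \<le> x$1" unfolding wedge_iff de_Morgan_conj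
          by (rule disjI1) (use ip that in linarith)
      qed
    qed (use G open_regions in auto)
    moreover have "{s. 0 + s *\<^sub>R ee \<in> G \<inter> Ureg i} = upper_set G i"
      unfolding upper_set_def Ureg_def using cc_pos by (auto simp: mult.commute)
    ultimately show ?thesis by (simp add: norm_minus_commute)
  qed
  have D: "ennreal (norm (col \<beta> \<gamma> i - \<alpha>)) * emeasure lborel (lower_set G i) \<le> total_var ?u (G \<inter> Dreg i)" for i
  proof -
    have "ennreal (norm (\<alpha> - col \<beta> \<gamma> i)) * emeasure lborel {s. 0 + s *\<^sub>R ee' \<in> G \<inter> Dreg i} \<le> total_var ?u (G \<inter> Dreg i)"
    proof (rule mirrored.total_var_ge_jump[OF u1])
      fix x assume x: "x \<in> G \<inter> Dreg i"
      have f: "cc * q (Suc i) < x$1" "x$1 < cc * q i" "4 * \<bar>cc * x$2 + x$1 / 2\<bar> < x$1 - cc * q (Suc i)"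
        using x by (auto simp: Dreg_def)
      have ip: "(x - 0) \<bullet> nn' = - (cc * x$2) - x$1 / 2" by (simp add: inner_real2)
      show "?u x = col \<beta> \<gamma> i" if "(x - 0) \<bullet> nn' < 0"
      proof (rule u_map_zone)
        show "2 * cc * \<bar>x$2\<bar> \<le> x$1" unfolding wedge_iff
          using g2[OF f(3) _ cq_pos] that unfolding ip by blast
      qed (use f in auto)
      show "?u x = \<alpha>" if "(x - 0) \<bullet> nn' > 0"
      proof (rule u_map_outside, rule disjI1)
        show "\<not> 2 * cc * \<bar>x$2\<bar> \<le> x$1" unfolding wedge_iff de_Morgan_conj
          by (rule disjI2) (use ip that in linarith)
      qed
    qed (use G open_regions in auto)
    moreover have "{s. 0 + s *\<^sub>R ee' \<in> G \<inter> Dreg i} = lower_set G i"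
      unfolding lower_set_def Dreg_def using cc_pos by (auto simp: mult.commute)
    ultimately show ?thesis by (simp add: norm_minus_commute)
  qed
  have V: "ennreal (norm (jump \<alpha> \<beta> \<gamma> i)) * emeasure lborel (vertical_set G i) \<le> total_var ?u (G \<inter> Vreg i)" for i
  proof -
    let ?r = "if i = 0 then \<alpha> else col \<beta> \<gamma> (i - 1)"
    let ?p = "(cc * q i) *\<^sub>R axis 1 1 :: real^2"
    have "ennreal (norm (?r - col \<beta> \<gamma> i)) * emeasure lborel {s. ?p + s *\<^sub>R axis 2 1 \<in> G \<inter> Vreg i} \<le> total_var ?u (G \<inter> Vreg i)"
    proof (rule axes'.total_var_ge_jump[OF u1])
      fix x assume x: "x \<in> G \<inter> Vreg i"
      have f: "2 * \<bar>x$1 - cc * q i\<bar> < cc * q i / 2 - cc * \<bar>x$2\<bar>" "0 \<le> cc * \<bar>x$2\<bar>" using x cc_pos by (auto simp: Vreg_def)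
      have "2 * c \<le> z" if "2 * \<bar>z - k\<bar> < k / 2 - c" "0 \<le> c" for c z k :: real
        using that by (auto simp: abs_if split: if_splits)
      from this[OF f] have w: "2 * cc * \<bar>x$2\<bar> \<le> x$1" by (simp add: mult.assoc)
      show "?u x = col \<beta> \<gamma> i" if "(x - ?p) \<bullet> axis 1 1 < 0"
        by (rule u_map_zone[OF w]) (use that f in \<open>auto simp: inner_real2 cq_Suc\<close>)
      show "?u x = ?r" if "(x - ?p) \<bullet> axis 1 1 > 0"
      proof (cases "i = 0")
        case True
        then show ?thesis using that by (auto simp: inner_real2 intro!: u_map_outside)
      next
        case False
        then obtain j where j: "i = Suc j" using not0_implies_Suc by blast
        have "?u x = col \<beta> \<gamma> j"
          by (rule u_map_zone[OF w]) (use that f j in \<open>auto simp: inner_real2 cq_Suc\<close>)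
        then show ?thesis using j by simp
      qed
    qed (use G open_regions in auto)
    moreover have "{s. ?p + s *\<^sub>R axis 2 1 \<in> G \<inter> Vreg i} = vertical_set G i"
      unfolding vertical_set_def Vreg_def using cc_pos by (auto simp: mult.commute)
    ultimately show ?thesis by (simp add: norm_minus_commute jump_def)
  qed
  \<comment> \<open>The second index 0, 1, 2 stands for the upper, lower and vertical side, so that
    one finite disjoint family carries all contributions.\<close>
  define A where "A = (\<lambda>(i,k). G \<inter> (if k = 0 then Ureg i else if k = (1::nat) then Dreg i else Vreg i))"
  have "interface_measure \<alpha> \<beta> \<gamma> n G \<le> (\<Sum>i<n. total_var ?u (G \<inter> Ureg i) + total_var ?u (G \<inter> Dreg i) + total_var ?u (G \<inter> Vreg i))"
    unfolding interface_measure_def distrib_left by (intro sum_mono add_mono U D V)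
  also have "\<dots> = (\<Sum>i<n. \<Sum>k\<in>{0,1,2}. total_var ?u (A (i, k)))" by (simp add: A_def add.assoc)
  also have "\<dots> = (\<Sum>x\<in>{..<n} \<times> {0,1,2}. total_var ?u (A x))"
    unfolding sum.cartesian_product by (rule sum.cong) auto
  also have "\<dots> \<le> total_var ?u G"
  proof (rule total_var_sum_le[OF u1])
    show "A x \<inter> A y = {}" if "x \<in> {..<n} \<times> {0,1,2}" "y \<in> {..<n} \<times> {0,1,2}" "x \<noteq> y" for x y
      using that regions_disjoint[of "fst x" "fst y"] regions_disjoint(4-6)[of "fst y" "fst x"] by (cases x; cases y) (auto simp: A_def)
  qed (auto simp: A_def)
  finally show ?thesis .
qed

section \<open>Adding up the lengths of the sides\<close>

definition total :: "real^2 \<Rightarrow> real^2 \<Rightarrow> real^2 \<Rightarrow> real" where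
  "total \<alpha> \<beta> \<gamma> = 7/3 * norm (\<beta> - \<alpha>) + 2/3 * norm (\<alpha> - \<gamma>) + norm (\<beta> - \<gamma>)"

lemma norm_jump: "norm (jump \<alpha> \<beta> \<gamma> i) = (if i = 0 then norm (\<beta> - \<alpha>) else norm (\<beta> - \<gamma>))"
  by (cases i) (auto simp: jump_def col_def norm_minus_commute)

text \<open>The geometric series in remainder form, so that induction replaces infinite sums. The
  oblique sides of the trapezoids with even index have total length 4/3, those with odd index 2/3;
  \<beta> gains 1 from the side A_0 B_0, and the inner vertical sides have total length 1.\<close>

lemma partial_total:
  "total \<alpha> \<beta> \<gamma> = (\<Sum>i<Suc n. q i * (norm (col \<beta> \<gamma> i - \<alpha>) + norm (jump \<alpha> \<beta> \<gamma> i)))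
    + q (Suc n) * (4/3 * norm (col \<beta> \<gamma> (Suc n) - \<alpha>) + 2/3 * norm (col \<beta> \<gamma> n - \<alpha>) + 2 * norm (\<beta> - \<gamma>))"
proof (induction n)
  case 0
  show ?case by (simp add: total_def q_Suc col_def norm_jump norm_minus_commute) (simp add: field_simps)
next
  case (Suc n)
  have "col \<beta> \<gamma> (Suc (Suc n)) = col \<beta> \<gamma> n" by (simp add: col_def)
  then show ?case using Suc.IH by (simp add: norm_jump q_Suc algebra_simps)
qed

lemma partial_total_le:
  "total \<alpha> \<beta> \<gamma> \<le> (\<Sum>i<Suc n. q i * (norm (col \<beta> \<gamma> i - \<alpha>) + norm (jump \<alpha> \<beta> \<gamma> i)))
    + q n * (norm (\<beta> - \<alpha>) + norm (\<gamma> - \<alpha>) + norm (\<beta> - \<gamma>))"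
proof -
  have "4/3 * norm (col \<beta> \<gamma> (Suc n) - \<alpha>) + 2/3 * norm (col \<beta> \<gamma> n - \<alpha>) + 2 * norm (\<beta> - \<gamma>) \<le> 2 * (norm (\<beta> - \<alpha>) + norm (\<gamma> - \<alpha>) + norm (\<beta> - \<gamma>))"
    using norm_ge_zero[of "\<beta> - \<alpha>"] norm_ge_zero[of "\<gamma> - \<alpha>"] by (cases "even n") (simp_all add: col_def del: norm_ge_zero)
  from mult_left_mono[OF this, of "q (Suc n)"] show ?thesis
    unfolding partial_total[of \<alpha> \<beta> \<gamma> n] by (simp add: q_Suc)
qed

lemma open_slices:
  assumes "open G"
  shows "open (upper_set G i)" "open (lower_set G i)" "open (vertical_set G i)"
proof -
  have v: "open {s. f s \<in> G}" if "continuous_on UNIV f" for f :: "real \<Rightarrow> real^2"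
    using open_vimage[OF assms that] by (simp add: vimage_def)
  have "upper_set G i = {q (Suc i)<..<q i} \<inter> {s. s *\<^sub>R ee \<in> G}" "lower_set G i = {q (Suc i)<..<q i} \<inter> {s. s *\<^sub>R ee' \<in> G}"
    "vertical_set G i = {- (q i / 2)<..<q i / 2} \<inter> {s. (cc * q i) *\<^sub>R axis 1 1 + s *\<^sub>R axis 2 1 \<in> G}"
    by (auto simp: upper_set_def lower_set_def vertical_set_def abs_less_iff)
  moreover have "continuous_on UNIV (\<lambda>s. s *\<^sub>R ee)" "continuous_on UNIV (\<lambda>s. s *\<^sub>R ee')"
    "continuous_on UNIV (\<lambda>s. (cc * q i) *\<^sub>R axis 1 1 + s *\<^sub>R (axis 2 1 :: real^2))" by (intro continuous_intros)+
  ultimately show "open (upper_set G i)" "open (lower_set G i)" "open (vertical_set G i)" using v by auto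
qed

lemma norm_ee [simp]: "norm ee = 1" "norm ee' = 1" "norm nn = 1" "norm nn' = 1" by simp_all

lemma vertical_in_ball: "\<bar>s\<bar> < q i / 2 \<Longrightarrow> (cc * q i) *\<^sub>R axis 1 1 + s *\<^sub>R axis 2 1 \<in> ball (0::real^2) 1"
proof -
  assume s: "\<bar>s\<bar> < q i / 2"
  let ?x = "(cc * q i) *\<^sub>R axis 1 1 + s *\<^sub>R axis 2 1 :: real^2"
  have s2: "s * s < q i * q i / 4" using mult_strict_mono'[OF s s] by simp
  have "?x \<bullet> ?x = (cc * cc) * (q i * q i) + s * s" by (simp add: inner_real2)
  also have "\<dots> < q i * q i" using s2 by (simp add: cc_sq)
  also have "\<dots> \<le> 1" using q_le_1[of i] by (simp add: mult_le_one)
  finally have "(norm ?x)\<^sup>2 < 1\<^sup>2" by (simp add: power2_norm_eq_inner)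
  then have "norm ?x < 1" by (rule power_less_imp_less_base) simp
  then show ?thesis by simp
qed

lemma total_le_total_var: "ennreal (total \<alpha> \<beta> \<gamma>) \<le> total_var (u_map \<alpha> \<beta> \<gamma>) (ball 0 1)"
proof (rule ennreal_le_epsilon)
  fix \<epsilon> :: real assume \<epsilon>: "0 < \<epsilon>"
  define C where "C = norm (\<beta> - \<alpha>) + norm (\<gamma> - \<alpha>) + norm (\<beta> - \<gamma>)"
  \<comment> \<open>Truncate after finitely many trapezoids; the tail is at most \<open>q n\<close>
    times a constant.\<close>
  have "(\<lambda>n. q n * C) \<longlonglongrightarrow> 0" using tendsto_mult_left_zero[OF q_tendsto] .
  from order_tendstoD(2)[OF this \<epsilon>] obtain n where n: "q n * C < \<epsilon>" using eventually_sequentially by auto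
  have us: "upper_set (ball 0 1) i = {q (Suc i)<..<q i}" "lower_set (ball 0 1) i = {q (Suc i)<..<q i}"
    "vertical_set (ball 0 1) i = {- (q i / 2)<..<q i / 2}" for i
  proof -
    have "z *\<^sub>R ee \<in> ball 0 1 \<and> z *\<^sub>R ee' \<in> ball 0 1" if "q (Suc i) < z" "z < q i" for z
      using that q_le_1[of i] less_trans[OF q_pos[of "Suc i"] that(1)] by auto
    then show "upper_set (ball 0 1) i = {q (Suc i)<..<q i}" "lower_set (ball 0 1) i = {q (Suc i)<..<q i}"
      by (auto simp: upper_set_def lower_set_def simp del: mem_ball_0 mem_ball)
    show "vertical_set (ball 0 1) i = {- (q i / 2)<..<q i / 2}"
      unfolding vertical_set_def using vertical_in_ball[of _ i] by (auto simp: abs_less_iff simp del: mem_ball_0 mem_ball)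
  qed
  have "interface_measure \<alpha> \<beta> \<gamma> (Suc n) (ball 0 1) = (\<Sum>i<Suc n. ennreal (q i * (norm (col \<beta> \<gamma> i - \<alpha>) + norm (jump \<alpha> \<beta> \<gamma> i))))"
    unfolding interface_measure_def us
  proof (rule sum.cong)
    fix i
    have "ennreal (norm (col \<beta> \<gamma> i - \<alpha>)) * (emeasure lborel {q (Suc i)<..<q i} + emeasure lborel {q (Suc i)<..<q i}) = ennreal (norm (col \<beta> \<gamma> i - \<alpha>) * q i)"
      using q_pos[of i] by (simp add: q_Suc ennreal_plus[symmetric] ennreal_mult del: ennreal_plus q_pos)
    moreover have "ennreal (norm (jump \<alpha> \<beta> \<gamma> i)) * emeasure lborel {- (q i / 2)<..<q i / 2} = ennreal (norm (jump \<alpha> \<beta> \<gamma> i) * q i)"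
      using q_pos[of i] by (simp add: ennreal_mult del: q_pos)
    ultimately show "ennreal (norm (col \<beta> \<gamma> i - \<alpha>)) * (emeasure lborel {q (Suc i)<..<q i} + emeasure lborel {q (Suc i)<..<q i}) +
      ennreal (norm (jump \<alpha> \<beta> \<gamma> i)) * emeasure lborel {- (q i / 2)<..<q i / 2} = ennreal (q i * (norm (col \<beta> \<gamma> i - \<alpha>) + norm (jump \<alpha> \<beta> \<gamma> i)))"
      using q_pos[of i] by (simp add: ennreal_plus[symmetric] algebra_simps del: ennreal_plus q_pos)
  qed simp
  also have "\<dots> = ennreal (\<Sum>i<Suc n. q i * (norm (col \<beta> \<gamma> i - \<alpha>) + norm (jump \<alpha> \<beta> \<gamma> i)))"
    by (rule sum_ennreal) (simp add: less_imp_le)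
  finally have "ennreal (\<Sum>i<Suc n. q i * (norm (col \<beta> \<gamma> i - \<alpha>) + norm (jump \<alpha> \<beta> \<gamma> i))) \<le> total_var (u_map \<alpha> \<beta> \<gamma>) (ball 0 1)"
    using interface_measure_le_total_var[of "ball 0 1" \<alpha> \<beta> \<gamma> "Suc n"] by simp
  note S = this
  let ?S = "\<Sum>i<Suc n. q i * (norm (col \<beta> \<gamma> i - \<alpha>) + norm (jump \<alpha> \<beta> \<gamma> i))"
  have "ennreal (total \<alpha> \<beta> \<gamma>) \<le> ennreal (?S + \<epsilon>)"
    using partial_total_le[of \<alpha> \<beta> \<gamma> n] n by (intro ennreal_leI) (simp add: C_def)
  also have "\<dots> = ennreal ?S + ennreal \<epsilon>"
    using \<epsilon> by (intro ennreal_plus sum_nonneg mult_nonneg_nonneg add_nonneg_nonneg) simp_all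
  also have "\<dots> \<le> total_var (u_map \<alpha> \<beta> \<gamma>) (ball 0 1) + ennreal \<epsilon>" by (rule add_right_mono[OF S])
  finally show "ennreal (total \<alpha> \<beta> \<gamma>) \<le> total_var (u_map \<alpha> \<beta> \<gamma>) (ball 0 1) + ennreal \<epsilon>" .
qed

section \<open>Smooth approximants\<close>

text \<open>One ramp for each oblique ray. The product vanishes outside the open wedge, so all
  smoothing takes place inside it.\<close>

definition wedge :: "real \<Rightarrow> real^2 \<Rightarrow> real" where
  "wedge \<delta> x = sstep ((x$1 - 2 * cc * x$2) / \<delta>) * sstep ((x$1 + 2 * cc * x$2) / \<delta>)"

definition wedge_grad :: "real \<Rightarrow> real^2 \<Rightarrow> real^2" where
  "wedge_grad \<delta> x = (sstep' ((x$1 - 2 * cc * x$2) / \<delta>) * sstep ((x$1 + 2 * cc * x$2) / \<delta>) / \<delta>) *\<^sub>R vector [1, - 2 * cc]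
     + (sstep ((x$1 - 2 * cc * x$2) / \<delta>) * sstep' ((x$1 + 2 * cc * x$2) / \<delta>) / \<delta>) *\<^sub>R vector [1, 2 * cc]"

definition approximant :: "real^2 \<Rightarrow> (real \<Rightarrow> real^2) \<Rightarrow> real \<Rightarrow> real^2 \<Rightarrow> real^2" where
  "approximant \<alpha> G \<delta> x = \<alpha> + wedge \<delta> x *\<^sub>R G (x$1)"

lemma wedge_bounds: "0 \<le> wedge \<delta> x" "wedge \<delta> x \<le> 1"
  by (auto simp: wedge_def intro!: mult_le_one)

lemma has_derivative_nth: "((\<lambda>x::real^2. x $ i) has_derivative (\<lambda>h. h $ i)) F"
  by (rule bounded_linear_imp_has_derivative[OF bounded_linear_vec_nth])

lemma wedge_has_derivative:
  assumes "0 < \<delta>"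
  shows "(wedge \<delta> has_derivative (\<lambda>h. wedge_grad \<delta> x \<bullet> h)) (at x)"
proof -
  have l: "((\<lambda>x::real^2. (x$1 - 2 * cc * x$2) / \<delta>) has_derivative (\<lambda>h. (h$1 - 2 * cc * h$2) / \<delta>)) (at x)"
     "((\<lambda>x::real^2. (x$1 + 2 * cc * x$2) / \<delta>) has_derivative (\<lambda>h. (h$1 + 2 * cc * h$2) / \<delta>)) (at x)"
    unfolding divide_inverse by (auto intro!: derivative_eq_intros has_derivative_nth)
  have s: "((\<lambda>x. sstep (f x)) has_derivative (\<lambda>h. sstep' (f x) * D h)) (at x)" if "(f has_derivative D) (at x)" for f :: "real^2 \<Rightarrow> real" and D
    using has_derivative_compose[OF that sstep_deriv[of "f x", unfolded has_field_derivative_def]] by simp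
  have "(wedge \<delta> has_derivative (\<lambda>h. sstep ((x$1 - 2 * cc * x$2) / \<delta>) * (sstep' ((x$1 + 2 * cc * x$2) / \<delta>) * ((h$1 + 2 * cc * h$2) / \<delta>))
     + (sstep' ((x$1 - 2 * cc * x$2) / \<delta>) * ((h$1 - 2 * cc * h$2) / \<delta>)) * sstep ((x$1 + 2 * cc * x$2) / \<delta>))) (at x)"
    unfolding wedge_def[abs_def] by (rule has_derivative_mult[OF s[OF l(1)] s[OF l(2)]])
  moreover have "(\<lambda>h. sstep ((x$1 - 2 * cc * x$2) / \<delta>) * (sstep' ((x$1 + 2 * cc * x$2) / \<delta>) * ((h$1 + 2 * cc * h$2) / \<delta>))
     + (sstep' ((x$1 - 2 * cc * x$2) / \<delta>) * ((h$1 - 2 * cc * h$2) / \<delta>)) * sstep ((x$1 + 2 * cc * x$2) / \<delta>)) = (\<lambda>h. wedge_grad \<delta> x \<bullet> h)"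
    by (simp add: wedge_grad_def inner_real2 fun_eq_iff algebra_simps add_divide_distrib diff_divide_distrib)
  ultimately show ?thesis by simp
qed

lemma norm_wedge_vector: "norm (vector [1, - 2 * cc] :: real^2) = 2" "norm (vector [1, 2 * cc] :: real^2) = 2"
proof -
  have "1 + 2 * cc * (2 * cc) = (4::real)" using cc_sq by simp
  then show "norm (vector [1, - 2 * cc] :: real^2) = 2" "norm (vector [1, 2 * cc] :: real^2) = 2"
    by (simp_all add: norm_eq_sqrt_inner inner_real2)
qed

lemma norm_wedge_grad:
  assumes "0 < \<delta>"
  shows "norm (wedge_grad \<delta> x) \<le> 2 * (sstep' ((x$1 - 2 * cc * x$2) / \<delta>) / \<delta>) + 2 * (sstep' ((x$1 + 2 * cc * x$2) / \<delta>) / \<delta>)"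
proof -
  let ?a = "(x$1 - 2 * cc * x$2) / \<delta>" and ?b = "(x$1 + 2 * cc * x$2) / \<delta>"
  have "norm (wedge_grad \<delta> x) \<le> sstep' ?a * sstep ?b / \<delta> * 2 + sstep ?a * sstep' ?b / \<delta> * 2"
    unfolding wedge_grad_def
    by (rule order_trans[OF norm_triangle_ineq]) (use assms norm_wedge_vector in \<open>simp add: abs_mult sstep'_nonneg\<close>)
  moreover have "sstep' ?a * sstep ?b \<le> sstep' ?a * 1" "sstep ?a * sstep' ?b \<le> 1 * sstep' ?b"
    by (intro mult_mono; simp add: sstep'_nonneg)+
  ultimately show ?thesis using assms by (simp add: divide_right_mono order_trans[OF _ add_mono] field_simps)
qed

lemma wedge_zero: "0 < \<delta> \<Longrightarrow> (x::real^2)$1 \<le> 2 * cc * \<bar>x$2\<bar> \<Longrightarrow> wedge \<delta> x = 0 \<and> wedge_grad \<delta> x = 0"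
proof -
  assume \<delta>: "0 < \<delta>" and "(x::real^2)$1 \<le> 2 * cc * \<bar>x$2\<bar>"
  then have "x$1 - 2 * cc * x$2 \<le> 0 \<or> x$1 + 2 * cc * x$2 \<le> 0" by (auto simp: abs_if split: if_splits)
  then have "(x$1 - 2 * cc * x$2) / \<delta> \<le> 0 \<or> (x$1 + 2 * cc * x$2) / \<delta> \<le> 0" using \<delta> by (auto simp: divide_nonpos_pos)
  then show ?thesis by (auto simp: wedge_def wedge_grad_def sstep_0 sstep'_0)
qed

lemma approximant_has_derivative:
  assumes "0 < \<delta>" and G: "\<And>t. (G has_vector_derivative G' t) (at t)"
  shows "(approximant \<alpha> G \<delta> has_derivative (\<lambda>h. wedge \<delta> x *\<^sub>R (h$1 *\<^sub>R G' (x$1)) + (wedge_grad \<delta> x \<bullet> h) *\<^sub>R G (x$1))) (at x)"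
proof -
  have "((\<lambda>x. G (x$1)) has_derivative (\<lambda>h. h$1 *\<^sub>R G' (x$1))) (at x)"
    using has_derivative_compose[OF has_derivative_nth G[unfolded has_vector_derivative_def]] by simp
  from has_derivative_add[OF has_derivative_const[of \<alpha>] has_derivative_scaleR[OF wedge_has_derivative[OF assms(1)] this]]
  show ?thesis unfolding approximant_def[abs_def] by simp
qed

lemma approximant_C1:
  assumes "0 < \<delta>" and G: "\<And>t. (G has_vector_derivative G' t) (at t)" and c: "continuous_on UNIV G'"
  shows "C1_on \<Omega> (approximant \<alpha> G \<delta>)"
proof -
  have n: "C1_on \<Omega> (\<lambda>x::real^2. x$i)" for i by (intro C1_on_linear bounded_linear_vec_nth)
  have "C1_on \<Omega> (\<lambda>x. G (x$1))" by (rule C1_on_compose_real[OF G c n])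
  moreover have "C1_on \<Omega> (wedge \<delta>)" unfolding wedge_def[abs_def] divide_inverse
    by (intro C1_on_mult C1_on_sstep C1_on_add C1_on_diff C1_on_const n)
  ultimately show ?thesis unfolding approximant_def[abs_def] by (intro C1_on_add C1_on_const C1_on_scaleR)
qed

lemma matrix_approximant:
  "matrix (\<lambda>h::real^2. f *\<^sub>R (h$1 *\<^sub>R b) + (v \<bullet> h) *\<^sub>R (a::real^2)) = outer a v + outer (f *\<^sub>R b) (axis 1 1)"
  by (simp add: matrix_def outer_def vec_eq_iff forall_2 inner_real2)

lemma grad_approximant:
  assumes "0 < \<delta>" and G: "\<And>t. (G has_vector_derivative G' t) (at t)"
  shows "grad (approximant \<alpha> G \<delta>) x = outer (G (x$1)) (wedge_grad \<delta> x) + outer (wedge \<delta> x *\<^sub>R G' (x$1)) (axis 1 1)"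
  by (simp only: grad_eq[OF approximant_has_derivative[OF assms]] matrix_approximant)

text \<open>The gradient is a sum of two rank-one matrices, hence the determinant is a multiple of
  the cross product of G and G'. It vanishes wherever these are parallel.\<close>

lemma det_grad_approximant:
  fixes x :: "real^2" and G G' :: "real \<Rightarrow> real^2"
  assumes "0 < \<delta>" and G: "\<And>t. (G has_vector_derivative G' t) (at t)"
  shows "det (grad (approximant \<alpha> G \<delta>) x)
    = - (wedge \<delta> x * wedge_grad \<delta> x$2 * ((G (x$1))$1 * (G' (x$1))$2 - (G (x$1))$2 * (G' (x$1))$1))"
  unfolding grad_approximant[OF assms] det_2 by (simp add: outer_def algebra_simps)

lemma nn_integral_sstep':
  assumes "a \<noteq> 0"
  shows "(\<integral>\<^sup>+t. ennreal (sstep' (b + a * t)) \<partial>lborel) = ennreal (1 / \<bar>a\<bar>)"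
proof -
  have m: "sstep' \<in> borel_measurable borel" by (intro borel_measurable_continuous_onI sstep'_continuous)
  have "(\<integral>\<^sup>+t. ennreal (sstep' t) \<partial>lborel) = (\<integral>\<^sup>+t. ennreal (sstep' t) * indicator {0..1} t \<partial>lborel)"
    by (intro nn_integral_cong) (auto simp: indicator_def sstep'_0 sstep'_1 not_le)
  also have "\<dots> = ennreal (sstep 1 - sstep 0)"
    by (rule nn_integral_FTC_Icc[OF m sstep_deriv sstep'_nonneg]) simp
  finally have 1: "(\<integral>\<^sup>+t. ennreal (sstep' t) \<partial>lborel) = 1" by (simp add: sstep_0 sstep_1)
  have "1 = ennreal \<bar>a\<bar> * (\<integral>\<^sup>+t. ennreal (sstep' (b + a * t)) \<partial>lborel)"
    using nn_integral_real_affine[of "\<lambda>t. ennreal (sstep' t)" a b] assms m 1 by simp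
  then have "ennreal (1 / \<bar>a\<bar>) = ennreal (1 / \<bar>a\<bar>) * (ennreal \<bar>a\<bar> * (\<integral>\<^sup>+t. ennreal (sstep' (b + a * t)) \<partial>lborel))" by simp
  also have "\<dots> = ennreal (1 / \<bar>a\<bar> * \<bar>a\<bar>) * (\<integral>\<^sup>+t. ennreal (sstep' (b + a * t)) \<partial>lborel)"
    by (simp only: ennreal_mult'' abs_ge_zero mult.assoc)
  finally show ?thesis using assms by simp
qed

text \<open>Fubini over vertical lines. Per unit of x$1 each oblique ray has length 1/cc, and at
  abscissa t the wedge has height t/cc. This gives (2 A + B) / cc, whatever the width
  \<delta>.\<close>

lemma nn_integral_grad_approximant_le:
  assumes \<delta>: "0 < \<delta>" and G: "\<And>t. (G has_vector_derivative G' t) (at t)" and c: "continuous_on UNIV G'"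
    and A: "(\<integral>\<^sup>+t. ennreal (norm (G t)) * indicator {0<..} t \<partial>lborel) \<le> ennreal A"
    and B: "(\<integral>\<^sup>+t. ennreal (t * norm (G' t)) * indicator {0<..} t \<partial>lborel) \<le> ennreal B"
    and AB: "0 \<le> A" "0 \<le> B"
  shows "(\<integral>\<^sup>+x. ennreal (norm (grad (approximant \<alpha> G \<delta>) x)) \<partial>lborel) \<le> ennreal ((2 * A + B) / cc)"
proof -
  have cG: "continuous_on UNIV G"
    using G by (meson continuous_at_imp_continuous_on has_vector_derivative_continuous)
  have [measurable]: "G \<in> borel_measurable borel" "G' \<in> borel_measurable borel" "sstep' \<in> borel_measurable borel"
    by (intro borel_measurable_continuous_onI cG c sstep'_continuous)+
  have [measurable]: "(\<lambda>x::real^2. x$i) \<in> borel_measurable borel" for i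
    by (intro borel_measurable_continuous_onI continuous_intros)
  \<comment> \<open>A majorant in which the two oblique ramps and the vertical transitions are
    decoupled, by bounding each remaining ramp factor by 1.\<close>
  define g where "g x = (ennreal (2 * (sstep' ((x$1 - 2 * cc * x$2) / \<delta>) / \<delta>)) + ennreal (2 * (sstep' ((x$1 + 2 * cc * x$2) / \<delta>) / \<delta>)))
      * (ennreal (norm (G (x$1))) * indicator {0<..} (x$1))
    + ennreal (norm (G' (x$1))) * indicator {0<..} (x$1) * indicator {y::real^2. \<bar>y$2\<bar> \<le> y$1 / (2 * cc)} x" for x :: "real^2"
  have set_m [measurable]: "{y::real^2. \<bar>y$2\<bar> \<le> y$1 / (2 * cc)} \<in> sets borel" by measurable
  have gm: "g \<in> borel_measurable borel" unfolding g_def[abs_def] by measurable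
  have le: "ennreal (norm (grad (approximant \<alpha> G \<delta>) x)) \<le> g x" for x
  proof (cases "x$1 \<le> 2 * cc * \<bar>x$2\<bar>")
    case True
    have "outer 0 v = 0" "outer v 0 = 0" for v by (simp_all add: outer_def vec_eq_iff)
    then show ?thesis unfolding grad_approximant[OF \<delta> G] using wedge_zero[OF \<delta> True] by simp
  next
    case False
    then have x: "2 * cc * \<bar>x$2\<bar> < x$1" by simp
    have x0: "x$1 > 0" using x cc_pos by (smt (verit) abs_ge_zero mult_nonneg_nonneg)
    have x2: "\<bar>x$2\<bar> \<le> x$1 / (2 * cc)" using x cc_pos by (simp add: field_simps)
    let ?s = "2 * (sstep' ((x$1 - 2 * cc * x$2) / \<delta>) / \<delta>)" and ?s' = "2 * (sstep' ((x$1 + 2 * cc * x$2) / \<delta>) / \<delta>)"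
    have s0: "0 \<le> ?s" "0 \<le> ?s'" using \<delta> by (simp_all add: sstep'_nonneg)
    have "norm (grad (approximant \<alpha> G \<delta>) x) \<le> norm (G (x$1)) * norm (wedge_grad \<delta> x) + wedge \<delta> x * norm (G' (x$1))"
      unfolding grad_approximant[OF \<delta> G]
      by (rule order_trans[OF norm_triangle_ineq]) (simp add: norm_outer wedge_bounds)
    also have "\<dots> \<le> norm (G (x$1)) * (?s + ?s') + 1 * norm (G' (x$1))"
      by (intro add_mono mult_mono norm_wedge_grad \<delta> wedge_bounds) auto
    finally have "ennreal (norm (grad (approximant \<alpha> G \<delta>) x)) \<le> ennreal (norm (G (x$1)) * (?s + ?s') + norm (G' (x$1)))"
      by (intro ennreal_leI) simp
    also have "\<dots> = ennreal (norm (G (x$1))) * (ennreal ?s + ennreal ?s') + ennreal (norm (G' (x$1)))"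
      using s0 by (simp add: ennreal_plus ennreal_mult)
    also have "\<dots> = g x" using x0 x2 by (simp add: g_def mult.commute)
    finally show ?thesis .
  qed
  have ax: "(p::real^2) + s *\<^sub>R axis 1 1 + t *\<^sub>R axis 2 1 = p + s *\<^sub>R axis 1 1 + t *\<^sub>R axis 2 1" for p s t by simp
  \<comment> \<open>Substitution in a ramp yields 2/\<delta> times \<delta>/(2 cc), so the width
    cancels.\<close>
  have in1: "(\<integral>\<^sup>+t. ennreal (2 * (sstep' ((s - 2 * cc * t) / \<delta>) / \<delta>)) \<partial>lborel) = ennreal (1 / cc)"
    "(\<integral>\<^sup>+t. ennreal (2 * (sstep' ((s + 2 * cc * t) / \<delta>) / \<delta>)) \<partial>lborel) = ennreal (1 / cc)" for s
  proof -
    have e: "ennreal (2 * (sstep' z / \<delta>)) = ennreal (2 / \<delta>) * ennreal (sstep' z)" for z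
      using \<delta> by (simp add: ennreal_mult[symmetric] sstep'_nonneg)
    have f: "(s - 2 * cc * t) / \<delta> = s / \<delta> + (- 2 * cc / \<delta>) * t" "(s + 2 * cc * t) / \<delta> = s / \<delta> + (2 * cc / \<delta>) * t" for t
      using \<delta> by (simp_all add: field_simps)
    have h: "ennreal (2 / \<delta>) * ennreal (1 / \<bar>- 2 * cc / \<delta>\<bar>) = ennreal (1 / cc)" "ennreal (2 / \<delta>) * ennreal (1 / \<bar>2 * cc / \<delta>\<bar>) = ennreal (1 / cc)"
      using \<delta> cc_pos by (simp_all add: ennreal_mult[symmetric])
    have nz: "- 2 * cc / \<delta> \<noteq> 0" "2 * cc / \<delta> \<noteq> 0" using \<delta> cc_pos by auto
    have "(\<integral>\<^sup>+t. ennreal (2 * (sstep' ((s - 2 * cc * t) / \<delta>) / \<delta>)) \<partial>lborel) = ennreal (2 / \<delta>) * (\<integral>\<^sup>+t. ennreal (sstep' (s / \<delta> + (- 2 * cc / \<delta>) * t)) \<partial>lborel)"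
      unfolding e f by (rule nn_integral_cmult) measurable
    then show "(\<integral>\<^sup>+t. ennreal (2 * (sstep' ((s - 2 * cc * t) / \<delta>) / \<delta>)) \<partial>lborel) = ennreal (1 / cc)"
      unfolding nn_integral_sstep'[OF nz(1)] h .
    have "(\<integral>\<^sup>+t. ennreal (2 * (sstep' ((s + 2 * cc * t) / \<delta>) / \<delta>)) \<partial>lborel) = ennreal (2 / \<delta>) * (\<integral>\<^sup>+t. ennreal (sstep' (s / \<delta> + (2 * cc / \<delta>) * t)) \<partial>lborel)"
      unfolding e f by (rule nn_integral_cmult) measurable
    then show "(\<integral>\<^sup>+t. ennreal (2 * (sstep' ((s + 2 * cc * t) / \<delta>) / \<delta>)) \<partial>lborel) = ennreal (1 / cc)"
      unfolding nn_integral_sstep'[OF nz(2)] h .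
  qed
  have inner: "(\<integral>\<^sup>+t. g (0 + s *\<^sub>R axis 1 1 + t *\<^sub>R axis 2 1) \<partial>lborel)
    \<le> ennreal (2 / cc) * (ennreal (norm (G s)) * indicator {0<..} s) + ennreal (1 / cc) * (ennreal (s * norm (G' s)) * indicator {0<..} s)" for s
  proof -
    have "(\<integral>\<^sup>+t. g (0 + s *\<^sub>R axis 1 1 + t *\<^sub>R axis 2 1) \<partial>lborel) =
      (\<integral>\<^sup>+t. (ennreal (2 * (sstep' ((s - 2 * cc * t) / \<delta>) / \<delta>)) + ennreal (2 * (sstep' ((s + 2 * cc * t) / \<delta>) / \<delta>))) * (ennreal (norm (G s)) * indicator {0<..} s)
        + ennreal (norm (G' s)) * indicator {0<..} s * indicator {- (s / (2 * cc))..s / (2 * cc)} t \<partial>lborel)"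
      unfolding g_def by (intro nn_integral_cong) (auto simp: indicator_def abs_le_iff)
    also have "\<dots> = (ennreal (1 / cc) + ennreal (1 / cc)) * (ennreal (norm (G s)) * indicator {0<..} s)
        + ennreal (norm (G' s)) * indicator {0<..} s * emeasure lborel {- (s / (2 * cc))..s / (2 * cc)}"
    proof -
      have "(\<integral>\<^sup>+t. (f t + h t) * c + d * indicator X t \<partial>lborel) = (integral\<^sup>N lborel f + integral\<^sup>N lborel h) * c + d * emeasure lborel X"
        if [measurable]: "f \<in> borel_measurable borel" "h \<in> borel_measurable borel" "X \<in> sets borel" for f h :: "real \<Rightarrow> ennreal" and c d X
        by (simp add: nn_integral_add nn_integral_multc nn_integral_cmult_indicator)
      note this[where f="\<lambda>t. ennreal (2 * (sstep' ((s - 2 * cc * t) / \<delta>) / \<delta>))" and h="\<lambda>t. ennreal (2 * (sstep' ((s + 2 * cc * t) / \<delta>) / \<delta>))" and X="{- (s / (2 * cc))..s / (2 * cc)}"]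
      note this[of "ennreal (norm (G s)) * indicator {0<..} s" "ennreal (norm (G' s)) * indicator {0<..} s"]
      moreover have "(\<lambda>t. ennreal (2 * (sstep' ((s - 2 * cc * t) / \<delta>) / \<delta>))) \<in> borel_measurable borel"
        "(\<lambda>t. ennreal (2 * (sstep' ((s + 2 * cc * t) / \<delta>) / \<delta>))) \<in> borel_measurable borel" by measurable
      ultimately show ?thesis unfolding in1 by simp
    qed
    also have "\<dots> \<le> ennreal (2 / cc) * (ennreal (norm (G s)) * indicator {0<..} s) + ennreal (1 / cc) * (ennreal (s * norm (G' s)) * indicator {0<..} s)"
    proof (cases "s > 0")
      case True
      then have "emeasure lborel {- (s / (2 * cc))..s / (2 * cc)} = ennreal (1 / cc * s)" using cc_pos by simp
      moreover have "ennreal (1 / cc) + ennreal (1 / cc) = ennreal (2 / cc)"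
        using cc_pos by (simp add: ennreal_plus[symmetric] del: ennreal_plus)
      moreover have "ennreal (norm (G' s)) * ennreal (1 / cc * s) = ennreal (1 / cc) * ennreal (s * norm (G' s))"
        using cc_pos True by (simp add: ennreal_mult[symmetric] mult_ac)
      ultimately show ?thesis using True by simp
    qed simp
    finally show ?thesis .
  qed
  have "(\<integral>\<^sup>+x. ennreal (norm (grad (approximant \<alpha> G \<delta>) x)) \<partial>lborel) \<le> (\<integral>\<^sup>+x. g x \<partial>lborel)" by (intro nn_integral_mono le)
  also have "\<dots> = (\<integral>\<^sup>+s. \<integral>\<^sup>+t. g (0 + s *\<^sub>R axis 1 1 + t *\<^sub>R axis 2 1) \<partial>lborel \<partial>lborel)" by (rule axes.nn_integral_frame[OF gm])
  also have "\<dots> \<le> (\<integral>\<^sup>+s. ennreal (2 / cc) * (ennreal (norm (G s)) * indicator {0<..} s) + ennreal (1 / cc) * (ennreal (s * norm (G' s)) * indicator {0<..} s) \<partial>lborel)"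
    by (intro nn_integral_mono inner)
  also have "\<dots> = ennreal (2 / cc) * (\<integral>\<^sup>+s. ennreal (norm (G s)) * indicator {0<..} s \<partial>lborel) + ennreal (1 / cc) * (\<integral>\<^sup>+s. ennreal (s * norm (G' s)) * indicator {0<..} s \<partial>lborel)"
    by (subst nn_integral_add) (auto simp: nn_integral_cmult)
  also have "\<dots> \<le> ennreal (2 / cc) * ennreal A + ennreal (1 / cc) * ennreal B"
    by (intro add_mono mult_left_mono A B) auto
  also have "\<dots> = ennreal (2 / cc * A + 1 / cc * B)" using AB cc_pos
    by (simp only: ennreal_mult[symmetric] ennreal_plus[symmetric] mult_nonneg_nonneg divide_nonneg_pos zero_le_numeral zero_le_one)
  also have "2 / cc * A + 1 / cc * B = (2 * A + B) / cc" using cc_pos by (simp add: add_divide_distrib)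
  finally show ?thesis .
qed

text \<open>The ramp occupies the interval from \<tau> - \<delta> to \<tau> and ends exactly at
  \<tau>; in this way the profiles vanish to the right of A_0 B_0.\<close>

definition step_at :: "real \<Rightarrow> real \<Rightarrow> real \<Rightarrow> real" where
  "step_at \<delta> \<tau> t = sstep ((\<tau> - t) / \<delta>)"

lemma step_at_deriv: "0 < \<delta> \<Longrightarrow> (step_at \<delta> \<tau> has_real_derivative - (sstep' ((\<tau> - t) / \<delta>) / \<delta>)) (at t)"
proof -
  assume \<delta>: "0 < \<delta>"
  have "((\<lambda>t. (\<tau> - t) / \<delta>) has_real_derivative - (1 / \<delta>)) (at t)"
    using \<delta> by (auto intro!: derivative_eq_intros)
  from DERIV_chain2[OF sstep_deriv this] show ?thesis unfolding step_at_def[abs_def] by simp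
qed

lemma step_at_bounds: "0 \<le> step_at \<delta> \<tau> t" "step_at \<delta> \<tau> t \<le> 1" by (simp_all add: step_at_def)

lemma step_at_0: "0 < \<delta> \<Longrightarrow> \<tau> \<le> t \<Longrightarrow> step_at \<delta> \<tau> t = 0" and step_at_1: "0 < \<delta> \<Longrightarrow> t \<le> \<tau> - \<delta> \<Longrightarrow> step_at \<delta> \<tau> t = 1"
  by (auto simp: step_at_def intro!: sstep_0 sstep_1 simp: divide_nonpos_pos pos_le_divide_eq)

lemma step_at_mono: "0 < \<delta> \<Longrightarrow> \<tau> \<le> \<tau>' \<Longrightarrow> step_at \<delta> \<tau> t \<le> step_at \<delta> \<tau>' t"
  unfolding step_at_def by (intro sstep_mono divide_right_mono) auto

text \<open>The slope has total mass 1 and lives to the left of \<tau>, where the weight t is at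
  most \<tau>.\<close>

lemma nn_integral_step_deriv_le:
  assumes "0 < \<delta>" "0 \<le> \<tau>" "0 \<le> d"
  shows "(\<integral>\<^sup>+t. ennreal (t * (d * (sstep' ((\<tau> - t) / \<delta>) / \<delta>))) * indicator {0<..} t \<partial>lborel) \<le> ennreal (d * \<tau>)"
proof -
  have [measurable]: "sstep' \<in> borel_measurable borel" by (intro borel_measurable_continuous_onI sstep'_continuous)
  have "ennreal (t * (d * (sstep' ((\<tau> - t) / \<delta>) / \<delta>))) * indicator {0<..} t \<le> ennreal (d * \<tau> / \<delta>) * ennreal (sstep' (\<tau> / \<delta> + (- 1 / \<delta>) * t))" for t
  proof (cases "0 < t \<and> t < \<tau>")
    case True
    have "t * (d * (sstep' ((\<tau> - t) / \<delta>) / \<delta>)) \<le> \<tau> * (d * (sstep' ((\<tau> - t) / \<delta>) / \<delta>))"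
      using True assms by (intro mult_right_mono) (auto simp: sstep'_nonneg)
    moreover have "(\<tau> - t) / \<delta> = \<tau> / \<delta> + (- 1 / \<delta>) * t" by (simp add: diff_divide_distrib)
    ultimately have "t * (d * (sstep' ((\<tau> - t) / \<delta>) / \<delta>)) \<le> d * \<tau> / \<delta> * sstep' (\<tau> / \<delta> + (- 1 / \<delta>) * t)" by (simp add: mult_ac)
    then show ?thesis using True assms by (simp add: ennreal_mult[symmetric] sstep'_nonneg ennreal_leI)
  next
    case False
    then consider "t \<le> 0" | "t \<ge> \<tau>" by linarith
    then show ?thesis
    proof cases
      case 2
      then have "sstep' ((\<tau> - t) / \<delta>) = 0" using assms by (intro sstep'_0) (simp add: divide_nonpos_pos)
      then show ?thesis by simp
    qed simp
  qed
  then have "(\<integral>\<^sup>+t. ennreal (t * (d * (sstep' ((\<tau> - t) / \<delta>) / \<delta>))) * indicator {0<..} t \<partial>lborel)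
     \<le> (\<integral>\<^sup>+t. ennreal (d * \<tau> / \<delta>) * ennreal (sstep' (\<tau> / \<delta> + (- 1 / \<delta>) * t)) \<partial>lborel)" by (rule nn_integral_mono)
  also have "\<dots> = ennreal (d * \<tau> / \<delta>) * (\<integral>\<^sup>+t. ennreal (sstep' (\<tau> / \<delta> + (- 1 / \<delta>) * t)) \<partial>lborel)"
    by (rule nn_integral_cmult) measurable
  also have "\<dots> = ennreal (d * \<tau> / \<delta>) * ennreal (1 / \<bar>- 1 / \<delta>\<bar>)" using assms by (subst nn_integral_sstep') auto
  also have "\<dots> = ennreal (d * \<tau>)" using assms by (simp add: ennreal_mult[symmetric])
  finally show ?thesis .
qed

section \<open>Strict convergence near a triple point\<close>

lemma A_pt_inner: "A_pt i \<bullet> nn = 0" "A_pt i $ 1 = cc * q i" "A_pt i $ 2 = q i / 2"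
  by (simp_all add: A_pt_eq inner_nn mult.commute)

lemma A_pt_ball_subset:
  assumes "i \<ge> 1" "r \<le> q i / 2"
  shows "cball (A_pt i) r \<subseteq> ball 0 1"
proof
  fix x assume "x \<in> cball (A_pt i) r"
  then have "norm (x - A_pt i) \<le> r" by (simp add: dist_norm norm_minus_commute)
  moreover have "norm (A_pt i) = q i" by (simp add: A_pt_eq)
  ultimately have "norm x \<le> q i + q i / 2" using assms(2) norm_triangle_ineq[of "A_pt i" "x - A_pt i"] by simp
  moreover have "q i \<le> 1 / 2" using q_less[of 0 i] assms(1) by simp
  ultimately show "x \<in> ball 0 1" by simp
qed

text \<open>The radius q i / 2 is the distance from A_i to the next vertex A_(i+1). Up to it, the
  ball meets no part of the interface except the three rays at A_i.\<close>

lemma u_map_near_A_pt: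
  fixes x :: "real^2"
  assumes i: "i \<ge> 1" and r: "r \<le> q i / 2" and x: "x \<in> ball (A_pt i) r"
  shows "(x - A_pt i) \<bullet> nn > 0 \<Longrightarrow> u_map \<alpha> \<beta> \<gamma> x = \<alpha>"
    "(x - A_pt i) \<bullet> nn < 0 \<Longrightarrow> (x - A_pt i)$1 > 0 \<Longrightarrow> u_map \<alpha> \<beta> \<gamma> x = col \<beta> \<gamma> (i - 1)"
    "(x - A_pt i) \<bullet> nn < 0 \<Longrightarrow> (x - A_pt i)$1 < 0 \<Longrightarrow> u_map \<alpha> \<beta> \<gamma> x = col \<beta> \<gamma> i"
proof -
  define y where "y = x - A_pt i"
  have ny: "norm y < q i / 2" using x r by (simp add: y_def dist_norm norm_minus_commute)
  have e: "(x - A_pt i) \<bullet> nn = cc * x$2 - x$1 / 2" "(x - A_pt i)$1 = x$1 - cc * q i"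
    by (simp_all add: inner_nn A_pt_inner) (simp_all add: field_simps)
  show "u_map \<alpha> \<beta> \<gamma> x = \<alpha>" if "(x - A_pt i) \<bullet> nn > 0"
  proof (rule u_map_outside, rule disjI1)
    show "\<not> 2 * cc * \<bar>x$2\<bar> \<le> x$1" unfolding wedge_iff using that e(1) by linarith
  qed
  \<comment> \<open>A_i is at distance cc q i from the lower ray, which is more than the
    radius.\<close>
  have low: "- (2 * (cc * x$2)) \<le> x$1"
  proof -
    have "\<bar>y \<bullet> nn'\<bar> \<le> norm y * norm nn'" by (rule Cauchy_Schwarz_ineq2)
    then have "y \<bullet> nn' < q i / 2" using ny by simp
    moreover have "y \<bullet> nn' = - (cc * x$2) - x$1 / 2 + cc * q i"
      by (simp add: y_def inner_real2 A_pt_inner) (simp add: field_simps)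
    moreover have "q i / 2 < cc * q i" using cc_bounds(1) mult_strict_right_mono[of "1/2" cc "q i"] by simp
    ultimately show ?thesis by linarith
  qed
  have y1: "\<bar>y$1\<bar> < q i / 2" using ny component_le_norm_cart[of y 1] by simp
  have cq: "q i / 2 < cc * q i" using cc_bounds(1) mult_strict_right_mono[of "1/2" cc "q i"] by simp
  show "u_map \<alpha> \<beta> \<gamma> x = col \<beta> \<gamma> (i - 1)" if "(x - A_pt i) \<bullet> nn < 0" "(x - A_pt i)$1 > 0"
  proof (rule u_map_zone)
    have k: "cc * q (Suc (i - 1)) = cc * q (i - 1) / 2" "Suc (i - 1) = i" using cq_Suc[of "i - 1"] i by simp_all
    have "x$1 - cc * q i < q i / 2" using y1 unfolding y_def e(2) by linarith
    then show "x$1 \<le> cc * q (i - 1)" using k(1) cq unfolding k(2) by linarith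
    show "cc * q (Suc (i - 1)) < x$1" using that(2) unfolding k(2) e(2) by linarith
    show "2 * cc * \<bar>x$2\<bar> \<le> x$1" unfolding wedge_iff using that(1) e(1) low by auto
  qed
  show "u_map \<alpha> \<beta> \<gamma> x = col \<beta> \<gamma> i" if "(x - A_pt i) \<bullet> nn < 0" "(x - A_pt i)$1 < 0"
  proof (rule u_map_zone)
    show "x$1 \<le> cc * q i" using that(2) e(2) by simp
    show "2 * cc * \<bar>x$2\<bar> \<le> x$1" unfolding wedge_iff using that(1) e(1) low by auto
    show "cc * q (Suc i) < x$1"
    proof (rule ccontr)
      assume "\<not> cc * q (Suc i) < x$1"
      \<comment> \<open>The offset from A_i would then be at least cc q i / 2 to the left and q i /
        4 downwards, hence of length at least q i / 2.\<close>
      then have x1: "x$1 \<le> cc * (q i / 2)" by (simp add: q_Suc)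
      then have "cc * x$2 < cc * (q i / 4)" using that(1) e(1) by simp
      then have "x$2 < q i / 4" using cc_pos by (simp only: mult_less_cancel_left_pos)
      then have a: "q i / 4 \<le> - y$2" by (simp add: y_def A_pt_inner)
      have b: "cc * (q i / 2) \<le> - y$1" using x1 by (simp add: y_def A_pt_inner)
      have c0: "0 \<le> cc * (q i / 2)" "0 \<le> q i / 4" using cc_pos by simp_all
      have "(cc * (q i / 2)) * (cc * (q i / 2)) = (cc * cc) * (q i * q i) / 4" by (simp add: field_simps)
      then have 1: "3/16 * (q i * q i) \<le> (- y$1) * (- y$1)" using mult_mono'[OF b b c0(1) c0(1)] unfolding cc_sq by linarith
      have "(q i / 4) * (q i / 4) = q i * q i / 16" by (simp add: field_simps)
      then have 2: "q i * q i / 16 \<le> (- y$2) * (- y$2)" using mult_mono'[OF a a c0(2) c0(2)] by linarith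
      have "y \<bullet> y = (- y$1) * (- y$1) + (- y$2) * (- y$2)" by (simp add: inner_real2)
      then have "q i * q i / 4 \<le> y \<bullet> y" using 1 2 by linarith
      moreover have "y \<bullet> y = norm y * norm y" by (simp add: power2_norm_eq_inner[symmetric] power2_eq_square)
      moreover have "norm y * norm y < (q i / 2) * (q i / 2)" using ny by (intro mult_strict_mono') auto
      ultimately show False by simp
    qed
  qed
qed

lemma three_sectors_A_pt:
  assumes "i \<ge> 1" "0 < r" "r \<le> q i / 2"
  shows "three_sectors (A_pt i) r (u_map \<alpha> \<beta> \<gamma>) \<alpha> (col \<beta> \<gamma> (i - 1)) (col \<beta> \<gamma> i)"
  using assms u_map_near_A_pt[OF assms(1,3)] by unfold_locales (auto intro!: u_map_L1)

section \<open>Variation inside and outside a small ball at a triple point\<close>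

definition local_total :: "real^2 \<Rightarrow> real^2 \<Rightarrow> real^2 \<Rightarrow> nat \<Rightarrow> real" where
  "local_total \<alpha> \<beta> \<gamma> i = norm (col \<beta> \<gamma> (i - 1) - \<alpha>) + norm (col \<beta> \<gamma> i - \<alpha>) + norm (col \<beta> \<gamma> (i - 1) - col \<beta> \<gamma> i)"

lemma not_in_cball:
  fixes x :: "real^2"
  assumes "0 \<le> r" "r * r < (x - p) \<bullet> (x - p)"
  shows "x \<notin> cball p r"
proof
  assume "x \<in> cball p r"
  then have "norm (x - p) \<le> r" by (simp add: dist_norm norm_minus_commute)
  then have "norm (x - p) * norm (x - p) \<le> r * r" using assms by (intro mult_mono) auto
  then show False using assms(2) by (simp add: power2_norm_eq_inner[symmetric] power2_eq_square)
qed

text \<open>Removing the ball costs a length r on the three sides that end at A_i and nothing on any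
  other. The remaining work is to check that all other sides keep a distance greater than r from
  A_i.\<close>

lemma slices_outside_cball:
  assumes i: "i \<ge> 1" and r: "0 < r" "r < q i / 2"
  defines "G \<equiv> ball 0 1 - cball (A_pt i) r"
  shows "j \<noteq> i \<Longrightarrow> j \<noteq> i - 1 \<Longrightarrow> {q (Suc j)<..<q j} \<subseteq> upper_set G j"
    "{q i + r<..<q (i - 1)} \<subseteq> upper_set G (i - 1)" "{q (Suc i)<..<q i - r} \<subseteq> upper_set G i"
    "{q (Suc j)<..<q j} \<subseteq> lower_set G j"
    "j \<noteq> i \<Longrightarrow> {- (q j / 2)<..<q j / 2} \<subseteq> vertical_set G j"
    "{- (q i / 2)<..<q i / 2 - r} \<subseteq> vertical_set G i"
proof -
  have rr: "r * r < q i * q i / 4" using r mult_strict_mono'[OF r(2) r(2)] by simp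
  have lin1: "x < 3/4 * z + y" if "x < z / 4" "0 \<le> y" "0 \<le> z" for x y z :: real using that by linarith
  have lin2: "x < 3/4 * y + y'" if "x < z / 4" "z / 4 \<le> y" "y / 4 \<le> y'" for x y z y' :: real using that by linarith
  have up: "s *\<^sub>R ee \<in> G" if "0 < s" "s < 1" "\<bar>s - q i\<bar> > r" for s
  proof -
    have "s *\<^sub>R ee - A_pt i = (s - q i) *\<^sub>R ee" by (simp add: A_pt_eq scaleR_diff_left)
    then have "norm (s *\<^sub>R ee - A_pt i) > r" using that by simp
    then show ?thesis using that unfolding G_def by (simp add: dist_norm norm_minus_commute)
  qed
  have i1: "q i = q (i - 1) / 2" using q_Suc[of "i - 1"] i by simp
  have pos: "0 < s \<and> s < 1" if "q (Suc j) < s" "s < q j" for s j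
    using that q_le_1[of j] less_trans[OF q_pos that(1)] by simp
  show "{q (Suc j)<..<q j} \<subseteq> upper_set G j" if j: "j \<noteq> i" "j \<noteq> i - 1"
  proof
    fix s assume s: "s \<in> {q (Suc j)<..<q j}"
    consider "j < i - 1" | "i < j" using j by linarith
    then have "\<bar>s - q i\<bar> > r"
    proof cases
      case 1
      then have "q (i - 1) \<le> q (Suc j)" unfolding q_def by (intro power_decreasing) auto
      then show ?thesis using s r i1 by (simp add: q_Suc)
    next
      case 2
      then have "q j \<le> q i / 2" by (rule q_less)
      then show ?thesis using s r by simp
    qed
    then show "s \<in> upper_set G j" using s pos[of j s] up by (auto simp: upper_set_def)
  qed
  show "{q i + r<..<q (i - 1)} \<subseteq> upper_set G (i - 1)"
  proof
    fix s assume s: "s \<in> {q i + r<..<q (i - 1)}"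
    then have "q (Suc (i - 1)) < s" "s < q (i - 1)" using r i by auto
    then show "s \<in> upper_set G (i - 1)" using s r pos[of "i - 1" s] up[of s] by (auto simp: upper_set_def)
  qed
  show "{q (Suc i)<..<q i - r} \<subseteq> upper_set G i"
  proof
    fix s assume s: "s \<in> {q (Suc i)<..<q i - r}"
    then have "q (Suc i) < s" "s < q i" using r by auto
    then show "s \<in> upper_set G i" using s r pos[of i s] up[of s] by (auto simp: upper_set_def)
  qed
  show "{q (Suc j)<..<q j} \<subseteq> lower_set G j"
  proof
    \<comment> \<open>The squared distance from A_i to a point of the lower ray is (s - q i / 2)^2
      plus 3/4 of the square of q i, well above r^2.\<close>
    fix s assume s: "s \<in> {q (Suc j)<..<q j}"
    have "(s *\<^sub>R ee' - A_pt i) \<bullet> (s *\<^sub>R ee' - A_pt i) = (cc * cc) * ((s - q i) * (s - q i)) + (s + q i) * (s + q i) / 4"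
      by (simp add: inner_real2 A_pt_inner) (simp add: algebra_simps)
    also have "\<dots> = (s - q i / 2) * (s - q i / 2) + 3/4 * (q i * q i)" unfolding cc_sq by (simp add: field_simps)
    finally have e: "(s *\<^sub>R ee' - A_pt i) \<bullet> (s *\<^sub>R ee' - A_pt i) = (s - q i / 2) * (s - q i / 2) + 3/4 * (q i * q i)" .
    have "r * r < (s *\<^sub>R ee' - A_pt i) \<bullet> (s *\<^sub>R ee' - A_pt i)"
      unfolding e using lin1[OF rr zero_le_square[of "s - q i / 2"] zero_le_square[of "q i"]] by linarith
    then have "s *\<^sub>R ee' \<notin> cball (A_pt i) r" using r by (intro not_in_cball) auto
    moreover have "s *\<^sub>R ee' \<in> ball 0 1" using pos[of j s] s by simp
    ultimately show "s \<in> lower_set G j" using s unfolding lower_set_def G_def by (auto simp del: mem_ball mem_cball mem_ball_0)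
  qed
  have vd: "((cc * q j) *\<^sub>R axis 1 1 + s *\<^sub>R axis 2 1 - A_pt i) \<bullet> ((cc * q j) *\<^sub>R axis 1 1 + s *\<^sub>R axis 2 1 - A_pt i)
      = 3/4 * ((q j - q i) * (q j - q i)) + (s - q i / 2) * (s - q i / 2)" for s j
  proof -
    have "((cc * q j) *\<^sub>R axis 1 1 + s *\<^sub>R axis 2 1 - A_pt i) \<bullet> ((cc * q j) *\<^sub>R axis 1 1 + s *\<^sub>R axis 2 1 - A_pt i)
      = (cc * cc) * ((q j - q i) * (q j - q i)) + (s - q i / 2) * (s - q i / 2)"
      by (simp add: inner_real2 A_pt_inner) (simp add: algebra_simps)
    then show ?thesis by (simp add: cc_sq)
  qed
  show "{- (q j / 2)<..<q j / 2} \<subseteq> vertical_set G j" if j: "j \<noteq> i"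
  proof
    fix s assume s: "s \<in> {- (q j / 2)<..<q j / 2}"
    have "r * r < 3/4 * ((q j - q i) * (q j - q i)) + (s - q i / 2) * (s - q i / 2)"
    proof (cases "j < i")
      case True
      have h: "q i \<le> q j - q i" using q_less[OF True] q_pos[of i] by linarith
      have "q i * q i \<le> (q j - q i) * (q j - q i)" by (rule mult_mono'[OF h h q_nonneg q_nonneg])
      then have "r * r < (q j - q i) * (q j - q i) / 4" using rr by linarith
      from lin1[OF this zero_le_square[of "s - q i / 2"] zero_le_square[of "q j - q i"]] show ?thesis by linarith
    next
      case False
      \<comment> \<open>For the smaller triangles the horizontal gap supplies at least 3/16 of the
        square of q i, and the vertical gap supplies the missing 1/16.\<close>
      then have ij: "i < j" using j by simp
      have d: "q i / 2 \<le> q i - q j" using q_less[OF ij] by linarith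
      have "(q i / 2) * (q i / 2) \<le> (q i - q j) * (q i - q j)" by (rule mult_mono'[OF d d]) simp_all
      then have 1: "q i * q i / 4 \<le> (q j - q i) * (q j - q i)" by (simp add: algebra_simps)
      have "s < q j / 2" using s by simp
      then have h1: "(q i - q j) / 2 \<le> q i / 2 - s" by (simp add: diff_divide_distrib)
      have h2: "0 \<le> (q i - q j) / 2" using order_trans[OF _ d, of 0] by simp
      have "((q i - q j) / 2) * ((q i - q j) / 2) \<le> (q i / 2 - s) * (q i / 2 - s)" by (rule mult_mono'[OF h1 h1 h2 h2])
      then have 2: "(q j - q i) * (q j - q i) / 4 \<le> (s - q i / 2) * (s - q i / 2)" by (simp add: algebra_simps)
      show ?thesis by (rule lin2[OF rr 1 2])
    qed
    then have "(cc * q j) *\<^sub>R axis 1 1 + s *\<^sub>R axis 2 1 \<notin> cball (A_pt i) r" using r vd[of j s] by (intro not_in_cball) auto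
    moreover have "(cc * q j) *\<^sub>R axis 1 1 + s *\<^sub>R axis 2 1 \<in> ball (0::real^2) 1" using s by (intro vertical_in_ball) (auto simp: abs_less_iff)
    ultimately show "s \<in> vertical_set G j" using s unfolding vertical_set_def G_def by (auto simp: abs_less_iff simp del: mem_ball mem_cball mem_ball_0)
  qed
  show "{- (q i / 2)<..<q i / 2 - r} \<subseteq> vertical_set G i"
  proof
    fix s assume s: "s \<in> {- (q i / 2)<..<q i / 2 - r}"
    have "r < q i / 2 - s" using s by simp
    then have "r * r < (q i / 2 - s) * (q i / 2 - s)" using r by (intro mult_strict_mono') auto
    then have "r * r < (s - q i / 2) * (s - q i / 2)" by (simp add: algebra_simps)
    then have "(cc * q i) *\<^sub>R axis 1 1 + s *\<^sub>R axis 2 1 \<notin> cball (A_pt i) r" using r vd[of i s] by (intro not_in_cball) auto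
    moreover have "(cc * q i) *\<^sub>R axis 1 1 + s *\<^sub>R axis 2 1 \<in> ball (0::real^2) 1" using s r by (intro vertical_in_ball) (auto simp: abs_less_iff)
    ultimately show "s \<in> vertical_set G i" using s r unfolding vertical_set_def G_def by (auto simp: abs_less_iff simp del: mem_ball mem_cball mem_ball_0)
  qed
qed

text \<open>What is cut off is exactly r times the three jumps at A_i. The bound is thus sharp, and
  strict convergence leaves just this amount for the ball.\<close>

lemma total_var_complement:
  assumes i: "i \<ge> 1" and r: "0 < r" "r < q i / 2"
  shows "ennreal (total \<alpha> \<beta> \<gamma>) \<le> total_var (u_map \<alpha> \<beta> \<gamma>) (ball 0 1 - cball (A_pt i) r) + ennreal (r * local_total \<alpha> \<beta> \<gamma> i)"
proof (rule ennreal_le_epsilon)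
  fix \<epsilon> :: real assume \<epsilon>: "0 < \<epsilon>"
  define G where "G = ball 0 1 - cball (A_pt i) r"
  have oG: "open G" "bounded G" unfolding G_def by (auto intro: open_Diff bounded_subset[OF bounded_ball])
  define C where "C = norm (\<beta> - \<alpha>) + norm (\<gamma> - \<alpha>) + norm (\<beta> - \<gamma>)"
  have "(\<lambda>n. q n * C) \<longlonglongrightarrow> 0" using tendsto_mult_left_zero[OF q_tendsto] .
  then have "eventually (\<lambda>n. q n * C < \<epsilon> \<and> i < n) sequentially" using \<epsilon>
    by (intro eventually_conj order_tendstoD(2) eventually_gt_at_top)
  then obtain n where n: "q n * C < \<epsilon>" "i < n" using eventually_sequentially by auto
  note sl = slices_outside_cball[OF i r, folded G_def]
  have bm: "upper_set G j \<in> sets lborel" "lower_set G j \<in> sets lborel" "vertical_set G j \<in> sets lborel" for j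
    using open_slices[OF oG(1)] by auto
  \<comment> \<open>The loss at index j: the oblique side to the right of A_i belongs to index i -
    1, while the one to its left and the vertical side belong to index i.\<close>
  define cost where "cost j = (if j = i - 1 then r * norm (col \<beta> \<gamma> j - \<alpha>) else 0) + (if j = i then r * (norm (col \<beta> \<gamma> j - \<alpha>) + norm (jump \<alpha> \<beta> \<gamma> j)) else 0)" for j
  have i1: "q i = q (i - 1) / 2" "i - 1 \<noteq> i" using q_Suc[of "i - 1"] i by simp_all
  have ou: "ennreal (q (Suc j) - (if j = i - 1 then r else 0) - (if j = i then r else 0)) \<le> emeasure lborel (upper_set G j)" for j
  proof -
    have "emeasure lborel {q i + r<..<q (i - 1)} \<le> emeasure lborel (upper_set G (i - 1))" "emeasure lborel {q (Suc i)<..<q i - r} \<le> emeasure lborel (upper_set G i)"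
       "j \<noteq> i \<Longrightarrow> j \<noteq> i - 1 \<Longrightarrow> emeasure lborel {q (Suc j)<..<q j} \<le> emeasure lborel (upper_set G j)"
      by (rule emeasure_mono[OF sl(2) bm(1)], rule emeasure_mono[OF sl(3) bm(1)], rule emeasure_mono[OF sl(1) bm(1)], assumption+)
    note le = this
    consider "j = i" | "j = i - 1" "j \<noteq> i" | "j \<noteq> i" "j \<noteq> i - 1" by blast
    then show ?thesis
    proof cases
      case 1 then show ?thesis using le(2) r i1(2) by (simp add: q_Suc)
    next
      case 2
      have e: "q (i - 1) = 2 * q i" using i1(1) by simp
      show ?thesis using le(1) r i 2 unfolding e by simp
    next
      case 3 then show ?thesis using le(3) by (simp add: q_Suc)
    qed
  qed
  have ol: "ennreal (q (Suc j)) \<le> emeasure lborel (lower_set G j)" for j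
    using emeasure_mono[OF sl(4) bm(2)] by (simp add: q_Suc)
  have ov: "ennreal (q j - (if j = i then r else 0)) \<le> emeasure lborel (vertical_set G j)" for j
  proof -
    have "emeasure lborel {- (q i / 2)<..<q i / 2 - r} \<le> emeasure lborel (vertical_set G i)"
       "j \<noteq> i \<Longrightarrow> emeasure lborel {- (q j / 2)<..<q j / 2} \<le> emeasure lborel (vertical_set G j)"
      by (rule emeasure_mono[OF sl(6) bm(3)], rule emeasure_mono[OF sl(5) bm(3)], assumption)
    then show ?thesis using r by (cases "j = i") auto
  qed
  have summand: "ennreal (q j * (norm (col \<beta> \<gamma> j - \<alpha>) + norm (jump \<alpha> \<beta> \<gamma> j)) - cost j)
     \<le> ennreal (norm (col \<beta> \<gamma> j - \<alpha>)) * (emeasure lborel (upper_set G j) + emeasure lborel (lower_set G j))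
     + ennreal (norm (jump \<alpha> \<beta> \<gamma> j)) * emeasure lborel (vertical_set G j)" for j
  proof -
    let ?x = "q (Suc j) - (if j = i - 1 then r else 0) - (if j = i then r else 0)" and ?z = "q j - (if j = i then r else 0)"
    have nn0: "0 \<le> ?x" "0 \<le> ?z" using r i1 by (auto simp: q_Suc)
    have "q j * (norm (col \<beta> \<gamma> j - \<alpha>) + norm (jump \<alpha> \<beta> \<gamma> j)) - cost j = norm (col \<beta> \<gamma> j - \<alpha>) * (?x + q (Suc j)) + norm (jump \<alpha> \<beta> \<gamma> j) * ?z"
      using i1 by (simp add: cost_def q_Suc algebra_simps)
    also have "ennreal \<dots> = ennreal (norm (col \<beta> \<gamma> j - \<alpha>)) * (ennreal ?x + ennreal (q (Suc j))) + ennreal (norm (jump \<alpha> \<beta> \<gamma> j)) * ennreal ?z"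
      using nn0 by (simp only: ennreal_plus ennreal_mult mult_nonneg_nonneg norm_ge_zero q_nonneg add_nonneg_nonneg)
    also have "\<dots> \<le> ennreal (norm (col \<beta> \<gamma> j - \<alpha>)) * (emeasure lborel (upper_set G j) + emeasure lborel (lower_set G j))
     + ennreal (norm (jump \<alpha> \<beta> \<gamma> j)) * emeasure lborel (vertical_set G j)"
      by (intro add_mono mult_left_mono ou ol ov) auto
    finally show ?thesis .
  qed
  let ?S = "\<Sum>j<Suc n. q j * (norm (col \<beta> \<gamma> j - \<alpha>) + norm (jump \<alpha> \<beta> \<gamma> j))"
  have cost: "(\<Sum>j<Suc n. cost j) = r * local_total \<alpha> \<beta> \<gamma> i"
    using n(2) i by (simp add: cost_def sum.distrib local_total_def jump_def algebra_simps norm_minus_commute del: sum.lessThan_Suc)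
  have "ennreal (?S - r * local_total \<alpha> \<beta> \<gamma> i) = ennreal (\<Sum>j<Suc n. q j * (norm (col \<beta> \<gamma> j - \<alpha>) + norm (jump \<alpha> \<beta> \<gamma> j)) - cost j)"
    by (simp add: cost[symmetric] sum_subtractf del: sum.lessThan_Suc)
  also have "\<dots> = (\<Sum>j<Suc n. ennreal (q j * (norm (col \<beta> \<gamma> j - \<alpha>) + norm (jump \<alpha> \<beta> \<gamma> j)) - cost j))"
  proof (rule sum_ennreal[symmetric])
    fix j
    have "r * norm (col \<beta> \<gamma> j - \<alpha>) \<le> q j * norm (col \<beta> \<gamma> j - \<alpha>)" "r * norm (jump \<alpha> \<beta> \<gamma> j) \<le> q j * norm (jump \<alpha> \<beta> \<gamma> j)" if "j = i \<or> j = i - 1"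
      using that r i1 by (auto intro!: mult_right_mono)
    note le = this
    show "0 \<le> q j * (norm (col \<beta> \<gamma> j - \<alpha>) + norm (jump \<alpha> \<beta> \<gamma> j)) - cost j"
    proof -
      have "0 \<le> A + B - ((if P then a else 0) + (if Q then a + b else 0))"
        if "P \<or> Q \<Longrightarrow> a \<le> A" "P \<or> Q \<Longrightarrow> b \<le> B" "0 \<le> A" "0 \<le> B" "\<not> (P \<and> Q)" for A B a b :: real and P Q using that by auto
      note gen = this
      show ?thesis unfolding cost_def distrib_left by (rule gen) (use i1 le in auto)
    qed
  qed
  also have "\<dots> \<le> interface_measure \<alpha> \<beta> \<gamma> (Suc n) G"
    unfolding interface_measure_def by (intro sum_mono summand)
  also have "\<dots> \<le> total_var (u_map \<alpha> \<beta> \<gamma>) G" by (rule interface_measure_le_total_var[OF oG])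
  finally have S: "ennreal (?S - r * local_total \<alpha> \<beta> \<gamma> i) \<le> total_var (u_map \<alpha> \<beta> \<gamma>) G" .
  have lt: "0 \<le> r * local_total \<alpha> \<beta> \<gamma> i" using r by (simp add: local_total_def)
  have "ennreal (total \<alpha> \<beta> \<gamma>) \<le> ennreal ((?S - r * local_total \<alpha> \<beta> \<gamma> i) + (r * local_total \<alpha> \<beta> \<gamma> i + \<epsilon>))"
    using partial_total_le[of \<alpha> \<beta> \<gamma> n] n by (intro ennreal_leI) (simp add: C_def)
  also have "\<dots> \<le> ennreal (?S - r * local_total \<alpha> \<beta> \<gamma> i) + ennreal (r * local_total \<alpha> \<beta> \<gamma> i + \<epsilon>)"
    using lt \<epsilon> by (cases "0 \<le> ?S - r * local_total \<alpha> \<beta> \<gamma> i")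
      (simp_all add: ennreal_plus[symmetric] ennreal_neg ennreal_leI del: ennreal_plus sum.lessThan_Suc)
  also have "\<dots> \<le> total_var (u_map \<alpha> \<beta> \<gamma>) G + (ennreal (r * local_total \<alpha> \<beta> \<gamma> i) + ennreal \<epsilon>)"
    using lt \<epsilon> S by (intro add_mono) (auto simp: ennreal_plus)
  finally show "ennreal (total \<alpha> \<beta> \<gamma>) \<le> total_var (u_map \<alpha> \<beta> \<gamma>) (ball 0 1 - cball (A_pt i) r) + ennreal (r * local_total \<alpha> \<beta> \<gamma> i) + ennreal \<epsilon>"
    by (simp add: G_def add.assoc)
qed

section \<open>Ramp widths and the two profiles\<close>

definition width :: "nat \<Rightarrow> real" where "width n = q n * q n / 4"

lemma width_pos [simp]: "0 < width n" and width_neq_0 [simp]: "width n \<noteq> 0" by (simp_all add: width_def)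

text \<open>The reason for the square of \<open>q n\<close> in \<open>width\<close>: the n + 1 ramps
  together have width at most q n / 4, so the accumulated smoothing error tends to 0.\<close>

lemma Suc_mult_width_le: "real (Suc n) * width n \<le> q n / 4"
proof -
  have "real (Suc n) \<le> 2 ^ n" using less_exp[of n] by (metis Suc_leI of_nat_le_iff of_nat_numeral of_nat_power)
  then have "real (Suc n) * q n \<le> 1" by (simp add: q_def power_one_over field_simps)
  from mult_right_mono[OF this, of "q n / 4"] show ?thesis by (simp add: width_def field_simps)
qed

lemma width_le: "width n \<le> q n / 4"
proof -
  have "q n * q n \<le> 1 * q n" by (intro mult_right_mono q_le_1) simp
  then show ?thesis by (simp add: width_def)
qed

lemma cq_lower: "q i * (866/1000) \<le> cc * q i"
  using mult_right_mono[of "866/1000" cc "q i"] cc_bounds by (simp add: mult.commute)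

lemma width_le_cq: "j \<le> n \<Longrightarrow> width n \<le> cc * q (Suc j)"
proof -
  assume "j \<le> n"
  then have "q n \<le> q j" unfolding q_def by (intro power_decreasing) auto
  then show ?thesis using width_le[of n] cq_lower[of j] q_pos[of j] unfolding cq_Suc by linarith
qed

lemma width_tendsto: "width \<longlonglongrightarrow> 0"
proof -
  have "(\<lambda>n. q n * q n / 4) \<longlonglongrightarrow> 0 * 0 / 4" by (intro tendsto_intros q_tendsto) simp
  then show ?thesis by (simp add: width_def[abs_def])
qed

definition slope :: "real \<Rightarrow> real \<Rightarrow> real \<Rightarrow> real" where "slope \<delta> \<tau> t = sstep' ((\<tau> - t) / \<delta>) / \<delta>"

lemma slope_nonneg: "0 < \<delta> \<Longrightarrow> 0 \<le> slope \<delta> \<tau> t" by (simp add: slope_def sstep'_nonneg)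

lemma slope_0: "0 < \<delta> \<Longrightarrow> \<tau> \<le> t \<or> t \<le> \<tau> - \<delta> \<Longrightarrow> slope \<delta> \<tau> t = 0"
  using sstep'_0[of "(\<tau> - t) / \<delta>"] sstep'_1[of "(\<tau> - t) / \<delta>"] by (auto simp: slope_def divide_nonpos_pos pos_le_divide_eq)

lemma slope_continuous: "0 < \<delta> \<Longrightarrow> continuous_on A (slope \<delta> \<tau>)"
  unfolding slope_def[abs_def]
  by (intro continuous_intros continuous_on_compose2[OF sstep'_continuous[of UNIV]]) auto

lemma step_at_has_slope: "0 < \<delta> \<Longrightarrow> (step_at \<delta> \<tau> has_real_derivative - slope \<delta> \<tau> t) (at t)"
  unfolding slope_def by (rule step_at_deriv)

lemma scaleR_const_has_vector_derivative:
  "(f has_real_derivative f') (at t) \<Longrightarrow> ((\<lambda>t. f t *\<^sub>R v) has_vector_derivative f' *\<^sub>R v) (at t)"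
  using has_vector_derivative_scaleR[of f f' t UNIV "\<lambda>_. v" 0] by simp

text \<open>\<open>shift \<alpha> \<beta> \<gamma> i\<close> is the value on the \<open>i\<close>-th trapezoid relative to the background \<open>\<alpha>\<close>.\<close>
definition shift :: "real^2 \<Rightarrow> real^2 \<Rightarrow> real^2 \<Rightarrow> nat \<Rightarrow> real^2" where "shift \<alpha> \<beta> \<gamma> i = col \<beta> \<gamma> i - \<alpha>"

definition spread :: "real^2 \<Rightarrow> real^2 \<Rightarrow> real^2 \<Rightarrow> real" where "spread \<alpha> \<beta> \<gamma> = norm (\<beta> - \<alpha>) + norm (\<gamma> - \<alpha>)"

lemma norm_shift_le: "norm (shift \<alpha> \<beta> \<gamma> i) \<le> spread \<alpha> \<beta> \<gamma>"
  by (simp add: shift_def spread_def col_def)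

lemma spread_nonneg: "0 \<le> spread \<alpha> \<beta> \<gamma>" by (simp add: spread_def)

lemma sum_jump: "(\<Sum>j<Suc i. jump \<alpha> \<beta> \<gamma> j) = shift \<alpha> \<beta> \<gamma> i"
  by (induction i) (auto simp: jump_def shift_def)

definition strict_profile :: "real^2 \<Rightarrow> real^2 \<Rightarrow> real^2 \<Rightarrow> nat \<Rightarrow> real \<Rightarrow> real^2" where
  "strict_profile \<alpha> \<beta> \<gamma> n t = (\<Sum>i<Suc n. step_at (width n) (cc * q i) t *\<^sub>R jump \<alpha> \<beta> \<gamma> i)"
definition strict_profile' :: "real^2 \<Rightarrow> real^2 \<Rightarrow> real^2 \<Rightarrow> nat \<Rightarrow> real \<Rightarrow> real^2" where
  "strict_profile' \<alpha> \<beta> \<gamma> n t = (\<Sum>i<Suc n. (- slope (width n) (cc * q i) t) *\<^sub>R jump \<alpha> \<beta> \<gamma> i)"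

text \<open>A plateau over the i-th trapezoid. The inner ramp is shifted by \<open>width n\<close>
  so that it already equals 1 at the left end of the trapezoid; the bump therefore vanishes up to
  that end and never overlaps its neighbour.\<close>

definition bump :: "nat \<Rightarrow> nat \<Rightarrow> real \<Rightarrow> real" where
  "bump n i t = step_at (width n) (cc * q i) t - step_at (width n) (cc * q (Suc i) + width n) t"
definition bump' :: "nat \<Rightarrow> nat \<Rightarrow> real \<Rightarrow> real" where
  "bump' n i t = slope (width n) (cc * q (Suc i) + width n) t - slope (width n) (cc * q i) t"

definition flat_profile :: "real^2 \<Rightarrow> real^2 \<Rightarrow> real^2 \<Rightarrow> nat \<Rightarrow> real \<Rightarrow> real^2" where
  "flat_profile \<alpha> \<beta> \<gamma> n t = (\<Sum>i<Suc n. bump n i t *\<^sub>R shift \<alpha> \<beta> \<gamma> i)"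
definition flat_profile' :: "real^2 \<Rightarrow> real^2 \<Rightarrow> real^2 \<Rightarrow> nat \<Rightarrow> real \<Rightarrow> real^2" where
  "flat_profile' \<alpha> \<beta> \<gamma> n t = (\<Sum>i<Suc n. bump' n i t *\<^sub>R shift \<alpha> \<beta> \<gamma> i)"

lemma strict_profile_deriv: "(strict_profile \<alpha> \<beta> \<gamma> n has_vector_derivative strict_profile' \<alpha> \<beta> \<gamma> n t) (at t)"
  unfolding strict_profile_def[abs_def] strict_profile'_def
  by (intro has_vector_derivative_sum scaleR_const_has_vector_derivative step_at_has_slope width_pos)

lemma bump_deriv: "(bump n i has_real_derivative bump' n i t) (at t)"
  using DERIV_diff[OF step_at_has_slope[OF width_pos[of n], of "cc * q i" t] step_at_has_slope[OF width_pos[of n], of "cc * q (Suc i) + width n" t]]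
  unfolding bump_def[abs_def] bump'_def by simp

lemma flat_profile_deriv: "(flat_profile \<alpha> \<beta> \<gamma> n has_vector_derivative flat_profile' \<alpha> \<beta> \<gamma> n t) (at t)"
  unfolding flat_profile_def[abs_def] flat_profile'_def
  by (intro has_vector_derivative_sum scaleR_const_has_vector_derivative bump_deriv)

lemma strict_profile'_continuous: "continuous_on UNIV (strict_profile' \<alpha> \<beta> \<gamma> n)"
  unfolding strict_profile'_def[abs_def] by (intro continuous_intros slope_continuous width_pos)

lemma flat_profile'_continuous: "continuous_on UNIV (flat_profile' \<alpha> \<beta> \<gamma> n)"
  unfolding flat_profile'_def[abs_def] bump'_def by (intro continuous_intros slope_continuous width_pos)

lemma bump_outside:
  assumes "i \<le> n" "\<not> (cc * q (Suc i) < t \<and> t \<le> cc * q i)"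
  shows "bump n i t = 0" "bump' n i t = 0"
proof -
  have w: "width n \<le> cc * q (Suc i)" by (rule width_le_cq[OF assms(1)])
  have e: "cc * q i = cc * q (Suc i) + cc * q (Suc i)" by (simp add: q_Suc)
  from assms(2) consider "t \<le> cc * q (Suc i)" | "cc * q i \<le> t" by linarith
  then have "bump n i t = 0 \<and> bump' n i t = 0"
  proof cases
    case 1
    then have "t \<le> cc * q i - width n" "t \<le> cc * q (Suc i) + width n - width n" using e w by linarith+
    then show ?thesis by (simp add: bump_def bump'_def step_at_1 slope_0)
  next
    case 2
    then have "cc * q i \<le> t" "cc * q (Suc i) + width n \<le> t" using e w by linarith+
    then show ?thesis by (simp add: bump_def bump'_def step_at_0 slope_0)
  qed
  then show "bump n i t = 0" "bump' n i t = 0" by auto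
qed

lemma bump_bounds: "i \<le> n \<Longrightarrow> 0 \<le> bump n i t" "bump n i t \<le> 1"
proof -
  assume "i \<le> n"
  from width_le_cq[OF this] have "cc * q (Suc i) + width n \<le> cc * q i" unfolding cq_Suc by linarith
  from step_at_mono[OF width_pos this] show "0 \<le> bump n i t" by (simp add: bump_def)
next
  show "bump n i t \<le> 1" using step_at_bounds(2)[of "width n" "cc * q i" t] step_at_bounds(1)[of "width n" "cc * q (Suc i) + width n" t] unfolding bump_def by linarith
qed

lemma cq_zone_unique:
  assumes "cc * q (Suc i) < z" "z \<le> cc * q i" "cc * q (Suc j) < z" "z \<le> cc * q j"
  shows "i = j"
proof (rule zone_unique)
  show "q (Suc i) < z / cc" "z / cc \<le> q i" "q (Suc j) < z / cc" "z / cc \<le> q j"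
    using assms cc_pos by (simp_all add: pos_less_divide_eq pos_divide_le_eq mult.commute)
qed

lemma sum_eq_single: "finite I \<Longrightarrow> i0 \<in> I \<Longrightarrow> (\<And>i. i \<in> I \<Longrightarrow> i \<noteq> i0 \<Longrightarrow> f i = 0) \<Longrightarrow> sum f I = f i0"
  by (metis (no_types, lifting) DiffE add.right_neutral insertI1 sum.neutral sum.remove)

text \<open>At each height at most one bump is active, so the profile and its derivative are parallel.\<close>
lemma flat_profile_single:
  obtains a b v where "flat_profile \<alpha> \<beta> \<gamma> n t = a *\<^sub>R v" "flat_profile' \<alpha> \<beta> \<gamma> n t = b *\<^sub>R v" "\<bar>a\<bar> \<le> 1" "norm v \<le> spread \<alpha> \<beta> \<gamma>"
proof (cases "\<exists>i<Suc n. cc * q (Suc i) < t \<and> t \<le> cc * q i")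
  case True
  then obtain i where i: "i < Suc n" "cc * q (Suc i) < t" "t \<le> cc * q i" by auto
  have z: "bump n j t = 0" "bump' n j t = 0" if "j < Suc n" "j \<noteq> i" for j
    using bump_outside[of j n t] that cq_zone_unique[OF i(2,3), of j] by auto
  have "flat_profile \<alpha> \<beta> \<gamma> n t = bump n i t *\<^sub>R shift \<alpha> \<beta> \<gamma> i" "flat_profile' \<alpha> \<beta> \<gamma> n t = bump' n i t *\<^sub>R shift \<alpha> \<beta> \<gamma> i"
    unfolding flat_profile_def flat_profile'_def using i z by (auto intro!: sum_eq_single simp del: sum.lessThan_Suc)
  then show ?thesis using that[of "bump n i t" "shift \<alpha> \<beta> \<gamma> i" "bump' n i t"] bump_bounds(1)[of i n t] bump_bounds(2)[of n i t] i norm_shift_le[of \<alpha> \<beta> \<gamma> i] by auto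
next
  case False
  then have "bump n j t = 0" "bump' n j t = 0" if "j < Suc n" for j
    using bump_outside[of j n t] that by auto
  then have "flat_profile \<alpha> \<beta> \<gamma> n t = 0" "flat_profile' \<alpha> \<beta> \<gamma> n t = 0"
    unfolding flat_profile_def flat_profile'_def by (auto intro!: sum.neutral)
  then show ?thesis using that[of 0 0 0] spread_nonneg by auto
qed

lemma det_flat_approximant: "det (grad (approximant \<alpha> (flat_profile \<alpha> \<beta> \<gamma> n) \<delta>) x) = 0" if "0 < \<delta>"
proof -
  obtain a b v where "flat_profile \<alpha> \<beta> \<gamma> n (x$1) = a *\<^sub>R v" "flat_profile' \<alpha> \<beta> \<gamma> n (x$1) = b *\<^sub>R v"
    by (rule flat_profile_single[of \<alpha> \<beta> \<gamma> n "x$1"]) (rule that)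
  then show ?thesis unfolding det_grad_approximant[OF that flat_profile_deriv] by simp
qed

lemma norm_flat_profile_le: "norm (flat_profile \<alpha> \<beta> \<gamma> n t) \<le> spread \<alpha> \<beta> \<gamma>"
proof -
  obtain a b v where v: "flat_profile \<alpha> \<beta> \<gamma> n t = a *\<^sub>R v" "\<bar>a\<bar> \<le> 1" "norm v \<le> spread \<alpha> \<beta> \<gamma>"
    by (rule flat_profile_single[of \<alpha> \<beta> \<gamma> n t]) (rule that)
  have "\<bar>a\<bar> * norm v \<le> 1 * norm v" using v(2) by (intro mult_right_mono) auto
  then show ?thesis using v by simp
qed

text \<open>Summation by parts turns jumps into values, with nonnegative weights whose sum is the
  outermost ramp and hence at most 1. This gives a bound on the profile that is uniform in
  n.\<close>

lemma strict_profile_abel: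
  "strict_profile \<alpha> \<beta> \<gamma> n t = (\<Sum>i<n. (step_at (width n) (cc * q i) t - step_at (width n) (cc * q (Suc i)) t) *\<^sub>R shift \<alpha> \<beta> \<gamma> i)
    + step_at (width n) (cc * q n) t *\<^sub>R shift \<alpha> \<beta> \<gamma> n"
proof -
  have "(\<Sum>i<Suc m. s i *\<^sub>R jump \<alpha> \<beta> \<gamma> i) = (\<Sum>i<m. (s i - s (Suc i)) *\<^sub>R shift \<alpha> \<beta> \<gamma> i) + s m *\<^sub>R shift \<alpha> \<beta> \<gamma> m" for s :: "nat \<Rightarrow> real" and m
    by (induction m) (simp_all add: jump_def shift_def algebra_simps)
  then show ?thesis unfolding strict_profile_def .
qed

lemma step_at_cq_mono: "step_at (width n) (cc * q (Suc i)) t \<le> step_at (width n) (cc * q i) t"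
  by (rule step_at_mono[OF width_pos]) (use cq_pos[of i] in \<open>unfold cq_Suc, linarith\<close>)

lemma norm_strict_profile_abel:
  "norm (strict_profile \<alpha> \<beta> \<gamma> n t) \<le> (\<Sum>i<n. (step_at (width n) (cc * q i) t - step_at (width n) (cc * q (Suc i)) t) * norm (shift \<alpha> \<beta> \<gamma> i))
    + step_at (width n) (cc * q n) t * norm (shift \<alpha> \<beta> \<gamma> n)"
  unfolding strict_profile_abel
  by (rule order_trans[OF norm_triangle_ineq add_mono[OF sum_norm_le]]) (use step_at_cq_mono step_at_bounds(1) in auto)

lemma norm_strict_profile_le: "norm (strict_profile \<alpha> \<beta> \<gamma> n t) \<le> spread \<alpha> \<beta> \<gamma>"
proof -
  let ?s = "\<lambda>i. step_at (width n) (cc * q i) t" and ?M = "spread \<alpha> \<beta> \<gamma>"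
  have "norm (strict_profile \<alpha> \<beta> \<gamma> n t) \<le> (\<Sum>i<n. (?s i - ?s (Suc i)) * ?M) + ?s n * ?M"
    by (rule order_trans[OF norm_strict_profile_abel add_mono[OF sum_mono]])
      (use step_at_cq_mono step_at_bounds(1) norm_shift_le in \<open>auto intro!: mult_left_mono\<close>)
  also have "\<dots> = ((\<Sum>i<n. ?s i - ?s (Suc i)) + ?s n) * ?M" by (simp only: sum_distrib_right[symmetric] distrib_right)
  also have "\<dots> = ?s 0 * ?M" unfolding sum_lessThan_telescope'[of ?s n] by simp
  also have "\<dots> \<le> 1 * ?M" by (intro mult_right_mono step_at_bounds spread_nonneg)
  finally show ?thesis by simp
qed

text \<open>Under the hypotheses on t only the i-th ramp can be active: those of smaller index lie
  further to the right and have reached 1, those of larger index are 0.\<close>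

lemma strict_profile'_zone:
  assumes "i \<le> n" "cc * q (Suc i) \<le> t" "\<And>j. j < i \<Longrightarrow> t \<le> cc * q j - width n"
  shows "strict_profile \<alpha> \<beta> \<gamma> n t = (\<Sum>j<i. jump \<alpha> \<beta> \<gamma> j) + step_at (width n) (cc * q i) t *\<^sub>R jump \<alpha> \<beta> \<gamma> i"
    and "strict_profile' \<alpha> \<beta> \<gamma> n t = - slope (width n) (cc * q i) t *\<^sub>R jump \<alpha> \<beta> \<gamma> i"
proof -
  have hi: "cc * q j \<le> t" if "i < j" for j
  proof -
    have "q j \<le> q (Suc i)" using q_less[OF that] by (simp add: q_Suc)
    then have "cc * q j \<le> cc * q (Suc i)" using cc_pos by simp
    then show ?thesis using assms(2) by linarith
  qed
  have s: "{..<Suc n} = {..<i} \<union> {i} \<union> {i<..<Suc n}" using assms(1) by auto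
  have d: "sum f {..<Suc n} = sum f {..<i} + f i + sum f {i<..<Suc n}" for f :: "nat \<Rightarrow> real^2"
    unfolding s by (subst sum.union_disjoint; (subst sum.union_disjoint)?) auto
  have 1: "(\<Sum>j<i. step_at (width n) (cc * q j) t *\<^sub>R jump \<alpha> \<beta> \<gamma> j) = (\<Sum>j<i. jump \<alpha> \<beta> \<gamma> j)"
    using assms(3) by (intro sum.cong) (auto simp: step_at_1)
  have 2: "(\<Sum>j\<in>{i<..<Suc n}. step_at (width n) (cc * q j) t *\<^sub>R jump \<alpha> \<beta> \<gamma> j) = 0"
    using hi by (intro sum.neutral) (auto simp: step_at_0)
  show "strict_profile \<alpha> \<beta> \<gamma> n t = (\<Sum>j<i. jump \<alpha> \<beta> \<gamma> j) + step_at (width n) (cc * q i) t *\<^sub>R jump \<alpha> \<beta> \<gamma> i"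
    unfolding strict_profile_def d 1 2 by simp
  have 1: "(\<Sum>j<i. - slope (width n) (cc * q j) t *\<^sub>R jump \<alpha> \<beta> \<gamma> j) = 0"
    using assms(3) by (intro sum.neutral) (auto simp: slope_0)
  have 2: "(\<Sum>j\<in>{i<..<Suc n}. - slope (width n) (cc * q j) t *\<^sub>R jump \<alpha> \<beta> \<gamma> j) = 0"
    using hi by (intro sum.neutral) (auto simp: slope_0)
  show "strict_profile' \<alpha> \<beta> \<gamma> n t = - slope (width n) (cc * q i) t *\<^sub>R jump \<alpha> \<beta> \<gamma> i"
    unfolding strict_profile'_def d 1 2 by simp
qed

section \<open>Variation of the approximants\<close>

lemma nn_integral_indicators_le:
  assumes "finite I" and b: "\<And>t. 0 < t \<Longrightarrow> norm (G t) \<le> (\<Sum>i\<in>I. d i * indicator {l i..h i} t)"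
    and "\<And>i. i \<in> I \<Longrightarrow> 0 \<le> d i" "\<And>i. i \<in> I \<Longrightarrow> l i \<le> h i"
  shows "(\<integral>\<^sup>+t. ennreal (norm (G t)) * indicator {0<..} t \<partial>lborel) \<le> ennreal (\<Sum>i\<in>I. d i * (h i - l i))"
proof -
  have "(\<integral>\<^sup>+t. ennreal (norm (G t)) * indicator {0<..} t \<partial>lborel) \<le> (\<integral>\<^sup>+t. (\<Sum>i\<in>I. ennreal (d i) * indicator {l i..h i} t) \<partial>lborel)"
  proof (rule nn_integral_mono)
    fix t
    show "ennreal (norm (G t)) * indicator {0<..} t \<le> (\<Sum>i\<in>I. ennreal (d i) * indicator {l i..h i} t)"
    proof (cases "0 < t")
      case True
      have "ennreal (norm (G t)) \<le> ennreal (\<Sum>i\<in>I. d i * indicator {l i..h i} t)" by (intro ennreal_leI b True)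
      also have "\<dots> = (\<Sum>i\<in>I. ennreal (d i * indicator {l i..h i} t))" using assms(3) by (subst sum_ennreal) auto
      also have "\<dots> = (\<Sum>i\<in>I. ennreal (d i) * indicator {l i..h i} t)" using assms(3) by (intro sum.cong) (auto simp: indicator_def)
      finally show ?thesis using True by simp
    qed simp
  qed
  also have "\<dots> = (\<Sum>i\<in>I. \<integral>\<^sup>+t. ennreal (d i) * indicator {l i..h i} t \<partial>lborel)" by (rule nn_integral_sum) simp
  also have "\<dots> = (\<Sum>i\<in>I. ennreal (d i * (h i - l i)))"
    using assms(3,4) by (intro sum.cong) (simp_all add: nn_integral_cmult_indicator ennreal_mult)
  also have "\<dots> = ennreal (\<Sum>i\<in>I. d i * (h i - l i))" using assms(3,4) by (intro sum_ennreal) simp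
  finally show ?thesis .
qed

text \<open>Two slopes are allowed per index because a bump rises on one side and falls on the
  other; a single ramp is the case of zero second coefficient.\<close>

lemma nn_integral_slopes_le:
  assumes "finite I" "0 < \<delta>" and b: "\<And>t. norm (G' t) \<le> (\<Sum>i\<in>I. d i * slope \<delta> (\<tau> i) t + e i * slope \<delta> (\<sigma> i) t)"
    and nn: "\<And>i. i \<in> I \<Longrightarrow> 0 \<le> d i" "\<And>i. i \<in> I \<Longrightarrow> 0 \<le> e i" "\<And>i. i \<in> I \<Longrightarrow> 0 \<le> \<tau> i" "\<And>i. i \<in> I \<Longrightarrow> 0 \<le> \<sigma> i"
  shows "(\<integral>\<^sup>+t. ennreal (t * norm (G' t)) * indicator {0<..} t \<partial>lborel) \<le> ennreal (\<Sum>i\<in>I. d i * \<tau> i + e i * \<sigma> i)"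
proof -
  have [measurable]: "slope \<delta> c \<in> borel_measurable borel" for c by (intro borel_measurable_continuous_onI slope_continuous assms(2))
  let ?f = "\<lambda>d \<tau> t. ennreal (t * (d * slope \<delta> \<tau> t)) * indicator {0<..} t"
  have "(\<integral>\<^sup>+t. ennreal (t * norm (G' t)) * indicator {0<..} t \<partial>lborel) \<le> (\<integral>\<^sup>+t. (\<Sum>i\<in>I. ?f (d i) (\<tau> i) t + ?f (e i) (\<sigma> i) t) \<partial>lborel)"
  proof (rule nn_integral_mono)
    fix t
    show "ennreal (t * norm (G' t)) * indicator {0<..} t \<le> (\<Sum>i\<in>I. ?f (d i) (\<tau> i) t + ?f (e i) (\<sigma> i) t)"
    proof (cases "0 < t")
      case True
      have p: "0 \<le> t * (d i * slope \<delta> (\<tau> i) t)" "0 \<le> t * (e i * slope \<delta> (\<sigma> i) t)" if "i \<in> I" for i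
        using True nn[OF that] slope_nonneg[OF assms(2)] by (auto intro!: mult_nonneg_nonneg)
      have "ennreal (t * norm (G' t)) \<le> ennreal (t * (\<Sum>i\<in>I. d i * slope \<delta> (\<tau> i) t + e i * slope \<delta> (\<sigma> i) t))"
        using True b by (intro ennreal_leI mult_left_mono) auto
      also have "\<dots> = ennreal (\<Sum>i\<in>I. t * (d i * slope \<delta> (\<tau> i) t) + t * (e i * slope \<delta> (\<sigma> i) t))"
        by (simp add: sum_distrib_left distrib_left)
      also have "\<dots> = (\<Sum>i\<in>I. ennreal (t * (d i * slope \<delta> (\<tau> i) t) + t * (e i * slope \<delta> (\<sigma> i) t)))"
        by (rule sum_ennreal[symmetric]) (intro add_nonneg_nonneg p)
      also have "\<dots> = (\<Sum>i\<in>I. ennreal (t * (d i * slope \<delta> (\<tau> i) t)) + ennreal (t * (e i * slope \<delta> (\<sigma> i) t)))"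
        by (intro sum.cong refl ennreal_plus p)
      finally show ?thesis using True by simp
    qed simp
  qed
  also have "\<dots> = (\<Sum>i\<in>I. (\<integral>\<^sup>+t. ?f (d i) (\<tau> i) t \<partial>lborel) + (\<integral>\<^sup>+t. ?f (e i) (\<sigma> i) t \<partial>lborel))"
    by (subst nn_integral_sum) (simp_all add: nn_integral_add)
  also have "\<dots> \<le> (\<Sum>i\<in>I. ennreal (d i * \<tau> i) + ennreal (e i * \<sigma> i))"
    unfolding slope_def by (intro sum_mono add_mono nn_integral_step_deriv_le assms(2) nn)
  also have "\<dots> = (\<Sum>i\<in>I. ennreal (d i * \<tau> i + e i * \<sigma> i))" using nn by (intro sum.cong refl ennreal_plus[symmetric] mult_nonneg_nonneg) auto
  also have "\<dots> = ennreal (\<Sum>i\<in>I. d i * \<tau> i + e i * \<sigma> i)" using nn by (intro sum_ennreal add_nonneg_nonneg mult_nonneg_nonneg) auto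
  finally show ?thesis .
qed

lemma width_spread_le: "(\<Sum>i<Suc n. norm (shift \<alpha> \<beta> \<gamma> i)) * width n \<le> spread \<alpha> \<beta> \<gamma> * (q n / 4)"
proof -
  have "(\<Sum>i<Suc n. norm (shift \<alpha> \<beta> \<gamma> i)) \<le> (\<Sum>i<Suc n. spread \<alpha> \<beta> \<gamma>)" by (intro sum_mono norm_shift_le)
  then have "(\<Sum>i<Suc n. norm (shift \<alpha> \<beta> \<gamma> i)) * width n \<le> (\<Sum>i<Suc n. spread \<alpha> \<beta> \<gamma>) * width n"
    by (intro mult_right_mono) (auto simp: less_imp_le)
  also have "\<dots> = spread \<alpha> \<beta> \<gamma> * (real (Suc n) * width n)" by simp
  also have "\<dots> \<le> spread \<alpha> \<beta> \<gamma> * (q n / 4)" by (intro mult_left_mono Suc_mult_width_le spread_nonneg)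
  finally show ?thesis .
qed

lemma divide_cc_le: "0 \<le> x \<Longrightarrow> x / cc \<le> 6/5 * x"
proof -
  assume "0 \<le> x"
  then have "5/6 * x \<le> cc * x" using cc_bounds by (intro mult_right_mono) auto
  then show ?thesis using cc_pos by (simp add: field_simps)
qed

lemma grad_strict_approximant_le:
  "(\<integral>\<^sup>+x. ennreal (norm (grad (approximant \<alpha> (strict_profile \<alpha> \<beta> \<gamma> n) (width n)) x)) \<partial>lborel)
    \<le> ennreal (total \<alpha> \<beta> \<gamma> + 2 * spread \<alpha> \<beta> \<gamma> * q n)"
proof -
  let ?c = "\<lambda>i. norm (shift \<alpha> \<beta> \<gamma> i)" and ?j = "\<lambda>i. norm (jump \<alpha> \<beta> \<gamma> i)" and ?w = "width n"
  define h where "h i = cc * q i" for i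
  \<comment> \<open>The i-th weight lives between the start of the next inner ramp and the end of
    its own. The innermost piece has no further ramp and extends down to 0.\<close>
  define l where "l i = (if i = n then 0 else cc * q (Suc i) - ?w)" for i
  have lh: "l i \<le> h i" if "i \<le> n" for i
    using cq_pos[of i] width_pos[of n] unfolding l_def h_def cq_Suc by (auto simp del: width_pos cq_pos)
  define A where "A = (\<Sum>i<Suc n. ?c i * (h i - l i))"
  define B where "B = (\<Sum>i<Suc n. ?j i * (cc * q i) + 0 * 0)"
  have A: "(\<integral>\<^sup>+t. ennreal (norm (strict_profile \<alpha> \<beta> \<gamma> n t)) * indicator {0<..} t \<partial>lborel) \<le> ennreal A" unfolding A_def
  proof (rule nn_integral_indicators_le)
    fix t :: real assume t: "0 < t"
    let ?s = "\<lambda>i. step_at ?w (cc * q i) t"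
    have "(?s i - ?s (Suc i)) * ?c i \<le> ?c i * indicator {l i..h i} t" if "i < n" for i
    proof (cases "t \<in> {l i..h i}")
      case True
      have "?s i - ?s (Suc i) \<le> 1" using step_at_bounds(2)[of ?w "cc * q i" t] step_at_bounds(1)[of ?w "cc * q (Suc i)" t] by linarith
      from mult_right_mono[OF this, of "?c i"] show ?thesis using True by simp
    next
      case False
      then consider "h i < t" | "t < l i" by fastforce
      then have "?s i = ?s (Suc i)"
      proof cases
        case 1
        then have "cc * q i \<le> t" "cc * q (Suc i) \<le> t" using cq_pos[of i] unfolding h_def cq_Suc by linarith+
        then show ?thesis by (simp add: step_at_0)
      next
        case 2
        moreover have "l i = cc * q (Suc i) - ?w" using that by (simp add: l_def)
        ultimately have "t \<le> cc * q (Suc i) - ?w" "t \<le> cc * q i - ?w" using cq_pos[of i] cq_Suc[of i] by linarith+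
        then show ?thesis by (simp add: step_at_1)
      qed
      then show ?thesis by simp
    qed
    moreover have "?s n * ?c n \<le> ?c n * indicator {l n..h n} t"
    proof (cases "t \<le> cc * q n")
      case True
      then show ?thesis using t step_at_bounds(2)[of ?w "cc * q n" t] by (simp add: l_def h_def mult_left_le_one_le step_at_bounds)
    next
      case False then show ?thesis by (simp add: step_at_0)
    qed
    ultimately show "norm (strict_profile \<alpha> \<beta> \<gamma> n t) \<le> (\<Sum>i<Suc n. ?c i * indicator {l i..h i} t)"
      using norm_strict_profile_abel[of \<alpha> \<beta> \<gamma> n t] unfolding sum.lessThan_Suc
      by (intro order_trans[OF norm_strict_profile_abel add_mono[OF sum_mono]]) auto
  qed (use lh in auto)
  have B: "(\<integral>\<^sup>+t. ennreal (t * norm (strict_profile' \<alpha> \<beta> \<gamma> n t)) * indicator {0<..} t \<partial>lborel) \<le> ennreal B" unfolding B_def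
  proof (rule nn_integral_slopes_le)
    fix t
    show "norm (strict_profile' \<alpha> \<beta> \<gamma> n t) \<le> (\<Sum>i<Suc n. ?j i * slope ?w (cc * q i) t + 0 * slope ?w 0 t)"
      unfolding strict_profile'_def using slope_nonneg[OF width_pos, of n]
      by (intro sum_norm_le) (simp add: mult.commute)
  qed (auto simp: less_imp_le)
  have AB: "0 \<le> A" "0 \<le> B" unfolding A_def B_def using lh cc_pos by (auto intro!: sum_nonneg add_nonneg_nonneg mult_nonneg_nonneg simp: less_imp_le)
  note nn_integral_grad_approximant_le[OF width_pos strict_profile_deriv strict_profile'_continuous A B AB, of \<alpha>]
  also have "ennreal ((2 * A + B) / cc) \<le> ennreal (total \<alpha> \<beta> \<gamma> + 2 * spread \<alpha> \<beta> \<gamma> * q n)"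
  proof (rule ennreal_leI)
    have "?c i * (h i - l i) = cc * (q i * ?c i / 2) + ?c i * ?w" if "i < n" for i
      using that by (simp add: h_def l_def q_Suc algebra_simps)
    then have "A = (\<Sum>i<n. cc * (q i * ?c i / 2) + ?c i * ?w) + cc * q n * ?c n"
      unfolding A_def by (simp add: h_def l_def)
    also have "\<dots> = cc * (\<Sum>i<n. q i * ?c i) / 2 + (\<Sum>i<n. ?c i) * ?w + cc * q n * ?c n"
      by (simp add: sum.distrib sum_distrib_left sum_distrib_right sum_divide_distrib)
    also have "\<dots> \<le> cc * (\<Sum>i<Suc n. q i * ?c i) / 2 + (\<Sum>i<Suc n. ?c i) * ?w + cc * (q n * ?c n) / 2"
      using mult_nonneg_nonneg[of "?c n" ?w] by (simp add: algebra_simps add_divide_distrib less_imp_le)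
    finally have A': "A \<le> cc * (\<Sum>i<Suc n. q i * ?c i) / 2 + (\<Sum>i<Suc n. ?c i) * ?w + cc * (q n * ?c n) / 2" .
    have B': "B = cc * (\<Sum>i<Suc n. q i * ?j i)" unfolding B_def by (simp add: sum_distrib_left algebra_simps del: sum.lessThan_Suc)
    have S: "(\<Sum>i<Suc n. q i * ?c i) + (\<Sum>i<Suc n. q i * ?j i) \<le> total \<alpha> \<beta> \<gamma>"
      unfolding partial_total[of \<alpha> \<beta> \<gamma> n] by (simp add: sum.distrib distrib_left shift_def del: sum.lessThan_Suc)
    have cn: "q n * ?c n \<le> q n * spread \<alpha> \<beta> \<gamma>" by (intro mult_left_mono norm_shift_le) simp
    let ?e = "(\<Sum>i<Suc n. ?c i) * ?w"
    have "(2 * A + B) / cc \<le> (2 * (cc * (\<Sum>i<Suc n. q i * ?c i) / 2 + ?e + cc * (q n * ?c n) / 2) + B) / cc"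
    proof -
      have "(2 * A + B) / cc \<le> (2 * X + B) / cc" if "A \<le> X" for X using that cc_pos by (intro divide_right_mono) auto
      then show ?thesis using A' by blast
    qed
    also have "\<dots> = (\<Sum>i<Suc n. q i * ?c i) + (\<Sum>i<Suc n. q i * ?j i) + 2 * ?e / cc + q n * ?c n"
      unfolding B' using cc_pos by (simp add: field_simps del: sum.lessThan_Suc)
    also have "2 * ?e / cc \<le> 6/5 * (2 * ?e)" by (intro divide_cc_le mult_nonneg_nonneg sum_nonneg) (auto simp: less_imp_le)
    \<comment> \<open>Two errors remain: 12/5 of at most spread times q n / 4 from the ramps, and
      spread times q n from the innermost triangle, which has lost its subdivision.\<close>
    finally have "(2 * A + B) / cc \<le> total \<alpha> \<beta> \<gamma> + 12/5 * ?e + q n * spread \<alpha> \<beta> \<gamma>" using S cn by linarith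
    moreover have "?e \<le> spread \<alpha> \<beta> \<gamma> * q n / 4" using width_spread_le[of \<alpha> \<beta> \<gamma> n] by simp
    moreover have "0 \<le> spread \<alpha> \<beta> \<gamma> * q n" by (simp add: spread_nonneg)
    moreover have "q n * spread \<alpha> \<beta> \<gamma> = spread \<alpha> \<beta> \<gamma> * q n" "2 * spread \<alpha> \<beta> \<gamma> * q n = 2 * (spread \<alpha> \<beta> \<gamma> * q n)" by simp_all
    ultimately show "(2 * A + B) / cc \<le> total \<alpha> \<beta> \<gamma> + 2 * spread \<alpha> \<beta> \<gamma> * q n" by linarith
  qed
  finally show ?thesis .
qed

lemma partial_shift_sum_le: "(\<Sum>i<Suc n. q i * norm (shift \<alpha> \<beta> \<gamma> i)) \<le> 4/3 * norm (\<beta> - \<alpha>) + 2/3 * norm (\<gamma> - \<alpha>)"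
proof -
  have "(\<Sum>i<Suc n. q i * norm (shift \<alpha> \<beta> \<gamma> i)) + q (Suc n) * (4/3 * norm (shift \<alpha> \<beta> \<gamma> (Suc n)) + 2/3 * norm (shift \<alpha> \<beta> \<gamma> n))
    = 4/3 * norm (\<beta> - \<alpha>) + 2/3 * norm (\<gamma> - \<alpha>)"
  proof (induction n)
    case 0 then show ?case by (simp add: shift_def col_def q_Suc field_simps)
  next
    case (Suc n)
    have "shift \<alpha> \<beta> \<gamma> (Suc (Suc n)) = shift \<alpha> \<beta> \<gamma> n" by (simp add: shift_def col_def)
    then show ?case using Suc.IH by (simp add: q_Suc algebra_simps)
  qed
  moreover have "0 \<le> q (Suc n) * (4/3 * norm (shift \<alpha> \<beta> \<gamma> (Suc n)) + 2/3 * norm (shift \<alpha> \<beta> \<gamma> n))" by (intro mult_nonneg_nonneg add_nonneg_nonneg) simp_all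
  ultimately show ?thesis by linarith
qed

text \<open>A trapezoid of index i has two oblique sides of length q i / 2 and vertical sides of
  lengths q i and q i / 2, in total 5/2 q i. Summation gives 10/3 and 5/3; smoothing adds at most
  3/10 of each norm, within the available margin of 1/2.\<close>

lemma grad_flat_approximant_le:
  "(\<integral>\<^sup>+x. ennreal (norm (grad (approximant \<alpha> (flat_profile \<alpha> \<beta> \<gamma> n) (width n)) x)) \<partial>lborel)
    \<le> ennreal (23/6 * norm (\<beta> - \<alpha>) + 13/6 * norm (\<alpha> - \<gamma>))"
proof -
  let ?c = "\<lambda>i. norm (shift \<alpha> \<beta> \<gamma> i)" and ?w = "width n"
  define A where "A = (\<Sum>i<Suc n. ?c i * (cc * q i - cc * q (Suc i)))"
  define B where "B = (\<Sum>i<Suc n. ?c i * (cc * q (Suc i) + ?w) + ?c i * (cc * q i))"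
  have A: "(\<integral>\<^sup>+t. ennreal (norm (flat_profile \<alpha> \<beta> \<gamma> n t)) * indicator {0<..} t \<partial>lborel) \<le> ennreal A" unfolding A_def
  proof (rule nn_integral_indicators_le)
    fix t :: real
    show "norm (flat_profile \<alpha> \<beta> \<gamma> n t) \<le> (\<Sum>i<Suc n. ?c i * indicator {cc * q (Suc i)..cc * q i} t)"
      unfolding flat_profile_def
    proof (rule sum_norm_le)
      fix i assume "i \<in> {..<Suc n}"
      then have i: "i \<le> n" by simp
      show "norm (bump n i t *\<^sub>R shift \<alpha> \<beta> \<gamma> i) \<le> ?c i * indicator {cc * q (Suc i)..cc * q i} t"
      proof (cases "cc * q (Suc i) < t \<and> t \<le> cc * q i")
        case True
        then show ?thesis using bump_bounds(1)[of i n t] bump_bounds(2)[of n i t] i by (simp add: mult_left_le_one_le)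
      next
        case False
        then show ?thesis using bump_outside(1)[OF i False] by simp
      qed
    qed
  qed (use cq_pos in \<open>auto simp: q_Suc less_imp_le\<close>)
  have B: "(\<integral>\<^sup>+t. ennreal (t * norm (flat_profile' \<alpha> \<beta> \<gamma> n t)) * indicator {0<..} t \<partial>lborel) \<le> ennreal B" unfolding B_def
  proof (rule nn_integral_slopes_le)
    fix t
    show "norm (flat_profile' \<alpha> \<beta> \<gamma> n t) \<le> (\<Sum>i<Suc n. ?c i * slope ?w (cc * q (Suc i) + ?w) t + ?c i * slope ?w (cc * q i) t)"
      unfolding flat_profile'_def
    proof (rule sum_norm_le)
      fix i
      have "\<bar>bump' n i t\<bar> \<le> slope ?w (cc * q (Suc i) + ?w) t + slope ?w (cc * q i) t"
        using slope_nonneg[OF width_pos, of n "cc * q (Suc i) + ?w" t] slope_nonneg[OF width_pos, of n "cc * q i" t] unfolding bump'_def by linarith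
      from mult_right_mono[OF this, of "?c i"]
      show "norm (bump' n i t *\<^sub>R shift \<alpha> \<beta> \<gamma> i) \<le> ?c i * slope ?w (cc * q (Suc i) + ?w) t + ?c i * slope ?w (cc * q i) t"
        by (simp add: algebra_simps)
    qed
  qed (auto simp: less_imp_le intro!: add_nonneg_nonneg)
  have AB: "0 \<le> A" "0 \<le> B" unfolding A_def B_def using cq_pos cc_pos by (auto intro!: sum_nonneg add_nonneg_nonneg mult_nonneg_nonneg simp: less_imp_le q_Suc)
  note nn_integral_grad_approximant_le[OF width_pos flat_profile_deriv flat_profile'_continuous A B AB, of \<alpha>]
  also have "ennreal ((2 * A + B) / cc) \<le> ennreal (23/6 * norm (\<beta> - \<alpha>) + 13/6 * norm (\<alpha> - \<gamma>))"
  proof (rule ennreal_leI)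
    let ?S = "\<Sum>i<Suc n. q i * ?c i" and ?e = "(\<Sum>i<Suc n. ?c i) * ?w"
    have A': "A = cc * ?S / 2" unfolding A_def by (simp add: sum_distrib_left sum_divide_distrib q_Suc algebra_simps del: sum.lessThan_Suc)
    have "B = (\<Sum>i<Suc n. 3/2 * cc * (q i * ?c i) + ?c i * ?w)" unfolding B_def by (intro sum.cong refl) (simp add: q_Suc field_simps)
    also have "\<dots> = 3/2 * cc * ?S + ?e" by (simp add: sum.distrib sum_distrib_left sum_distrib_right del: sum.lessThan_Suc)
    finally have "(2 * A + B) / cc = 5/2 * ?S + ?e / cc" unfolding A' using cc_pos by (simp add: field_simps del: sum.lessThan_Suc)
    moreover have "?e / cc \<le> 6/5 * ?e" by (intro divide_cc_le mult_nonneg_nonneg sum_nonneg) (auto simp: less_imp_le)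
    moreover have "?e \<le> spread \<alpha> \<beta> \<gamma> * (q n / 4)" using width_spread_le[of \<alpha> \<beta> \<gamma> n] by simp
    moreover have "spread \<alpha> \<beta> \<gamma> * (q n / 4) \<le> spread \<alpha> \<beta> \<gamma> * (1 / 4)" using q_le_1[of n] by (intro mult_left_mono spread_nonneg) simp
    moreover have "x \<le> 5/2 * s + 6/5 * (v * (1/4))" if "x = 5/2 * S + E" "E \<le> 6/5 * e" "e \<le> v'" "v' \<le> v * (1/4)" "S \<le> s" for x S E e v v' s :: real
      using that by linarith
    ultimately have "(2 * A + B) / cc \<le> 5/2 * (4/3 * norm (\<beta> - \<alpha>) + 2/3 * norm (\<gamma> - \<alpha>)) + 6/5 * (spread \<alpha> \<beta> \<gamma> * (1/4))"
      using partial_shift_sum_le by blast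
    also have "\<dots> \<le> 23/6 * norm (\<beta> - \<alpha>) + 13/6 * norm (\<alpha> - \<gamma>)"
    proof -
      have "5/2 * (4/3 * b + 2/3 * c) + 6/5 * ((b + c) * (1/4)) \<le> 23/6 * b + 13/6 * c" if "0 \<le> b" "0 \<le> c" for b c :: real
      proof -
        have "23/6 * b + 13/6 * c = 5/2 * (4/3 * b + 2/3 * c) + 6/5 * ((b + c) * (1/4)) + (b + c) / 5" by (simp add: field_simps)
        then show ?thesis using that by simp
      qed
      from this[OF norm_ge_zero norm_ge_zero] show ?thesis unfolding spread_def norm_minus_commute[of \<alpha> \<gamma>] .
    qed
    finally show "(2 * A + B) / cc \<le> 23/6 * norm (\<beta> - \<alpha>) + 13/6 * norm (\<alpha> - \<gamma>)" .
  qed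
  finally show ?thesis .
qed

section \<open>Convergence of the approximants in L1\<close>

lemma exists_zone:
  assumes "0 < s" "s \<le> 1"
  shows "\<exists>i. q (Suc i) < s \<and> s \<le> q i"
proof -
  have "eventually (\<lambda>n. q n < s) sequentially" using q_tendsto assms(1) by (rule order_tendstoD)
  then obtain n where n: "q n < s" using eventually_sequentially by auto
  define m where "m = (LEAST n. q n < s)"
  have m: "q m < s" unfolding m_def using n by (rule LeastI)
  then obtain i where i: "m = Suc i" using assms(2) by (cases m) auto
  have "\<not> q i < s" using not_less_Least[of i "\<lambda>n. q n < s"] unfolding m_def[symmetric] i by simp
  then show ?thesis using m i by (intro exI[of _ i]) auto
qed

lemma wedge_one:
  fixes x :: "real^2"
  assumes "0 < \<delta>" "\<delta> \<le> x$1 - 2 * cc * x$2" "\<delta> \<le> x$1 + 2 * cc * x$2"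
  shows "wedge \<delta> x = 1"
proof -
  have "1 \<le> (x$1 - 2 * cc * x$2) / \<delta>" "1 \<le> (x$1 + 2 * cc * x$2) / \<delta>" using assms by (simp_all add: pos_le_divide_eq)
  then show ?thesis by (simp add: wedge_def sstep_1)
qed

lemma eventually_small_width: "0 < \<epsilon> \<Longrightarrow> eventually (\<lambda>n. width n \<le> \<epsilon> \<and> i \<le> n) sequentially"
proof -
  assume "0 < \<epsilon>"
  then have "eventually (\<lambda>n. width n < \<epsilon>) sequentially" using width_tendsto by (rule order_tendstoD(2)[rotated])
  then show ?thesis using eventually_ge_at_top[of i] by eventually_elim auto
qed

text \<open>Off the countably many lines that carry the interfaces, the approximants agree with u
  from some index on. They are uniformly bounded, so dominated convergence applies on the bounded
  set.\<close>

lemma approximants_L1_conv: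
  fixes G :: "nat \<Rightarrow> real \<Rightarrow> real^2"
  assumes d: "\<And>n t. (G n has_vector_derivative G' n t) (at t)"
    and M: "\<And>n t. norm (G n t) \<le> M"
    and out: "\<And>n t. cc < t \<Longrightarrow> G n t = 0"
    and zone: "\<And>i t. cc * q (Suc i) < t \<Longrightarrow> t < cc * q i \<Longrightarrow> eventually (\<lambda>n. G n t = shift \<alpha> \<beta> \<gamma> i) sequentially"
    and \<Omega>: "open \<Omega>" "bounded \<Omega>"
  shows "L1_conv \<Omega> (\<lambda>n. approximant \<alpha> (G n) (width n)) (u_map \<alpha> \<beta> \<gamma>)"
proof -
  let ?w = "\<lambda>n. approximant \<alpha> (G n) (width n)" and ?u = "u_map \<alpha> \<beta> \<gamma>"
  have wm [measurable]: "?w n \<in> borel_measurable borel" for n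
  proof (intro borel_measurable_continuous_onI continuous_at_imp_continuous_on ballI)
    show "isCont (?w n) x" for x using approximant_has_derivative[OF width_pos d] by (rule has_derivative_continuous)
  qed
  note um [measurable] = u_map_measurable
  have wb: "norm (?w n x) \<le> norm \<alpha> + M" for n x
  proof -
    have "wedge (width n) x * norm (G n (x$1)) \<le> 1 * norm (G n (x$1))" by (intro mult_right_mono wedge_bounds) simp
    then have "norm (wedge (width n) x *\<^sub>R G n (x$1)) \<le> M" using M[of n "x$1"] wedge_bounds by simp
    then show ?thesis unfolding approximant_def using norm_triangle_ineq[of \<alpha> "wedge (width n) x *\<^sub>R G n (x$1)"] by linarith
  qed
  have ub: "norm (?u x) \<le> norm \<alpha> + norm \<beta> + norm \<gamma>" for x using u_map_range[of \<alpha> \<beta> \<gamma> x] by auto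
  define C where "C = (norm \<alpha> + M) + (norm \<alpha> + norm \<beta> + norm \<gamma>)"
  have db: "norm (?w n x - ?u x) \<le> C" for n x
    unfolding C_def using norm_triangle_ineq4[of "?w n x" "?u x"] wb[of n x] ub[of x] by linarith
  have ae: "AE x in lebesgue. (\<lambda>n. norm (?w n x - ?u x)) \<longlonglongrightarrow> 0"
  proof -
    have n: "nn \<noteq> 0" "nn' \<noteq> 0" "axis 1 1 \<noteq> (0::real^2)" by (metis norm_ee(3) norm_zero zero_neq_one, metis norm_ee(4) norm_zero zero_neq_one, simp)
    have "AE x in (lebesgue :: (real^2) measure). \<forall>i. (x - (cc * q i) *\<^sub>R axis 1 1) \<bullet> axis 1 (1::real) \<noteq> (0::real)"
      unfolding AE_all_countable by (intro allI AE_not_hyperplane n(3))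
    with AE_not_hyperplane[OF n(1), of 0] AE_not_hyperplane[OF n(2), of 0]
    show ?thesis
    proof eventually_elim
      case (elim x)
      then have ne: "x$1 \<noteq> 2 * (cc * x$2)" "x$1 \<noteq> - (2 * (cc * x$2))" "\<And>i. x$1 \<noteq> cc * q i"
      proof -
        have "(x - 0) \<bullet> nn = cc * x$2 - x$1 / 2" "(x - 0) \<bullet> nn' = - (cc * x$2) - x$1 / 2" "\<And>i. (x - (cc * q i) *\<^sub>R axis 1 1) \<bullet> axis 1 1 = x$1 - cc * q i"
          by (simp_all add: inner_real2)
        then show "x$1 \<noteq> 2 * (cc * x$2)" "x$1 \<noteq> - (2 * (cc * x$2))" "\<And>i. x$1 \<noteq> cc * q i" using elim by force+
      qed
      have "eventually (\<lambda>n. ?w n x = ?u x) sequentially"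
      proof (cases "2 * cc * \<bar>x$2\<bar> \<le> x$1")
        case False
        then show ?thesis using wedge_zero[OF width_pos, of x] u_map_outside[of x \<alpha> \<beta> \<gamma>] by (simp add: approximant_def)
      next
        case True
        then have lt: "2 * (cc * x$2) < x$1" "- (2 * (cc * x$2)) < x$1" using ne(1,2) unfolding wedge_iff by linarith+
        show ?thesis
        proof (cases "cc < x$1")
          case True
          then show ?thesis using u_map_outside[of x \<alpha> \<beta> \<gamma>] out by (simp add: approximant_def)
        next
          case False
          then have "0 < x$1 / cc" "x$1 / cc \<le> 1" using lt cc_pos by (auto simp: divide_simps)
          then obtain i where "q (Suc i) < x$1 / cc" "x$1 / cc \<le> q i" using exists_zone by blast
          then have i: "cc * q (Suc i) < x$1" "x$1 \<le> cc * q i" using cc_pos by (simp_all add: field_simps)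
          then have i': "x$1 < cc * q i" using ne(3)[of i] by linarith
          have "0 < min (x$1 - 2 * (cc * x$2)) (x$1 + 2 * (cc * x$2))" using lt by simp
          from eventually_small_width[OF this, of 0] zone[OF i(1) i'] show ?thesis
          proof eventually_elim
            case (elim n)
            then have "wedge (width n) x = 1" by (intro wedge_one) simp_all
            then show ?case using elim u_map_zone[OF True i, of \<alpha> \<beta> \<gamma>] by (simp add: approximant_def shift_def)
          qed
        qed
      qed
      then show ?case by (intro tendsto_eventually) (auto elim: eventually_mono)
    qed
  qed
  have l: "\<Omega> \<in> lmeasurable" using \<Omega> by (simp add: bounded_set_imp_lmeasurable)
  have "(\<lambda>n. LINT x|lebesgue. indicator \<Omega> x *\<^sub>R norm (?w n x - ?u x)) \<longlonglongrightarrow> (LINT x|(lebesgue :: (real^2) measure). (0::real))"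
  proof (rule integral_dominated_convergence[where w="\<lambda>x. C * indicator \<Omega> x"])
    show "integrable lebesgue (\<lambda>x. C * indicator \<Omega> x :: real)" using l unfolding lmeasurable_iff_integrable by (rule integrable_mult_right)
    have [measurable]: "\<Omega> \<in> sets borel" using \<Omega> by simp
    show "(\<lambda>x. indicator \<Omega> x *\<^sub>R norm (?w n x - ?u x)) \<in> borel_measurable lebesgue" for n
      by (intro measurable_completion) measurable
    show "AE x in lebesgue. (\<lambda>n. indicator \<Omega> x *\<^sub>R norm (?w n x - ?u x)) \<longlonglongrightarrow> 0"
      using ae by eventually_elim (auto simp: indicator_def)
    show "AE x in lebesgue. norm (indicator \<Omega> x *\<^sub>R norm (?w n x - ?u x)) \<le> C * indicator \<Omega> x" for n
      using db by (auto simp: indicator_def)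
  qed simp
  then show ?thesis unfolding L1_conv_def set_lebesgue_integral_def
    using borel_bounded_L1_maps[OF wm wb \<Omega>(2,1)] u_map_L1[OF \<Omega>(2,1)] by simp
qed

lemma strict_approximants_L1_conv:
  assumes "open \<Omega>" "bounded \<Omega>"
  shows "L1_conv \<Omega> (\<lambda>n. approximant \<alpha> (strict_profile \<alpha> \<beta> \<gamma> n) (width n)) (u_map \<alpha> \<beta> \<gamma>)"
proof (rule approximants_L1_conv[OF strict_profile_deriv norm_strict_profile_le _ _ assms])
  fix n t assume "cc < t"
  then have "cc * q i \<le> t" for i using \<open>cc < t\<close> mult_left_mono[OF q_le_1[of i] less_imp_le[OF cc_pos]] by linarith
  then show "strict_profile \<alpha> \<beta> \<gamma> n t = 0" unfolding strict_profile_def by (intro sum.neutral) (simp add: step_at_0)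
next
  fix i t assume t: "cc * q (Suc i) < t" "t < cc * q i"
  then have "0 < cc * q i - t" by simp
  from eventually_small_width[OF this, of i] show "eventually (\<lambda>n. strict_profile \<alpha> \<beta> \<gamma> n t = shift \<alpha> \<beta> \<gamma> i) sequentially"
  proof eventually_elim
    case (elim n)
    have "t \<le> cc * q j - width n" if "j \<le> i" for j
    proof -
      have "q i \<le> q j" unfolding q_def using that by (intro power_decreasing) auto
      then have "cc * q i \<le> cc * q j" using cc_pos by simp
      then show ?thesis using elim by linarith
    qed
    then have "strict_profile \<alpha> \<beta> \<gamma> n t = (\<Sum>j<i. jump \<alpha> \<beta> \<gamma> j) + step_at (width n) (cc * q i) t *\<^sub>R jump \<alpha> \<beta> \<gamma> i" "step_at (width n) (cc * q i) t = 1"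
      using t elim by (auto intro!: strict_profile'_zone step_at_1)
    then show ?case by (simp add: sum_jump[symmetric])
  qed
qed

lemma flat_approximants_L1_conv:
  assumes "open \<Omega>" "bounded \<Omega>"
  shows "L1_conv \<Omega> (\<lambda>n. approximant \<alpha> (flat_profile \<alpha> \<beta> \<gamma> n) (width n)) (u_map \<alpha> \<beta> \<gamma>)"
proof (rule approximants_L1_conv[OF flat_profile_deriv norm_flat_profile_le _ _ assms])
  fix n t assume t: "cc < t"
  have "\<not> t \<le> cc * q i" for i using t mult_left_mono[OF q_le_1[of i] less_imp_le[OF cc_pos]] by linarith
  then show "flat_profile \<alpha> \<beta> \<gamma> n t = 0" unfolding flat_profile_def by (intro sum.neutral) (simp add: bump_outside)
next
  fix i t assume t: "cc * q (Suc i) < t" "t < cc * q i"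
  then have "0 < min (cc * q i - t) (t - cc * q (Suc i))" by simp
  from eventually_small_width[OF this, of i] show "eventually (\<lambda>n. flat_profile \<alpha> \<beta> \<gamma> n t = shift \<alpha> \<beta> \<gamma> i) sequentially"
  proof eventually_elim
    case (elim n)
    have "flat_profile \<alpha> \<beta> \<gamma> n t = bump n i t *\<^sub>R shift \<alpha> \<beta> \<gamma> i" unfolding flat_profile_def
    proof (rule sum_eq_single)
      fix j assume j: "j \<in> {..<Suc n}" "j \<noteq> i"
      then have "\<not> (cc * q (Suc j) < t \<and> t \<le> cc * q j)" using cq_zone_unique[of i t j] t by auto
      then show "bump n j t *\<^sub>R shift \<alpha> \<beta> \<gamma> j = 0" using j bump_outside(1)[of j n t] by simp
    qed (use elim in auto)
    moreover have "bump n i t = 1" using elim unfolding bump_def by (subst step_at_1, simp, simp, subst step_at_0) auto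
    ultimately show ?case by simp
  qed
qed

section \<open>Strict convergence\<close>

lemma continuous_on_grad:
  assumes "C1_on \<Omega> w"
  shows "continuous_on \<Omega> (grad w)"
proof -
  obtain W where W: "\<And>x. x \<in> \<Omega> \<Longrightarrow> (w has_derivative W x) (at x)" "\<And>h. continuous_on \<Omega> (\<lambda>x. W x h)"
    using C1_onE[OF assms] by blast
  have "continuous_on \<Omega> (\<lambda>x. matrix (W x))" unfolding matrix_def by (intro continuous_intros W(2))
  then show ?thesis by (rule continuous_on_eq) (simp add: grad_eq[OF W(1)])
qed

lemma continuous_on_det_grad: "C1_on \<Omega> w \<Longrightarrow> continuous_on \<Omega> (\<lambda>x. det (grad w x))"
  unfolding det_2 by (intro continuous_intros continuous_on_grad)

lemma L1_maps_subset: "u \<in> L1_maps \<Omega> \<Longrightarrow> A \<subseteq> \<Omega> \<Longrightarrow> open A \<Longrightarrow> u \<in> L1_maps A"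
  unfolding L1_maps_def by (auto intro: set_integrable_subset)

lemma L1_conv_subset:
  assumes L: "L1_conv \<Omega> w u" and A: "A \<subseteq> \<Omega>" "open A"
  shows "L1_conv A w u"
proof -
  have u: "u \<in> L1_maps \<Omega>" and w: "\<And>k. w k \<in> L1_maps \<Omega>" and l: "(\<lambda>k. LINT x:\<Omega>|lebesgue. norm (w k x - u x)) \<longlonglongrightarrow> 0"
    using L unfolding L1_conv_def by auto
  have i: "set_integrable lebesgue \<Omega> (\<lambda>x. norm (w k x - u x))" for k
    using w[of k] u unfolding L1_maps_def by (intro set_integrable_norm set_integral_diff) auto
  have iA: "set_integrable lebesgue A (\<lambda>x. norm (w k x - u x))" for k
    by (rule set_integrable_subset[OF i _ A(1)]) (use A in auto)
  have le: "(LINT x:A|lebesgue. norm (w k x - u x)) \<le> (LINT x:\<Omega>|lebesgue. norm (w k x - u x))" for k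
    unfolding set_lebesgue_integral_def
    by (rule integral_mono[OF iA[unfolded set_integrable_def] i[unfolded set_integrable_def]]) (use A(1) in \<open>auto simp: indicator_def\<close>)
  have "(\<lambda>k. LINT x:A|lebesgue. norm (w k x - u x)) \<longlonglongrightarrow> 0"
    by (rule tendsto_sandwich[OF _ _ tendsto_const l]) (use le in \<open>auto intro!: always_eventually integral_nonneg_AE simp: set_lebesgue_integral_def\<close>)
  then show ?thesis unfolding L1_conv_def using L1_maps_subset[OF _ A] u w by blast
qed

text \<open>The chain c \<le> |Du| \<le> liminf \<le> limsup \<le> c yields the value of the
  variation and the convergence at the same time.\<close>

lemma tendsto_total_var:
  assumes L: "L1_conv \<Omega> w u" and A: "A \<subseteq> \<Omega>" and c: "ennreal c \<le> total_var u A" "0 \<le> c"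
    and ev: "\<And>\<epsilon>. 0 < \<epsilon> \<Longrightarrow> eventually (\<lambda>k. total_var (w k) A \<le> ennreal (c + \<epsilon>)) sequentially"
  shows "(\<lambda>k. total_var (w k) A) \<longlonglongrightarrow> total_var u A" "total_var u A = ennreal c"
proof -
  have sup: "limsup (\<lambda>k. total_var (w k) A) \<le> ennreal c"
  proof (rule ennreal_le_epsilon)
    fix e :: real assume "0 < e"
    from Limsup_bounded[OF ev[OF this]] show "limsup (\<lambda>k. total_var (w k) A) \<le> ennreal c + ennreal e"
      using c(2) \<open>0 < e\<close> by simp
  qed
  have inf: "total_var u A \<le> liminf (\<lambda>k. total_var (w k) A)" by (rule total_var_lower_semicontinuous[OF L A])
  have le: "liminf (\<lambda>k. total_var (w k) A) \<le> limsup (\<lambda>k. total_var (w k) A)" by (rule Liminf_le_Limsup) simp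
  show "total_var u A = ennreal c" using sup inf le c by (meson antisym order_trans)
  then have "limsup (\<lambda>k. total_var (w k) A) = total_var u A" "liminf (\<lambda>k. total_var (w k) A) = total_var u A"
    using sup inf le by (auto intro: antisym order_trans)
  then show "(\<lambda>k. total_var (w k) A) \<longlonglongrightarrow> total_var u A" by (simp add: tendsto_iff_Liminf_eq_Limsup)
qed

definition strict_approximant :: "real^2 \<Rightarrow> real^2 \<Rightarrow> real^2 \<Rightarrow> nat \<Rightarrow> real^2 \<Rightarrow> real^2" where
  "strict_approximant \<alpha> \<beta> \<gamma> n = approximant \<alpha> (strict_profile \<alpha> \<beta> \<gamma> n) (width n)"

lemma strict_approximant_C1: "C1_on \<Omega> (strict_approximant \<alpha> \<beta> \<gamma> n)"
  unfolding strict_approximant_def by (rule approximant_C1[OF width_pos strict_profile_deriv strict_profile'_continuous])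

lemma nn_integral_restrict_le: "(\<integral>\<^sup>+x\<in>\<Omega>. f x \<partial>lebesgue) \<le> (\<integral>\<^sup>+x. f x \<partial>lborel)"
  unfolding nn_integral_completion[symmetric, of lborel f] by (intro nn_integral_mono) (simp add: indicator_def)

lemma total_var_strict_approximant_le:
  "open \<Omega> \<Longrightarrow> total_var (strict_approximant \<alpha> \<beta> \<gamma> n) \<Omega> \<le> ennreal (total \<alpha> \<beta> \<gamma> + 2 * spread \<alpha> \<beta> \<gamma> * q n)"
  by (rule order_trans[OF total_var_C1_le[OF _ strict_approximant_C1] order_trans[OF nn_integral_restrict_le]])
    (auto simp: strict_approximant_def intro: grad_strict_approximant_le)

lemma total_nonneg: "0 \<le> total \<alpha> \<beta> \<gamma>" by (simp add: total_def)

text \<open>The jumps give the lower bound and the gradients of the approximants the matching upper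
  bound, which determines |Du| and the limit together.\<close>

lemma strict_approximants:
  shows "(\<lambda>k. total_var (strict_approximant \<alpha> \<beta> \<gamma> k) (ball 0 1)) \<longlonglongrightarrow> total_var (u_map \<alpha> \<beta> \<gamma>) (ball 0 1)"
    and total_var_u_map: "total_var (u_map \<alpha> \<beta> \<gamma>) (ball 0 1) = ennreal (total \<alpha> \<beta> \<gamma>)"
    and strict_approximants_L1: "L1_conv (ball 0 1) (strict_approximant \<alpha> \<beta> \<gamma>) (u_map \<alpha> \<beta> \<gamma>)"
proof -
  show L: "L1_conv (ball 0 1) (strict_approximant \<alpha> \<beta> \<gamma>) (u_map \<alpha> \<beta> \<gamma>)"
    unfolding strict_approximant_def[abs_def] by (rule strict_approximants_L1_conv) auto
  have "eventually (\<lambda>k. total_var (strict_approximant \<alpha> \<beta> \<gamma> k) (ball 0 1) \<le> ennreal (total \<alpha> \<beta> \<gamma> + \<epsilon>)) sequentially" if "0 < \<epsilon>" for \<epsilon>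
  proof -
    have "(\<lambda>n. 2 * spread \<alpha> \<beta> \<gamma> * q n) \<longlonglongrightarrow> 0" using tendsto_mult_right_zero[OF q_tendsto] .
    then have "eventually (\<lambda>n. 2 * spread \<alpha> \<beta> \<gamma> * q n < \<epsilon>) sequentially" using that by (rule order_tendstoD)
    then show ?thesis
    proof eventually_elim
      case (elim n)
      then show ?case by (intro order_trans[OF total_var_strict_approximant_le]) (auto intro: ennreal_leI)
    qed
  qed
  from tendsto_total_var[OF L subset_refl total_le_total_var total_nonneg this]
  show "(\<lambda>k. total_var (strict_approximant \<alpha> \<beta> \<gamma> k) (ball 0 1)) \<longlonglongrightarrow> total_var (u_map \<alpha> \<beta> \<gamma>) (ball 0 1)"
    and "total_var (u_map \<alpha> \<beta> \<gamma>) (ball 0 1) = ennreal (total \<alpha> \<beta> \<gamma>)" by auto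
qed

lemma u_map_BV: "u_map \<alpha> \<beta> \<gamma> \<in> BV_maps (ball 0 1)"
  unfolding BV_maps_def by (simp add: total_var_u_map u_map_L1)

lemma strict_approximants_strict: "strict_BV_conv (ball 0 1) (strict_approximant \<alpha> \<beta> \<gamma>) (u_map \<alpha> \<beta> \<gamma>)"
  unfolding strict_BV_conv_def
proof (intro conjI allI u_map_BV strict_approximants strict_approximants_L1)
  fix k
  have "total_var (strict_approximant \<alpha> \<beta> \<gamma> k) (ball 0 1) < \<infinity>"
    using order_le_less_trans[OF total_var_strict_approximant_le[of "ball 0 1" \<alpha> \<beta> \<gamma> k]] by simp
  then show "strict_approximant \<alpha> \<beta> \<gamma> k \<in> BV_maps (ball 0 1)"
    using strict_approximants_L1[of \<alpha> \<beta> \<gamma>] unfolding BV_maps_def L1_conv_def by simp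
qed

section \<open>Localisation to balls at the triple points\<close>

lemma local_total_nonneg: "0 \<le> local_total \<alpha> \<beta> \<gamma> i" by (simp add: local_total_def)

lemma local_total_le:
  assumes "i \<ge> 1" "0 < r" "r \<le> q i / 2"
  shows "ennreal (r * local_total \<alpha> \<beta> \<gamma> i) \<le> total_var (u_map \<alpha> \<beta> \<gamma>) (ball (A_pt i) r)"
proof -
  interpret three_sectors "A_pt i" r "u_map \<alpha> \<beta> \<gamma>" \<alpha> "col \<beta> \<gamma> (i - 1)" "col \<beta> \<gamma> i"
    by (rule three_sectors_A_pt[OF assms])
  have d: "dist p (p + s *\<^sub>R e) = \<bar>s\<bar>" if "norm e = 1" for p e :: "real^2" and s using that by (simp add: dist_norm)
  have n: "norm (axis 2 1 :: real^2) = 1" by (simp add: norm_axis_1)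
  have "{s. 0 < s \<and> A_pt i + s *\<^sub>R ee \<in> ball (A_pt i) r} = {0<..<r}" "{s. s < 0 \<and> A_pt i + s *\<^sub>R ee \<in> ball (A_pt i) r} = {-r<..<0}"
    "{s. s < 0 \<and> A_pt i + s *\<^sub>R axis 2 1 \<in> ball (A_pt i) r} = {-r<..<0}"
    using assms(2) unfolding mem_ball d[OF norm_ee(1)] d[OF n] by auto
  from total_var_ge_rays[OF open_ball subset_refl, unfolded this] assms(2)
  show ?thesis by (simp add: local_total_def ennreal_mult[symmetric] ennreal_plus[symmetric] distrib_left mult.commute del: ennreal_plus)
qed

text \<open>Strict convergence passes from the disk to the ball: the three rays bound the variation
  of u below, and the sharp bound off the closed ball limits what approximants can have inside.
  Removing the closed ball keeps both sets open and disjoint.\<close>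

lemma strict_on_ball:
  assumes s: "strict_BV_conv (ball 0 1) w (u_map \<alpha> \<beta> \<gamma>)" and i: "i \<ge> 1" and r: "0 < r" "r < q i / 2"
  shows "strict_BV_conv (ball (A_pt i) r) w (u_map \<alpha> \<beta> \<gamma>)"
    and "total_var (u_map \<alpha> \<beta> \<gamma>) (ball (A_pt i) r) = ennreal (r * local_total \<alpha> \<beta> \<gamma> i)"
proof -
  let ?u = "u_map \<alpha> \<beta> \<gamma>" and ?B = "ball (A_pt i) r"
  have L: "L1_conv (ball 0 1) w ?u" and lim: "(\<lambda>k. total_var (w k) (ball 0 1)) \<longlonglongrightarrow> total_var ?u (ball 0 1)" and bv: "\<And>k. w k \<in> BV_maps (ball 0 1)"
    using s unfolding strict_BV_conv_def by auto
  have sub: "?B \<subseteq> ball 0 1" using A_pt_ball_subset[OF i, of r] r ball_subset_cball by (meson less_imp_le order_trans)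
  have c0: "0 \<le> r * local_total \<alpha> \<beta> \<gamma> i" using r local_total_nonneg by simp
  have ev: "eventually (\<lambda>k. total_var (w k) ?B \<le> ennreal (r * local_total \<alpha> \<beta> \<gamma> i + \<epsilon>)) sequentially" if "0 < \<epsilon>" for \<epsilon>
    by (rule eventually_total_var_le[OF L lim _ sub _ _ _ c0 that, where B="ball 0 1 - cball (A_pt i) r"])
      (use total_var_complement[OF i r] in \<open>auto simp: total_var_u_map\<close>)
  note t = tendsto_total_var[OF L sub local_total_le[OF i r(1) less_imp_le[OF r(2)]] c0 ev]
  show "total_var ?u ?B = ennreal (r * local_total \<alpha> \<beta> \<gamma> i)" by (rule t(2))
  have "w k \<in> BV_maps ?B" for k
    using bv[of k] total_var_mono[OF sub, of "w k"] L1_maps_subset[OF _ sub open_ball] unfolding BV_maps_def by auto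
  moreover have "?u \<in> BV_maps ?B" unfolding BV_maps_def using t(2) by (simp add: u_map_L1)
  ultimately show "strict_BV_conv ?B w ?u"
    unfolding strict_BV_conv_def using L1_conv_subset[OF L sub open_ball] t(1) by blast
qed

lemma col_set: "i \<ge> 1 \<Longrightarrow> {\<alpha>, col \<beta> \<gamma> (i - 1), col \<beta> \<gamma> i} = {\<alpha>, \<beta>, \<gamma>}"
  by (cases i) (auto simp: col_def)

lemma triangle_le_liminf_TVJ:
  assumes s: "strict_BV_conv (ball (A_pt i) r) w (u_map \<alpha> \<beta> \<gamma>)" and i: "i \<ge> 1" and r: "0 < r" "r < q i / 2"
    and c: "\<And>k. C1_on (ball (A_pt i) r) (w k)"
  shows "emeasure lebesgue (convex hull {\<alpha>, \<beta>, \<gamma>}) \<le> liminf (\<lambda>k. TVJ (w k) (ball (A_pt i) r))"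
proof -
  have V: "total_var (u_map \<alpha> \<beta> \<gamma>) (ball (A_pt i) r) \<le> ennreal (r * (norm (col \<beta> \<gamma> (i - 1) - \<alpha>) + norm (col \<beta> \<gamma> i - \<alpha>) + norm (col \<beta> \<gamma> (i - 1) - col \<beta> \<gamma> i)))"
    \<comment> \<open>The value on the ball depends on u alone, so the explicit strictly convergent
      sequence may be used to obtain it.\<close>
    using strict_on_ball(2)[OF strict_approximants_strict i r, of \<alpha> \<beta> \<gamma>] by (simp add: local_total_def)
  have L: "L1_conv (ball (A_pt i) r) w (u_map \<alpha> \<beta> \<gamma>)" "(\<lambda>k. total_var (w k) (ball (A_pt i) r)) \<longlonglongrightarrow> total_var (u_map \<alpha> \<beta> \<gamma>) (ball (A_pt i) r)"
    using s unfolding strict_BV_conv_def by auto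
  note three_sectors.emeasure_triangle_le_liminf_TVJ[OF three_sectors_A_pt[OF i r(1) less_imp_le[OF r(2)]] V c L]
  then show ?thesis unfolding col_set[OF i] .
qed

section \<open>Jacobian of the approximants near a triple point\<close>

lemma cross_noncollinear:
  fixes \<alpha> \<beta> \<gamma> :: "real^2"
  assumes "\<not> collinear {\<alpha>, \<beta>, \<gamma>}"
  shows "(\<beta> - \<alpha>)$1 * (\<gamma> - \<alpha>)$2 - (\<beta> - \<alpha>)$2 * (\<gamma> - \<alpha>)$1 \<noteq> 0"
proof
  define v w where "v = \<beta> - \<alpha>" and "w = \<gamma> - \<alpha>"
  assume "(\<beta> - \<alpha>)$1 * (\<gamma> - \<alpha>)$2 - (\<beta> - \<alpha>)$2 * (\<gamma> - \<alpha>)$1 = 0"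
  then have z: "v$1 * w$2 = v$2 * w$1" unfolding v_def w_def by simp
  have "collinear {0, v, w}"
  proof (cases "v = 0")
    case False
    then consider "v$1 \<noteq> 0" | "v$2 \<noteq> 0" by (auto simp: vec_eq_iff forall_2)
    then have "\<exists>c. w = c *\<^sub>R v"
    proof cases
      case 1 then show ?thesis using z by (intro exI[of _ "w$1 / v$1"]) (simp add: vec_eq_iff forall_2 field_simps)
    next
      case 2 then show ?thesis using z by (intro exI[of _ "w$2 / v$2"]) (simp add: vec_eq_iff forall_2 field_simps)
    qed
    then show ?thesis by (simp add: collinear_lemma)
  qed (simp add: insert_commute)
  then have "collinear {\<beta>, \<alpha>, \<gamma>}" unfolding v_def w_def by (subst collinear_3) (auto simp: NO_MATCH_def)
  then show False using assms by (simp add: insert_commute)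
qed

text \<open>Up to a sign depending on parity this is the cross product of \<beta> - \<alpha> and
  \<gamma> - \<alpha>, twice the signed area of the triangle.\<close>

lemma cross_shift_jump:
  assumes "\<not> collinear {\<alpha>, \<beta>, \<gamma>}" "i \<ge> 1"
  shows "shift \<alpha> \<beta> \<gamma> (i - 1)$1 * jump \<alpha> \<beta> \<gamma> i$2 - shift \<alpha> \<beta> \<gamma> (i - 1)$2 * jump \<alpha> \<beta> \<gamma> i$1 \<noteq> 0"
proof -
  obtain k where k: "i = Suc k" using assms(2) by (cases i) auto
  show ?thesis using cross_noncollinear[OF assms(1)] by (cases "even k") (simp_all add: k shift_def jump_def col_def algebra_simps)
qed

lemma coefficients_unique:
  fixes c j :: "real^2"
  assumes D: "c$1 * j$2 - c$2 * j$1 \<noteq> 0" and e: "a *\<^sub>R c + b *\<^sub>R j = a' *\<^sub>R c + b' *\<^sub>R j"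
  shows "a = a'" "b = b'"
proof -
  have e: "a * c$1 + b * j$1 = a' * c$1 + b' * j$1" "a * c$2 + b * j$2 = a' * c$2 + b' * j$2"
    using arg_cong[OF e, of "\<lambda>v::real^2. v$1"] arg_cong[OF e, of "\<lambda>v::real^2. v$2"] by simp_all
  then have "(a - a') * (c$1 * j$2 - c$2 * j$1) = 0" "(b - b') * (c$1 * j$2 - c$2 * j$1) = 0" by algebra+
  then show "a = a'" "b = b'" using D by simp_all
qed

text \<open>Near \<open>A\<^sub>i\<close> only the square where the ramp across the oblique side meets the ramp across
  the vertical one is mapped onto a set of positive measure, and there the map is injective.\<close>
lemma TVJ_strict_approximant_le:
  assumes nc: "\<not> collinear {\<alpha>, \<beta>, \<gamma>}" and i: "i \<ge> 1" "i \<le> n" and r: "r < q i / 2"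
  shows "TVJ (strict_approximant \<alpha> \<beta> \<gamma> n) (ball (A_pt i) r) \<le> emeasure lebesgue (convex hull {\<alpha>, \<beta>, \<gamma>})"
proof -
  define \<delta> where "\<delta> = width n"
  define c j where "c = shift \<alpha> \<beta> \<gamma> (i - 1)" and "j = jump \<alpha> \<beta> \<gamma> i"
  have \<delta>: "0 < \<delta>" by (simp add: \<delta>_def)
  have qn: "q n \<le> q i" unfolding q_def using i(2) by (intro power_decreasing) auto
  have \<delta>1: "\<delta> \<le> cc * q (Suc i)" unfolding \<delta>_def by (rule width_le_cq[OF i(2)])
  have \<delta>2: "\<delta> \<le> q i / 4" using width_le[of n] qn by (simp add: \<delta>_def)
  let ?w = "strict_approximant \<alpha> \<beta> \<gamma> n" and ?B = "ball (A_pt i) r"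
  define S where "S = ?B \<inter> {x::real^2. 0 < x$1 - 2 * cc * x$2 \<and> x$1 - 2 * cc * x$2 < \<delta> \<and> cc * q i - \<delta> < x$1 \<and> x$1 < cc * q i}"
  have x2: "0 < x$2" and x1: "x$1 < cc * q i + q i / 2" and ex: "q i / 2 < cc * x$1 + x$2 / 2" if "x \<in> ?B" for x :: "real^2"
  proof -
    have n: "norm (x - A_pt i) < r" using that by (simp add: dist_norm norm_minus_commute)
    have "\<bar>(x - A_pt i)$1\<bar> < r" "\<bar>(x - A_pt i)$2\<bar> < r"
      using n component_le_norm_cart[of "x - A_pt i" 1] component_le_norm_cart[of "x - A_pt i" 2] by linarith+
    then show "0 < x$2" "x$1 < cc * q i + q i / 2" using r by (auto simp: A_pt_inner)
    have "\<bar>(x - A_pt i) \<bullet> ee\<bar> \<le> norm (x - A_pt i) * norm ee" by (rule Cauchy_Schwarz_ineq2)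
    moreover have "(x - A_pt i) \<bullet> ee = cc * x$1 + x$2 / 2 - (cc * cc * q i + q i / 4)"
      by (simp add: inner_ee A_pt_inner algebra_simps diff_divide_distrib)
    ultimately show "q i / 2 < cc * x$1 + x$2 / 2" using n r by (simp add: cc_sq abs_le_iff)
  qed
  have low: "cc * q (Suc i) < x$1" if "x \<in> ?B" "0 < x$1 - 2 * cc * x$2" for x :: "real^2"
  proof -
    have "cc * (q i / 2) < cc * (cc * x$1 + x$2 / 2)" using ex[OF that(1)] cc_pos by (rule mult_strict_left_mono)
    moreover have "cc * (cc * x$1 + x$2 / 2) = (cc * cc) * x$1 + cc * x$2 / 2" by (simp add: algebra_simps)
    ultimately show ?thesis using that(2) by (simp add: cc_sq q_Suc)
  qed
  have right: "\<delta> \<le> x$1 + 2 * cc * x$2" if "x \<in> ?B" "0 < x$1 - 2 * cc * x$2" for x :: "real^2"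
    using low[OF that] \<delta>1 mult_pos_pos[OF cc_pos x2[OF that(1)]] by simp
  have high: "x$1 \<le> cc * q k - width n" if "x \<in> ?B" "k < i" for x :: "real^2" and k
    using x1[OF that(1)] cq_less[OF that(2)] \<delta>2 cq_lower[of i] q_pos[of i] unfolding \<delta>_def by linarith
  have prof: "strict_profile \<alpha> \<beta> \<gamma> n (x$1) = c + sstep ((cc * q i - x$1) / \<delta>) *\<^sub>R j"
    "strict_profile' \<alpha> \<beta> \<gamma> n (x$1) = - slope \<delta> (cc * q i) (x$1) *\<^sub>R j" if "x \<in> ?B" "0 < x$1 - 2 * cc * x$2" for x :: "real^2"
  proof -
    have "(\<Sum>k<i. jump \<alpha> \<beta> \<gamma> k) = c" using sum_jump[of \<alpha> \<beta> \<gamma> "i - 1"] i(1) by (simp add: c_def del: sum.lessThan_Suc)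
    then show "strict_profile \<alpha> \<beta> \<gamma> n (x$1) = c + sstep ((cc * q i - x$1) / \<delta>) *\<^sub>R j"
      using strict_profile'_zone(1)[OF i(2) less_imp_le[OF low[OF that]] high[OF that(1)], of \<alpha> \<beta> \<gamma>] by (simp add: step_at_def \<delta>_def j_def)
    show "strict_profile' \<alpha> \<beta> \<gamma> n (x$1) = - slope \<delta> (cc * q i) (x$1) *\<^sub>R j"
      using strict_profile'_zone(2)[OF i(2) less_imp_le[OF low[OF that]] high[OF that(1)], of \<alpha> \<beta> \<gamma>] by (simp add: \<delta>_def j_def)
  qed
  have w: "?w x = \<alpha> + sstep ((x$1 - 2 * cc * x$2) / \<delta>) *\<^sub>R (c + sstep ((cc * q i - x$1) / \<delta>) *\<^sub>R j)" if "x \<in> S" for x :: "real^2"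
  proof -
    have x: "x \<in> ?B" "0 < x$1 - 2 * cc * x$2" using that by (auto simp: S_def)
    have "1 \<le> (x$1 + 2 * cc * x$2) / \<delta>" using right[OF x] \<delta> by simp
    then show ?thesis using prof(1)[OF x] by (simp add: strict_approximant_def approximant_def wedge_def sstep_1 \<delta>_def)
  qed
  have d: "(?w has_derivative (\<lambda>h. wedge \<delta> x *\<^sub>R (h$1 *\<^sub>R strict_profile' \<alpha> \<beta> \<gamma> n (x$1)) + (wedge_grad \<delta> x \<bullet> h) *\<^sub>R strict_profile \<alpha> \<beta> \<gamma> n (x$1))) (at x)" for x :: "real^2"
    using approximant_has_derivative[OF width_pos strict_profile_deriv] unfolding strict_approximant_def \<delta>_def .
  have z: "det (grad ?w x) = 0" if "x \<in> ?B - S" for x :: "real^2"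
  proof -
    have xB: "x \<in> ?B" and xS: "x \<notin> S" using that by simp_all
    have D: "det (grad ?w x) = - (wedge \<delta> x * wedge_grad \<delta> x$2 * ((strict_profile \<alpha> \<beta> \<gamma> n (x$1))$1 * (strict_profile' \<alpha> \<beta> \<gamma> n (x$1))$2 - (strict_profile \<alpha> \<beta> \<gamma> n (x$1))$2 * (strict_profile' \<alpha> \<beta> \<gamma> n (x$1))$1))"
      unfolding strict_approximant_def \<delta>_def by (rule det_grad_approximant[OF width_pos strict_profile_deriv])
    \<comment> \<open>Outside the square one factor of the determinant vanishes: the wedge function
      itself, its gradient because both ramps are saturated, or the derivative of the
      profile.\<close>
    consider (1) "x$1 - 2 * cc * x$2 \<le> 0" | (2) "\<delta> \<le> x$1 - 2 * cc * x$2" | (3) "0 < x$1 - 2 * cc * x$2" "x$1 \<le> cc * q i - \<delta> \<or> cc * q i \<le> x$1"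
      using xS xB unfolding S_def by (simp add: not_less) argo
    then show ?thesis
    proof cases
      case 1
      then have "x$1 \<le> 2 * cc * \<bar>x$2\<bar>" using x2[OF xB] by simp
      then show ?thesis unfolding D using wedge_zero[OF \<delta>] by simp
    next
      case 2
      then have "1 \<le> (x$1 - 2 * cc * x$2) / \<delta>" "1 \<le> (x$1 + 2 * cc * x$2) / \<delta>"
        using \<delta> mult_pos_pos[OF cc_pos x2[OF xB]] by (simp_all add: pos_le_divide_eq)
      then show ?thesis unfolding D wedge_grad_def by (simp add: sstep'_1)
    next
      case 3
      then have "strict_profile' \<alpha> \<beta> \<gamma> n (x$1) = 0" using prof(2)[OF xB 3(1)] slope_0[OF \<delta>, of "cc * q i" "x$1"] by auto
      then show ?thesis unfolding D by simp
    qed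
  qed
  have arg: "0 < (x$1 - 2 * cc * x$2) / \<delta>" "(x$1 - 2 * cc * x$2) / \<delta> < 1" "0 < (cc * q i - x$1) / \<delta>" "(cc * q i - x$1) / \<delta> < 1" if "x \<in> S" for x :: "real^2"
    using that \<delta> by (auto simp: S_def)
  have inj: "inj_on ?w S"
  proof (rule inj_onI)
    fix x y :: "real^2" assume xy: "x \<in> S" "y \<in> S" "?w x = ?w y"
    \<comment> \<open>In the basis c, j the map minus \<alpha> has coordinates f and f g. Since f >
      0, both f and g are recovered, and strict monotonicity of \<open>sstep\<close> then returns
      the two coordinates of the point.\<close>
    let ?f = "\<lambda>x::real^2. sstep ((x$1 - 2 * cc * x$2) / \<delta>)" and ?g = "\<lambda>x::real^2. sstep ((cc * q i - x$1) / \<delta>)"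
    have "?f x *\<^sub>R c + (?f x * ?g x) *\<^sub>R j = ?f y *\<^sub>R c + (?f y * ?g y) *\<^sub>R j"
      using xy(3) unfolding w[OF xy(1)] w[OF xy(2)] by (simp add: scaleR_add_right)
    note u = coefficients_unique[OF cross_shift_jump[OF nc i(1), folded c_def j_def] this]
    have "0 < ?f y" using sstep_strict_mono[of 0 "(y$1 - 2 * cc * y$2) / \<delta>"] arg[OF xy(2)] by (simp add: sstep_0)
    then have "?g x = ?g y" using u by simp
    then have g: "(cc * q i - x$1) / \<delta> = (cc * q i - y$1) / \<delta>"
      by (rule inj_onD[OF sstep_inj]) (use arg[OF xy(1)] arg[OF xy(2)] in auto)
    have f: "(x$1 - 2 * cc * x$2) / \<delta> = (y$1 - 2 * cc * y$2) / \<delta>"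
      by (rule inj_onD[OF sstep_inj u(1)]) (use arg[OF xy(1)] arg[OF xy(2)] in auto)
    have 1: "x$1 = y$1" using g \<delta> by simp
    have "x$2 = y$2" using f \<delta> cc_pos unfolding 1 by simp
    with 1 show "x = y" by (simp add: vec_eq_iff forall_2)
  qed
  have T: "?w ` S \<subseteq> convex hull {\<alpha>, \<beta>, \<gamma>}"
  proof
    fix v assume "v \<in> ?w ` S"
    then obtain x :: "real^2" where x: "x \<in> S" "v = ?w x" by auto
    \<comment> \<open>The barycentric weights of the value are 1 - f, f (1 - g) and f g.\<close>
    let ?f = "sstep ((x$1 - 2 * cc * x$2) / \<delta>)" and ?g = "sstep ((cc * q i - x$1) / \<delta>)"
    have "v = (1 - ?f) *\<^sub>R \<alpha> + (?f * (1 - ?g)) *\<^sub>R col \<beta> \<gamma> (i - 1) + (?f * ?g) *\<^sub>R col \<beta> \<gamma> i"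
      unfolding x(2) w[OF x(1)] c_def j_def shift_def jump_def using i(1) by (simp add: algebra_simps)
    moreover have "0 \<le> 1 - ?f" "0 \<le> ?f * (1 - ?g)" "0 \<le> ?f * ?g" by (simp_all add: mult_nonneg_nonneg)
    moreover have "1 - ?f + ?f * (1 - ?g) + ?f * ?g = 1" by (simp add: algebra_simps)
    ultimately have "v \<in> convex hull {\<alpha>, col \<beta> \<gamma> (i - 1), col \<beta> \<gamma> i}" unfolding convex_hull_3 by blast
    then show "v \<in> convex hull {\<alpha>, \<beta>, \<gamma>}" unfolding col_set[OF i(1)] .
  qed
  have "open S" unfolding S_def by (intro open_Int open_ball open_Collect_conj open_Collect_less continuous_intros)
  moreover have "compact (convex hull {\<alpha>, \<beta>, \<gamma>})" by (intro finite_imp_compact_convex_hull) simp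
  ultimately show ?thesis
    by (intro TVJ_le_emeasure_of_inj_on[OF _ _ d z inj T]) (auto simp: S_def compact_imp_bounded lmeasurable_compact fmeasurableD)
qed

section \<open>The relaxed functionals\<close>

lemma TVJ_BV_local:
  assumes nc: "\<not> collinear {\<alpha>, \<beta>, \<gamma>}" and i: "i \<ge> 1" and r: "0 < r" "r < q i / 2"
  shows "TVJ_BV (u_map \<alpha> \<beta> \<gamma>) (ball (A_pt i) r) = emeasure lebesgue (convex hull {\<alpha>, \<beta>, \<gamma>})"
proof (rule antisym)
  let ?T = "emeasure lebesgue (convex hull {\<alpha>, \<beta>, \<gamma>})"
  have "eventually (\<lambda>n. TVJ (strict_approximant \<alpha> \<beta> \<gamma> n) (ball (A_pt i) r) \<le> ?T) sequentially"
    using eventually_ge_at_top[of i] by eventually_elim (rule TVJ_strict_approximant_le[OF nc i _ r(2)])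
  then have "liminf (\<lambda>n. TVJ (strict_approximant \<alpha> \<beta> \<gamma> n) (ball (A_pt i) r)) \<le> ?T"
    by (intro order_trans[OF Liminf_le_Limsup Limsup_bounded]) simp_all
  moreover have "TVJ_BV (u_map \<alpha> \<beta> \<gamma>) (ball (A_pt i) r) \<le> liminf (\<lambda>n. TVJ (strict_approximant \<alpha> \<beta> \<gamma> n) (ball (A_pt i) r))"
    unfolding TVJ_BV_def using strict_on_ball(1)[OF strict_approximants_strict i r] strict_approximant_C1 by (intro Inf_lower) blast
  ultimately show "TVJ_BV (u_map \<alpha> \<beta> \<gamma>) (ball (A_pt i) r) \<le> ?T" by (rule order_trans[rotated])
  show "?T \<le> TVJ_BV (u_map \<alpha> \<beta> \<gamma>) (ball (A_pt i) r)"
    unfolding TVJ_BV_def using triangle_le_liminf_TVJ[OF _ i r] by (intro Inf_greatest) blast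
qed

section \<open>Infinite relaxed Jacobian on the disk\<close>

lemma emeasure_triangle_pos:
  fixes \<alpha> \<beta> \<gamma> :: "real^2"
  assumes "\<not> collinear {\<alpha>, \<beta>, \<gamma>}"
  shows "0 < emeasure lebesgue (convex hull {\<alpha>, \<beta>, \<gamma>})"
proof (rule ccontr)
  assume "\<not> 0 < emeasure lebesgue (convex hull {\<alpha>, \<beta>, \<gamma>})"
  then have "emeasure lebesgue (convex hull {\<alpha>, \<beta>, \<gamma>}) = 0" by (simp add: not_gr_zero)
  moreover have "convex hull {\<alpha>, \<beta>, \<gamma>} \<in> sets lebesgue" by (intro fmeasurableD lmeasurable_compact finite_imp_compact_convex_hull) simp
  ultimately have "negligible (convex hull {\<alpha>, \<beta>, \<gamma>})" by (simp add: negligible_iff_null_sets null_setsI)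
  then have "negligible (interior (convex hull {\<alpha>, \<beta>, \<gamma>}))" using interior_subset negligible_subset by blast
  then have "interior (convex hull {\<alpha>, \<beta>, \<gamma>}) = {}" using open_not_negligible[OF open_interior] by blast
  moreover have "(1/3) *\<^sub>R \<alpha> + (1/3) *\<^sub>R \<beta> + (1/3) *\<^sub>R \<gamma> \<in> interior (convex hull {\<alpha>, \<beta>, \<gamma>})"
    by (subst interior_convex_hull_3_minimal[OF assms]) (auto intro!: exI[of _ "1/3"])
  ultimately show False by simp
qed

lemma TVJ_sum_le:
  assumes c: "C1_on \<Omega> w" and "open \<Omega>" "finite I" "\<And>i. i \<in> I \<Longrightarrow> open (R i) \<and> R i \<subseteq> \<Omega>" and d: "disjoint_family_on R I"
  shows "(\<Sum>i\<in>I. TVJ w (R i)) \<le> TVJ w \<Omega>"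
proof -
  have m: "(\<lambda>x. ennreal \<bar>det (grad w x)\<bar> * indicator (R i) x) \<in> borel_measurable lebesgue" if "i \<in> I" for i
  proof -
    have "continuous_on (R i) (\<lambda>x. \<bar>det (grad w x)\<bar>)"
      using continuous_on_subset[OF continuous_on_det_grad[OF c]] assms(4)[OF that] by (intro continuous_intros) blast
    from borel_measurable_continuous_on_indicator[OF _ this]
    have "(\<lambda>x. ennreal (indicator (R i) x *\<^sub>R \<bar>det (grad w x)\<bar>)) \<in> borel_measurable borel" using assms(4)[OF that] by simp
    also have "(\<lambda>x. ennreal (indicator (R i) x *\<^sub>R \<bar>det (grad w x)\<bar>)) = (\<lambda>x. ennreal \<bar>det (grad w x)\<bar> * indicator (R i) x)"
      by (auto simp: indicator_def fun_eq_iff)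
    finally show ?thesis by (intro measurable_completion) simp
  qed
  have "(\<Sum>i\<in>I. TVJ w (R i)) = (\<integral>\<^sup>+x. (\<Sum>i\<in>I. ennreal \<bar>det (grad w x)\<bar> * indicator (R i) x) \<partial>lebesgue)"
    unfolding TVJ_def using m by (subst nn_integral_sum) auto
  also have "\<dots> \<le> TVJ w \<Omega>" unfolding TVJ_def
  proof (rule nn_integral_mono)
    fix x
    have "(\<Sum>i\<in>I. indicator (R i) x :: ennreal) = indicator (\<Union>i\<in>I. R i) x"
      by (rule indicator_UN_disjoint[OF assms(3) d, symmetric])
    also have "\<dots> \<le> indicator \<Omega> x" using assms(4) by (auto simp: indicator_def)
    finally show "(\<Sum>i\<in>I. ennreal \<bar>det (grad w x)\<bar> * indicator (R i) x) \<le> ennreal \<bar>det (grad w x)\<bar> * indicator \<Omega> x"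
      unfolding sum_distrib_left[symmetric] by (rule mult_left_mono) simp
  qed
  finally show ?thesis .
qed

lemma disjoint_balls: "disjoint_family_on (\<lambda>i. ball (A_pt i) (q i / 4)) I"
  unfolding disjoint_family_on_def
proof (intro ballI impI)
  have d: "ball (A_pt i) (q i / 4) \<inter> ball (A_pt j) (q j / 4) = {}" if "i < j" for i j
  proof -
    have "dist (A_pt i) (A_pt j) = \<bar>q i - q j\<bar>" unfolding A_pt_eq dist_norm scaleR_diff_left[symmetric] by simp
    then show ?thesis using q_less[OF that] q_pos[of i] by (intro disjoint_ballI) linarith
  qed
  show "ball (A_pt i) (q i / 4) \<inter> ball (A_pt j) (q j / 4) = {}" if "i \<noteq> j" for i j
    using d[of i j] d[of j i] that by (cases "i < j") (auto simp: Int_commute not_less_iff_gr_or_eq)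
qed

lemma TVJ_BV_infinite:
  assumes nc: "\<not> collinear {\<alpha>, \<beta>, \<gamma>}"
  shows "TVJ_BV (u_map \<alpha> \<beta> \<gamma>) (ball 0 1) = \<infinity>"
proof -
  let ?T = "emeasure lebesgue (convex hull {\<alpha>, \<beta>, \<gamma>})"
  \<comment> \<open>A finite level strictly below the area: each ball eventually exceeds it, so N
    disjoint balls contribute at least N c, for every N.\<close>
  obtain z where z: "0 < z" "z < ?T" using dense[OF emeasure_triangle_pos[OF nc]] by auto
  then obtain c where c: "z = ennreal c" "0 < c" by (cases z) (auto simp: top_unique)
  have "liminf (\<lambda>k. TVJ (w k) (ball 0 1)) = \<infinity>" if C1: "\<And>k. C1_on (ball 0 1) (w k)" and s: "strict_BV_conv (ball 0 1) w (u_map \<alpha> \<beta> \<gamma>)" for w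
  proof -
    let ?R = "\<lambda>i. ball (A_pt i) (q i / 4)"
    have ge: "ennreal (real N * c) \<le> liminf (\<lambda>k. TVJ (w k) (ball 0 1))" for N
    proof (rule Liminf_bounded)
      have sub: "?R i \<subseteq> ball 0 1" if "i \<ge> 1" for i
        using A_pt_ball_subset[OF that, of "q i / 4"] ball_subset_cball by (auto intro: order_trans)
      have "eventually (\<lambda>k. z < TVJ (w k) (?R i)) sequentially" if "i \<in> {1..N}" for i
      proof -
        have i: "i \<ge> 1" "0 < q i / 4" "q i / 4 < q i / 2" using that by auto
        have "?T \<le> liminf (\<lambda>k. TVJ (w k) (?R i))"
          by (rule triangle_le_liminf_TVJ[OF strict_on_ball(1)[OF s i] i C1_on_subset[OF C1 sub[OF i(1)]]])
        then show ?thesis using z(2) by (intro less_LiminfD) auto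
      qed
      then have "eventually (\<lambda>k. \<forall>i\<in>{1..N}. z < TVJ (w k) (?R i)) sequentially" by (intro eventually_ball_finite) auto
      then show "eventually (\<lambda>k. ennreal (real N * c) \<le> TVJ (w k) (ball 0 1)) sequentially"
      proof eventually_elim
        case (elim k)
        have "ennreal (real N * c) = (\<Sum>i\<in>{1..N}. z)" using c by (simp add: ennreal_mult ennreal_of_nat_eq_real_of_nat)
        also have "\<dots> \<le> (\<Sum>i\<in>{1..N}. TVJ (w k) (?R i))" using elim by (intro sum_mono) (auto simp: less_imp_le)
        also have "\<dots> \<le> TVJ (w k) (ball 0 1)" using sub by (intro TVJ_sum_le C1 disjoint_balls) auto
        finally show ?case .
      qed
    qed
    show ?thesis
    proof (rule ccontr)
      assume "liminf (\<lambda>k. TVJ (w k) (ball 0 1)) \<noteq> \<infinity>"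
      then obtain y where y: "liminf (\<lambda>k. TVJ (w k) (ball 0 1)) = ennreal y" "0 \<le> y" by (cases "liminf (\<lambda>k. TVJ (w k) (ball 0 1))") auto
      obtain N where "y < real N * c" using reals_Archimedean3[OF c(2)] by blast
      then show False using ge[of N] y c(2) by (simp add: ennreal_le_iff)
    qed
  qed
  then show ?thesis unfolding TVJ_BV_def by (auto intro!: antisym Inf_greatest simp: top_unique[symmetric])
qed

lemma TVJ_le_area: "TVJ v \<Omega> \<le> area_functional v \<Omega>"
  unfolding TVJ_def area_functional_def
  by (intro nn_integral_mono mult_right_mono ennreal_leI real_le_rsqrt) auto

lemma TVJ_BV_le_area_BV: "TVJ_BV u \<Omega> \<le> area_BV u \<Omega>"
  unfolding area_BV_def
proof (rule Inf_greatest)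
  fix y assume "y \<in> {liminf (\<lambda>k. area_functional (w k) \<Omega>) |w. (\<forall>k. C1_on \<Omega> (w k)) \<and> strict_BV_conv \<Omega> w u}"
  then obtain w where w: "y = liminf (\<lambda>k. area_functional (w k) \<Omega>)" "\<forall>k. C1_on \<Omega> (w k)" "strict_BV_conv \<Omega> w u" by auto
  have "TVJ_BV u \<Omega> \<le> liminf (\<lambda>k. TVJ (w k) \<Omega>)" unfolding TVJ_BV_def using w by (intro Inf_lower) auto
  also have "\<dots> \<le> y" unfolding w(1) by (intro Liminf_mono always_eventually allI TVJ_le_area)
  finally show "TVJ_BV u \<Omega> \<le> y" .
qed

section \<open>Upper bound for the relaxed area and comparison of the domains\<close>

lemma area_flat_approximant_le:
  "area_functional (approximant \<alpha> (flat_profile \<alpha> \<beta> \<gamma> n) (width n)) (ball 0 1)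
    \<le> ennreal (pi + 23/6 * norm (\<beta> - \<alpha>) + 13/6 * norm (\<alpha> - \<gamma>))"
proof -
  let ?w = "approximant \<alpha> (flat_profile \<alpha> \<beta> \<gamma> n) (width n)"
  have "C1_on UNIV ?w" by (rule approximant_C1[OF width_pos flat_profile_deriv flat_profile'_continuous])
  then have m [measurable]: "grad ?w \<in> borel_measurable borel" by (intro borel_measurable_continuous_onI continuous_on_grad)
  \<comment> \<open>As the Jacobian vanishes, this inequality splits off the area of the disk, which
    is where \<open>pi\<close> comes from.\<close>
  have "sqrt (1 + (norm (grad ?w x))\<^sup>2) \<le> 1 + norm (grad ?w x)" for x
    by (rule real_le_lsqrt) (auto simp: power2_eq_square algebra_simps)
  then have "area_functional ?w (ball 0 1) \<le> (\<integral>\<^sup>+x. ennreal (1 + norm (grad ?w x)) * indicator (ball 0 1) x \<partial>lebesgue)"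
    unfolding area_functional_def using det_flat_approximant[OF width_pos]
    by (intro nn_integral_mono mult_right_mono ennreal_leI) auto
  also have "\<dots> = (\<integral>\<^sup>+x. ennreal (1 + norm (grad ?w x)) * indicator (ball 0 1) x \<partial>lborel)" by (rule nn_integral_completion)
  also have "\<dots> \<le> (\<integral>\<^sup>+x. indicator (ball 0 1) x + ennreal (norm (grad ?w x)) \<partial>lborel)"
    by (intro nn_integral_mono) (auto simp: indicator_def ennreal_plus)
  also have "\<dots> = emeasure lborel (ball (0::real^2) 1) + (\<integral>\<^sup>+x. ennreal (norm (grad ?w x)) \<partial>lborel)"
    by (subst nn_integral_add) (auto intro!: borel_measurable_indicator)
  also have "\<dots> \<le> ennreal pi + ennreal (23/6 * norm (\<beta> - \<alpha>) + 13/6 * norm (\<alpha> - \<gamma>))"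
    by (intro add_mono grad_flat_approximant_le) (simp add: emeasure_ball unit_ball_vol_2)
  also have "\<dots> = ennreal (pi + 23/6 * norm (\<beta> - \<alpha>) + 13/6 * norm (\<alpha> - \<gamma>))"
    by (subst ennreal_plus[symmetric]) (auto simp: add.assoc)
  finally show ?thesis .
qed

lemma area_L1_u_map_le:
  "area_L1 (u_map \<alpha> \<beta> \<gamma>) (ball 0 1) \<le> ennreal (pi + 23/6 * norm (\<beta> - \<alpha>) + 13/6 * norm (\<alpha> - \<gamma>))"
proof -
  let ?w = "\<lambda>n. approximant \<alpha> (flat_profile \<alpha> \<beta> \<gamma> n) (width n)"
  have "\<forall>n. C1_on (ball 0 1) (?w n)" by (intro allI approximant_C1[OF width_pos flat_profile_deriv flat_profile'_continuous])
  then have "area_L1 (u_map \<alpha> \<beta> \<gamma>) (ball 0 1) \<le> liminf (\<lambda>n. area_functional (?w n) (ball 0 1))" unfolding area_L1_def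
    by (intro Inf_lower CollectI exI[of _ ?w] conjI refl flat_approximants_L1_conv open_ball bounded_ball)
  also have "\<dots> \<le> ennreal (pi + 23/6 * norm (\<beta> - \<alpha>) + 13/6 * norm (\<alpha> - \<gamma>))"
    by (intro order_trans[OF Liminf_le_Limsup Limsup_bounded] always_eventually allI area_flat_approximant_le) simp
  finally show ?thesis .
qed

text \<open>Every strictly convergent sequence is in particular a competitor for L1
  convergence.\<close>

lemma area_L1_le_area_BV: "area_L1 u \<Omega> \<le> area_BV u \<Omega>"
  unfolding area_L1_def area_BV_def strict_BV_conv_def by (intro Inf_superset_mono) blast

lemma Dom_area_psubset:
  fixes \<alpha> \<beta> \<gamma> :: "real^2"
  assumes nc: "\<not> collinear {\<alpha>, \<beta>, \<gamma>}"
  shows "Dom_area_BV (ball 0 1) \<subset> Dom_area_L1 (ball 0 1)"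
proof
  show "Dom_area_BV (ball 0 1) \<subseteq> Dom_area_L1 (ball 0 1)"
    unfolding Dom_area_BV_def Dom_area_L1_def BV_maps_def using area_L1_le_area_BV le_less_trans by blast
  have "u_map \<alpha> \<beta> \<gamma> \<in> Dom_area_L1 (ball 0 1)"
    unfolding Dom_area_L1_def using le_less_trans[OF area_L1_u_map_le[of \<alpha> \<beta> \<gamma>]] by (simp add: u_map_L1)
  moreover have "u_map \<alpha> \<beta> \<gamma> \<notin> Dom_area_BV (ball 0 1)"
    unfolding Dom_area_BV_def using TVJ_BV_le_area_BV[of "u_map \<alpha> \<beta> \<gamma>" "ball 0 1"] TVJ_BV_infinite[OF nc] by (simp add: top_unique)
  ultimately show "Dom_area_BV (ball 0 1) \<noteq> Dom_area_L1 (ball 0 1)" by blast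
qed

section \<open>Triple points\<close>

text \<open>Nonempty open sets are not negligible. This turns the almost everywhere condition of a
  triple point into actual points.\<close>

lemma AE_open_exists:
  assumes "AE x in lebesgue. P x" "open U" "U \<noteq> {}"
  shows "\<exists>x\<in>U. P (x::'a::euclidean_space)"
proof (rule ccontr)
  assume "\<not> (\<exists>x\<in>U. P x)"
  then have "AE x in lebesgue. x \<notin> U" using assms(1) by (auto elim: eventually_mono)
  then have "negligible U" using assms(2) by (simp add: negligible_iff_null_sets AE_iff_null_sets)
  then show False using open_not_negligible assms(2,3) by blast
qed

text \<open>Each sector is a cone and so meets every neighbourhood of p in a nonempty open set,
  where its value is attained. A map with at most three values must therefore show all of them
  arbitrarily close to a triple point.\<close>

lemma triple_point_values:
  assumes t: "triple_point u p" and W: "\<And>x. u x \<in> W" "finite W" "card W \<le> 3"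
  obtains r C where "0 < r" "\<And>a. a \<in> W \<Longrightarrow> open (C a)" "\<And>a x t. a \<in> W \<Longrightarrow> x \<in> C a \<Longrightarrow> 0 < t \<Longrightarrow> t *\<^sub>R x \<in> C a"
    "disjoint_family_on C W" "AE x in lebesgue. x \<in> ball p r \<longrightarrow> x - p \<in> C (u x)"
    "\<And>a U. a \<in> W \<Longrightarrow> open U \<Longrightarrow> p \<in> U \<Longrightarrow> \<exists>x\<in>U. u x = a"
proof -
  obtain r V C where r: "0 < r" and V: "card V = 3"
    and C: "\<And>a. a \<in> V \<Longrightarrow> open (C a) \<and> connected (C a) \<and> C a \<noteq> {} \<and> (\<forall>x\<in>C a. \<forall>t>0. t *\<^sub>R x \<in> C a)"
    and d: "disjoint_family_on C V" and ae: "AE x in lebesgue. x \<in> ball p r \<longrightarrow> u x \<in> V \<and> x - p \<in> C (u x)"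
    using t unfolding triple_point_def by blast
  have ex: "\<exists>x\<in>U. u x = a" if a: "a \<in> V" and U: "open U" "p \<in> U" for a U
  proof -
    let ?U = "U \<inter> ball p r \<inter> (\<lambda>x. x - p) -` C a"
    have "open ?U" using C[OF a] U by (intro open_Int open_ball open_vimage continuous_intros) auto
    moreover have "?U \<noteq> {}"
    proof -
      obtain y where y: "y \<in> C a" using C[OF a] by blast
      have "open (U \<inter> ball p r)" "p \<in> U \<inter> ball p r" using U r by auto
      then obtain e where e: "0 < e" "ball p e \<subseteq> U \<inter> ball p r" unfolding open_contains_ball by blast
      define t where "t = e / (norm y + 1)"
      have "0 < norm y + 1" by (simp add: add_nonneg_pos)
      then have t: "0 < t" "t * norm y < e" using e(1) by (auto simp: t_def field_simps)
      then have "p + t *\<^sub>R y \<in> ball p e" by (simp add: dist_norm)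
      then have "p + t *\<^sub>R y \<in> ?U" using e(2) C[OF a] y t(1) by auto
      then show ?thesis by blast
    qed
    ultimately obtain x where "x \<in> ?U" "x \<in> ball p r \<longrightarrow> u x \<in> V \<and> x - p \<in> C (u x)" using AE_open_exists[OF ae] by blast
    then have "x \<in> U" "u x \<in> V" "x - p \<in> C (u x) \<inter> C a" by auto
    then show ?thesis using disjoint_family_onD[OF d, of "u x" a] a by blast
  qed
  have "V \<subseteq> W" using ex[OF _ open_UNIV] W(1) by fastforce
  then have VW: "V = W" using V W(2,3) by (intro card_seteq) auto
  show thesis
  proof (rule that[of r C])
    show "AE x in lebesgue. x \<in> ball p r \<longrightarrow> x - p \<in> C (u x)" using ae by eventually_elim blast
  qed (use r C d ex VW in auto)
qed

lemma triple_pointI: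
  fixes p \<nu> y :: "real^2"
  assumes r: "0 < r" and dist: "\<alpha> \<noteq> b" "\<alpha> \<noteq> g" "b \<noteq> g" and \<nu>: "\<nu>$1 < 0" "y \<bullet> \<nu> < 0" "y$1 < 0"
    and above: "\<And>x. x \<in> ball p r \<Longrightarrow> (x - p) \<bullet> \<nu> > 0 \<Longrightarrow> u x = \<alpha>"
    and right: "\<And>x. x \<in> ball p r \<Longrightarrow> (x - p) \<bullet> \<nu> < 0 \<Longrightarrow> (x - p)$1 > 0 \<Longrightarrow> u x = b"
    and left: "\<And>x. x \<in> ball p r \<Longrightarrow> (x - p) \<bullet> \<nu> < 0 \<Longrightarrow> (x - p)$1 < 0 \<Longrightarrow> u x = g"
  shows "triple_point u p"
proof -
  define C where "C a = (if a = \<alpha> then {x. 0 < x \<bullet> \<nu>} else if a = b then {x. x \<bullet> \<nu> < 0} \<inter> {x. 0 < x$1} else {x. x \<bullet> \<nu> < 0} \<inter> {x. x$1 < 0})" for a :: "real^2"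
  have C: "C \<alpha> = {x. 0 < x \<bullet> \<nu>}" "C b = {x. x \<bullet> \<nu> < 0} \<inter> {x. 0 < x$1}" "C g = {x. x \<bullet> \<nu> < 0} \<inter> {x. x$1 < 0}"
    using dist by (auto simp: C_def)
  have i: "x$1 = axis 1 1 \<bullet> x" for x :: "real^2" by (simp add: inner_real2)
  have cv: "convex {x. 0 < x \<bullet> \<nu>}" "convex {x. x \<bullet> \<nu> < 0}" "convex {x::real^2. 0 < x$1}" "convex {x::real^2. x$1 < 0}"
    unfolding i inner_commute[of _ \<nu>] by (rule convex_halfspace_gt convex_halfspace_lt)+
  have \<nu>0: "\<nu> \<noteq> 0" "axis 1 1 \<noteq> (0::real^2)" using \<nu>(1) by auto
  have "AE x in lebesgue. x \<in> ball p r \<longrightarrow> u x \<in> {\<alpha>, b, g} \<and> x - p \<in> C (u x)"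
    using AE_not_hyperplane[OF \<nu>0(1), of p] AE_not_hyperplane[OF \<nu>0(2), of p]
  proof eventually_elim
    case (elim x)
    have ne: "(x - p) \<bullet> \<nu> \<noteq> 0" "(x - p)$1 \<noteq> 0" using elim unfolding i inner_commute[of _ "axis 1 1"] by simp_all
    show ?case
    proof
      assume x: "x \<in> ball p r"
      consider "(x - p) \<bullet> \<nu> > 0" | "(x - p) \<bullet> \<nu> < 0" "(x - p)$1 > 0" | "(x - p) \<bullet> \<nu> < 0" "(x - p)$1 < 0"
        using ne by linarith
      then show "u x \<in> {\<alpha>, b, g} \<and> x - p \<in> C (u x)"
      proof cases
        case 1 then show ?thesis using above[OF x 1] by (simp add: C)
      next
        case 2 then show ?thesis using right[OF x 2] by (simp add: C)
      next
        case 3 then show ?thesis using left[OF x 3] by (simp add: C)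
      qed
    qed
  qed
  moreover have "open (C a) \<and> connected (C a) \<and> C a \<noteq> {} \<and> (\<forall>x\<in>C a. \<forall>t>0. t *\<^sub>R x \<in> C a)" for a
  proof (intro conjI)
    show "open (C a)" unfolding C_def by (auto intro!: open_Int open_Collect_less continuous_intros)
    show "connected (C a)" unfolding C_def by (auto intro!: convex_connected convex_Int cv)
    \<comment> \<open>The normal, the horizontal axis and y witness that the three sectors are
      nonempty.\<close>
    have "\<nu> \<in> {x. 0 < x \<bullet> \<nu>}" "axis 1 1 \<in> {x. x \<bullet> \<nu> < 0} \<inter> {x. 0 < x$1}" "y \<in> {x. x \<bullet> \<nu> < 0} \<inter> {x. x$1 < 0}"
      using \<nu> \<nu>0 by (simp_all add: inner_real2[of "axis 1 1"])
    then show "C a \<noteq> {}" unfolding C_def by (auto simp del: Int_iff mem_Collect_eq)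
    show "\<forall>x\<in>C a. \<forall>t>0. t *\<^sub>R x \<in> C a" unfolding C_def by (auto simp: mult_pos_neg)
  qed
  moreover have "disjoint_family_on C {\<alpha>, b, g}" unfolding disjoint_family_on_def using dist by (auto simp: C)
  moreover have "card {\<alpha>, b, g} = 3" using dist by simp
  ultimately show ?thesis unfolding triple_point_def using r by blast
qed

lemma noncollinear_distinct:
  assumes "\<not> collinear {\<alpha>, \<beta>, \<gamma>}"
  shows "\<alpha> \<noteq> \<beta>" "\<alpha> \<noteq> \<gamma>" "\<beta> \<noteq> \<gamma>"
  using assms by (auto simp: insert_commute)

lemma triple_point_A_pt:
  assumes nc: "\<not> collinear {\<alpha>, \<beta>, \<gamma>}" and i: "i \<ge> 1"
  shows "triple_point (u_map \<alpha> \<beta> \<gamma>) (A_pt i)"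
proof (rule triple_pointI[where \<nu>=nn and \<alpha>=\<alpha> and b="col \<beta> \<gamma> (i - 1)" and g="col \<beta> \<gamma> i" and r="q i / 2" and y="vector [-1, -1]"])
  show "\<alpha> \<noteq> col \<beta> \<gamma> (i - 1)" "\<alpha> \<noteq> col \<beta> \<gamma> i" "col \<beta> \<gamma> (i - 1) \<noteq> col \<beta> \<gamma> i"
    using noncollinear_distinct[OF nc] i by (cases i; auto simp: col_def)+
  show "vector [-1, -1] \<bullet> nn < 0" using cc_bounds by (simp add: inner_real2)
qed (use u_map_near_A_pt[OF i order_refl] in auto)

text \<open>Reflection in the horizontal axis reduces statements about B_i to those about
  A_i.\<close>

lemma u_map_mirror:
  fixes x :: "real^2"
  shows "u_map \<alpha> \<beta> \<gamma> (vector [x$1, - x$2]) = u_map \<alpha> \<beta> \<gamma> x"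
proof -
  have "vector [x$1, - x$2] \<in> tri i \<longleftrightarrow> x \<in> tri i" for i by (simp add: tri_eq)
  then show ?thesis by (simp add: u_map_def)
qed

lemma triple_point_B_pt:
  assumes nc: "\<not> collinear {\<alpha>, \<beta>, \<gamma>}" and i: "i \<ge> 1"
  shows "triple_point (u_map \<alpha> \<beta> \<gamma>) (B_pt i)"
proof (rule triple_pointI[where \<nu>=nn' and \<alpha>=\<alpha> and b="col \<beta> \<gamma> (i - 1)" and g="col \<beta> \<gamma> i" and r="q i / 2" and y="vector [-1, 1]"])
  show "\<alpha> \<noteq> col \<beta> \<gamma> (i - 1)" "\<alpha> \<noteq> col \<beta> \<gamma> i" "col \<beta> \<gamma> (i - 1) \<noteq> col \<beta> \<gamma> i"
    using noncollinear_distinct[OF nc] i by (cases i; auto simp: col_def)+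
  show "vector [-1, 1] \<bullet> nn' < 0" using cc_bounds by (simp add: inner_real2)
  let ?m = "\<lambda>x::real^2. vector [x$1, - x$2] :: real^2"
  have m: "?m x - A_pt i = ?m (x - B_pt i)" for x
    by (simp add: vec_eq_iff forall_2 A_pt_eq B_pt_eq)
  have nm: "norm (?m v) = norm v" for v by (simp add: norm_eq_sqrt_inner inner_real2)
  have b: "?m x \<in> ball (A_pt i) (q i / 2)" if "x \<in> ball (B_pt i) (q i / 2)" for x
    using that unfolding mem_ball dist_norm norm_minus_commute[of "A_pt i"] norm_minus_commute[of "B_pt i"] m nm .
  have n: "(?m x - A_pt i) \<bullet> nn = (x - B_pt i) \<bullet> nn'" "(?m x - A_pt i)$1 = (x - B_pt i)$1" for x
    unfolding m by (simp_all add: inner_real2 algebra_simps)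
  note near = u_map_near_A_pt[OF i order_refl b, unfolded n u_map_mirror]
  show "u_map \<alpha> \<beta> \<gamma> x = \<alpha>" if "x \<in> ball (B_pt i) (q i / 2)" "0 < (x - B_pt i) \<bullet> nn'" for x using near(1) that by blast
  show "u_map \<alpha> \<beta> \<gamma> x = col \<beta> \<gamma> (i - 1)" if "x \<in> ball (B_pt i) (q i / 2)" "(x - B_pt i) \<bullet> nn' < 0" "0 < (x - B_pt i)$1" for x using near(2) that by blast
  show "u_map \<alpha> \<beta> \<gamma> x = col \<beta> \<gamma> i" if "x \<in> ball (B_pt i) (q i / 2)" "(x - B_pt i) \<bullet> nn' < 0" "(x - B_pt i)$1 < 0" for x using near(3) that by blast
qed simp_all

lemma u_map_strip:
  fixes x :: "real^2"
  assumes "cc * q (Suc i) < x$1" "x$1 \<le> cc * q i"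
  shows "u_map \<alpha> \<beta> \<gamma> x \<in> {\<alpha>, col \<beta> \<gamma> i}"
  using u_map_zone[OF _ assms] u_map_outside by blast

lemma col_neq_Suc: "\<beta> \<noteq> \<gamma> \<Longrightarrow> col \<beta> \<gamma> (Suc i) \<noteq> col \<beta> \<gamma> i" by (simp add: col_def)

text \<open>Everywhere else one value is absent nearby: outside the triangle \<beta>, in an open
  strip the colour of the next trapezoid, at the abscissa of A_0 B_0 the value \<gamma>, and on an
  inner vertical side away from its ends the background \<alpha>.\<close>

lemma missing_value:
  assumes nc: "\<not> collinear {\<alpha>, \<beta>, \<gamma>}" and p: "p \<in> ball 0 1" "p \<noteq> 0" "\<And>i. i \<ge> 1 \<Longrightarrow> p \<noteq> A_pt i \<and> p \<noteq> B_pt i"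
  shows "\<exists>U a. open U \<and> p \<in> U \<and> a \<in> {\<alpha>, \<beta>, \<gamma>} \<and> (\<forall>x\<in>U. u_map \<alpha> \<beta> \<gamma> x \<noteq> a)"
proof -
  note d = noncollinear_distinct[OF nc]
  have col: "col \<beta> \<gamma> i \<in> {\<alpha>, \<beta>, \<gamma>}" "col \<beta> \<gamma> i \<noteq> \<alpha>" for i using d by (auto simp: col_def)
  show ?thesis
  proof (cases "p \<in> tri 0")
    case False
    have "open (- tri 0)" unfolding tri_def by (intro open_Compl compact_imp_closed finite_imp_compact_convex_hull) simp
    then show ?thesis using False d by (intro exI[of _ "- tri 0"] exI[of _ \<beta>]) (auto simp: u_map_def)
  next
    case True
    then have p1: "2 * cc * \<bar>p$2\<bar> \<le> p$1" "p$1 \<le> cc" by (simp_all add: tri_eq)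
    have "p$1 \<noteq> 0"
    proof
      assume "p$1 = 0"
      then have "p$2 = 0" using p1(1) cc_pos by (simp add: mult_le_0_iff)
      with \<open>p$1 = 0\<close> p(2) show False by (simp add: vec_eq_iff forall_2)
    qed
    moreover have "0 \<le> 2 * cc * \<bar>p$2\<bar>" using cc_pos by simp
    ultimately have "0 < p$1" using p1(1) by linarith
    then have "0 < p$1 / cc" "p$1 / cc \<le> 1" using p1(2) cc_pos by simp_all
    then obtain i where "q (Suc i) < p$1 / cc" "p$1 / cc \<le> q i" using exists_zone by blast
    then have i: "cc * q (Suc i) < p$1" "p$1 \<le> cc * q i" using cc_pos by (simp_all add: field_simps)
    show ?thesis
    proof (cases "p$1 < cc * q i")
      case True
      let ?U = "{x::real^2. cc * q (Suc i) < x$1 \<and> x$1 < cc * q i}"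
      have "open ?U" by (intro open_Collect_conj open_Collect_less continuous_intros)
      moreover have "u_map \<alpha> \<beta> \<gamma> x \<noteq> col \<beta> \<gamma> (Suc i)" if "x \<in> ?U" for x
        using u_map_strip[of i x \<alpha> \<beta> \<gamma>] that col(2)[of "Suc i"] col_neq_Suc[OF d(3), of i] by auto
      ultimately show ?thesis using True i col by blast
    next
      case False
      then have e: "p$1 = cc * q i" using i by simp
      show ?thesis
      proof (cases i)
        case 0
        \<comment> \<open>This also covers the corners A_0 and B_0, since to the right of the
          outermost strip only \<alpha> occurs.\<close>
        let ?U = "{x::real^2. cc * q (Suc 0) < x$1}"
        have "open ?U" by (intro open_Collect_less continuous_intros)
        moreover have "u_map \<alpha> \<beta> \<gamma> x \<noteq> \<gamma>" if "x \<in> ?U" for x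
          using u_map_strip[of 0 x \<alpha> \<beta> \<gamma>] u_map_outside[of x \<alpha> \<beta> \<gamma>] that d by (cases "cc < x$1") (auto simp: col_def)
        ultimately show ?thesis using i 0 by blast
      next
        case (Suc k)
        have "2 * cc * \<bar>p$2\<bar> \<noteq> p$1"
        proof
          assume "2 * cc * \<bar>p$2\<bar> = p$1"
          then have "\<bar>p$2\<bar> = q i / 2" using e cc_pos by simp
          then have "p$2 = q i / 2 \<or> p$2 = - (q i / 2)" by linarith
          then have "p = A_pt i \<or> p = B_pt i" using e by (auto simp: vec_eq_iff forall_2 A_pt_eq B_pt_eq)
          then show False using p(3)[of i] Suc by simp
        qed
        then have lt: "2 * cc * \<bar>p$2\<bar> < p$1" using p1 by simp
        let ?U = "{x::real^2. 2 * cc * \<bar>x$2\<bar> < x$1 \<and> cc * q (Suc i) < x$1 \<and> x$1 < cc * q k}"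
        have "open ?U" by (intro open_Collect_conj open_Collect_less continuous_intros)
        moreover have "u_map \<alpha> \<beta> \<gamma> x \<noteq> \<alpha>" if "x \<in> ?U" for x
        proof (cases "x$1 \<le> cc * q i")
          case True
          then show ?thesis using u_map_zone[of x i \<alpha> \<beta> \<gamma>] that col(2)[of i] by simp
        next
          case False
          then show ?thesis using u_map_zone[of x k \<alpha> \<beta> \<gamma>] that col(2)[of k] Suc by simp
        qed
        moreover have "cc * q i < cc * q k" using cq_pos[of k] unfolding Suc cq_Suc by linarith
        then have "p \<in> ?U" using lt i(1) e by simp
        ultimately show ?thesis by blast
      qed
    qed
  qed
qed

text \<open>Halving maps a \<open>\<beta>\<close>-trapezoid onto a \<open>\<gamma>\<close>-trapezoid along the same rays, so the sectors
  of \<open>\<beta>\<close> and \<open>\<gamma>\<close> at the origin would overlap.\<close>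
lemma not_triple_point_0:
  assumes nc: "\<not> collinear {\<alpha>, \<beta>, \<gamma>}"
  shows "\<not> triple_point (u_map \<alpha> \<beta> \<gamma>) 0"
proof
  assume t: "triple_point (u_map \<alpha> \<beta> \<gamma>) 0"
  note d = noncollinear_distinct[OF nc]
  have c3: "card {\<alpha>, \<beta>, \<gamma>} \<le> 3" using d by simp
  obtain r C where r: "0 < r" and o: "\<And>a. a \<in> {\<alpha>, \<beta>, \<gamma>} \<Longrightarrow> open (C a)"
    and cone: "\<And>a x t. a \<in> {\<alpha>, \<beta>, \<gamma>} \<Longrightarrow> x \<in> C a \<Longrightarrow> 0 < t \<Longrightarrow> t *\<^sub>R x \<in> C a"
    and dj: "disjoint_family_on C {\<alpha>, \<beta>, \<gamma>}" and ae: "AE x in lebesgue. x \<in> ball 0 r \<longrightarrow> x - 0 \<in> C (u_map \<alpha> \<beta> \<gamma> x)"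
    by (rule triple_point_values[OF t u_map_range _ c3]) (use that in auto)
  define Z where "Z i = {x::real^2. 2 * cc * \<bar>x$2\<bar> < x$1 \<and> cc * q (Suc i) < x$1 \<and> x$1 < cc * q i}" for i
  have oZ: "open (Z i)" for i unfolding Z_def by (intro open_Collect_conj open_Collect_less continuous_intros)
  have uZ: "u_map \<alpha> \<beta> \<gamma> x = col \<beta> \<gamma> i" if "x \<in> Z i" for x i using that by (intro u_map_zone) (auto simp: Z_def)
  have half: "(1/2) *\<^sub>R x \<in> Z (Suc i)" if "x \<in> Z i" for x i using that by (auto simp: Z_def q_Suc abs_mult)
  have nZ: "norm x < 2 * q i" if "x \<in> Z i" for x i
  proof -
    have x: "2 * cc * \<bar>x$2\<bar> < x$1" "x$1 < cc * q i" using that by (auto simp: Z_def)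
    have "1 * \<bar>x$2\<bar> \<le> 2 * cc * \<bar>x$2\<bar>" using cc_bounds by (intro mult_right_mono) auto
    then have "\<bar>x$2\<bar> < x$1" using x by simp
    then have "\<bar>x$1\<bar> + \<bar>x$2\<bar> < 2 * x$1" by linarith
    moreover have "cc * q i \<le> 1 * q i" using cc_bounds by (intro mult_right_mono) auto
    moreover have "norm x \<le> \<bar>x$1\<bar> + \<bar>x$2\<bar>" using norm_le_l1_cart[of x] by (simp add: sum_2)
    ultimately show ?thesis using x by linarith
  qed
  have "eventually (\<lambda>n. q n < r / 2) sequentially" using q_tendsto r by (intro order_tendstoD) auto
  then obtain k where k: "q k < r / 2" using eventually_sequentially by auto
  \<comment> \<open>The even index 2 k selects a \<beta>-trapezoid inside the ball; its image under
    halving has odd index.\<close>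
  have "q (2 * k) \<le> q k" unfolding q_def by (intro power_decreasing) auto
  then have sub: "Z (2 * k) \<subseteq> ball 0 r" using nZ k by fastforce
  have "vector [3/4 * (cc * q (2 * k)), 0] \<in> Z (2 * k)" using cq_pos[of "2 * k"] by (simp add: Z_def q_Suc)
  then obtain x where x: "x \<in> Z (2 * k)" "x \<in> C \<beta>"
    using AE_open_exists[OF ae oZ, of "2 * k"] sub uZ by (force simp: col_def)
  have "open (Z (2 * k) \<inter> C \<beta>)" using oZ o by auto
  then have "open ((\<lambda>y. 2 *\<^sub>R y) -` (Z (2 * k) \<inter> C \<beta>))" by (intro open_vimage continuous_intros)
  moreover have "(1/2) *\<^sub>R x \<in> (\<lambda>y. 2 *\<^sub>R y) -` (Z (2 * k) \<inter> C \<beta>)" using x by simp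
  ultimately obtain y where y: "2 *\<^sub>R y \<in> Z (2 * k)" "2 *\<^sub>R y \<in> C \<beta>" "y \<in> ball 0 r \<longrightarrow> y - 0 \<in> C (u_map \<alpha> \<beta> \<gamma> y)"
    using AE_open_exists[OF ae] by blast
  have "norm (2 *\<^sub>R y) < r" using sub y(1) by auto
  then have "norm y < r" using order_le_less_trans[of "norm y" "2 * norm y" r] by simp
  moreover have "u_map \<alpha> \<beta> \<gamma> y = \<gamma>" using uZ[OF half[OF y(1)]] by (simp add: col_def)
  ultimately have "y \<in> C \<gamma>" using y(3) by simp
  then have "2 *\<^sub>R y \<in> C \<gamma>" by (intro cone) auto
  then show False using y(2) disjoint_family_onD[OF dj, of \<beta> \<gamma>] d by auto
qed

lemma triple_points_eq:
  assumes nc: "\<not> collinear {\<alpha>, \<beta>, \<gamma>}"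
  shows "{p \<in> ball 0 1. triple_point (u_map \<alpha> \<beta> \<gamma>) p} = A_pt ` {1..} \<union> B_pt ` {1..}"
proof
  have c3: "card {\<alpha>, \<beta>, \<gamma>} \<le> 3" using noncollinear_distinct[OF nc] by simp
  show "{p \<in> ball 0 1. triple_point (u_map \<alpha> \<beta> \<gamma>) p} \<subseteq> A_pt ` {1..} \<union> B_pt ` {1..}"
  proof (rule subsetI, rule ccontr)
    fix p assume p: "p \<in> {p \<in> ball 0 1. triple_point (u_map \<alpha> \<beta> \<gamma>) p}" "p \<notin> A_pt ` {1..} \<union> B_pt ` {1..}"
    have p': "p \<in> ball 0 1" "p \<noteq> 0" "\<And>i. i \<ge> 1 \<Longrightarrow> p \<noteq> A_pt i \<and> p \<noteq> B_pt i"
      using p not_triple_point_0[OF nc] by auto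
    obtain U a where U: "open U" "p \<in> U" "a \<in> {\<alpha>, \<beta>, \<gamma>}" "\<And>x. x \<in> U \<Longrightarrow> u_map \<alpha> \<beta> \<gamma> x \<noteq> a"
      using missing_value[OF nc p'] by blast
    have t: "triple_point (u_map \<alpha> \<beta> \<gamma>) p" using p by simp
    have "\<And>a U. a \<in> {\<alpha>, \<beta>, \<gamma>} \<Longrightarrow> open U \<Longrightarrow> p \<in> U \<Longrightarrow> \<exists>x\<in>U. u_map \<alpha> \<beta> \<gamma> x = a"
      by (rule triple_point_values[OF t u_map_range _ c3]) simp_all
    from this[OF U(3,1,2)] show False using U(4) by blast
  qed
  have "A_pt i \<in> ball 0 1" "B_pt i \<in> ball 0 1" if "i \<ge> 1" for i
  proof -
    have "q i \<le> q 0 / 2" using that by (intro q_less) simp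
    then show "A_pt i \<in> ball 0 1" "B_pt i \<in> ball 0 1" by (simp_all add: A_pt_eq B_pt_eq)
  qed
  then show "A_pt ` {1..} \<union> B_pt ` {1..} \<subseteq> {p \<in> ball 0 1. triple_point (u_map \<alpha> \<beta> \<gamma>) p}"
    using triple_point_A_pt[OF nc] triple_point_B_pt[OF nc] by auto
qed

lemma infinite_A_pt: "infinite (A_pt ` {1..})"
proof -
  have "inj_on A_pt {1..}"
  proof (rule inj_onI)
    fix i j assume "A_pt i = A_pt j"
    then have "q i = q j" using A_pt_inner(3)[of i] A_pt_inner(3)[of j] by simp
    then show "i = j" using q_less[of i j] q_less[of j i] q_pos[of i] q_pos[of j] by (cases i j rule: linorder_cases) linarith+
  qed
  then show ?thesis using finite_imageD infinite_Ici by blast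
qed

theorem mainTheorem2:
  fixes \<alpha> \<beta> \<gamma> :: "real^2"
  assumes "\<not> collinear {\<alpha>, \<beta>, \<gamma>}"
  shows
    "{p \<in> ball 0 1. triple_point (u_map \<alpha> \<beta> \<gamma>) p} = A_pt ` {1..} \<union> B_pt ` {1..} \<and>
     infinite {p \<in> ball 0 1. triple_point (u_map \<alpha> \<beta> \<gamma>) p} \<and>

     u_map \<alpha> \<beta> \<gamma> \<in> BV_maps (ball 0 1) \<and>
     (\<forall>x\<in>ball 0 1. u_map \<alpha> \<beta> \<gamma> x \<in> {\<alpha>, \<beta>, \<gamma>}) \<and>
     total_var (u_map \<alpha> \<beta> \<gamma>) (ball 0 1) =
       ennreal (7/3 * norm (\<beta> - \<alpha>) + 2/3 * norm (\<alpha> - \<gamma>) + norm (\<beta> - \<gamma>)) \<and>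

     (\<forall>r :: nat \<Rightarrow> real. (\<forall>i\<ge>1. 0 < r i \<and> r i < (1/2) ^ (i + 1)) \<and> r \<longlonglongrightarrow> 0 \<longrightarrow>
        (\<forall>i\<ge>1. TVJ_BV (u_map \<alpha> \<beta> \<gamma>) (ball (A_pt i) (r i)) =
                  emeasure lebesgue (convex hull {\<alpha>, \<beta>, \<gamma>}))) \<and>
     area_BV (u_map \<alpha> \<beta> \<gamma>) (ball 0 1) \<ge> TVJ_BV (u_map \<alpha> \<beta> \<gamma>) (ball 0 1) \<and>
     TVJ_BV (u_map \<alpha> \<beta> \<gamma>) (ball 0 1) = \<infinity> \<and>

     area_L1 (u_map \<alpha> \<beta> \<gamma>) (ball 0 1) \<le>
       ennreal (pi + 23/6 * norm (\<beta> - \<alpha>) + 13/6 * norm (\<alpha> - \<gamma>)) \<and>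
     ennreal (pi + 23/6 * norm (\<beta> - \<alpha>) + 13/6 * norm (\<alpha> - \<gamma>)) < \<infinity> \<and>

     Dom_area_BV (ball 0 1) \<subset> Dom_area_L1 (ball 0 1)"
proof (intro conjI allI impI)
  note nc = assms
  show "{p \<in> ball 0 1. triple_point (u_map \<alpha> \<beta> \<gamma>) p} = A_pt ` {1..} \<union> B_pt ` {1..}" by (rule triple_points_eq[OF nc])
  then show "infinite {p \<in> ball 0 1. triple_point (u_map \<alpha> \<beta> \<gamma>) p}" using infinite_A_pt by simp
  show "u_map \<alpha> \<beta> \<gamma> \<in> BV_maps (ball 0 1)" by (rule u_map_BV)
  show "\<forall>x\<in>ball 0 1. u_map \<alpha> \<beta> \<gamma> x \<in> {\<alpha>, \<beta>, \<gamma>}" using u_map_range by blast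
  show "total_var (u_map \<alpha> \<beta> \<gamma>) (ball 0 1) = ennreal (7/3 * norm (\<beta> - \<alpha>) + 2/3 * norm (\<alpha> - \<gamma>) + norm (\<beta> - \<gamma>))"
    using total_var_u_map[of \<alpha> \<beta> \<gamma>] unfolding total_def .
  show "TVJ_BV (u_map \<alpha> \<beta> \<gamma>) (ball (A_pt i) (r i)) = emeasure lebesgue (convex hull {\<alpha>, \<beta>, \<gamma>})"
    if "(\<forall>i\<ge>1. 0 < r i \<and> r i < (1/2) ^ (i + 1)) \<and> r \<longlonglongrightarrow> 0" "1 \<le> i" for r :: "nat \<Rightarrow> real" and i
    \<comment> \<open>The bound (1/2)^(i + 1) is q i / 2, the radius up to which the ball at A_i
      sees only its three sectors.\<close>
    using that by (intro TVJ_BV_local[OF nc]) (auto simp: q_def)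
  show "TVJ_BV (u_map \<alpha> \<beta> \<gamma>) (ball 0 1) \<le> area_BV (u_map \<alpha> \<beta> \<gamma>) (ball 0 1)" by (rule TVJ_BV_le_area_BV)
  show "TVJ_BV (u_map \<alpha> \<beta> \<gamma>) (ball 0 1) = \<infinity>" by (rule TVJ_BV_infinite[OF nc])
  show "area_L1 (u_map \<alpha> \<beta> \<gamma>) (ball 0 1) \<le> ennreal (pi + 23/6 * norm (\<beta> - \<alpha>) + 13/6 * norm (\<alpha> - \<gamma>))" by (rule area_L1_u_map_le)
  show "Dom_area_BV (ball 0 1) \<subset> Dom_area_L1 (ball 0 1)" by (rule Dom_area_psubset[OF nc])
qed simp_all

end
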